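(* There is an algorithm that, given any feasible instance of the RAP--NC with separable convex objective (as defined in the context), finds an optimal solution of the RAP--NC restricted to integer variables ($\mathbf{x} \in \mathbb{Z}^n$) in $\mathcal{O}(n \log m \log B)$ time, where $n$ is the number of decision variables, $m$ is the number of nested constraints (including the global resource constraint), and $B$ is the resource bound. The algorithm accesses the objective only through evaluations of the functions $f_i$ and does not require strict convexity or differentiability.
   Context: The resource allocation problem with nested lower and upper constraints (RAP--NC) is $$\min \sum_{i=1}^n f_i(x_i) \quad \text{s.t.} \quad a_i \le \sum_{k=1}^{\sigma[i]} x_k \le b_i \ (i \in \{1,\dots,m-1\}), \quad \sum_{k=1}^n x_k = B, \quad c_i \le x_i \le d_i \ (i\in\{1,\dots,n\}),$$ where $(\sigma[1],\dots,\sigma[m])$ is a (strictly increasing) subsequence of $(1,\dots,n)$ with $\sigma[m]=n$. The coefficients $a_i,b_i,c_i,d_i$ and $B$ are integers, $a_i \le b_i$ for all $i$, and each $f_i : [c_i,d_i]\to\mathbb{R}$ is convex and Lipschitz continuous (not necessarily differentiable or strictly convex). Model of computation: time is the number of elementary operations (arithmetic operations and comparisons), and an oracle evaluates each $f_i$ at a given point in $\mathcal{O}(1)$ time. As usual in such bounds, logarithmic factors are understood to be at least $1$.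
   Formalization: If some lower bounds c_i are negative, B in the time bound is replaced by B minus the sum of the negative c_i, since the bound with B itself fails (e.g. x_1+x_2=0, -D≤x_i≤D); for nonnegative c_i it is exactly O(n log m log B). *)

theory Defs
  imports "HOL-Analysis.Analysis"
begin

section \<open>The resource allocation problem with nested constraints\<close>

text \<open>All families are indexed from 1. The fields \<open>lo\<close>, \<open>up\<close> are the bounds \<open>a\<close>, \<open>b\<close> on the nested
  sums, and \<open>lb\<close>, \<open>ub\<close> are the bounds \<open>c\<close>, \<open>d\<close> on the variables. Only the values at the indices
  mentioned in \<open>valid_instance\<close> are meaningful, and \<open>obj i\<close> only on \<open>[lb i, ub i]\<close>.\<close>

record rapnc =
  nvars :: nat
  ncons :: nat
  sig :: "nat \<Rightarrow> nat"
  lo :: "nat \<Rightarrow> int"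
  up :: "nat \<Rightarrow> int"
  lb :: "nat \<Rightarrow> int"
  ub :: "nat \<Rightarrow> int"
  res :: int
  obj :: "nat \<Rightarrow> real \<Rightarrow> real"

definition valid_instance :: "rapnc \<Rightarrow> bool" where
  "valid_instance I \<longleftrightarrow>
     1 \<le> ncons I \<and>
     sig I ` {1..ncons I} \<subseteq> {1..nvars I} \<and>
     strict_mono_on {1..ncons I} (sig I) \<and>
     sig I (ncons I) = nvars I \<and>
     (\<forall>i\<in>{1..<ncons I}. lo I i \<le> up I i) \<and>
     (\<forall>i\<in>{1..nvars I}.
        convex_on {of_int (lb I i)..of_int (ub I i)} (obj I i) \<and>
        (\<exists>L. L-lipschitz_on {of_int (lb I i)..of_int (ub I i)} (obj I i)))"

definition rapnc_feasible :: "rapnc \<Rightarrow> (nat \<Rightarrow> real) \<Rightarrow> bool" where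
  "rapnc_feasible I x \<longleftrightarrow>
     (\<forall>i\<in>{1..<ncons I}. of_int (lo I i) \<le> (\<Sum>k=1..sig I i. x k)
                         \<and> (\<Sum>k=1..sig I i. x k) \<le> of_int (up I i)) \<and>
     (\<Sum>k=1..nvars I. x k) = of_int (res I) \<and>
     (\<forall>i\<in>{1..nvars I}. of_int (lb I i) \<le> x i \<and> x i \<le> of_int (ub I i))"

definition rapnc_cost :: "rapnc \<Rightarrow> (nat \<Rightarrow> real) \<Rightarrow> real" where
  "rapnc_cost I x = (\<Sum>i=1..nvars I. obj I i (x i))"

definition integer_feasible :: "rapnc \<Rightarrow> (nat \<Rightarrow> real) \<Rightarrow> bool" where
  "integer_feasible I x \<longleftrightarrow> rapnc_feasible I x \<and> (\<forall>i\<in>{1..nvars I}. x i \<in> \<int>)"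

definition integer_optimal :: "rapnc \<Rightarrow> (nat \<Rightarrow> real) \<Rightarrow> bool" where
  "integer_optimal I x \<longleftrightarrow>
     integer_feasible I x \<and> (\<forall>y. integer_feasible I y \<longrightarrow> rapnc_cost I x \<le> rapnc_cost I y)"

text \<open>The resource bound entering the running time. It is \<open>B\<close> itself when all \<open>c\<^sub>i\<close> are nonnegative,
  the usual situation in resource allocation. If some \<open>c\<^sub>i\<close> are negative, then \<open>B\<close> alone does not bound
  the range of the variables (take \<open>x\<^sub>1 + x\<^sub>2 = 0\<close>, \<open>-D \<le> x\<^sub>i \<le> D\<close>, where no bound
  independent of \<open>D\<close> is possible), and \<open>B\<close> has to be read after the translation
  \<open>x\<^sub>i \<mapsto> x\<^sub>i - c\<^sub>i\<close> of the variables with \<open>c\<^sub>i < 0\<close>.\<close>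

definition resource_bound :: "rapnc \<Rightarrow> int" where
  "resource_bound I = res I - (\<Sum>i=1..nvars I. min (lb I i) 0)"

lemma resource_bound_eq_res:
  assumes "\<forall>i\<in>{1..nvars I}. 0 \<le> lb I i"
  shows "resource_bound I = res I"
  using assms by (simp add: resource_bound_def)

definition lg :: "real \<Rightarrow> real" where
  "lg x = max 1 (log 2 x)"


section \<open>Model of computation\<close>

text \<open>Random access machine programs with finitely many named integer and real arrays; a scalar is
  cell 0 of an array. Integers can be converted to reals but not conversely, so real data influence
  the integer data only through comparisons. \<open>IDiv\<close> is floor division; division by zero yields zero.
  The objective is accessible only through the command \<open>Query\<close>.\<close>

datatype iexp =
    IConst int
  | IMem string iexp
  | IAdd iexp iexp
  | ISub iexp iexp
  | IMul iexp iexp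
  | IDiv iexp iexp

datatype rexp =
    OfInt iexp
  | RMem string iexp
  | RAdd rexp rexp
  | RSub rexp rexp
  | RMul rexp rexp
  | RDiv rexp rexp

datatype bexp =
    ILess iexp iexp
  | RLess rexp rexp
  | BNot bexp
  | BAnd bexp bexp

datatype com =
    Skip
  | IAssign string iexp iexp
  | RAssign string iexp rexp
  | Query string iexp iexp rexp
  | Seq com com
  | Cond bexp com com
  | While bexp com

record state =
  imem :: "string \<Rightarrow> int \<Rightarrow> int"
  rmem :: "string \<Rightarrow> int \<Rightarrow> real"

primrec ival :: "iexp \<Rightarrow> state \<Rightarrow> int" where
  "ival (IConst k) s = k"
| "ival (IMem v e) s = imem s v (ival e s)"
| "ival (IAdd e e') s = ival e s + ival e' s"
| "ival (ISub e e') s = ival e s - ival e' s"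
| "ival (IMul e e') s = ival e s * ival e' s"
| "ival (IDiv e e') s = ival e s div ival e' s"

primrec rval :: "rexp \<Rightarrow> state \<Rightarrow> real" where
  "rval (OfInt e) s = of_int (ival e s)"
| "rval (RMem v e) s = rmem s v (ival e s)"
| "rval (RAdd e e') s = rval e s + rval e' s"
| "rval (RSub e e') s = rval e s - rval e' s"
| "rval (RMul e e') s = rval e s * rval e' s"
| "rval (RDiv e e') s = rval e s / rval e' s"

primrec bval :: "bexp \<Rightarrow> state \<Rightarrow> bool" where
  "bval (ILess e e') s \<longleftrightarrow> ival e s < ival e' s"
| "bval (RLess e e') s \<longleftrightarrow> rval e s < rval e' s"
| "bval (BNot b) s \<longleftrightarrow> \<not> bval b s"
| "bval (BAnd b b') s \<longleftrightarrow> bval b s \<and> bval b' s"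

text \<open>Every arithmetic or Boolean operation, comparison, constant, conversion and memory access
  costs one unit.\<close>

primrec icost :: "iexp \<Rightarrow> nat" where
  "icost (IConst k) = 1"
| "icost (IMem v e) = 1 + icost e"
| "icost (IAdd e e') = 1 + icost e + icost e'"
| "icost (ISub e e') = 1 + icost e + icost e'"
| "icost (IMul e e') = 1 + icost e + icost e'"
| "icost (IDiv e e') = 1 + icost e + icost e'"

primrec rcost :: "rexp \<Rightarrow> nat" where
  "rcost (OfInt e) = 1 + icost e"
| "rcost (RMem v e) = 1 + icost e"
| "rcost (RAdd e e') = 1 + rcost e + rcost e'"
| "rcost (RSub e e') = 1 + rcost e + rcost e'"
| "rcost (RMul e e') = 1 + rcost e + rcost e'"
| "rcost (RDiv e e') = 1 + rcost e + rcost e'"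

primrec bcost :: "bexp \<Rightarrow> nat" where
  "bcost (ILess e e') = 1 + icost e + icost e'"
| "bcost (RLess e e') = 1 + rcost e + rcost e'"
| "bcost (BNot b) = 1 + bcost b"
| "bcost (BAnd b b') = 1 + bcost b + bcost b'"

definition iupdate :: "string \<Rightarrow> int \<Rightarrow> int \<Rightarrow> state \<Rightarrow> state" where
  "iupdate v k z s = s\<lparr>imem := (imem s)(v := (imem s v)(k := z))\<rparr>"

definition rupdate :: "string \<Rightarrow> int \<Rightarrow> real \<Rightarrow> state \<Rightarrow> state" where
  "rupdate v k r s = s\<lparr>rmem := (rmem s)(v := (rmem s v)(k := r))\<rparr>"

text \<open>\<open>exec orc p s t s'\<close>: with evaluation map \<open>orc\<close>, program \<open>p\<close> started in \<open>s\<close> terminates in \<open>s'\<close> after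
  time \<open>t\<close>. There is no execution beyond a query on which \<open>orc\<close> is undefined.\<close>

inductive exec ::
    "(int \<Rightarrow> real \<Rightarrow> real option) \<Rightarrow> com \<Rightarrow> state \<Rightarrow> nat \<Rightarrow> state \<Rightarrow> bool"
  for orc where
  exec_Skip: "exec orc Skip s 1 s"
| exec_IAssign: "exec orc (IAssign v j e) s (1 + icost j + icost e)
                   (iupdate v (ival j s) (ival e s) s)"
| exec_RAssign: "exec orc (RAssign v j e) s (1 + icost j + rcost e)
                   (rupdate v (ival j s) (rval e s) s)"
| exec_Query: "orc (ival i s) (rval p s) = Some y \<Longrightarrow>
                 exec orc (Query v j i p) s (1 + icost j + icost i + rcost p)
                   (rupdate v (ival j s) y s)"
| exec_Seq: "exec orc p s t s' \<Longrightarrow> exec orc q s' t' s'' \<Longrightarrow> exec orc (Seq p q) s (t + t') s''"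
| exec_CondTrue: "bval b s \<Longrightarrow> exec orc p s t s' \<Longrightarrow> exec orc (Cond b p q) s (1 + bcost b + t) s'"
| exec_CondFalse: "\<not> bval b s \<Longrightarrow> exec orc q s t s' \<Longrightarrow> exec orc (Cond b p q) s (1 + bcost b + t) s'"
| exec_WhileFalse: "\<not> bval b s \<Longrightarrow> exec orc (While b p) s (1 + bcost b) s"
| exec_WhileTrue: "bval b s \<Longrightarrow> exec orc p s t s' \<Longrightarrow> exec orc (While b p) s' t' s'' \<Longrightarrow>
                     exec orc (While b p) s (1 + bcost b + t + t') s''"

inductive_cases exec_SkipE: "exec orc Skip s t s'"
inductive_cases exec_IAssignE: "exec orc (IAssign v j e) s t s'"
inductive_cases exec_RAssignE: "exec orc (RAssign v j e) s t s'"
inductive_cases exec_QueryE: "exec orc (Query v j i p) s t s'"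
inductive_cases exec_SeqE: "exec orc (Seq p q) s t s'"
inductive_cases exec_CondE: "exec orc (Cond b p q) s t s'"
inductive_cases exec_WhileE: "exec orc (While b p) s t s'"

lemma exec_deterministic:
  assumes "exec orc p s t s1" "exec orc p s u s2"
  shows "t = u \<and> s1 = s2"
  using assms
proof (induction arbitrary: u s2 rule: exec.induct)
  case exec_Skip
  from exec_Skip.prems show ?case by (rule exec_SkipE) simp
next
  case exec_IAssign
  from exec_IAssign.prems show ?case by (rule exec_IAssignE) simp
next
  case exec_RAssign
  from exec_RAssign.prems show ?case by (rule exec_RAssignE) simp
next
  case exec_Query
  from exec_Query.prems show ?case by (rule exec_QueryE) (use exec_Query.hyps in simp)
next
  case (exec_Seq p s t s' q t' s'')
  from exec_Seq.prems show ?case by (rule exec_SeqE) (metis exec_Seq.IH)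
next
  case (exec_CondTrue b s p t s' q)
  from exec_CondTrue.prems show ?case by (rule exec_CondE) (auto dest: exec_CondTrue.IH simp: exec_CondTrue.hyps(1))
next
  case (exec_CondFalse b s q t s' p)
  from exec_CondFalse.prems show ?case by (rule exec_CondE) (auto dest: exec_CondFalse.IH simp: exec_CondFalse.hyps(1))
next
  case (exec_WhileFalse b s p)
  from exec_WhileFalse.prems show ?case by (rule exec_WhileE) (use exec_WhileFalse.hyps in simp_all)
next
  case (exec_WhileTrue b s p t s' t' s'')
  from exec_WhileTrue.prems show ?case by (rule exec_WhileE) (auto dest!: exec_WhileTrue.IH simp: exec_WhileTrue.hyps(1))
qed


section \<open>Solving instances\<close>

text \<open>\<open>f\<^sub>i\<close> can be evaluated only on its domain \<open>[c\<^sub>i, d\<^sub>i]\<close>.\<close>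

definition eval_oracle :: "rapnc \<Rightarrow> int \<Rightarrow> real \<Rightarrow> real option" where
  "eval_oracle I i p =
     (if 1 \<le> i \<and> i \<le> int (nvars I) \<and> of_int (lb I (nat i)) \<le> p \<and> p \<le> of_int (ub I (nat i))
      then Some (obj I (nat i) p) else None)"

definition load_array :: "nat \<Rightarrow> (nat \<Rightarrow> int) \<Rightarrow> int \<Rightarrow> int" where
  "load_array l g k = (if 1 \<le> k \<and> k \<le> int l then g (nat k) else 0)"

definition load_scalar :: "int \<Rightarrow> int \<Rightarrow> int" where
  "load_scalar z k = (if k = 0 then z else 0)"

text \<open>The integer data are given in the arrays \<open>n\<close>, \<open>m\<close>, \<open>B\<close>, \<open>sigma\<close>, \<open>a\<close>, \<open>b\<close>, \<open>c\<close>, \<open>d\<close>;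
  the rest of the memory is zero.\<close>

definition initial_state :: "rapnc \<Rightarrow> state" where
  "initial_state I =
     \<lparr> imem = (\<lambda>v k. 0)
         (''n'' := load_scalar (int (nvars I)),
          ''m'' := load_scalar (int (ncons I)),
          ''B'' := load_scalar (res I),
          ''sigma'' := load_array (ncons I) (\<lambda>i. int (sig I i)),
          ''a'' := load_array (ncons I - 1) (lo I),
          ''b'' := load_array (ncons I - 1) (up I),
          ''c'' := load_array (nvars I) (lb I),
          ''d'' := load_array (nvars I) (ub I)),
       rmem = (\<lambda>v k. 0) \<rparr>"

definition solution_output :: "state \<Rightarrow> nat \<Rightarrow> real" where
  "solution_output s i = of_int (imem s ''x'' (int i))"

end

(*
  View variable i as a stack of units whose k-th marginal cost is g i k = F i k - F i (k - 1), and order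
  the units lexicographically by (g i k, i, k). A feasible point is stable if no exchange of a taken unit
  for an earlier untaken one is feasible. By convexity stable points are optimal, and as the order is
  strict, the stable point of a segment of variables is unique and monotone in the two partial sums
  prescribed at its ends. Hence, when two adjacent segments are joined, the stable points for the two
  extreme sums at the common boundary are lower and upper bounds for the variables of the joined segment,
  and once these bounds are imposed the nested constraints inside it are redundant. What remains is a
  resource allocation problem over a box, which is solved four times per node of a binary tree (the outer
  sums at either extreme); so there are O(log m) levels, each with boxes of total dimension O(n).

  Over a box, the K units still to be taken lie in blocks of s consecutive units of one variable. The
  K div s + 1 blocks with the smallest last units cannot all be taken, so every block that starts after all
  of them is discarded; dually, every block that ends before the (K div s + 1)-th smallest first unit is
  taken. Only boundedly many blocks per variable straddle a pivot; these are cut in half and s is halved.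
  A phase costs O(n) by median-of-medians selection. After subtracting the lower bounds no variable exceeds
  R = B - sum c, so O(log R) phases suffice. Marginals are continued by -M and M outside [c, d], and by 2 M
  above the current box, so that the problems at the leaves are always feasible.
*)
theory Submission imports Defs begin

subsection \<open>Timed total correctness\<close>

text \<open>Uniqueness, monotonicity and optimality of stable points all come from one exchange. If
  \<open>x\<close> exceeds \<open>z\<close> in some variable, a unit of \<open>x\<close> can be
  moved towards \<open>z\<close> while the opposite move is feasible for \<open>z\<close>. For two
  stable points the two comparisons close a cycle in a strict order; for a stable and an arbitrary
  point, repeating the move walks to the stable point without raising the cost. A segment may have
  no point within [c, d] for a given pair of extreme outer sums. Therefore all segments are solved
  over [c - R, c + R], and only at the root do the penalties -M and M, played against a feasible
  point, force the solution back into [c, d]. This also bounds every box by 2 R, so the number of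
  phases is the same at all levels. The pivots order blocks by marginal and block index. This agrees
  with the order of the units because the blocks are kept sorted by variable and position. Programs
  have no recursion: selection keeps its own stack, and the tree is traversed bottom-up by levels.
  All running times are potential arguments, in which an iteration is paid by the decrease of a
  natural number.\<close>

primrec iw :: "com \<Rightarrow> string set" where
  "iw Skip = {}"
| "iw (IAssign v j e) = {v}"
| "iw (RAssign v j e) = {}"
| "iw (Query v j i p) = {}"
| "iw (Seq p q) = iw p \<union> iw q"
| "iw (Cond b p q) = iw p \<union> iw q"
| "iw (While b p) = iw p"

primrec rw :: "com \<Rightarrow> string set" where
  "rw Skip = {}"
| "rw (IAssign v j e) = {}"
| "rw (RAssign v j e) = {v}"
| "rw (Query v j i p) = {v}"
| "rw (Seq p q) = rw p \<union> rw q"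
| "rw (Cond b p q) = rw p \<union> rw q"
| "rw (While b p) = rw p"

lemma mem_update [simp]:
  "imem (iupdate v k z s) = (imem s)(v := (imem s v)(k := z))"
  "rmem (iupdate v k z s) = rmem s"
  "rmem (rupdate v k r s) = (rmem s)(v := (rmem s v)(k := r))"
  "imem (rupdate v k r s) = imem s"
  by (simp_all add: iupdate_def rupdate_def)

text \<open>The frame condition, read off the syntax. As it holds for every execution,
  postconditions need only mention what a program changes, and all other facts are recovered from
  here.\<close>

definition same_off :: "com \<Rightarrow> state \<Rightarrow> state \<Rightarrow> bool" where
  "same_off c s s' \<longleftrightarrow>
     (\<forall>v. v \<notin> iw c \<longrightarrow> imem s' v = imem s v) \<and> (\<forall>v. v \<notin> rw c \<longrightarrow> rmem s' v = rmem s v)"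

lemma same_offD:
  assumes "same_off c s s'"
  shows "\<And>v. v \<notin> iw c \<Longrightarrow> imem s' v = imem s v" "\<And>v. v \<notin> rw c \<Longrightarrow> rmem s' v = rmem s v"
  using assms by (auto simp: same_off_def)

lemma exec_same_off: "exec orc c s t s' \<Longrightarrow> same_off c s s'"
  by (induction rule: exec.induct) (auto simp: same_off_def)

text \<open>Asking for one good execution amounts to total correctness because \<open>exec\<close>
  is deterministic. An upper bound \<open>T\<close> instead of the exact time lets bounds be added
  along sequences.\<close>

definition runs :: "(int \<Rightarrow> real \<Rightarrow> real option) \<Rightarrow> com \<Rightarrow> state \<Rightarrow> nat \<Rightarrow> (state \<Rightarrow> bool) \<Rightarrow> bool" where
  "runs orc c s T Q \<longleftrightarrow> (\<exists>t s'. exec orc c s t s' \<and> t \<le> T \<and> Q s')"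

lemma runs_mono:
  assumes "runs orc c s T Q" "T \<le> T'" "\<And>s'. Q s' \<Longrightarrow> same_off c s s' \<Longrightarrow> Q' s'"
  shows "runs orc c s T' Q'"
  using assms exec_same_off unfolding runs_def by (meson le_trans)

lemma runs_exec: "exec orc c s T s' \<Longrightarrow> Q s' \<Longrightarrow> runs orc c s T Q"
  unfolding runs_def by blast

lemma runs_Seq:
  assumes "runs orc c s T (\<lambda>s'. runs orc c' s' T' Q)"
  shows "runs orc (Seq c c') s (T + T') Q"
  using assms unfolding runs_def by (blast intro: exec_Seq add_mono)

lemma runs_Seq2:
  assumes "runs orc c s T Q" "\<And>s'. Q s' \<Longrightarrow> same_off c s s' \<Longrightarrow> runs orc c' s' T' Q'" "T + T' \<le> T''"
  shows "runs orc (Seq c c') s T'' Q'"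
proof -
  have "runs orc (Seq c c') s (T + T') Q'"
    by (rule runs_Seq, rule runs_mono[OF assms(1) order_refl]) (rule assms(2))
  then show ?thesis using assms(3) by (rule runs_mono)
qed

text \<open>Turns straight-line code into a goal for the simplifier. Loops are sent to
  \<open>False\<close>, so that nothing about a loop can be derived this way and the time of a
  loop-free command is \<open>ccost\<close>.\<close>

primrec wp :: "(int \<Rightarrow> real \<Rightarrow> real option) \<Rightarrow> com \<Rightarrow> (state \<Rightarrow> bool) \<Rightarrow> state \<Rightarrow> bool" where
  "wp orc Skip Q s = Q s"
| "wp orc (IAssign v j e) Q s = Q (iupdate v (ival j s) (ival e s) s)"
| "wp orc (RAssign v j e) Q s = Q (rupdate v (ival j s) (rval e s) s)"
| "wp orc (Query v j i p) Q s =
     (\<exists>y. orc (ival i s) (rval p s) = Some y \<and> Q (rupdate v (ival j s) y s))"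
| "wp orc (Seq p q) Q s = wp orc p (wp orc q Q) s"
| "wp orc (Cond b p q) Q s = (if bval b s then wp orc p Q s else wp orc q Q s)"
| "wp orc (While b p) Q s = False"

text \<open>Meaningful for loop-free commands only.\<close>

primrec ccost :: "com \<Rightarrow> nat" where
  "ccost Skip = 1"
| "ccost (IAssign v j e) = 1 + icost j + icost e"
| "ccost (RAssign v j e) = 1 + icost j + rcost e"
| "ccost (Query v j i p) = 1 + icost j + icost i + rcost p"
| "ccost (Seq p q) = ccost p + ccost q"
| "ccost (Cond b p q) = 1 + bcost b + max (ccost p) (ccost q)"
| "ccost (While b p) = 0"

lemma runs_wp: "wp orc c Q s \<Longrightarrow> runs orc c s (ccost c) Q"
proof (induction c arbitrary: Q s)
  case (Seq c1 c2)
  have "runs orc c1 s (ccost c1) (wp orc c2 Q)" using Seq by simp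
  then show ?case
    by (auto intro!: runs_Seq2[where T' = "ccost c2"] Seq.IH)
next
  case (Cond b c1 c2)
  show ?case
  proof (cases "bval b s")
    case True
    then have "runs orc c1 s (ccost c1) Q" using Cond by simp
    then show ?thesis using True unfolding runs_def by (force intro: exec_CondTrue)
  next
    case False
    then have "runs orc c2 s (ccost c2) Q" using Cond by simp
    then show ?thesis using False unfolding runs_def by (force intro: exec_CondFalse)
  qed
next
  case (Query v j i p)
  then show ?case by (auto intro!: runs_exec exec_Query simp del: One_nat_def)
qed (auto intro!: runs_exec[OF exec_Skip] runs_exec[OF exec_IAssign] runs_exec[OF exec_RAssign]
      simp del: One_nat_def)

lemma runs_wp_le: "wp orc c Q s \<Longrightarrow> ccost c \<le> T \<Longrightarrow> runs orc c s T Q"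
  using runs_wp runs_mono by blast

lemma runs_block:
  assumes "wp orc c Q s" "\<And>s'. Q s' \<Longrightarrow> same_off c s s' \<Longrightarrow> runs orc c' s' T' Q'" "ccost c + T' \<le> T"
  shows "runs orc (Seq c c') s T Q'"
  using runs_Seq2[OF runs_wp] assms by blast

lemma runs_Cond:
  assumes "bval b s \<Longrightarrow> runs orc c s T Q" "\<not> bval b s \<Longrightarrow> runs orc c' s T Q" "1 + bcost b + T \<le> T'"
  shows "runs orc (Cond b c c') s T' Q"
proof (cases "bval b s")
  case True
  then show ?thesis using assms(1,3) unfolding runs_def by (force intro: exec_CondTrue)
next
  case False
  then show ?thesis using assms(2,3) unfolding runs_def by (force intro: exec_CondFalse)
qed

text \<open>The potential \<open>\<Phi>\<close> serves as termination measure and as time account at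
  once: an iteration must lower it by its own time plus that of the guard. The time \<open>T\<close>
  may differ from iteration to iteration, which the amortised analyses below rely on.\<close>

lemma runs_While:
  assumes "Inv s"
    and body: "\<And>s'. Inv s' \<Longrightarrow> bval b s' \<Longrightarrow> same_off c s s' \<Longrightarrow>
      \<exists>T. runs orc c s' T (\<lambda>s''. Inv s'' \<and> T + 1 + bcost b + \<Phi> s'' \<le> \<Phi> s')"
  shows "runs orc (While b c) s (\<Phi> s + 1 + bcost b) (\<lambda>s'. Inv s' \<and> \<not> bval b s')"
proof -
  have "\<lbrakk>Inv s'; same_off c s s'\<rbrakk> \<Longrightarrow>
      runs orc (While b c) s' (\<Phi> s' + 1 + bcost b) (\<lambda>s'. Inv s' \<and> \<not> bval b s')" for s'
  proof (induction "\<Phi> s'" arbitrary: s' rule: less_induct)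
    case less
    show ?case
    proof (cases "bval b s'")
      case True
      from body[OF less.prems(1) True less.prems(2)] obtain T t s'' where
        *: "exec orc c s' t s''" "t \<le> T" "Inv s''" "T + 1 + bcost b + \<Phi> s'' \<le> \<Phi> s'"
        unfolding runs_def by blast
      have "same_off c s s''"
        using less.prems(2) exec_same_off[OF *(1)] by (simp add: same_off_def)
      with less.hyps[of s''] * obtain t' s3 where
        "exec orc (While b c) s'' t' s3" "t' \<le> \<Phi> s'' + 1 + bcost b" "Inv s3" "\<not> bval b s3"
        unfolding runs_def by auto
      then show ?thesis
        unfolding runs_def using exec_WhileTrue[OF True *(1)] *(2,4)
        by (intro exI[of _ "1 + bcost b + t + t'"] exI[of _ s3]) auto
    next
      case False
      then show ?thesis
        unfolding runs_def using exec_WhileFalse[OF False] less.prems(1) by fastforce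
    qed
  qed
  then show ?thesis using assms(1) by (simp add: same_off_def)
qed

section \<open>Notation and counting loops\<close>

abbreviation V :: "string \<Rightarrow> iexp" where "V v \<equiv> IMem v (IConst 0)"

abbreviation set_scalar :: "string \<Rightarrow> iexp \<Rightarrow> com" (infix "::=" 62) where
  "v ::= e \<equiv> IAssign v (IConst 0) e"

notation Seq (infixr ";;" 60)

definition For :: "string \<Rightarrow> iexp \<Rightarrow> com \<Rightarrow> com" where
  "For v e c = While (ILess (V v) e) (c ;; v ::= IAdd (V v) (IConst 1))"

lemma writes_For [simp]: "iw (For v e c) = insert v (iw c)" "rw (For v e c) = rw c"
  by (auto simp: For_def)

text \<open>The limit \<open>e\<close> is evaluated afresh in each round, hence the premise
  \<open>bound\<close>. The increment belongs to the loop, so the body has to establish the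
  invariant for the state after \<open>iupdate v 0 (k + 1)\<close>. A round adds 6 for the
  increment, \<open>3 + icost e\<close> for the guard and 1 for the loop itself.\<close>

lemma runs_For:
  assumes "imem s v 0 = lw" "lw \<le> hg" "Inv lw s"
    and body: "\<And>k s'. lw \<le> k \<Longrightarrow> k < hg \<Longrightarrow> Inv k s' \<Longrightarrow> imem s' v 0 = k \<Longrightarrow> same_off (For v e c) s s' \<Longrightarrow>
       runs orc c s' T (\<lambda>s''. imem s'' v 0 = k \<and> Inv (k + 1) (iupdate v 0 (k + 1) s''))"
    and bound: "\<And>k s'. Inv k s' \<Longrightarrow> same_off (For v e c) s s' \<Longrightarrow> ival e s' = hg"
    and T': "nat (hg - lw) * (T + icost e + 10) + icost e + 4 \<le> T'"
  shows "runs orc (For v e c) s T' (\<lambda>s'. Inv hg s' \<and> imem s' v 0 = hg)"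
proof -
  let ?b = "ILess (V v) e"
  let ?c = "c ;; v ::= IAdd (V v) (IConst 1)"
  let ?I = "\<lambda>s'. lw \<le> imem s' v 0 \<and> imem s' v 0 \<le> hg \<and> Inv (imem s' v 0) s' \<and> same_off (For v e c) s s'"
  let ?F = "\<lambda>s'. nat (hg - imem s' v 0) * (T + icost e + 10)"
  have "runs orc (While ?b ?c) s (?F s + 1 + bcost ?b) (\<lambda>s'. ?I s' \<and> \<not> bval ?b s')"
  proof (rule runs_While)
    show "?I s" using assms by (simp add: same_off_def)
  next
    fix s' assume I: "?I s'" and b: "bval ?b s'"
    define k where "k = imem s' v 0"
    have e: "ival e s' = hg" using bound I by blast
    then have k: "lw \<le> k" "k < hg" using I b by (auto simp: k_def)
    have "runs orc ?c s' (T + 6)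
       (\<lambda>s''. ?I s'' \<and> T + 6 + 1 + bcost ?b + ?F s'' \<le> ?F s')"
    proof (rule runs_Seq2[OF body[of k s']])
      fix s'' assume a: "imem s'' v 0 = k \<and> Inv (k + 1) (iupdate v 0 (k + 1) s'')" and so: "same_off c s' s''"
      have "nat (hg - k) = Suc (nat (hg - (k + 1)))" using k by simp
      moreover have "same_off (For v e c) s (iupdate v 0 (k + 1) s'')"
        using I so by (auto simp: same_off_def)
      ultimately show "runs orc (v ::= IAdd (V v) (IConst 1)) s'' 6
          (\<lambda>s''. ?I s'' \<and> T + 6 + 1 + bcost ?b + ?F s'' \<le> ?F s')"
        using a k by (intro runs_wp_le) (auto simp: k_def[symmetric] mult_Suc)
    qed (use I k k_def in auto)
    then show "\<exists>T'. runs orc ?c s' T' (\<lambda>s''. ?I s'' \<and> T' + 1 + bcost ?b + ?F s'' \<le> ?F s')" by blast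
  qed
  note main = this
  show ?thesis
    apply (subst For_def)
  proof (rule runs_mono[OF main])
    show "?F s + 1 + bcost ?b \<le> T'" using T' assms(1) by simp
  next
    fix s' assume a: "?I s' \<and> \<not> bval ?b s'"
    then have "ival e s' = hg" using bound by blast
    with a have "imem s' v 0 = hg" by simp
    with a show "Inv hg s' \<and> imem s' v 0 = hg" by simp
  qed
qed

subsection \<open>Stable solutions of the nested problem\<close>

text \<open>\<open>g i k\<close> is the marginal cost of the \<open>k\<close>-th unit of variable \<open>i\<close>; breaking ties by position
  makes the optimum unique.\<close>

definition elt :: "(int \<Rightarrow> int \<Rightarrow> real) \<Rightarrow> int \<Rightarrow> int \<Rightarrow> int \<Rightarrow> int \<Rightarrow> bool" where
  "elt g i k j l \<longleftrightarrow> g i k < g j l \<or> g i k = g j l \<and> (i < j \<or> i = j \<and> k < l)"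

lemma elt_trans: "elt g i k j l \<Longrightarrow> elt g j l i' k' \<Longrightarrow> elt g i k i' k'"
  by (auto simp: elt_def)

lemma elt_irrefl: "\<not> elt g i k i k"
  by (auto simp: elt_def)

lemma elt_linear: "elt g i k j l \<or> i = j \<and> k = l \<or> elt g j l i k"
  by (auto simp: elt_def)

text \<open>A segment of the variables cut out of the whole: \<open>\<alpha>\<close> is the partial
  sum reached at its left end and \<open>\<beta>\<close> the one prescribed at its right end. The
  constraint at \<open>k\<close> is a set, so that \<open>UNIV\<close> can express its
  absence.\<close>

definition feas :: "(int \<Rightarrow> int) \<Rightarrow> (int \<Rightarrow> int) \<Rightarrow> (int \<Rightarrow> int set) \<Rightarrow> int \<Rightarrow> int \<Rightarrow> int \<Rightarrow> int \<Rightarrow> (int \<Rightarrow> int) \<Rightarrow> bool"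
  where "feas l u ok p q \<alpha> \<beta> x \<longleftrightarrow>
    (\<forall>i\<in>{p<..q}. l i \<le> x i \<and> x i \<le> u i) \<and>
    (\<forall>k\<in>{p<..<q}. \<alpha> + sum x {p<..k} \<in> ok k) \<and> \<alpha> + sum x {p<..q} = \<beta>"

lemma feasD:
  assumes "feas l u ok p q \<alpha> \<beta> x"
  shows "i \<in> {p<..q} \<Longrightarrow> l i \<le> x i" "i \<in> {p<..q} \<Longrightarrow> x i \<le> u i"
    "p < k \<Longrightarrow> k < q \<Longrightarrow> \<alpha> + sum x {p<..k} \<in> ok k" "\<alpha> + sum x {p<..q} = \<beta>"
  using assms by (auto simp: feas_def)

abbreviation exch :: "(int \<Rightarrow> int) \<Rightarrow> int \<Rightarrow> int \<Rightarrow> int \<Rightarrow> int" where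
  "exch x i j \<equiv> x(i := x i - 1, j := x j + 1)"

text \<open>Testing one unit of each variable is enough: for monotone marginals, \<open>x i\<close>
  is the costliest taken unit of \<open>i\<close> and \<open>x j + 1\<close> the cheapest untaken
  unit of \<open>j\<close>.\<close>

definition stable :: "(int \<Rightarrow> int \<Rightarrow> real) \<Rightarrow> (int \<Rightarrow> int) \<Rightarrow> (int \<Rightarrow> int) \<Rightarrow> (int \<Rightarrow> int set) \<Rightarrow>
    int \<Rightarrow> int \<Rightarrow> int \<Rightarrow> int \<Rightarrow> (int \<Rightarrow> int) \<Rightarrow> bool"
  where "stable g l u ok p q \<alpha> \<beta> x \<longleftrightarrow> feas l u ok p q \<alpha> \<beta> x \<and>
    (\<forall>i\<in>{p<..q}. \<forall>j\<in>{p<..q}. i \<noteq> j \<longrightarrow> feas l u ok p q \<alpha> \<beta> (exch x i j) \<longrightarrow> elt g i (x i) j (x j + 1))"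

definition intervals :: "(int \<Rightarrow> int set) \<Rightarrow> bool" where
  "intervals ok \<longleftrightarrow> (\<forall>k a b c. a \<in> ok k \<longrightarrow> c \<in> ok k \<longrightarrow> a \<le> b \<longrightarrow> b \<le> c \<longrightarrow> b \<in> ok k)"

lemma intervalsD: "intervals ok \<Longrightarrow> a \<in> ok k \<Longrightarrow> c \<in> ok k \<Longrightarrow> a \<le> b \<Longrightarrow> b \<le> c \<Longrightarrow> b \<in> ok k"
  unfolding intervals_def by blast

definition mono_marginals :: "(int \<Rightarrow> int \<Rightarrow> real) \<Rightarrow> bool" where
  "mono_marginals g \<longleftrightarrow> (\<forall>i k l. k \<le> l \<longrightarrow> g i k \<le> g i l)"

lemma mono_marginalsD: "mono_marginals g \<Longrightarrow> k \<le> l \<Longrightarrow> g i k \<le> g i l"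
  by (simp add: mono_marginals_def)

lemma feas_cong:
  assumes "\<And>i. i \<in> {p<..q} \<Longrightarrow> x i = y i"
  shows "feas l u ok p q \<alpha> \<beta> x \<longleftrightarrow> feas l u ok p q \<alpha> \<beta> y"
proof -
  have "sum x {p<..k} = sum y {p<..k}" if "k \<le> q" for k
    using that assms by (intro sum.cong) auto
  then show ?thesis using assms by (auto simp: feas_def)
qed

lemma stable_cong:
  assumes "\<And>i. i \<in> {p<..q} \<Longrightarrow> x i = y i"
  shows "stable g l u ok p q \<alpha> \<beta> x \<longleftrightarrow> stable g l u ok p q \<alpha> \<beta> y"
proof -
  have "feas l u ok p q \<alpha> \<beta> (exch x i j) \<longleftrightarrow> feas l u ok p q \<alpha> \<beta> (exch y i j)"
    if "i \<in> {p<..q}" "j \<in> {p<..q}" for i j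
    using assms that by (intro feas_cong) auto
  then show ?thesis using feas_cong[of p q x y] assms by (auto simp: stable_def)
qed

lemma sum_upd2:
  fixes x :: "int \<Rightarrow> int"
  assumes "i \<noteq> j" "p < i" "p < j"
  shows "sum (x(i := x i + a, j := x j + b)) {p<..k} =
    sum x {p<..k} + (if i \<le> k then a else 0) + (if j \<le> k then b else 0)"
proof -
  have "x(i := x i + a, j := x j + b) = (\<lambda>t. x t + (if t = i then a else 0) + (if t = j then b else 0))"
    using assms by auto
  then show ?thesis using assms by (simp add: sum.distrib)
qed

lemma sum_exch:
  assumes "i \<noteq> j" "p < i" "p < j"
  shows "sum (exch x i j) {p<..k} = sum x {p<..k} - (if i \<le> k then 1 else 0) + (if j \<le> k then 1 else 0)"
  using sum_upd2[OF assms, of x "-1" 1 k] by simp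

lemma sum_Ioc_last: "p < k \<Longrightarrow> sum x {p<..k} = sum x {p<..k - 1} + (x k :: int)" for k :: int
proof -
  assume "p < k"
  then have "{p<..k} = insert k {p<..k - 1}" by auto
  then show ?thesis by simp
qed

lemma sum_Ioc_split: "p \<le> r \<Longrightarrow> r \<le> k \<Longrightarrow> sum x {p<..k} = sum x {p<..r} + sum (x :: int \<Rightarrow> int) {r<..k}" for k :: int
proof -
  assume "p \<le> r" "r \<le> k"
  then have "{p<..k} = {p<..r} \<union> {r<..k}" "{p<..r} \<inter> {r<..k} = {}" by auto
  then show ?thesis by (simp add: sum.union_disjoint)
qed

text \<open>Follow the difference \<open>\<delta>\<close> of the partial sums of \<open>z\<close>
  and \<open>x\<close>. It is at most 0 at \<open>p\<close>, at least 0 at \<open>q\<close>, and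
  drops at \<open>i\<close>. So on one side of \<open>i\<close> there is a \<open>j\<close> where it
  rises, with a strict sign throughout between the two. There, shifting either partial sum by one
  moves it towards the other, hence within the interval \<open>ok k\<close>.\<close>

lemma exchange:
  assumes ok: "intervals ok"
    and x: "feas l u ok p q \<alpha> \<beta> x" and z: "feas l u ok p q \<alpha>' \<beta>' z"
    and "\<alpha>' \<le> \<alpha>" "\<beta> \<le> \<beta>'" and i: "i \<in> {p<..q}" "z i < x i"
  obtains j where "j \<in> {p<..q}" "x j < z j"
    "feas l u ok p q \<alpha> \<beta> (exch x i j)" "feas l u ok p q \<alpha>' \<beta>' (exch z j i)"
proof -
  note found = that
  define \<delta> where "\<delta> k = (\<alpha>' + sum z {p<..k}) - (\<alpha> + sum x {p<..k})" for k
  have \<delta>p: "\<delta> p \<le> 0" and \<delta>q: "0 \<le> \<delta> q"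
    using assms by (auto simp: \<delta>_def feas_def)
  have step: "\<delta> k = \<delta> (k - 1) + (z k - x k)" if "p < k" for k
    using that by (simp add: \<delta>_def sum_Ioc_last)
  have concl: thesis
    if j: "j \<in> {p<..q}" "x j < z j"
      and right: "\<And>k. i \<le> k \<Longrightarrow> k < j \<Longrightarrow> \<delta> k < 0"
      and left: "\<And>k. j \<le> k \<Longrightarrow> k < i \<Longrightarrow> 0 < \<delta> k" for j
  proof (rule found[OF j])
    have ij: "i \<noteq> j" "j \<noteq> i" "p < i" "p < j" "i \<le> q" "j \<le> q" using i j by auto
    have bnd: "l t \<le> x t \<and> x t \<le> u t" "l t \<le> z t \<and> z t \<le> u t" if "t \<in> {p<..q}" for t
      using x z that by (auto simp: feas_def)
    have bb: "l i \<le> x i - 1" "x i - 1 \<le> u i" "l j \<le> x j + 1" "x j + 1 \<le> u j"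
      "l i \<le> z i + 1" "z i + 1 \<le> u i" "l j \<le> z j - 1" "z j - 1 \<le> u j"
      using bnd[OF i(1)] bnd[OF j(1)] i j by auto
    have okx: "\<alpha> + sum x {p<..k} \<in> ok k" "\<alpha>' + sum z {p<..k} \<in> ok k" if "k \<in> {p<..<q}" for k
      using x z that by (auto simp: feas_def)
    have ends: "\<alpha> + sum x {p<..q} = \<beta>" "\<alpha>' + sum z {p<..q} = \<beta>'" using x z by (auto simp: feas_def)
    have "\<alpha> + sum (exch x i j) {p<..k} \<in> ok k" if k: "k \<in> {p<..<q}" for k
      using intervalsD[OF ok okx(1)[OF k] okx(2)[OF k], of "\<alpha> + sum x {p<..k} + 1"]
        intervalsD[OF ok okx(2)[OF k] okx(1)[OF k], of "\<alpha> + sum x {p<..k} - 1"]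
        okx(1)[OF k] right[of k] left[of k]
      unfolding sum_exch[OF ij(1,3,4)] \<delta>_def by (auto simp: algebra_simps)
    then show "feas l u ok p q \<alpha> \<beta> (exch x i j)"
      unfolding feas_def sum_exch[OF ij(1,3,4)] using bnd bb ij ends by auto
    have "\<alpha>' + sum (exch z j i) {p<..k} \<in> ok k" if k: "k \<in> {p<..<q}" for k
      using intervalsD[OF ok okx(1)[OF k] okx(2)[OF k], of "\<alpha>' + sum z {p<..k} - 1"]
        intervalsD[OF ok okx(2)[OF k] okx(1)[OF k], of "\<alpha>' + sum z {p<..k} + 1"]
        okx(2)[OF k] right[of k] left[of k]
      unfolding sum_exch[OF ij(2,4,3)] \<delta>_def by (auto simp: algebra_simps)
    then show "feas l u ok p q \<alpha>' \<beta>' (exch z j i)"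
      unfolding feas_def sum_exch[OF ij(2,4,3)] using bnd bb ij ends by auto
  qed
  show thesis
  proof (cases "\<delta> i < 0")
    case True
    define j where "j = Min {j \<in> {i..q}. 0 \<le> \<delta> j}"
    have "j \<in> {j \<in> {i..q}. 0 \<le> \<delta> j}"
      unfolding j_def
    proof (rule Min_in)
      show "finite {j \<in> {i..q}. 0 \<le> \<delta> j}" by (rule finite_subset[of _ "{i..q}"]) auto
      have "q \<in> {j \<in> {i..q}. 0 \<le> \<delta> j}" using \<delta>q i by simp
      then show "{j \<in> {i..q}. 0 \<le> \<delta> j} \<noteq> {}" by blast
    qed
    then have j: "i \<le> j" "j \<le> q" "0 \<le> \<delta> j" by auto
    have neg: "\<delta> k < 0" if "i \<le> k" "k < j" for k
    proof (rule ccontr)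
      assume "\<not> \<delta> k < 0"
      then have "j \<le> k" unfolding j_def using that j by (intro Min_le) (auto intro: finite_subset[of _ "{i..q}"])
      with that show False by simp
    qed
    have "i < j" using True j by (cases "i = j") auto
    then have "x j < z j" using neg[of "j - 1"] j step[of j] i by auto
    then show thesis using concl[of j] neg \<open>i < j\<close> i j by auto
  next
    case False
    \<comment> \<open>As \<open>\<delta>\<close> drops at \<open>i\<close>, being nonnegative after
      \<open>i\<close> means being positive before it; the rise is now searched to the left.\<close>
    then have pos: "0 < \<delta> (i - 1)" using step[of i] i by auto
    define j where "j = Max {j \<in> {p..i - 1}. \<delta> j \<le> 0}"
    have "j \<in> {j \<in> {p..i - 1}. \<delta> j \<le> 0}"
      unfolding j_def
    proof (rule Max_in)
      show "finite {j \<in> {p..i - 1}. \<delta> j \<le> 0}" by (rule finite_subset[of _ "{p..i - 1}"]) auto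
      have "p \<in> {j \<in> {p..i - 1}. \<delta> j \<le> 0}" using \<delta>p i by simp
      then show "{j \<in> {p..i - 1}. \<delta> j \<le> 0} \<noteq> {}" by blast
    qed
    then have j: "p \<le> j" "j \<le> i - 1" "\<delta> j \<le> 0" by auto
    have gt: "0 < \<delta> k" if "j < k" "k < i" for k
    proof (rule ccontr)
      assume "\<not> 0 < \<delta> k"
      then have "k \<le> j" unfolding j_def using that j by (intro Max_ge) (auto intro: finite_subset[of _ "{p..i - 1}"])
      with that show False by simp
    qed
    have "j < i - 1" using pos j by (cases "j = i - 1") auto
    then have "x (j + 1) < z (j + 1)" using gt[of "j + 1"] j step[of "j + 1"] i by auto
    then show thesis using concl[of "j + 1"] gt \<open>j < i - 1\<close> i j by auto
  qed
qed

text \<open>A violation permits exchanges in both points in opposite directions. Stability and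
  monotone marginals then order the units \<open>x i\<close> of \<open>i\<close>,
  \<open>x j + 1\<close> and \<open>z j\<close> of \<open>j\<close>, and \<open>z i + 1\<close> of
  \<open>i\<close> in a cycle; all marginals on it are equal, and the tie-breaking by index would
  need \<open>i < j\<close> and \<open>j < i\<close>. With equal outer sums this is
  uniqueness.\<close>

lemma stable_mono:
  assumes "intervals ok" "mono_marginals g" "stable g l u ok p q \<alpha> \<beta> x" "stable g l u ok p q \<alpha>' \<beta>' z"
    "\<alpha>' \<le> \<alpha>" "\<beta> \<le> \<beta>'" "i \<in> {p<..q}"
  shows "x i \<le> z i"
proof (rule ccontr)
  assume *: "\<not> x i \<le> z i"
  have f: "feas l u ok p q \<alpha> \<beta> x" "feas l u ok p q \<alpha>' \<beta>' z" using assms by (auto simp: stable_def)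
  obtain j where j: "j \<in> {p<..q}" "x j < z j"
    "feas l u ok p q \<alpha> \<beta> (exch x i j)" "feas l u ok p q \<alpha>' \<beta>' (exch z j i)"
    using exchange[OF assms(1) f assms(5,6,7)] * by auto
  then have "i \<noteq> j" using * by auto
  then have "elt g i (x i) j (x j + 1)" "elt g j (z j) i (z i + 1)"
    using assms(3,4,7) j by (auto simp: stable_def)
  moreover have "g i (z i + 1) \<le> g i (x i)" "g j (x j + 1) \<le> g j (z j)"
    using assms(2) j * by (auto simp: mono_marginals_def)
  ultimately show False using \<open>i \<noteq> j\<close> by (auto simp: elt_def)
qed

text \<open>Descent on the l1 distance to \<open>x\<close>: the exchange applied to \<open>z\<close>
  brings it closer, and stability of \<open>x\<close> compares precisely the two units involved, so
  the cost does not rise.\<close>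

lemma stable_min:
  fixes F :: "int \<Rightarrow> int \<Rightarrow> real"
  assumes "intervals ok" "mono_marginals g" and st: "stable g l u ok p q \<alpha> \<beta> x"
    and "feas l u ok p q \<alpha> \<beta> z"
    and F: "\<And>i k. i \<in> {p<..q} \<Longrightarrow> l i < k \<Longrightarrow> k \<le> u i \<Longrightarrow> F i k - F i (k - 1) = g i k"
  shows "(\<Sum>i\<in>{p<..q}. F i (x i)) \<le> (\<Sum>i\<in>{p<..q}. F i (z i))"
  using assms(4)
proof (induction "nat (\<Sum>i\<in>{p<..q}. \<bar>x i - z i\<bar>)" arbitrary: z rule: less_induct)
  case less
  note z = less.prems
  have x: "feas l u ok p q \<alpha> \<beta> x" using st by (auto simp: stable_def)
  show ?case
  proof (cases "\<exists>i\<in>{p<..q}. z i < x i")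
    case False
    then have le: "\<forall>i\<in>{p<..q}. x i \<le> z i" by auto
    have "sum x {p<..q} = sum z {p<..q}" using x z by (auto simp: feas_def)
    then have "\<forall>i\<in>{p<..q}. x i = z i"
      using le by (metis sum_mono_inv finite_greaterThanAtMost_int)
    then show ?thesis by simp
  next
    case True
    then obtain i where i: "i \<in> {p<..q}" "z i < x i" by auto
    from exchange[OF assms(1) x z _ _ i] obtain j where j: "j \<in> {p<..q}" "x j < z j"
      "feas l u ok p q \<alpha> \<beta> (exch x i j)" "feas l u ok p q \<alpha> \<beta> (exch z j i)" by auto
    have ij: "i \<noteq> j" using i j by auto
    have split: "sum h {p<..q} = h i + h j + sum h ({p<..q} - {i} - {j})" for h :: "int \<Rightarrow> 'a :: comm_monoid_add"
      using i j ij by (simp add: sum.remove[of _ i] sum.remove[of _ j] add.assoc)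
    let ?z = "exch z j i"
    have rest: "(\<Sum>t\<in>{p<..q} - {i} - {j}. h t (?z t)) = (\<Sum>t\<in>{p<..q} - {i} - {j}. h t (z t))"
      for h :: "int \<Rightarrow> int \<Rightarrow> 'a :: comm_monoid_add" by (intro sum.cong) auto
    have lt: "(\<Sum>t\<in>{p<..q}. \<bar>x t - ?z t\<bar>) < (\<Sum>t\<in>{p<..q}. \<bar>x t - z t\<bar>)"
      using rest[of "\<lambda>t v. \<bar>x t - v\<bar>"] i j ij by (simp add: split)
    have nn: "0 \<le> (\<Sum>t\<in>{p<..q}. \<bar>x t - ?z t\<bar>)" by (intro sum_nonneg) auto
    have "(\<Sum>t\<in>{p<..q}. F t (x t)) \<le> (\<Sum>t\<in>{p<..q}. F t (?z t))"
      by (rule less.hyps[OF iffD2[OF nat_less_eq_zless[OF nn] lt] j(4)])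
    also have "\<dots> = F i (z i + 1) + F j (z j - 1) + (\<Sum>t\<in>{p<..q} - {i} - {j}. F t (z t))"
    proof -
      have "F i (?z i) = F i (z i + 1)" "F j (?z j) = F j (z j - 1)" using ij by simp_all
      then show ?thesis using split[of "\<lambda>t. F t (?z t)"] rest[of F] by presburger
    qed
    also have "F i (z i + 1) = F i (z i) + g i (z i + 1)"
      using F[OF i(1), of "z i + 1"] i(2) feasD(1)[OF z i(1)] feasD(2)[OF x i(1)] by simp
    also have "F j (z j - 1) = F j (z j) - g j (z j)"
      using F[OF j(1), of "z j"] j(2) feasD(1)[OF x j(1)] feasD(2)[OF z j(1)] by simp
    also have "g i (z i + 1) \<le> g j (z j)"
    proof -
      have "elt g i (x i) j (x j + 1)" using st i j ij by (auto simp: stable_def)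
      moreover have "g i (z i + 1) \<le> g i (x i)" "g j (x j + 1) \<le> g j (z j)"
        using assms(2) i j by (auto simp: mono_marginals_def)
      ultimately show ?thesis by (auto simp: elt_def)
    qed
    finally show ?thesis by (simp add: split[of "\<lambda>t. F t (z t)"])
  qed
qed

text \<open>Minimising the real cost would not settle ties. The ranks \<open>\<rho>\<close> of the
  units in the strict order are natural numbers, and a feasible point with least total rank admits
  no improving exchange.\<close>

lemma stable_exists:
  assumes "feas l u ok p q \<alpha> \<beta> x0"
  shows "\<exists>x. stable g l u ok p q \<alpha> \<beta> x"
proof -
  define E where "E = Sigma {p<..q} (\<lambda>i. {l i<..u i})"
  have fin: "finite E" by (auto simp: E_def)
  define \<rho> where "\<rho> i k = card {e \<in> E. elt g (fst e) (snd e) i k}" for i k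
  have \<rho>: "\<rho> i k < \<rho> j m" if "elt g i k j m" "(i, k) \<in> E" for i k j m
    unfolding \<rho>_def
  proof (rule psubset_card_mono)
    show "{e \<in> E. elt g (fst e) (snd e) i k} \<subset> {e \<in> E. elt g (fst e) (snd e) j m}"
    proof (rule psubsetI)
      show "{e \<in> E. elt g (fst e) (snd e) i k} \<subseteq> {e \<in> E. elt g (fst e) (snd e) j m}"
        using that(1) elt_trans by blast
      have "(i, k) \<in> {e \<in> E. elt g (fst e) (snd e) j m}" "(i, k) \<notin> {e \<in> E. elt g (fst e) (snd e) i k}"
        using that by (auto simp: elt_irrefl)
      then show "{e \<in> E. elt g (fst e) (snd e) i k} \<noteq> {e \<in> E. elt g (fst e) (snd e) j m}" by metis
    qed
  qed (use fin in auto)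
  define G where "G x = (\<Sum>i\<in>{p<..q}. \<Sum>k\<in>{l i<..x i}. \<rho> i k)" for x
  from ex_has_least_nat[of "feas l u ok p q \<alpha> \<beta>", OF assms, of G] obtain x where
    x: "feas l u ok p q \<alpha> \<beta> x" "\<And>y. feas l u ok p q \<alpha> \<beta> y \<Longrightarrow> G x \<le> G y" by auto
  have "elt g i (x i) j (x j + 1)"
    if ij: "i \<in> {p<..q}" "j \<in> {p<..q}" "i \<noteq> j" and ex: "feas l u ok p q \<alpha> \<beta> (exch x i j)" for i j
  proof (rule ccontr)
    assume "\<not> elt g i (x i) j (x j + 1)"
    then have "elt g j (x j + 1) i (x i)" using elt_linear ij by blast
    moreover have b: "l i < x i" "x j < u j" "l j \<le> x j"
      using ex x ij unfolding feas_def by (smt (verit) fun_upd_apply)+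
    ultimately have lt: "\<rho> j (x j + 1) < \<rho> i (x i)" using ij by (intro \<rho>) (auto simp: E_def)
    let ?h = "\<lambda>x t. \<Sum>k\<in>{l t<..x t}. \<rho> t k"
    have split: "sum h {p<..q} = h i + h j + sum h ({p<..q} - {i} - {j})" for h :: "int \<Rightarrow> nat"
      using ij by (simp add: sum.remove[of _ i] sum.remove[of _ j] add.assoc)
    have rest: "sum (?h (exch x i j)) ({p<..q} - {i} - {j}) = sum (?h x) ({p<..q} - {i} - {j})"
      by (intro sum.cong) auto
    have "{l i<..x i} = insert (x i) {l i<..x i - 1}" "{l j<..x j + 1} = insert (x j + 1) {l j<..x j}"
      using b by auto
    then have "?h x i = \<rho> i (x i) + ?h (exch x i j) i" "?h (exch x i j) j = \<rho> j (x j + 1) + ?h x j"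
      using ij by auto
    then have "G (exch x i j) < G x" unfolding G_def split[of "?h x"] split[of "?h (exch x i j)"] rest
      using lt by linarith
    then show False using x(2)[OF ex] by simp
  qed
  then show ?thesis using x by (auto simp: stable_def)
qed

lemma feas_append:
  assumes "feas l u ok p r \<alpha> \<mu> x" "feas l u ok r q \<mu> \<beta> y" "\<mu> \<in> ok r" "p < r" "r < q"
  shows "feas l u ok p q \<alpha> \<beta> (\<lambda>i. if i \<le> r then x i else y i)"
proof -
  let ?z = "\<lambda>i. if i \<le> r then x i else y i"
  have 1: "sum ?z {p<..k} = sum x {p<..k}" if "k \<le> r" for k
    using that by (intro sum.cong) auto
  have 2: "sum ?z {r<..k} = sum y {r<..k}" for k
    by (intro sum.cong) auto
  have 3: "\<alpha> + sum ?z {p<..k} = \<mu> + sum y {r<..k}" if "r \<le> k" for k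
    using that assms sum_Ioc_split[of p r k ?z] by (auto simp: 1 2 feas_def)
  have "\<alpha> + sum ?z {p<..k} \<in> ok k" if "k \<in> {p<..<q}" for k
  proof (cases k r rule: linorder_cases)
    case less then show ?thesis using that assms(1) by (auto simp: 1 feas_def)
  next
    case equal then show ?thesis using assms by (auto simp: 1 feas_def)
  next
    case greater then show ?thesis using that assms(2) by (auto simp: 3 feas_def)
  qed
  moreover have "\<alpha> + sum ?z {p<..q} = \<beta>" using 3[of q] assms by (auto simp: feas_def)
  ultimately show ?thesis using assms(1,2) by (auto simp: feas_def)
qed

text \<open>An exchange inside one part leaves the partial sum at \<open>r\<close> alone. Glued to
  the unchanged other part it is therefore an exchange of the whole segment, where stability is
  known.\<close>

lemma stable_split:
  assumes st: "stable g l u ok p q \<alpha> \<beta> x" and r: "p < r" "r < q"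
  defines "\<mu> \<equiv> \<alpha> + sum x {p<..r}"
  shows "stable g l u ok p r \<alpha> \<mu> x" "stable g l u ok r q \<mu> \<beta> x" "\<mu> \<in> ok r"
proof -
  have x: "feas l u ok p q \<alpha> \<beta> x" using st by (simp add: stable_def)
  show \<mu>: "\<mu> \<in> ok r" using x r by (auto simp: \<mu>_def feas_def)
  have s: "\<alpha> + sum x {p<..k} = \<mu> + sum x {r<..k}" if "r \<le> k" for k
    using that r sum_Ioc_split[of p r k x] by (simp add: \<mu>_def)
  have f1: "feas l u ok p r \<alpha> \<mu> x" using x r by (auto simp: feas_def \<mu>_def)
  have f2: "feas l u ok r q \<mu> \<beta> x"
  proof -
    have "\<mu> + sum x {r<..k} \<in> ok k" if "k \<in> {r<..<q}" for k
      using x r that s[of k, symmetric] by (auto simp: feas_def)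
    moreover have "\<mu> + sum x {r<..q} = \<beta>" using x s[of q] r by (simp add: feas_def)
    ultimately show ?thesis using x r by (auto simp: feas_def)
  qed
  have "elt g i (x i) j (x j + 1)"
    if ij: "i \<in> {p<..r}" "j \<in> {p<..r}" "i \<noteq> j" and ex: "feas l u ok p r \<alpha> \<mu> (exch x i j)" for i j
  proof -
    have "feas l u ok p q \<alpha> \<beta> (exch x i j)"
      using feas_append[OF ex f2 \<mu> r] by (rule iffD1[OF feas_cong, rotated]) (use ij in auto)
    then show ?thesis using st ij r by (auto simp: stable_def)
  qed
  then show "stable g l u ok p r \<alpha> \<mu> x" using f1 by (auto simp: stable_def)
  have "elt g i (x i) j (x j + 1)"
    if ij: "i \<in> {r<..q}" "j \<in> {r<..q}" "i \<noteq> j" and ex: "feas l u ok r q \<mu> \<beta> (exch x i j)" for i j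
  proof -
    have "feas l u ok p q \<alpha> \<beta> (exch x i j)"
      using feas_append[OF f1 ex \<mu> r] by (rule iffD1[OF feas_cong, rotated]) (use ij in auto)
    then show ?thesis using st ij r by (auto simp: stable_def)
  qed
  then show "stable g l u ok r q \<mu> \<beta> x" using f2 by (auto simp: stable_def)
qed

text \<open>The monotone decomposition: the four extreme solutions of two adjacent segments confine the
  solution of their union to a box in which the nested constraints hold automatically.\<close>

lemma stable_combine:
  assumes ok: "intervals ok" and g: "mono_marginals g" and r: "p < r" "r < q"
    and z: "stable g l u ok p q \<alpha> \<beta> z"
    and bnd: "a \<in> ok r" "b \<in> ok r" "\<And>w. w \<in> ok r \<Longrightarrow> a \<le> w \<and> w \<le> b"
    and La: "stable g l u ok p r \<alpha> a La" and Lb: "stable g l u ok p r \<alpha> b Lb"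
    and Ra: "stable g l u ok r q a \<beta> Ra" and Rb: "stable g l u ok r q b \<beta> Rb"
  shows "stable g (\<lambda>i. if i \<le> r then La i else Rb i) (\<lambda>i. if i \<le> r then Lb i else Ra i)
    (\<lambda>_. UNIV) p q \<alpha> \<beta> z" (is "stable g ?l ?u _ _ _ _ _ _")
proof -
  let ?f = "feas ?l ?u (\<lambda>_. UNIV) p q \<alpha> \<beta>"
  note zs = stable_split[OF z r]
  have "a \<le> \<alpha> + sum z {p<..r}" "\<alpha> + sum z {p<..r} \<le> b" using bnd(3) zs(3) by auto
  \<comment> \<open>A larger sum at \<open>r\<close> raises the variables on its left and lowers
    those on its right. This is why \<open>a\<close> and \<open>b\<close> exchange their roles
    between the two sides.\<close>
  then have zbox: "?l i \<le> z i \<and> z i \<le> ?u i" if "i \<in> {p<..q}" for i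
    using that stable_mono[OF ok g La zs(1), of i] stable_mono[OF ok g zs(1) Lb, of i]
      stable_mono[OF ok g Rb zs(2), of i] stable_mono[OF ok g zs(2) Ra, of i] by auto
  have f: "feas l u ok p r \<alpha> a La" "feas l u ok p r \<alpha> b Lb" "feas l u ok r q a \<beta> Ra" "feas l u ok r q b \<beta> Rb"
    using La Lb Ra Rb by (auto simp: stable_def)
  \<comment> \<open>Inside the box, partial sums left of \<open>r\<close> lie between those of
    \<open>La\<close> and \<open>Lb\<close>; right of \<open>r\<close> they are counted backwards
    from \<open>\<beta>\<close> and lie between those of \<open>Ra\<close> and \<open>Rb\<close>.
    Both ends satisfy the constraint, and constraints are intervals.\<close>
  have box: "feas l u ok p q \<alpha> \<beta> x" if x: "?f x" for x
  proof -
    have le: "?l i \<le> x i \<and> x i \<le> ?u i" if "i \<in> {p<..q}" for i using x that by (auto simp: feas_def)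
    have 1: "sum La {p<..k} \<le> sum x {p<..k} \<and> sum x {p<..k} \<le> sum Lb {p<..k}" if "k \<le> r" for k
    proof -
      have "La i \<le> x i \<and> x i \<le> Lb i" if "i \<in> {p<..k}" for i using le[of i] that \<open>k \<le> r\<close> r by auto
      then show ?thesis by (auto intro: sum_mono)
    qed
    have 2: "sum Rb {k<..q} \<le> sum x {k<..q} \<and> sum x {k<..q} \<le> sum Ra {k<..q}" if "r \<le> k" for k
    proof -
      have "Rb i \<le> x i \<and> x i \<le> Ra i" if "i \<in> {k<..q}" for i using le[of i] that \<open>r \<le> k\<close> r by auto
      then show ?thesis by (auto intro: sum_mono)
    qed
    have tot: "\<alpha> + sum x {p<..q} = \<beta>" using x by (auto simp: feas_def)
    have "\<alpha> + sum x {p<..k} \<in> ok k" if k: "k \<in> {p<..<q}" for k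
    proof (cases k r rule: linorder_cases)
      case less
      have "p < k" using k by simp
      then show ?thesis using 1[of k] less
        by (intro intervalsD[OF ok feasD(3)[OF f(1)] feasD(3)[OF f(2)]]) simp_all
    next
      case equal
      have "a \<le> \<alpha> + sum x {p<..r}" "\<alpha> + sum x {p<..r} \<le> b"
        using feasD(4)[OF f(1)] feasD(4)[OF f(2)] 1[of r] by auto
      then show ?thesis using intervalsD[OF ok bnd(1,2)] equal by simp
    next
      case greater
      have "\<alpha> + sum x {p<..k} = \<beta> - sum x {k<..q}"
        using tot sum_Ioc_split[of p k q x] k by simp
      moreover have "a + sum Ra {r<..k} = \<beta> - sum Ra {k<..q}" "b + sum Rb {r<..k} = \<beta> - sum Rb {k<..q}"
        using feasD(4)[OF f(3)] feasD(4)[OF f(4)] sum_Ioc_split[of r k q Ra] sum_Ioc_split[of r k q Rb] greater k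
        by auto
      ultimately show ?thesis using 2[of k] greater k
        by (intro intervalsD[OF ok feasD(3)[OF f(3)] feasD(3)[OF f(4)]]) simp_all
    qed
    moreover have "l i \<le> x i \<and> x i \<le> u i" if "i \<in> {p<..q}" for i
    proof -
      have "l i \<le> ?l i \<and> ?u i \<le> u i"
        using feasD(1)[OF f(1)] feasD(1)[OF f(4)] feasD(2)[OF f(2)] feasD(2)[OF f(3)] that by simp
      then show ?thesis using le[OF that] by linarith
    qed
    ultimately show ?thesis using tot by (auto simp: feas_def)
  qed
  have "?f z" using zbox z by (auto simp: feas_def stable_def)
  then show ?thesis using z box by (auto simp: stable_def)
qed

subsection \<open>Linear-time selection\<close>

text \<open>Ties between keys are decided by position, which makes the order strict and linear and
  the ranks of distinct elements distinct.\<close>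

definition klt :: "(int \<Rightarrow> real) \<Rightarrow> int \<Rightarrow> int \<Rightarrow> bool" where
  "klt f p q \<longleftrightarrow> f p < f q \<or> \<not> f q < f p \<and> p < q"

lemma klt_irrefl [simp]: "\<not> klt f p p"
  by (simp add: klt_def)

lemma klt_trans: "klt f p q \<Longrightarrow> klt f q r \<Longrightarrow> klt f p r"
  by (auto simp: klt_def)

lemma klt_asym: "klt f p q \<Longrightarrow> \<not> klt f q p"
  by (auto simp: klt_def)

lemma klt_linear: "klt f p q \<or> p = q \<or> klt f q p"
  by (auto simp: klt_def)

definition krank :: "(int \<Rightarrow> real) \<Rightarrow> int set \<Rightarrow> int \<Rightarrow> nat" where
  "krank f S e = card {q \<in> S. klt f q e}"

definition isrank :: "(int \<Rightarrow> real) \<Rightarrow> int set \<Rightarrow> int \<Rightarrow> int \<Rightarrow> bool" where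
  "isrank f S r e \<longleftrightarrow> e \<in> S \<and> int (krank f S e) = r"

lemma krank_less: "finite S \<Longrightarrow> p \<in> S \<Longrightarrow> klt f p q \<Longrightarrow> krank f S p < krank f S q"
  unfolding krank_def
proof (rule psubset_card_mono)
  assume "finite S" "p \<in> S" "klt f p q"
  then have "{r \<in> S. klt f r p} \<subseteq> {r \<in> S. klt f r q}" "p \<in> {r \<in> S. klt f r q}" "p \<notin> {r \<in> S. klt f r p}"
    using klt_trans by auto
  then show "{r \<in> S. klt f r p} \<subset> {r \<in> S. klt f r q}" by blast
qed auto

text \<open>In a strict linear order ranks are injective and lie below \<open>card S\<close>; by
  counting they exhaust that range.\<close>

lemma isrank_exists:
  assumes "finite S" "0 \<le> r" "r < int (card S)"
  shows "\<exists>e. isrank f S r e"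
proof -
  have inj: "inj_on (krank f S) S"
    using krank_less[OF assms(1)] klt_linear by (metis inj_onI less_irrefl)
  have "krank f S ` S \<subseteq> {..<card S}"
  proof
    fix y assume "y \<in> krank f S ` S"
    then obtain e where e: "e \<in> S" "y = krank f S e" by auto
    have "card {q \<in> S. klt f q e} < card S"
    proof (rule psubset_card_mono)
      have "e \<notin> {q \<in> S. klt f q e}" by simp
      then show "{q \<in> S. klt f q e} \<subset> S" using e by blast
    qed (use assms in auto)
    then show "y \<in> {..<card S}" using e by (simp add: krank_def)
  qed
  moreover have "card (krank f S ` S) = card {..<card S}"
    using card_image[OF inj] by simp
  ultimately have "krank f S ` S = {..<card S}"
    by (intro card_subset_eq) auto
  then have "nat r \<in> krank f S ` S" using assms by auto
  then show ?thesis using assms(2) by (auto simp: isrank_def)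
qed

lemma card_filter_image:
  assumes "inj_on A J" "finite J"
  shows "card {q \<in> A ` J. P q} = card {k \<in> J. P (A k)}"
proof -
  have "{q \<in> A ` J. P q} = A ` {k \<in> J. P (A k)}" by auto
  then show ?thesis using assms by (simp add: card_image inj_on_subset)
qed

lemma card_Collect_upto:
  fixes k :: int
  assumes "l \<le> k"
  shows "card {j \<in> {l..<k + 1}. P j} = card {j \<in> {l..<k}. P j} + (if P k then 1 else 0)"
proof -
  have "{j \<in> {l..<k + 1}. P j} = (if P k then insert k else id) {j \<in> {l..<k}. P j}"
    using assms by (auto simp: order_le_less)
  moreover have "finite {j \<in> {l..<k}. P j}" by (rule finite_subset[of _ "{l..<k}"]) auto
  ultimately show ?thesis by simp
qed

text \<open>The test for \<open>klt\<close>; Boolean expressions offer only negation and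
  conjunction, so the disjunction appears through De Morgan.\<close>

definition LT :: "string \<Rightarrow> iexp \<Rightarrow> iexp \<Rightarrow> bexp" where
  "LT kn p q = BNot (BAnd (BNot (RLess (RMem kn p) (RMem kn q)))
     (BNot (BAnd (BNot (RLess (RMem kn q) (RMem kn p))) (ILess p q))))"

lemma bval_LT [simp]: "bval (LT kn p q) s \<longleftrightarrow> klt (rmem s kn) (ival p s) (ival q s)"
  by (auto simp: LT_def klt_def)

lemma bcost_LT [simp]: "bcost (LT kn p q) = 13 + 3 * icost p + 3 * icost q"
  by (simp add: LT_def)

abbreviation IEQ :: "iexp \<Rightarrow> iexp \<Rightarrow> bexp" where
  "IEQ a b \<equiv> BAnd (BNot (ILess a b)) (BNot (ILess b a))"

abbreviation "C0 \<equiv> IConst 0"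
abbreviation "C1 \<equiv> IConst 1"

definition rank_prog :: "string \<Rightarrow> com" where
  "rank_prog kn = (''rc'' ::= C0 ;; ''rt'' ::= V ''rlo'') ;;
     For ''rt'' (V ''rhi'') (Cond (LT kn (IMem ''A'' (V ''rt'')) (V ''re''))
       (''rc'' ::= IAdd (V ''rc'') C1) Skip)"

lemma rank_prog_writes [simp]: "iw (rank_prog kn) = {''rc'', ''rt''}" "rw (rank_prog kn) = {}"
  by (auto simp: rank_prog_def)

lemma runs_rank_prog:
  assumes "imem s ''rlo'' 0 \<le> imem s ''rhi'' 0"
  shows "runs orc (rank_prog kn) s (60 * nat (imem s ''rhi'' 0 - imem s ''rlo'' 0) + 20)
    (\<lambda>s'. imem s' ''rc'' 0 = int (card {k \<in> {imem s ''rlo'' 0..<imem s ''rhi'' 0}.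
      klt (rmem s kn) (imem s ''A'' k) (imem s ''re'' 0)}))"
proof -
  let ?lo = "imem s ''rlo'' 0" and ?hi = "imem s ''rhi'' 0"
  let ?P = "\<lambda>k. klt (rmem s kn) (imem s ''A'' k) (imem s ''re'' 0)"
  define cnt where "cnt j = card {k \<in> {?lo..<j}. ?P k}" for j
  have cnt: "cnt ?lo = 0" "?lo \<le> k \<Longrightarrow> cnt (k + 1) = cnt k + (if ?P k then 1 else 0)" for k
    unfolding cnt_def by (simp, rule card_Collect_upto)
  show ?thesis
    unfolding rank_prog_def cnt_def[symmetric]
  proof (rule runs_block[where Q = "\<lambda>s'. imem s' ''rc'' 0 = 0 \<and> imem s' ''rt'' 0 = imem s ''rlo'' 0"
      and T' = "60 * nat (imem s ''rhi'' 0 - imem s ''rlo'' 0) + 6"])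
  fix s1 assume s1: "imem s1 ''rc'' 0 = 0 \<and> imem s1 ''rt'' 0 = ?lo"
    and so1: "same_off (''rc'' ::= C0 ;; ''rt'' ::= V ''rlo'') s s1"
  note fr1 = same_offD[OF so1, simplified]
  have "runs orc (For ''rt'' (V ''rhi'') (Cond (LT kn (IMem ''A'' (V ''rt'')) (V ''re''))
       (''rc'' ::= IAdd (V ''rc'') C1) Skip)) s1 (60 * nat (?hi - ?lo) + 6)
     (\<lambda>s'. imem s' ''rc'' 0 = int (cnt ?hi) \<and> imem s' ''rt'' 0 = ?hi)"
  proof (rule runs_For[where T = 48 and lw = ?lo and hg = ?hi
        and Inv = "\<lambda>j s'. imem s' ''rc'' 0 = int (cnt j)"])
    fix k s' assume k: "?lo \<le> k" "k < ?hi" "imem s' ''rt'' 0 = k"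
      and I: "imem s' ''rc'' 0 = int (cnt k)"
      and so: "same_off (For ''rt'' (V ''rhi'') (Cond (LT kn (IMem ''A'' (V ''rt'')) (V ''re''))
       (''rc'' ::= IAdd (V ''rc'') C1) Skip)) s1 s'"
    note fr = same_offD[OF so, simplified]
    show "runs orc (Cond (LT kn (IMem ''A'' (V ''rt'')) (V ''re'')) (''rc'' ::= IAdd (V ''rc'') C1) Skip)
        s' 48 (\<lambda>s''. imem s'' ''rt'' 0 = k \<and>
          imem (iupdate ''rt'' 0 (k + 1) s'') ''rc'' 0 = int (cnt (k + 1)))"
      using k(1,3) I by (intro runs_wp_le) (auto simp: cnt fr fr1)
  next
    fix k s' assume so: "same_off (For ''rt'' (V ''rhi'') (Cond (LT kn (IMem ''A'' (V ''rt'')) (V ''re''))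
       (''rc'' ::= IAdd (V ''rc'') C1) Skip)) s1 s'"
    show "ival (V ''rhi'') s' = ?hi" using same_offD[OF so, simplified] fr1 by simp
  qed (use assms s1 cnt in auto)
  then show "runs orc (For ''rt'' (V ''rhi'') (Cond (LT kn (IMem ''A'' (V ''rt'')) (V ''re''))
       (''rc'' ::= IAdd (V ''rc'') C1) Skip)) s1 (60 * nat (?hi - ?lo) + 6)
     (\<lambda>s'. imem s' ''rc'' 0 = int (cnt ?hi))"
    by (rule runs_mono) auto
qed auto
qed

text \<open>Quadratic selection that tries every element. It is run only on groups of five and on
  segments shorter than 60, where it costs a constant.\<close>

definition brute_prog :: "string \<Rightarrow> com" where
  "brute_prog kn = ''bt'' ::= V ''bl'' ;;
     For ''bt'' (V ''bh'') ((''re'' ::= IMem ''A'' (V ''bt'') ;; ''rlo'' ::= V ''bl'' ;; ''rhi'' ::= V ''bh'') ;;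
       rank_prog kn ;;
       Cond (IEQ (V ''rc'') (V ''br'')) (''piv'' ::= IMem ''A'' (V ''bt'')) Skip)"

lemma brute_prog_writes [simp]:
  "iw (brute_prog kn) = {''bt'', ''re'', ''rlo'', ''rhi'', ''rc'', ''rt'', ''piv''}" "rw (brute_prog kn) = {}"
  by (auto simp: brute_prog_def)

lemma runs_brute_prog:
  fixes s :: state and kn :: string
  defines "l \<equiv> imem s ''bl'' 0" and "h \<equiv> imem s ''bh'' 0" and "r \<equiv> imem s ''br'' 0"
  assumes inj: "inj_on (imem s ''A'') {l..<h}" and r: "0 \<le> r" "r < h - l"
  shows "runs orc (brute_prog kn) s (nat (h - l) * (60 * nat (h - l) + 80) + 20)
    (\<lambda>s'. isrank (rmem s kn) (imem s ''A'' ` {l..<h}) r (imem s' ''piv'' 0))"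
proof -
  define A where "A = imem s ''A''"
  define f where "f = rmem s kn"
  define S where "S = A ` {l..<h}"
  let ?body = "(''re'' ::= IMem ''A'' (V ''bt'') ;; ''rlo'' ::= V ''bl'' ;; ''rhi'' ::= V ''bh'') ;;
       rank_prog kn ;;
       Cond (IEQ (V ''rc'') (V ''br'')) (''piv'' ::= IMem ''A'' (V ''bt'')) Skip"
  \<comment> \<open>An implication, since nothing is known about \<open>piv\<close> until the answer
    has been met. Its premise holds at the end because the rank exists.\<close>
  let ?I = "\<lambda>j s'. (\<exists>k\<in>{l..<j}. isrank f S r (A k)) \<longrightarrow> isrank f S r (imem s' ''piv'' 0)"
  have cardS: "card {k \<in> {l..<h}. klt f (A k) e} = krank f S e" for e
    using card_filter_image[OF inj, of "\<lambda>q. klt f q e"] by (simp add: S_def A_def krank_def)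
  have "runs orc (brute_prog kn) s (nat (h - l) * (60 * nat (h - l) + 80) + 20)
      (\<lambda>s'. ?I h s' \<and> imem s' ''bt'' 0 = h)"
    unfolding brute_prog_def
  proof (rule runs_block[where Q = "\<lambda>s'. imem s' ''bt'' 0 = l" and
        T' = "nat (h - l) * (60 * nat (h - l) + 80) + 6"])
    fix s1 assume s1: "imem s1 ''bt'' 0 = l" and so1: "same_off (''bt'' ::= V ''bl'') s s1"
    note fr1 = same_offD[OF so1, simplified]
    show "runs orc (For ''bt'' (V ''bh'') ?body) s1 (nat (h - l) * (60 * nat (h - l) + 80) + 6)
       (\<lambda>s'. ?I h s' \<and> imem s' ''bt'' 0 = h)"
    proof (rule runs_For[where T = "60 * nat (h - l) + 64" and lw = l and hg = h and Inv = ?I])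
      fix k s' assume k: "l \<le> k" "k < h" "imem s' ''bt'' 0 = k" and I: "?I k s'"
        and so: "same_off (For ''bt'' (V ''bh'') ?body) s1 s'"
      note fr = same_offD[OF so, simplified]
      have k_in: "A k \<in> S" using k by (auto simp: S_def)
      show "runs orc ?body s' (60 * nat (h - l) + 64)
          (\<lambda>s''. imem s'' ''bt'' 0 = k \<and> ?I (k + 1) (iupdate ''bt'' 0 (k + 1) s''))"
      proof (rule runs_block[where Q = "\<lambda>s''. imem s'' ''re'' 0 = A k \<and> imem s'' ''rlo'' 0 = l \<and> imem s'' ''rhi'' 0 = h"
            and T' = "60 * nat (h - l) + 50"])
        fix s2 assume s2: "imem s2 ''re'' 0 = A k \<and> imem s2 ''rlo'' 0 = l \<and> imem s2 ''rhi'' 0 = h"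
          and so2: "same_off (''re'' ::= IMem ''A'' (V ''bt'') ;; ''rlo'' ::= V ''bl'' ;; ''rhi'' ::= V ''bh'') s' s2"
        note fr2 = same_offD[OF so2, simplified]
        have "runs orc (rank_prog kn) s2 (60 * nat (h - l) + 20)
          (\<lambda>s'. imem s' ''rc'' 0 = int (krank f S (A k)))"
          using runs_rank_prog[of s2 orc kn] s2 r cardS[of "A k"]
          by (simp add: fr2 fr fr1 A_def f_def)
        then show "runs orc (rank_prog kn ;; Cond (IEQ (V ''rc'') (V ''br'')) (''piv'' ::= IMem ''A'' (V ''bt'')) Skip)
           s2 (60 * nat (h - l) + 50) (\<lambda>s''. imem s'' ''bt'' 0 = k \<and> ?I (k + 1) (iupdate ''bt'' 0 (k + 1) s''))"
        proof (rule runs_Seq2)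
          fix s3 assume s3: "imem s3 ''rc'' 0 = int (krank f S (A k))" and so3: "same_off (rank_prog kn) s2 s3"
          note fr3 = same_offD[OF so3, simplified]
          have e: "{l..<k + 1} = insert k {l..<k}" using k by auto
          show "runs orc (Cond (IEQ (V ''rc'') (V ''br'')) (''piv'' ::= IMem ''A'' (V ''bt'')) Skip) s3 30
            (\<lambda>s''. imem s'' ''bt'' 0 = k \<and> ?I (k + 1) (iupdate ''bt'' 0 (k + 1) s''))"
            using s3 k I k_in unfolding e
            by (intro runs_wp_le) (auto simp: fr3 fr2 fr fr1 isrank_def A_def r_def)
        qed simp
      qed (use k in \<open>auto simp: fr fr1 A_def l_def h_def\<close>)
    next
      fix k s' assume so: "same_off (For ''bt'' (V ''bh'') ?body) s1 s'"
      show "ival (V ''bh'') s' = h" using same_offD[OF so, simplified] fr1 by (simp add: h_def)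
    qed (use s1 r in \<open>auto simp: algebra_simps\<close>)
  qed (use r in \<open>auto simp: l_def\<close>)
  then show ?thesis
  proof (rule runs_mono)
    have "finite S" "card S = nat (h - l)" using inj by (auto simp: S_def A_def card_image)
    then obtain e where "isrank f S r e" using isrank_exists[of S r f] r by auto
    then have ex: "\<exists>k\<in>{l..<h}. isrank f S r (A k)" by (auto simp: isrank_def S_def)
    fix s' assume "?I h s' \<and> imem s' ''bt'' 0 = h"
    with ex show "isrank (rmem s kn) (imem s ''A'' ` {l..<h}) r (imem s' ''piv'' 0)"
      by (simp add: S_def A_def f_def)
  qed simp
qed

definition filter_prog :: "bexp \<Rightarrow> com" where
  "filter_prog b = (''fw'' ::= V ''fo'' ;; ''ft'' ::= V ''fo'') ;;
     For ''ft'' (V ''fh'') (Cond b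
       (IAssign ''A'' (V ''fw'') (IMem ''A'' (V ''ft'')) ;; ''fw'' ::= IAdd (V ''fw'') C1) Skip)"

lemma filter_prog_writes [simp]: "iw (filter_prog b) = {''fw'', ''ft'', ''A''}" "rw (filter_prog b) = {}"
  by (auto simp: filter_prog_def)

lemma runs_filter_prog:
  fixes s :: state
  defines "o' \<equiv> imem s ''fo'' 0" and "h \<equiv> imem s ''fh'' 0" and "A \<equiv> imem s ''A''"
  assumes oh: "o' \<le> h" and inj: "inj_on A {o'..<h}"
    and b: "\<And>s'. same_off (filter_prog b) s s' \<Longrightarrow> bval b s' \<longleftrightarrow> P (imem s' ''A'' (imem s' ''ft'' 0))"
  defines "c \<equiv> int (card {q \<in> A ` {o'..<h}. P q})"
  shows "runs orc (filter_prog b) s (nat (h - o') * (bcost b + 40) + 20)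
    (\<lambda>s'. imem s' ''A'' ` {o'..<o' + c} = {q \<in> A ` {o'..<h}. P q} \<and> inj_on (imem s' ''A'') {o'..<o' + c} \<and>
      (\<forall>j<o'. imem s' ''A'' j = A j))"
proof -
  define J where "J k = {j \<in> {o'..<k}. P (A j)}" for k
  let ?I = "\<lambda>k s'. imem s' ''fw'' 0 = o' + int (card (J k)) \<and>
      imem s' ''A'' ` {o'..<o' + int (card (J k))} = A ` J k \<and>
      (\<forall>j. j < o' \<or> k \<le> j \<longrightarrow> imem s' ''A'' j = A j)"
  let ?body = "Cond b (IAssign ''A'' (V ''fw'') (IMem ''A'' (V ''ft'')) ;; ''fw'' ::= IAdd (V ''fw'') C1) Skip"
  \<comment> \<open>The write position never overtakes the read position, so the entries still to be
    read are the original ones.\<close>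
  have cJ: "int (card (J k)) \<le> k - o'" if "o' \<le> k" for k
  proof -
    have "card (J k) \<le> card {o'..<k}" by (rule card_mono) (auto simp: J_def)
    then show ?thesis using that by simp
  qed
  have "runs orc (filter_prog b) s (nat (h - o') * (bcost b + 40) + 20) (\<lambda>s'. ?I h s' \<and> imem s' ''ft'' 0 = h)"
    unfolding filter_prog_def
  proof (rule runs_block[where Q = "\<lambda>s'. imem s' ''fw'' 0 = o' \<and> imem s' ''ft'' 0 = o'"
        and T' = "nat (h - o') * (bcost b + 40) + 6"])
    fix s1 assume s1: "imem s1 ''fw'' 0 = o' \<and> imem s1 ''ft'' 0 = o'"
      and so1: "same_off (''fw'' ::= V ''fo'' ;; ''ft'' ::= V ''fo'') s s1"
    note fr1 = same_offD[OF so1, simplified]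
    show "runs orc (For ''ft'' (V ''fh'') ?body) s1 (nat (h - o') * (bcost b + 40) + 6)
        (\<lambda>s'. ?I h s' \<and> imem s' ''ft'' 0 = h)"
    proof (rule runs_For[where T = "bcost b + 25" and lw = o' and hg = h and Inv = ?I])
      fix k s' assume k: "o' \<le> k" "k < h" "imem s' ''ft'' 0 = k" and I: "?I k s'"
        and so: "same_off (For ''ft'' (V ''fh'') ?body) s1 s'"
      have "same_off (filter_prog b) s s'" using so so1 by (auto simp: same_off_def filter_prog_def)
      then have bv: "bval b s' \<longleftrightarrow> P (A k)" using b[of s'] k I by simp
      let ?c = "int (card (J k))"
      have c1: "card (J (k + 1)) = card (J k) + (if P (A k) then 1 else 0)"
        using card_Collect_upto[OF k(1), of "\<lambda>j. P (A j)"] by (simp only: J_def)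
      have J1: "J (k + 1) = (if P (A k) then insert k (J k) else J k)"
        using k by (auto simp: J_def order_le_less)
      have iv: "{o'..<o' + (?c + 1)} = insert (o' + ?c) {o'..<o' + ?c}" by auto
      have img: "((imem s' ''A'')(o' + ?c := A k)) ` {o'..<o' + ?c} = imem s' ''A'' ` {o'..<o' + ?c}"
        by (intro image_cong) auto
      show "runs orc ?body s' (bcost b + 25)
          (\<lambda>s''. imem s'' ''ft'' 0 = k \<and> ?I (k + 1) (iupdate ''ft'' 0 (k + 1) s''))"
      proof (cases "P (A k)")
        case True
        have 1: "((imem s' ''A'')(o' + ?c := A k)) ` {o'..<o' + (?c + 1)} = A ` J (k + 1)"
          unfolding iv J1 using I True by (simp add: img del: fun_upd_apply) simp
        have 2: "((imem s' ''A'')(o' + ?c := A k)) j = A j" if "j < o' \<or> k + 1 \<le> j" for j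
          using that I cJ[OF k(1)] by auto
        have "wp orc ?body (\<lambda>s''. imem s'' ''ft'' 0 = k \<and> ?I (k + 1) (iupdate ''ft'' 0 (k + 1) s'')) s'"
          using True bv k I 1 2 c1 by (simp del: fun_upd_apply add: fun_upd_same fun_upd_other) (simp add: algebra_simps)
        then show ?thesis by (rule runs_wp_le) simp
      next
        case False
        then have "wp orc ?body (\<lambda>s''. imem s'' ''ft'' 0 = k \<and> ?I (k + 1) (iupdate ''ft'' 0 (k + 1) s'')) s'"
          using bv k I c1 J1 by simp
        then show ?thesis by (rule runs_wp_le) simp
      qed
    next
      fix k s' assume so: "same_off (For ''ft'' (V ''fh'') ?body) s1 s'"
      show "ival (V ''fh'') s' = h" using same_offD[OF so, simplified] fr1 by (simp add: h_def)
    next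
      show "?I o' s1" using s1 fr1 by (simp add: A_def J_def)
    qed (use s1 oh in \<open>auto simp: algebra_simps\<close>)
  qed (auto simp: o'_def)
  then show ?thesis
  proof (rule runs_mono)
    fix s' assume I: "?I h s' \<and> imem s' ''ft'' 0 = h"
    have "card (J h) = card {q \<in> A ` {o'..<h}. P q}"
      using card_filter_image[OF inj, of P] by (simp add: J_def)
    moreover have "A ` J h = {q \<in> A ` {o'..<h}. P q}" by (auto simp: J_def)
    ultimately have *: "imem s' ''A'' ` {o'..<o' + c} = {q \<in> A ` {o'..<h}. P q}"
      using I by (simp add: c_def)
    \<comment> \<open>Injectivity by counting: as many values as positions.\<close>
    then have "card (imem s' ''A'' ` {o'..<o' + c}) = card {o'..<o' + c}" by (simp add: c_def)
    then have "inj_on (imem s' ''A'') {o'..<o' + c}" by (intro eq_card_imp_inj_on) auto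
    with * I show "imem s' ''A'' ` {o'..<o' + c} = {q \<in> A ` {o'..<h}. P q} \<and>
       inj_on (imem s' ''A'') {o'..<o' + c} \<and> (\<forall>j<o'. imem s' ''A'' j = A j)" by auto
  qed simp
qed

lemma card_filter_split:
  assumes "finite S"
  shows "card S = card {q \<in> S. P q} + card {q \<in> S. \<not> P q}"
proof -
  have "S = {q \<in> S. P q} \<union> {q \<in> S. \<not> P q}" by blast
  moreover have "card ({q \<in> S. P q} \<union> {q \<in> S. \<not> P q}) = card {q \<in> S. P q} + card {q \<in> S. \<not> P q}"
    using assms by (intro card_Un_disjoint) auto
  ultimately show ?thesis by metis
qed

text \<open>In a group whose median is not below \<open>x\<close>, three of the five elements are
  not below \<open>x\<close>. There are \<open>card J - h\<close> such groups, and they are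
  disjoint. Dually, each group whose median is at most \<open>x\<close> has three elements not above
  \<open>x\<close>; these are \<open>h + 1\<close> groups, since that of \<open>x\<close> itself
  counts.\<close>

lemma median_of_medians:
  fixes G :: "int \<Rightarrow> int set" and m :: "int \<Rightarrow> int"
  assumes S: "finite S"
    and G: "\<And>j. j \<in> J \<Longrightarrow> G j \<subseteq> S" "\<And>j. j \<in> J \<Longrightarrow> card (G j) = 5"
      "\<And>i j. i \<in> J \<Longrightarrow> j \<in> J \<Longrightarrow> i \<noteq> j \<Longrightarrow> G i \<inter> G j = {}"
    and m: "\<And>j. j \<in> J \<Longrightarrow> isrank f (G j) 2 (m j)"
    and J: "finite J" and x: "isrank f (m ` J) h x"
  shows "inj_on m J"
    "int (card {q \<in> S. klt f q x}) + 3 * (int (card J) - h) \<le> int (card S)"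
    "int (card {q \<in> S. klt f x q}) + 3 * (h + 1) \<le> int (card S)"
proof -
  have finG: "finite (G j)" if "j \<in> J" for j using finite_subset[OF G(1)[OF that] S] .
  have mG: "m j \<in> G j" if "j \<in> J" for j using m[OF that] by (simp add: isrank_def)
  show inj: "inj_on m J"
  proof (rule inj_onI)
    fix i j assume ij: "i \<in> J" "j \<in> J" "m i = m j"
    then show "i = j" using mG[of i] mG[of j] G(3)[of i j] by auto
  qed
  have three: "card {q \<in> G j. \<not> klt f q (m j)} = 3" "card {q \<in> G j. \<not> klt f (m j) q} = 3"
    if j: "j \<in> J" for j
  proof -
    have c2: "card {q \<in> G j. klt f q (m j)} = 2" using m[OF j] by (simp add: isrank_def krank_def)
    have "card (G j) = card {q \<in> G j. klt f q (m j)} + card {q \<in> G j. \<not> klt f q (m j)}"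
      using card_filter_split[OF finG[OF j]] .
    then show "card {q \<in> G j. \<not> klt f q (m j)} = 3" using c2 G(2)[OF j] by simp
    have "{q \<in> G j. \<not> klt f (m j) q} = insert (m j) {q \<in> G j. klt f q (m j)}"
      using mG[OF j] klt_linear[of f] klt_asym[of f] by auto
    then show "card {q \<in> G j. \<not> klt f (m j) q} = 3" using c2 finG[OF j] by simp
  qed
  \<comment> \<open>The counting common to both estimates: disjoint triples of elements failing
    \<open>P\<close> are missing from the set counted.\<close>
  have block: "card {q \<in> S. P q} + 3 * card J' \<le> card S"
    if J': "J' \<subseteq> J" and G': "\<And>j. j \<in> J' \<Longrightarrow> G' j \<subseteq> G j \<and> card (G' j) = 3 \<and> (\<forall>q\<in>G' j. \<not> P q)"
    for P J' and G' :: "int \<Rightarrow> int set"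
  proof -
    have fJ: "finite J'" using J J' finite_subset by blast
    have fG: "finite (G' j)" if "j \<in> J'" for j using G'[OF that] finG J' that finite_subset by blast
    have "card (\<Union>j\<in>J'. G' j) = (\<Sum>j\<in>J'. card (G' j))"
    proof (rule card_UN_disjoint[OF fJ])
      show "\<forall>i\<in>J'. \<forall>j\<in>J'. i \<noteq> j \<longrightarrow> G' i \<inter> G' j = {}"
      proof (intro ballI impI)
        fix i j assume "i \<in> J'" "j \<in> J'" "i \<noteq> j"
        then have "G i \<inter> G j = {}" "G' i \<subseteq> G i" "G' j \<subseteq> G j" using G(3) J' G' by blast+
        then show "G' i \<inter> G' j = {}" by blast
      qed
    qed (use fG in blast)
    also have "\<dots> = 3 * card J'" using G' by simp
    finally have c: "card (\<Union>j\<in>J'. G' j) = 3 * card J'" .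
    have sub: "(\<Union>j\<in>J'. G' j) \<subseteq> S" using G' J' G(1) by blast
    have "card ({q \<in> S. P q} \<union> (\<Union>j\<in>J'. G' j)) = card {q \<in> S. P q} + card (\<Union>j\<in>J'. G' j)"
      using G' S sub finite_subset[OF sub S] by (intro card_Un_disjoint) auto
    moreover have "card ({q \<in> S. P q} \<union> (\<Union>j\<in>J'. G' j)) \<le> card S"
      using S sub by (intro card_mono) auto
    ultimately show ?thesis using c by simp
  qed
  have h: "int (card {j \<in> J. klt f (m j) x}) = h"
    using x card_filter_image[OF inj J, of "\<lambda>q. klt f q x"] by (simp add: isrank_def krank_def)
  obtain i where i: "i \<in> J" "m i = x" using x by (auto simp: isrank_def)
  let ?Jl = "{j \<in> J. klt f (m j) x}"
  have cJ: "card J = card ?Jl + card {j \<in> J. \<not> klt f (m j) x}"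
    using card_filter_split[OF J] .
  have "card {q \<in> S. klt f q x} + 3 * card {j \<in> J. \<not> klt f (m j) x} \<le> card S"
  proof (rule block[where G' = "\<lambda>j. {q \<in> G j. \<not> klt f q (m j)}"])
    fix j assume "j \<in> {j \<in> J. \<not> klt f (m j) x}"
    then show "{q \<in> G j. \<not> klt f q (m j)} \<subseteq> G j \<and> card {q \<in> G j. \<not> klt f q (m j)} = 3 \<and>
        (\<forall>q\<in>{q \<in> G j. \<not> klt f q (m j)}. \<not> klt f q x)"
      using three klt_linear[of f "m j" x] klt_trans[of f _ x "m j"] by auto
  qed auto
  then have "int (card {q \<in> S. klt f q x} + 3 * card {j \<in> J. \<not> klt f (m j) x}) \<le> int (card S)"
    by (simp only: of_nat_le_iff)
  then show "int (card {q \<in> S. klt f q x}) + 3 * (int (card J) - h) \<le> int (card S)"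
    using h unfolding cJ by simp
  have "card {q \<in> S. klt f x q} + 3 * card (insert i ?Jl) \<le> card S"
  proof (rule block[where G' = "\<lambda>j. {q \<in> G j. \<not> klt f (m j) q}"])
    fix j assume "j \<in> insert i ?Jl"
    then show "{q \<in> G j. \<not> klt f (m j) q} \<subseteq> G j \<and> card {q \<in> G j. \<not> klt f (m j) q} = 3 \<and>
        (\<forall>q\<in>{q \<in> G j. \<not> klt f (m j) q}. \<not> klt f x q)"
      using three i klt_trans[of f "m j" x] by auto
  qed (use i in auto)
  moreover have "card (insert i ?Jl) = card ?Jl + 1" using J i by simp
  ultimately have "int (card {q \<in> S. klt f x q} + 3 * (card ?Jl + 1)) \<le> int (card S)"
    by (simp only: of_nat_le_iff)
  then show "int (card {q \<in> S. klt f x q}) + 3 * (h + 1) \<le> int (card S)"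
    using h by simp
qed

text \<open>Each side has at most about 7/10 of the elements. The inequality is multiplied by ten to
  avoid fractions, and the 30 absorbs the rounding of the divisions by 5 and by 2.\<close>

definition good_pivot :: "(int \<Rightarrow> real) \<Rightarrow> int set \<Rightarrow> int \<Rightarrow> bool" where
  "good_pivot f S x \<longleftrightarrow> x \<in> S \<and> 10 * card {q \<in> S. klt f q x} \<le> 7 * card S + 30 \<and>
     10 * card {q \<in> S. klt f x q} \<le> 7 * card S + 30"

section \<open>The recursion of selection as an explicit stack\<close>

definition seg :: "(int \<Rightarrow> int) \<Rightarrow> (int \<Rightarrow> int) \<Rightarrow> (int \<Rightarrow> int) \<Rightarrow> int \<Rightarrow> int set" where
  "seg A off siz e = A ` {off e..<off e + siz e}"

text \<open>The recursion stack of the selection algorithm: at level \<open>e\<close> the element of rank \<open>rk e\<close> in a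
  segment of the array is sought; its value is the pivot for level \<open>e - 1\<close>.\<close>

definition sel_stack :: "(int \<Rightarrow> real) \<Rightarrow> int set \<Rightarrow> int \<Rightarrow> (int \<Rightarrow> int) \<Rightarrow> (int \<Rightarrow> int) \<Rightarrow> (int \<Rightarrow> int) \<Rightarrow>
    (int \<Rightarrow> int) \<Rightarrow> int \<Rightarrow> bool" where
  "sel_stack f U fl A off siz rk d \<longleftrightarrow>
    (\<forall>e. 0 \<le> e \<and> e \<le> d \<longrightarrow> 0 \<le> rk e \<and> rk e < siz e \<and> inj_on A {off e..<off e + siz e}) \<and>
    (\<forall>e e'. 0 \<le> e \<and> e < e' \<and> e' \<le> d \<longrightarrow> off e + siz e \<le> off e') \<and>
    (\<forall>e. 0 \<le> e \<and> e < d \<longrightarrow> 60 \<le> siz e) \<and>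
    (0 \<le> d \<longrightarrow> (\<forall>x. isrank f (seg A off siz 0) (rk 0) x \<longrightarrow> isrank f U fl x)) \<and>
    (\<forall>e. 0 \<le> e \<and> e < d \<longrightarrow>
      (\<forall>x. isrank f (seg A off siz (e + 1)) (rk (e + 1)) x \<longrightarrow> good_pivot f (seg A off siz e) x))"

lemma seg_cong:
  assumes "\<And>j. off e \<le> j \<Longrightarrow> j < off e + siz e \<Longrightarrow> A' j = A j" "off' e = off e" "siz' e = siz e"
  shows "seg A' off' siz' e = seg A off siz e"
  using assms by (auto simp: seg_def intro!: image_cong)

lemma sel_stack_top:
  assumes "sel_stack f U fl A off siz rk d" "0 \<le> d"
  shows "0 \<le> rk d" "rk d < siz d" "inj_on A {off d..<off d + siz d}"
  using assms by (auto simp: sel_stack_def)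

lemma sel_stack_pop:
  assumes st: "sel_stack f U fl A off siz rk d" and "0 \<le> d" and x: "isrank f (seg A off siz d) (rk d) x"
  shows "sel_stack f U fl A off siz rk (d - 1)"
    "d = 0 \<Longrightarrow> isrank f U fl x"
    "0 < d \<Longrightarrow> good_pivot f (seg A off siz (d - 1)) x \<and> 60 \<le> siz (d - 1)"
proof -
  show "sel_stack f U fl A off siz rk (d - 1)" using st by (auto simp: sel_stack_def)
  show "d = 0 \<Longrightarrow> isrank f U fl x" using st x by (auto simp: sel_stack_def)
  assume "0 < d"
  then have "0 \<le> d - 1 \<and> d - 1 < d" "d - 1 + 1 = d" by auto
  then show "good_pivot f (seg A off siz (d - 1)) x \<and> 60 \<le> siz (d - 1)"
    using st x unfolding sel_stack_def by metis
qed

text \<open>The search at the top level is narrowed to a smaller one whose answer is also an answer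
  of the old one. Lower levels live further left in the array, where nothing changes.\<close>

lemma sel_stack_shrink:
  assumes st: "sel_stack f U fl A off siz rk d" and d: "0 \<le> d"
    and A': "\<And>j. j < off d \<Longrightarrow> A' j = A j" "inj_on A' {off d..<off d + z}"
    and z: "z \<le> siz d" and r: "0 \<le> r" "r < z"
    and ans: "\<And>x. isrank f (A' ` {off d..<off d + z}) r x \<Longrightarrow> isrank f (seg A off siz d) (rk d) x"
  shows "sel_stack f U fl A' off (siz(d := z)) (rk(d := r)) d"
proof -
  have low: "off e + siz e \<le> off d" if "0 \<le> e" "e < d" for e
    using st that by (auto simp: sel_stack_def)
  have seg_eq: "seg A' off (siz(d := z)) e = seg A off siz e" if "0 \<le> e" "e < d" for e
    using low[OF that] A'(1) that by (intro seg_cong) auto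
  have seg_d: "seg A' off (siz(d := z)) d = A' ` {off d..<off d + z}" by (simp add: seg_def)
  have inj: "inj_on A' {off e..<off e + siz e}" if "0 \<le> e" "e < d" for e
  proof -
    have "inj_on A {off e..<off e + siz e}" using st that by (auto simp: sel_stack_def)
    then show ?thesis using low[OF that] A'(1) by (subst inj_on_cong[of _ _ A]) auto
  qed
  show ?thesis unfolding sel_stack_def
  proof (intro conjI allI impI)
    fix e assume e: "0 \<le> e \<and> e \<le> d"
    show "0 \<le> (rk(d := r)) e" "(rk(d := r)) e < (siz(d := z)) e"
      using st e r by (auto simp: sel_stack_def)
    show "inj_on A' {off e..<off e + (siz(d := z)) e}"
      using inj e A'(2) by (cases "e = d") auto
  next
    fix e e' assume "0 \<le> e \<and> e < e' \<and> e' \<le> d"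
    then show "off e + (siz(d := z)) e \<le> off e'" using st by (auto simp: sel_stack_def)
  next
    fix e assume "0 \<le> e \<and> e < d"
    then show "60 \<le> (siz(d := z)) e" using st by (auto simp: sel_stack_def)
  next
    fix x assume "isrank f (seg A' off (siz(d := z)) 0) ((rk(d := r)) 0) x"
    then show "isrank f U fl x"
      using st d ans seg_eq[of 0] seg_d by (cases "d = 0") (auto simp: sel_stack_def)
  next
    fix e x assume e: "0 \<le> e \<and> e < d" and x: "isrank f (seg A' off (siz(d := z)) (e + 1)) ((rk(d := r)) (e + 1)) x"
    have "isrank f (seg A off siz (e + 1)) (rk (e + 1)) x"
      using x e ans seg_eq[of "e + 1"] seg_d by (cases "e + 1 = d") auto
    then show "good_pivot f (seg A' off (siz(d := z)) e) x"
      using st e seg_eq[of e] by (auto simp: sel_stack_def)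
  qed
qed

text \<open>The medians of five are written directly above the top segment, so that no stored
  segment is overwritten. Asking for their median yields a good pivot for the level below by
  \<open>median_of_medians\<close>.\<close>

lemma sel_stack_push:
  assumes st: "sel_stack f U fl A off siz rk d" and d: "0 \<le> d" and big: "60 \<le> siz d"
  defines "tp \<equiv> off d + siz d" and "g \<equiv> siz d div 5"
  assumes A': "\<And>j. j < tp \<Longrightarrow> A' j = A j"
    and med: "\<And>j. 0 \<le> j \<Longrightarrow> j < g \<Longrightarrow>
      isrank f (A ` {off d + 5 * j..<off d + 5 * j + 5}) 2 (A' (tp + j))"
  shows "sel_stack f U fl A' (off(d + 1 := tp)) (siz(d + 1 := g)) (rk(d + 1 := g div 2)) (d + 1)"
proof -
  let ?off = "off(d + 1 := tp)" and ?siz = "siz(d + 1 := g)" and ?rk = "rk(d + 1 := g div 2)"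
  have low: "off e + siz e \<le> tp" if "0 \<le> e" "e \<le> d" for e
  proof (cases "e = d")
    case False
    then have "off e + siz e \<le> off d" using st that by (auto simp: sel_stack_def)
    then show ?thesis using big by (simp add: tp_def)
  qed (simp add: tp_def)
  have seg_eq: "seg A' ?off ?siz e = seg A off siz e" if "0 \<le> e" "e \<le> d" for e
    using low[OF that] A' that by (intro seg_cong) auto
  have inj: "inj_on A' {off e..<off e + siz e}" if "0 \<le> e" "e \<le> d" for e
  proof -
    have "inj_on A {off e..<off e + siz e}" using st that by (auto simp: sel_stack_def)
    then show ?thesis using low[OF that] A' by (subst inj_on_cong[of _ _ A]) auto
  qed
  define S where "S = seg A off siz d"
  define G where "G j = A ` {off d + 5 * j..<off d + 5 * j + 5}" for j
  define m where "m j = A' (tp + j)" for j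
  have injd: "inj_on A {off d..<off d + siz d}" using sel_stack_top[OF st d] by simp
  have sub: "{off d + 5 * j..<off d + 5 * j + 5} \<subseteq> {off d..<off d + siz d}" if "j \<in> {0..<g}" for j
    using that by (auto simp: g_def)
  have S: "finite S" "card S = nat (siz d)" using injd by (auto simp: S_def seg_def card_image)
  have GS: "G j \<subseteq> S" "card (G j) = 5" if "j \<in> {0..<g}" for j
  proof -
    show "G j \<subseteq> S" using sub[OF that] by (auto simp: G_def S_def seg_def)
    show "card (G j) = 5" unfolding G_def using inj_on_subset[OF injd sub[OF that]] by (simp add: card_image)
  qed
  have disj: "G i \<inter> G j = {}" if "i \<in> {0..<g}" "j \<in> {0..<g}" "i \<noteq> j" for i j
  proof -
    have "{off d + 5 * i..<off d + 5 * i + 5} \<inter> {off d + 5 * j..<off d + 5 * j + 5} = {}"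
      using that(3) by auto
    then show ?thesis unfolding G_def inj_on_image_Int[OF injd sub[OF that(1)] sub[OF that(2)], symmetric]
      by (simp only: image_empty)
  qed
  have med': "isrank f (G j) 2 (m j)" if "j \<in> {0..<g}" for j
    using med that by (auto simp: G_def m_def)
  have img: "m ` {0..<g} = A' ` {tp..<tp + g}"
  proof -
    have "tp + (x - tp) = x" for x :: int by simp
    moreover have "x - tp \<in> {0..<g}" if "x \<in> {tp..<tp + g}" for x using that by auto
    ultimately have "{tp..<tp + g} \<subseteq> (\<lambda>j. tp + j) ` {0..<g}" by (metis image_eqI subsetI)
    then have "{tp..<tp + g} = (\<lambda>j. tp + j) ` {0..<g}" by auto
    then show ?thesis by (simp only: image_image) (rule image_cong, simp_all add: m_def)
  qed
  have g: "12 \<le> g" using big by (auto simp: g_def)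
  have seg_new: "seg A' ?off ?siz (d + 1) = m ` {0..<g}" by (simp add: seg_def img)
  have injm: "inj_on A' {tp..<tp + g}"
  proof (rule inj_onI)
    fix a b assume ab: "a \<in> {tp..<tp + g}" "b \<in> {tp..<tp + g}" "A' a = A' b"
    then have "m (a - tp) \<in> G (a - tp)" "m (b - tp) \<in> G (b - tp)" "m (a - tp) = m (b - tp)"
      using med'[of "a - tp"] med'[of "b - tp"] by (auto simp: isrank_def m_def)
    then show "a = b" using disj[of "a - tp" "b - tp"] ab by auto
  qed
  have good: "good_pivot f S x" if x: "isrank f (m ` {0..<g}) (g div 2) x" for x
  proof -
    note mm = median_of_medians[OF S(1) GS disj med' _ x]
    have "x \<in> S" using x med' GS by (auto simp: isrank_def) blast
    moreover have "int (card {q \<in> S. klt f q x}) + 3 * (g - g div 2) \<le> siz d"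
      using mm(2) S(2) g big by simp
    moreover have "int (card {q \<in> S. klt f x q}) + 3 * (g div 2 + 1) \<le> siz d"
      using mm(3) S(2) g big by simp
    ultimately show ?thesis using S(2) big unfolding good_pivot_def g_def by auto
  qed
  show ?thesis unfolding sel_stack_def
  proof (intro conjI allI impI)
    fix e assume e: "0 \<le> e \<and> e \<le> d + 1"
    show "0 \<le> ?rk e" "?rk e < ?siz e" using st e g by (auto simp: sel_stack_def)
    show "inj_on A' {?off e..<?off e + ?siz e}"
      using inj e injm by (cases "e = d + 1") auto
  next
    fix e e' assume "0 \<le> e \<and> e < e' \<and> e' \<le> d + 1"
    then show "?off e + ?siz e \<le> ?off e'" using st low by (auto simp: sel_stack_def)
  next
    fix e assume "0 \<le> e \<and> e < d + 1"
    then show "60 \<le> ?siz e" using st big by (cases "e = d") (auto simp: sel_stack_def)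
  next
    fix x assume "isrank f (seg A' ?off ?siz 0) (?rk 0) x"
    then show "isrank f U fl x" using st d seg_eq[of 0] by (auto simp: sel_stack_def)
  next
    fix e x assume e: "0 \<le> e \<and> e < d + 1" and x: "isrank f (seg A' ?off ?siz (e + 1)) (?rk (e + 1)) x"
    show "good_pivot f (seg A' ?off ?siz e) x"
    proof (cases "e = d")
      case True
      then show ?thesis using good x seg_new seg_eq[of d] d by (simp add: S_def)
    next
      case False
      then show ?thesis using x st e seg_eq[of e] seg_eq[of "e + 1"] by (auto simp: sel_stack_def)
    qed
  qed
qed

lemma isrank_filter_less:
  assumes "isrank f {q \<in> S. klt f q p} r x" "finite S"
  shows "isrank f S r x"
proof -
  have "{q \<in> {q \<in> S. klt f q p}. klt f q x} = {q \<in> S. klt f q x}"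
    using assms klt_trans by (auto simp: isrank_def)
  then show ?thesis using assms by (simp add: isrank_def krank_def)
qed

text \<open>Besides the elements counted in the filtered set, all elements below \<open>p\<close>
  and \<open>p\<close> itself lie below \<open>x\<close>; hence the shift of the rank.\<close>

lemma isrank_filter_greater:
  assumes x: "isrank f {q \<in> S. klt f p q} r x" and "finite S" "p \<in> S"
  shows "isrank f S (r + int (krank f S p) + 1) x"
proof -
  have px: "klt f p x" "x \<in> S" using x by (auto simp: isrank_def)
  have "{q \<in> S. klt f q x} = {q \<in> {q \<in> S. klt f p q}. klt f q x} \<union> insert p {q \<in> S. klt f q p}"
    using px assms(3) klt_trans[of f _ p x] klt_linear[of f p] by auto
  moreover have "{q \<in> {q \<in> S. klt f p q}. klt f q x} \<inter> insert p {q \<in> S. klt f q p} = {}"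
    using klt_asym[of f] by auto
  ultimately have "card {q \<in> S. klt f q x} =
      card {q \<in> {q \<in> S. klt f p q}. klt f q x} + card (insert p {q \<in> S. klt f q p})"
    using assms(2) by (simp add: card_Un_disjoint)
  also have "card (insert p {q \<in> S. klt f q p}) = card {q \<in> S. klt f q p} + 1"
    using assms(2) by simp
  finally show ?thesis using x px by (simp add: isrank_def krank_def)
qed

lemma card_three_way:
  assumes "finite S" "p \<in> S"
  shows "card {q \<in> S. klt f q p} + card {q \<in> S. klt f p q} + 1 = card S"
proof -
  have "S = insert p ({q \<in> S. klt f q p} \<union> {q \<in> S. klt f p q})"
    using assms klt_linear[of f p] by auto
  moreover have "card ({q \<in> S. klt f q p} \<union> {q \<in> S. klt f p q}) =
      card {q \<in> S. klt f q p} + card {q \<in> S. klt f p q}"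
    using assms klt_asym[of f] by (intro card_Un_disjoint) auto
  ultimately show ?thesis using assms
    by (metis (no_types, lifting) Suc_eq_plus1 card_insert_disjoint finite_Un finite_insert klt_irrefl mem_Collect_eq Un_iff)
qed

section \<open>The moves on the selection stack: pushing, solving directly, returning a
  pivot\<close>

abbreviation "CC k \<equiv> IConst k"

definition push_body :: "string \<Rightarrow> com" where
  "push_body kn = (''bl'' ::= IAdd (V ''po'') (IMul (CC 5) (V ''pj'')) ;; ''bh'' ::= IAdd (V ''bl'') (CC 5) ;; ''br'' ::= CC 2) ;;
     brute_prog kn ;; IAssign ''A'' (IAdd (IAdd (V ''po'') (V ''pz'')) (V ''pj'')) (V ''piv'')"

definition push_prog :: "string \<Rightarrow> com" where
  "push_prog kn =
     (''po'' ::= IMem ''off'' (V ''dp'') ;; ''pz'' ::= IMem ''siz'' (V ''dp'') ;; ''pg'' ::= IDiv (V ''pz'') (CC 5) ;; ''pj'' ::= C0) ;;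
     For ''pj'' (V ''pg'') (push_body kn) ;;
     (''dp'' ::= IAdd (V ''dp'') C1 ;; IAssign ''off'' (V ''dp'') (IAdd (V ''po'') (V ''pz'')) ;;
      IAssign ''siz'' (V ''dp'') (V ''pg'') ;; IAssign ''rk'' (V ''dp'') (IDiv (V ''pg'') (CC 2)))"

lemma push_body_writes [simp]:
  "iw (push_body kn) = {''bl'', ''bh'', ''br'', ''bt'', ''re'', ''rlo'', ''rhi'', ''rc'', ''rt'', ''piv'', ''A''}"
  "rw (push_body kn) = {}"
  by (auto simp: push_body_def)

lemma push_prog_writes [simp]:
  "iw (push_prog kn) = {''po'', ''pz'', ''pg'', ''pj'', ''dp'', ''off'', ''siz'', ''rk'',
     ''bl'', ''bh'', ''br'', ''bt'', ''re'', ''rlo'', ''rhi'', ''rc'', ''rt'', ''piv'', ''A''}"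
  "rw (push_prog kn) = {}"
  by (auto simp: push_prog_def)

lemma runs_push_prog:
  fixes s :: state and kn :: string
  defines "A \<equiv> imem s ''A''" and "d \<equiv> imem s ''dp'' 0"
  defines "p \<equiv> imem s ''off'' d" and "z \<equiv> imem s ''siz'' d"
  assumes inj: "inj_on A {p..<p + z}" and z: "0 \<le> z"
  shows "runs orc (push_prog kn) s (2100 * nat (z div 5) + 100)
    (\<lambda>s'. imem s' ''dp'' 0 = d + 1 \<and> imem s' ''off'' = (imem s ''off'')(d + 1 := p + z) \<and>
      imem s' ''siz'' = (imem s ''siz'')(d + 1 := z div 5) \<and> imem s' ''rk'' = (imem s ''rk'')(d + 1 := z div 5 div 2) \<and>
      (\<forall>j<p + z. imem s' ''A'' j = A j) \<and>
      (\<forall>j. 0 \<le> j \<longrightarrow> j < z div 5 \<longrightarrow>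
         isrank (rmem s kn) (A ` {p + 5 * j..<p + 5 * j + 5}) 2 (imem s' ''A'' (p + z + j))))"
proof -
  define f where "f = rmem s kn"
  let ?I = "\<lambda>k s'. (\<forall>j<p + z. imem s' ''A'' j = A j) \<and>
      (\<forall>j. 0 \<le> j \<longrightarrow> j < k \<longrightarrow> isrank f (A ` {p + 5 * j..<p + 5 * j + 5}) 2 (imem s' ''A'' (p + z + j)))"
  show ?thesis unfolding push_prog_def f_def[symmetric]
  proof (rule runs_block[where Q = "\<lambda>s'. imem s' ''po'' 0 = p \<and> imem s' ''pz'' 0 = z \<and> imem s' ''pg'' 0 = z div 5 \<and> imem s' ''pj'' 0 = 0"
        and T' = "2100 * nat (z div 5) + 70"])
    fix s1 assume s1: "imem s1 ''po'' 0 = p \<and> imem s1 ''pz'' 0 = z \<and> imem s1 ''pg'' 0 = z div 5 \<and> imem s1 ''pj'' 0 = 0"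
      and so1: "same_off (''po'' ::= IMem ''off'' (V ''dp'') ;; ''pz'' ::= IMem ''siz'' (V ''dp'') ;;
        ''pg'' ::= IDiv (V ''pz'') (CC 5) ;; ''pj'' ::= C0) s s1"
    note fr1 = same_offD[OF so1, simplified]
    have loop: "runs orc (For ''pj'' (V ''pg'') (push_body kn)) s1 (2100 * nat (z div 5) + 6)
       (\<lambda>s'. ?I (z div 5) s' \<and> imem s' ''pj'' 0 = z div 5)"
    proof (rule runs_For[where T = 2050 and lw = 0 and hg = "z div 5" and Inv = ?I])
      fix k s' assume k: "0 \<le> k" "k < z div 5" "imem s' ''pj'' 0 = k" and I: "?I k s'"
        and so: "same_off (For ''pj'' (V ''pg'') (push_body kn)) s1 s'"
      note fr = same_offD[OF so, simplified]
      have sub: "{p + 5 * k..<p + 5 * k + 5} \<subseteq> {p..<p + z}" using k by auto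
      show "runs orc (push_body kn) s' 2050 (\<lambda>s''. imem s'' ''pj'' 0 = k \<and> ?I (k + 1) (iupdate ''pj'' 0 (k + 1) s''))"
        unfolding push_body_def
      proof (rule runs_block[where Q = "\<lambda>s'. imem s' ''bl'' 0 = p + 5 * k \<and> imem s' ''bh'' 0 = p + 5 * k + 5 \<and> imem s' ''br'' 0 = 2"
            and T' = 2020])
        fix s2 assume s2: "imem s2 ''bl'' 0 = p + 5 * k \<and> imem s2 ''bh'' 0 = p + 5 * k + 5 \<and> imem s2 ''br'' 0 = 2"
          and so2: "same_off (''bl'' ::= IAdd (V ''po'') (IMul (CC 5) (V ''pj'')) ;; ''bh'' ::= IAdd (V ''bl'') (CC 5) ;; ''br'' ::= CC 2) s' s2"
        note fr2 = same_offD[OF so2, simplified]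
        have A2: "imem s2 ''A'' j = A j" if "j \<in> {p + 5 * k..<p + 5 * k + 5}" for j
          using that sub I by (auto simp: fr2)
        have inj2: "inj_on (imem s2 ''A'') {p + 5 * k..<p + 5 * k + 5}"
          using inj_on_subset[OF inj sub] A2 by (subst inj_on_cong[of _ _ A]) auto
        have img2: "imem s2 ''A'' ` {p + 5 * k..<p + 5 * k + 5} = A ` {p + 5 * k..<p + 5 * k + 5}"
          using A2 by (intro image_cong) auto
        \<comment> \<open>\<open>1920 = 5 * (60 * 5 + 80) + 20\<close>, the cost of brute force on
          five elements.\<close>
        have "runs orc (brute_prog kn) s2 1920
            (\<lambda>s'. isrank f (A ` {p + 5 * k..<p + 5 * k + 5}) 2 (imem s' ''piv'' 0))"
          using runs_brute_prog[of s2 orc kn] s2 inj2 img2 by (simp add: fr2 fr fr1 f_def)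
        then show "runs orc (brute_prog kn ;; IAssign ''A'' (IAdd (IAdd (V ''po'') (V ''pz'')) (V ''pj'')) (V ''piv'')) s2 2020
           (\<lambda>s''. imem s'' ''pj'' 0 = k \<and> ?I (k + 1) (iupdate ''pj'' 0 (k + 1) s''))"
        proof (rule runs_Seq2)
          fix s3 assume s3: "isrank f (A ` {p + 5 * k..<p + 5 * k + 5}) 2 (imem s3 ''piv'' 0)"
            and so3: "same_off (brute_prog kn) s2 s3"
          note fr3 = same_offD[OF so3, simplified]
          have j: "j < k + 1 \<longleftrightarrow> j < k \<or> j = k" for j :: int by auto
          show "runs orc (IAssign ''A'' (IAdd (IAdd (V ''po'') (V ''pz'')) (V ''pj'')) (V ''piv'')) s3 100
             (\<lambda>s''. imem s'' ''pj'' 0 = k \<and> ?I (k + 1) (iupdate ''pj'' 0 (k + 1) s''))"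
            using s3 I k s1 unfolding j by (intro runs_wp_le) (auto simp: fr3 fr2 fr)
        qed simp
      qed (use k s1 in \<open>auto simp: fr\<close>)
    next
      fix k s' assume so: "same_off (For ''pj'' (V ''pg'') (push_body kn)) s1 s'"
      show "ival (V ''pg'') s' = z div 5" using same_offD[OF so, simplified] s1 by simp
    qed (use s1 z fr1 in \<open>auto simp: A_def\<close>)
    show "runs orc (For ''pj'' (V ''pg'') (push_body kn) ;;
     (''dp'' ::= IAdd (V ''dp'') C1 ;; IAssign ''off'' (V ''dp'') (IAdd (V ''po'') (V ''pz'')) ;;
      IAssign ''siz'' (V ''dp'') (V ''pg'') ;; IAssign ''rk'' (V ''dp'') (IDiv (V ''pg'') (CC 2)))) s1 (2100 * nat (z div 5) + 70)
     (\<lambda>s'. imem s' ''dp'' 0 = d + 1 \<and> imem s' ''off'' = (imem s ''off'')(d + 1 := p + z) \<and>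
      imem s' ''siz'' = (imem s ''siz'')(d + 1 := z div 5) \<and> imem s' ''rk'' = (imem s ''rk'')(d + 1 := z div 5 div 2) \<and>
      (\<forall>j<p + z. imem s' ''A'' j = A j) \<and>
      (\<forall>j. 0 \<le> j \<longrightarrow> j < z div 5 \<longrightarrow> isrank f (A ` {p + 5 * j..<p + 5 * j + 5}) 2 (imem s' ''A'' (p + z + j))))"
    proof (rule runs_Seq2[OF loop])
      fix s' assume s': "?I (z div 5) s' \<and> imem s' ''pj'' 0 = z div 5"
        and so: "same_off (For ''pj'' (V ''pg'') (push_body kn)) s1 s'"
      note fr = same_offD[OF so, simplified]
      show "runs orc (''dp'' ::= IAdd (V ''dp'') C1 ;; IAssign ''off'' (V ''dp'') (IAdd (V ''po'') (V ''pz'')) ;;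
         IAssign ''siz'' (V ''dp'') (V ''pg'') ;; IAssign ''rk'' (V ''dp'') (IDiv (V ''pg'') (CC 2))) s' 60
       (\<lambda>s'. imem s' ''dp'' 0 = d + 1 \<and> imem s' ''off'' = (imem s ''off'')(d + 1 := p + z) \<and>
        imem s' ''siz'' = (imem s ''siz'')(d + 1 := z div 5) \<and> imem s' ''rk'' = (imem s ''rk'')(d + 1 := z div 5 div 2) \<and>
        (\<forall>j<p + z. imem s' ''A'' j = A j) \<and>
        (\<forall>j. 0 \<le> j \<longrightarrow> j < z div 5 \<longrightarrow> isrank f (A ` {p + 5 * j..<p + 5 * j + 5}) 2 (imem s' ''A'' (p + z + j))))"
        using s' s1 by (intro runs_wp_le) (simp_all add: fr fr1 d_def)
    qed simp
  qed (auto simp: p_def z_def d_def)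
qed

definition base_prog :: "string \<Rightarrow> com" where
  "base_prog kn = (''bl'' ::= IMem ''off'' (V ''dp'') ;; ''bh'' ::= IAdd (V ''bl'') (IMem ''siz'' (V ''dp'')) ;;
      ''br'' ::= IMem ''rk'' (V ''dp'')) ;; brute_prog kn ;; (''ret'' ::= C1 ;; ''dp'' ::= ISub (V ''dp'') C1)"

definition filter_less :: "string \<Rightarrow> com" where
  "filter_less kn = filter_prog (LT kn (IMem ''A'' (V ''ft'')) (V ''piv''))"

definition filter_greater :: "string \<Rightarrow> com" where
  "filter_greater kn = filter_prog (LT kn (V ''piv'') (IMem ''A'' (V ''ft'')))"

lemma filter_writes [simp]:
  "iw (filter_less kn) = {''fw'', ''ft'', ''A''}" "rw (filter_less kn) = {}"
  "iw (filter_greater kn) = {''fw'', ''ft'', ''A''}" "rw (filter_greater kn) = {}"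
  by (simp_all add: filter_less_def filter_greater_def)

text \<open>\<open>piv\<close> is the answer of the level just removed. If its rank in the top
  segment is the one sought, it is the answer here too, and \<open>ret\<close> stays set so that it
  is handed further down. Otherwise one side of the pivot is kept and \<open>ret\<close> is cleared
  to search it.\<close>

definition back_prog :: "string \<Rightarrow> com" where
  "back_prog kn = (''rlo'' ::= IMem ''off'' (V ''dp'') ;; ''rhi'' ::= IAdd (V ''rlo'') (IMem ''siz'' (V ''dp'')) ;;
      ''re'' ::= V ''piv'' ;; ''fo'' ::= V ''rlo'' ;; ''fh'' ::= V ''rhi'') ;;
    rank_prog kn ;;
    Cond (IEQ (V ''rc'') (IMem ''rk'' (V ''dp''))) (''dp'' ::= ISub (V ''dp'') C1)
      (Cond (ILess (IMem ''rk'' (V ''dp'')) (V ''rc''))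
        (filter_less kn ;; (IAssign ''siz'' (V ''dp'') (V ''rc'') ;; ''ret'' ::= C0))
        (filter_greater kn ;;
          (IAssign ''siz'' (V ''dp'') (ISub (ISub (IMem ''siz'' (V ''dp'')) (V ''rc'')) C1) ;;
           IAssign ''rk'' (V ''dp'') (ISub (ISub (IMem ''rk'' (V ''dp'')) (V ''rc'')) C1) ;; ''ret'' ::= C0)))"

definition sel_step :: "string \<Rightarrow> com" where
  "sel_step kn = Cond (ILess (V ''ret'') C1)
     (Cond (ILess (IMem ''siz'' (V ''dp'')) (CC 60)) (base_prog kn) (push_prog kn))
     (back_prog kn)"

lemma sel_step_writes [simp]:
  "iw (sel_step kn) = {''po'', ''pz'', ''pg'', ''pj'', ''dp'', ''off'', ''siz'', ''rk'',
     ''bl'', ''bh'', ''br'', ''bt'', ''re'', ''rlo'', ''rhi'', ''rc'', ''rt'', ''piv'', ''A'', ''fw'', ''ft'', ''fo'', ''fh'', ''ret''}"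
  "rw (sel_step kn) = {}"
  by (auto simp: sel_step_def base_prog_def back_prog_def)

text \<open>\<open>ret\<close> tells whether the top level still has to be searched (0) or has just
  received a value in \<open>piv\<close> (1). The empty stack is \<open>dp = -1\<close>, and there
  the value received is the final answer.\<close>

definition sel_inv :: "(int \<Rightarrow> real) \<Rightarrow> int set \<Rightarrow> int \<Rightarrow> string \<Rightarrow> state \<Rightarrow> bool" where
  "sel_inv f U fl kn s \<longleftrightarrow> rmem s kn = f \<and> -1 \<le> imem s ''dp'' 0 \<and>
     sel_stack f U fl (imem s ''A'') (imem s ''off'') (imem s ''siz'') (imem s ''rk'') (imem s ''dp'' 0) \<and>
     (imem s ''ret'' 0 = 0 \<and> 0 \<le> imem s ''dp'' 0 \<or> imem s ''ret'' 0 = 1 \<and>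
        (if 0 \<le> imem s ''dp'' 0
         then good_pivot f (seg (imem s ''A'') (imem s ''off'') (imem s ''siz'') (imem s ''dp'' 0)) (imem s ''piv'' 0) \<and>
           60 \<le> imem s ''siz'' (imem s ''dp'' 0)
         else isrank f U fl (imem s ''piv'' 0)))"

text \<open>The constants satisfy the recurrence \<open>V(z) \<ge> 1000 z + V(z/5) + W(z)\<close>, \<open>W(z) \<ge> 1000 z + V(3z/4)\<close>
  of the median-of-medians algorithm for \<open>V(z) = 40000 z\<close>, \<open>W(z) = 31000 z\<close>.\<close>

definition sel_pot :: "state \<Rightarrow> nat" where
  "sel_pot s = (let d = imem s ''dp'' 0; siz = imem s ''siz'' in
     (\<Sum>e\<in>{0..<d}. 31000 * nat (siz e)) +
     (if d < 0 then 0 else if imem s ''ret'' 0 = 0 then 40000 * nat (siz d) else 31000 * nat (siz d)))"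

text \<open>A level waiting for its pivot and a level that has just received it carry the same
  weight 31000, so removing the top releases exactly the weight of the top.\<close>

lemma sel_pot_pop:
  "0 \<le> d \<Longrightarrow> (\<Sum>e\<in>{0..<d - 1}. 31000 * nat (siz e)) + (if d - 1 < 0 then 0 else 31000 * nat (siz (d - 1))) =
    (\<Sum>e\<in>{0..<d}. 31000 * nat (siz e))" for d :: int
proof -
  assume d: "0 \<le> d"
  show ?thesis
  proof (cases "d = 0")
    case False
    then have "{0..<d} = insert (d - 1) {0..<d - 1}" using d by auto
    then show ?thesis using d False by simp
  qed simp
qed

lemma runs_base_prog:
  assumes I: "sel_inv f U fl kn s" and d: "0 \<le> imem s ''dp'' 0" and ret: "imem s ''ret'' 0 = 0"
    and small: "imem s ''siz'' (imem s ''dp'' 0) < 60"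
  shows "runs orc (base_prog kn) s (4000 * nat (imem s ''siz'' (imem s ''dp'' 0)))
    (\<lambda>s'. sel_inv f U fl kn s' \<and> 36000 * nat (imem s ''siz'' (imem s ''dp'' 0)) + sel_pot s' \<le> sel_pot s)"
proof -
  define d A off siz rk where defs: "d = imem s ''dp'' 0" "A = imem s ''A''" "off = imem s ''off''"
    "siz = imem s ''siz''" "rk = imem s ''rk''"
  have st: "sel_stack f U fl A off siz rk d" and f: "rmem s kn = f" using I by (auto simp: sel_inv_def defs)
  have d': "0 \<le> d" using d by (simp add: defs)
  note top = sel_stack_top[OF st d']
  have z: "1 \<le> siz d" "siz d < 60" using top small by (auto simp: defs)
  \<comment> \<open>For at most 59 elements \<open>60 * 59 + 80 = 3620\<close>, so brute force is
    linear with factor 3700.\<close>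
  have bnd: "nat (siz d) * (60 * nat (siz d) + 80) \<le> nat (siz d) * 3700" using z by (intro mult_le_mono) auto
  show ?thesis unfolding base_prog_def defs[symmetric]
  proof (rule runs_block[where Q = "\<lambda>s'. imem s' ''bl'' 0 = off d \<and> imem s' ''bh'' 0 = off d + siz d \<and> imem s' ''br'' 0 = rk d"
        and T' = "3700 * nat (siz d) + 60"])
    fix s1 assume s1: "imem s1 ''bl'' 0 = off d \<and> imem s1 ''bh'' 0 = off d + siz d \<and> imem s1 ''br'' 0 = rk d"
      and so1: "same_off (''bl'' ::= IMem ''off'' (V ''dp'') ;; ''bh'' ::= IAdd (V ''bl'') (IMem ''siz'' (V ''dp'')) ;;
        ''br'' ::= IMem ''rk'' (V ''dp'')) s s1"
    note fr1 = same_offD[OF so1, simplified]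
    have "runs orc (brute_prog kn) s1 (nat (siz d) * (60 * nat (siz d) + 80) + 20)
        (\<lambda>s'. isrank f (seg A off siz d) (rk d) (imem s' ''piv'' 0))"
      using runs_brute_prog[of s1 orc kn] s1 top f by (simp add: fr1 seg_def defs(2)[symmetric])
    then show "runs orc (brute_prog kn ;; (''ret'' ::= C1 ;; ''dp'' ::= ISub (V ''dp'') C1)) s1 (3700 * nat (siz d) + 60)
       (\<lambda>s'. sel_inv f U fl kn s' \<and> 36000 * nat (siz d) + sel_pot s' \<le> sel_pot s)"
    proof (rule runs_Seq2)
      fix s2 assume s2: "isrank f (seg A off siz d) (rk d) (imem s2 ''piv'' 0)" and so2: "same_off (brute_prog kn) s1 s2"
      note fr2 = same_offD[OF so2, simplified]
      note pop = sel_stack_pop[OF st d' s2]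
      have "wp orc (''ret'' ::= C1 ;; ''dp'' ::= ISub (V ''dp'') C1)
        (\<lambda>s'. sel_inv f U fl kn s' \<and> 36000 * nat (siz d) + sel_pot s' \<le> sel_pot s) s2"
        using pop d' f z ret sel_pot_pop[OF d', of siz]
        by (auto simp: sel_inv_def sel_pot_def Let_def fr2 fr1 defs[symmetric])
      then show "runs orc (''ret'' ::= C1 ;; ''dp'' ::= ISub (V ''dp'') C1) s2 20
        (\<lambda>s'. sel_inv f U fl kn s' \<and> 36000 * nat (siz d) + sel_pot s' \<le> sel_pot s)"
        by (rule runs_wp_le) simp
    qed (use bnd in linarith)
  qed (use z in \<open>auto simp: defs\<close>)
qed

lemma runs_push_step:
  assumes I: "sel_inv f U fl kn s" and d: "0 \<le> imem s ''dp'' 0" and ret: "imem s ''ret'' 0 = 0"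
    and big: "60 \<le> imem s ''siz'' (imem s ''dp'' 0)"
  shows "runs orc (push_prog kn) s (500 * nat (imem s ''siz'' (imem s ''dp'' 0)))
    (\<lambda>s'. sel_inv f U fl kn s' \<and> 1000 * nat (imem s ''siz'' (imem s ''dp'' 0)) + sel_pot s' \<le> sel_pot s)"
proof -
  define d A off siz rk where defs: "d = imem s ''dp'' 0" "A = imem s ''A''" "off = imem s ''off''"
    "siz = imem s ''siz''" "rk = imem s ''rk''"
  have st: "sel_stack f U fl A off siz rk d" and f: "rmem s kn = f" using I by (auto simp: sel_inv_def defs)
  have d': "0 \<le> d" using d by (simp add: defs)
  note top = sel_stack_top[OF st d']
  have z: "60 \<le> siz d" using big by (simp add: defs)
  have z5: "5 * nat (siz d div 5) \<le> nat (siz d)" using z by linarith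
  have rp: "runs orc (push_prog kn) s (2100 * nat (siz d div 5) + 100)
    (\<lambda>s'. imem s' ''dp'' 0 = d + 1 \<and> imem s' ''off'' = off(d + 1 := off d + siz d) \<and>
      imem s' ''siz'' = siz(d + 1 := siz d div 5) \<and> imem s' ''rk'' = rk(d + 1 := siz d div 5 div 2) \<and>
      (\<forall>j<off d + siz d. imem s' ''A'' j = A j) \<and>
      (\<forall>j. 0 \<le> j \<longrightarrow> j < siz d div 5 \<longrightarrow>
         isrank f (A ` {off d + 5 * j..<off d + 5 * j + 5}) 2 (imem s' ''A'' (off d + siz d + j))))"
    using runs_push_prog[of s orc kn] top z unfolding defs[symmetric] f by simp
  show ?thesis unfolding defs[symmetric]
  proof (rule runs_mono[OF rp])
    fix s' assume s': "imem s' ''dp'' 0 = d + 1 \<and> imem s' ''off'' = off(d + 1 := off d + siz d) \<and>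
      imem s' ''siz'' = siz(d + 1 := siz d div 5) \<and> imem s' ''rk'' = rk(d + 1 := siz d div 5 div 2) \<and>
      (\<forall>j<off d + siz d. imem s' ''A'' j = A j) \<and>
      (\<forall>j. 0 \<le> j \<longrightarrow> j < siz d div 5 \<longrightarrow>
         isrank f (A ` {off d + 5 * j..<off d + 5 * j + 5}) 2 (imem s' ''A'' (off d + siz d + j)))"
      and so: "same_off (push_prog kn) s s'"
    note fr = same_offD[OF so, simplified]
    have "sel_stack f U fl (imem s' ''A'') (off(d + 1 := off d + siz d)) (siz(d + 1 := siz d div 5))
        (rk(d + 1 := siz d div 5 div 2)) (d + 1)"
      using s' by (intro sel_stack_push[OF st d' z]) auto
    then have "sel_inv f U fl kn s'"
      using s' d' f ret by (simp add: sel_inv_def fr)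
    \<comment> \<open>The old top falls from weight 40000 to 31000 and the new top, a fifth of its
      size, costs at most 8000 times that size; the difference pays for the step.\<close>
    moreover have "1000 * nat (siz d) + sel_pot s' \<le> sel_pot s"
    proof -
      have "{0..<d + 1} = insert d {0..<d}" using d' by auto
      moreover have "(\<Sum>e = 0..<d. 31000 * nat (if e = d + 1 then siz d div 5 else siz e)) = (\<Sum>e = 0..<d. 31000 * nat (siz e))"
        by (intro sum.cong) auto
      ultimately show ?thesis using s' d' ret z5 by (simp add: sel_pot_def Let_def fr defs[symmetric])
    qed
    ultimately show "sel_inv f U fl kn s' \<and> 1000 * nat (siz d) + sel_pot s' \<le> sel_pot s" by simp
  qed (use z z5 in linarith)
qed

lemma runs_back_prog:
  assumes I: "sel_inv f U fl kn s" and d: "0 \<le> imem s ''dp'' 0" and ret: "imem s ''ret'' 0 \<noteq> 0"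
  shows "runs orc (back_prog kn) s (500 * nat (imem s ''siz'' (imem s ''dp'' 0)))
    (\<lambda>s'. sel_inv f U fl kn s' \<and> 1000 * nat (imem s ''siz'' (imem s ''dp'' 0)) + sel_pot s' \<le> sel_pot s)"
proof -
  define d A off siz rk piv where defs: "d = imem s ''dp'' 0" "A = imem s ''A''" "off = imem s ''off''"
    "siz = imem s ''siz''" "rk = imem s ''rk''" "piv = imem s ''piv'' 0"
  define S where "S = seg A off siz d"
  have st: "sel_stack f U fl A off siz rk d" and f: "rmem s kn = f" using I by (auto simp: sel_inv_def defs)
  have d': "0 \<le> d" using d by (simp add: defs)
  have ret1: "imem s ''ret'' 0 = 1" and good: "good_pivot f S piv" and z: "60 \<le> siz d"
    using I ret d by (auto simp: sel_inv_def defs S_def)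
  note top = sel_stack_top[OF st d']
  have S: "finite S" "card S = nat (siz d)" using top by (auto simp: S_def seg_def card_image)
  have pS: "piv \<in> S" using good by (simp add: good_pivot_def)
  define c where "c = int (krank f S piv)"
  have three: "c + int (card {q \<in> S. klt f piv q}) + 1 = siz d"
    using card_three_way[OF S(1) pS, of f] S(2) z by (simp add: c_def krank_def)
  have gl: "10 * c \<le> 7 * siz d + 30" and gg: "10 * (siz d - c - 1) \<le> 7 * siz d + 30"
    using good S(2) z three by (auto simp: good_pivot_def c_def krank_def)
  let ?Q = "\<lambda>s'. sel_inv f U fl kn s' \<and> 1000 * nat (siz d) + sel_pot s' \<le> sel_pot s"
  let ?set = "''rlo'' ::= IMem ''off'' (V ''dp'') ;; ''rhi'' ::= IAdd (V ''rlo'') (IMem ''siz'' (V ''dp'')) ;;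
      ''re'' ::= V ''piv'' ;; ''fo'' ::= V ''rlo'' ;; ''fh'' ::= V ''rhi''"
  \<comment> \<open>Keeping the smaller side and keeping the larger side differ only in the new size
    \<open>z'\<close> and rank \<open>r'\<close>.\<close>
  have shrink: "?Q s'"
    if s': "rmem s' = rmem s" "imem s' ''dp'' 0 = d" "imem s' ''off'' = off" "imem s' ''siz'' = siz(d := z')"
      "imem s' ''rk'' = rk(d := r')" "imem s' ''ret'' 0 = 0" and z': "10 * z' \<le> 7 * siz d + 30" "z' \<le> siz d"
      and r': "0 \<le> r'" "r' < z'" and A': "\<forall>j<off d. imem s' ''A'' j = A j" "inj_on (imem s' ''A'') {off d..<off d + z'}"
      and ans: "\<And>x. isrank f (imem s' ''A'' ` {off d..<off d + z'}) r' x \<Longrightarrow> isrank f S (rk d) x" for s' z' r'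
  proof -
    have "sel_stack f U fl (imem s' ''A'') off (siz(d := z')) (rk(d := r')) d"
      using A' z' r' ans by (intro sel_stack_shrink[OF st d']) (auto simp: S_def)
    then have "sel_inv f U fl kn s'" using s' d' f by (simp add: sel_inv_def)
    moreover have "1000 * nat (siz d) + sel_pot s' \<le> sel_pot s"
    proof -
      have "(\<Sum>e = 0..<d. 31000 * nat (if e = d then z' else siz e)) = (\<Sum>e = 0..<d. 31000 * nat (siz e))"
        by (intro sum.cong) auto
      \<comment> \<open>The origin of the threshold 60: with
        \<open>10 * z' \<le> 7 * siz d + 30\<close> the left side is at most
        \<open>29000 * siz d + 120000\<close>, and this is below \<open>31000 * siz d\<close> from
        \<open>siz d = 60\<close> on.\<close>
      moreover have "1000 * nat (siz d) + 40000 * nat z' \<le> 31000 * nat (siz d)" using z' z by linarith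
      ultimately show ?thesis using s' d' ret1 by (simp add: sel_pot_def Let_def defs[symmetric])
    qed
    ultimately show ?thesis by simp
  qed
  show ?thesis unfolding back_prog_def defs[symmetric]
  proof (rule runs_block[where Q = "\<lambda>s'. imem s' ''rlo'' 0 = off d \<and> imem s' ''rhi'' 0 = off d + siz d \<and> imem s' ''re'' 0 = piv \<and>
          imem s' ''fo'' 0 = off d \<and> imem s' ''fh'' 0 = off d + siz d" and T' = "200 * nat (siz d) + 200"])
    fix s1 assume s1: "imem s1 ''rlo'' 0 = off d \<and> imem s1 ''rhi'' 0 = off d + siz d \<and> imem s1 ''re'' 0 = piv \<and>
          imem s1 ''fo'' 0 = off d \<and> imem s1 ''fh'' 0 = off d + siz d" and so1: "same_off ?set s s1"
    note fr1 = same_offD[OF so1, simplified]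
    have "card {k \<in> {off d..<off d + siz d}. klt f (A k) piv} = krank f S piv"
      using card_filter_image[OF top(3), of "\<lambda>q. klt f q piv"] by (simp add: S_def seg_def krank_def)
    then have "runs orc (rank_prog kn) s1 (60 * nat (siz d) + 20) (\<lambda>s'. imem s' ''rc'' 0 = c)"
      using runs_rank_prog[of s1 orc kn] s1 z f by (simp add: fr1 c_def defs(2)[symmetric])
    then show "runs orc (rank_prog kn ;;
        Cond (IEQ (V ''rc'') (IMem ''rk'' (V ''dp''))) (''dp'' ::= ISub (V ''dp'') C1)
      (Cond (ILess (IMem ''rk'' (V ''dp'')) (V ''rc''))
        (filter_less kn ;; (IAssign ''siz'' (V ''dp'') (V ''rc'') ;; ''ret'' ::= C0))
        (filter_greater kn ;;
          (IAssign ''siz'' (V ''dp'') (ISub (ISub (IMem ''siz'' (V ''dp'')) (V ''rc'')) C1) ;;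
           IAssign ''rk'' (V ''dp'') (ISub (ISub (IMem ''rk'' (V ''dp'')) (V ''rc'')) C1) ;; ''ret'' ::= C0)))) s1
        (200 * nat (siz d) + 200) ?Q"
    proof (rule runs_Seq2)
      fix s2 assume s2: "imem s2 ''rc'' 0 = c" and so2: "same_off (rank_prog kn) s1 s2"
      note fr2 = same_offD[OF so2, simplified]
      note fl = defs[symmetric]
      have rm: "rmem s2 = rmem s" using same_offD(2)[OF so2] same_offD(2)[OF so1] by (auto intro!: ext)
      show "runs orc (Cond (IEQ (V ''rc'') (IMem ''rk'' (V ''dp''))) (''dp'' ::= ISub (V ''dp'') C1)
      (Cond (ILess (IMem ''rk'' (V ''dp'')) (V ''rc''))
        (filter_less kn ;; (IAssign ''siz'' (V ''dp'') (V ''rc'') ;; ''ret'' ::= C0))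
        (filter_greater kn ;;
          (IAssign ''siz'' (V ''dp'') (ISub (ISub (IMem ''siz'' (V ''dp'')) (V ''rc'')) C1) ;;
           IAssign ''rk'' (V ''dp'') (ISub (ISub (IMem ''rk'' (V ''dp'')) (V ''rc'')) C1) ;; ''ret'' ::= C0)))) s2
        (68 * nat (siz d) + 150) ?Q"
      proof (rule runs_Cond[where T = "68 * nat (siz d) + 110"])
        assume "bval (IEQ (V ''rc'') (IMem ''rk'' (V ''dp''))) s2"
        then have "c = rk d" using s2 by (simp add: fr2 fr1 fl)
        then have x: "isrank f (seg A off siz d) (rk d) piv" using pS by (simp add: isrank_def c_def S_def)
        have "wp orc (''dp'' ::= ISub (V ''dp'') C1) ?Q s2"
          using sel_stack_pop[OF st d' x] d' f z ret1 sel_pot_pop[OF d', of siz]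
          by (auto simp: sel_inv_def sel_pot_def Let_def fr2 fr1 fl)
        then show "runs orc (''dp'' ::= ISub (V ''dp'') C1) s2 (68 * nat (siz d) + 110) ?Q"
          by (rule runs_wp_le) simp
      next
        assume "\<not> bval (IEQ (V ''rc'') (IMem ''rk'' (V ''dp''))) s2"
        then have ne: "c \<noteq> rk d" using s2 by (auto simp: fr2 fr1 fl)
        show "runs orc (Cond (ILess (IMem ''rk'' (V ''dp'')) (V ''rc''))
          (filter_less kn ;; (IAssign ''siz'' (V ''dp'') (V ''rc'') ;; ''ret'' ::= C0))
          (filter_greater kn ;;
            (IAssign ''siz'' (V ''dp'') (ISub (ISub (IMem ''siz'' (V ''dp'')) (V ''rc'')) C1) ;;
             IAssign ''rk'' (V ''dp'') (ISub (ISub (IMem ''rk'' (V ''dp'')) (V ''rc'')) C1) ;; ''ret'' ::= C0))) s2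
          (68 * nat (siz d) + 110) ?Q"
        proof (rule runs_Cond[where T = "68 * nat (siz d) + 90"])
          assume "bval (ILess (IMem ''rk'' (V ''dp'')) (V ''rc'')) s2"
          then have lt: "rk d < c" using s2 by (simp add: fr2 fr1 fl)
          have "runs orc (filter_less kn) s2 (nat (off d + siz d - off d) * (28 + 40) + 20)
            (\<lambda>s'. imem s' ''A'' ` {off d..<off d + c} = {q \<in> S. klt f q piv} \<and>
              inj_on (imem s' ''A'') {off d..<off d + c} \<and> (\<forall>j<off d. imem s' ''A'' j = A j))"
            using runs_filter_prog[of s2 "LT kn (IMem ''A'' (V ''ft'')) (V ''piv'')" "\<lambda>q. klt f q piv" orc] s1 z top(3) f
            by (simp add: filter_less_def fr2 fr1 fl same_off_def seg_def S_def c_def krank_def)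
          then show "runs orc (filter_less kn ;; (IAssign ''siz'' (V ''dp'') (V ''rc'') ;; ''ret'' ::= C0)) s2
            (68 * nat (siz d) + 90) ?Q"
          proof (rule runs_Seq2)
            fix s3 assume s3: "imem s3 ''A'' ` {off d..<off d + c} = {q \<in> S. klt f q piv} \<and>
              inj_on (imem s3 ''A'') {off d..<off d + c} \<and> (\<forall>j<off d. imem s3 ''A'' j = A j)"
              and so3: "same_off (filter_less kn) s2 s3"
            note fr3 = same_offD[OF so3, simplified]
            have rm3: "rmem s3 = rmem s" using fr3(2) rm by (auto intro!: ext)
            have "wp orc (IAssign ''siz'' (V ''dp'') (V ''rc'') ;; ''ret'' ::= C0) ?Q s3"
              unfolding wp.simps
              by (rule shrink[where z' = c and r' = "rk d"])
                (use s3 s2 lt gl top(1) z three rm3 isrank_filter_less[OF _ S(1)] in \<open>auto simp: fr3 fr2 fr1 fl\<close>)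
            then show "runs orc (IAssign ''siz'' (V ''dp'') (V ''rc'') ;; ''ret'' ::= C0) s3 60 ?Q"
              by (rule runs_wp_le) simp
          qed simp
        next
          assume "\<not> bval (ILess (IMem ''rk'' (V ''dp'')) (V ''rc'')) s2"
          then have gt: "c < rk d" using s2 ne by (simp add: fr2 fr1 fl)
          have cg: "int (card {q \<in> S. klt f piv q}) = siz d - c - 1" using three by simp
          have "runs orc (filter_greater kn) s2 (nat (off d + siz d - off d) * (28 + 40) + 20)
            (\<lambda>s'. imem s' ''A'' ` {off d..<off d + (siz d - c - 1)} = {q \<in> S. klt f piv q} \<and>
              inj_on (imem s' ''A'') {off d..<off d + (siz d - c - 1)} \<and> (\<forall>j<off d. imem s' ''A'' j = A j))"
            using runs_filter_prog[of s2 "LT kn (V ''piv'') (IMem ''A'' (V ''ft''))" "\<lambda>q. klt f piv q" orc] s1 z top(3) f cg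
            by (simp add: filter_greater_def fr2 fr1 fl same_off_def seg_def S_def)
          then show "runs orc (filter_greater kn ;;
            (IAssign ''siz'' (V ''dp'') (ISub (ISub (IMem ''siz'' (V ''dp'')) (V ''rc'')) C1) ;;
             IAssign ''rk'' (V ''dp'') (ISub (ISub (IMem ''rk'' (V ''dp'')) (V ''rc'')) C1) ;; ''ret'' ::= C0)) s2
            (68 * nat (siz d) + 90) ?Q"
          proof (rule runs_Seq2)
            fix s3 assume s3: "imem s3 ''A'' ` {off d..<off d + (siz d - c - 1)} = {q \<in> S. klt f piv q} \<and>
              inj_on (imem s3 ''A'') {off d..<off d + (siz d - c - 1)} \<and> (\<forall>j<off d. imem s3 ''A'' j = A j)"
              and so3: "same_off (filter_greater kn) s2 s3"
            note fr3 = same_offD[OF so3, simplified]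
            have rm3: "rmem s3 = rmem s" using fr3(2) rm by (auto intro!: ext)
            have ans: "isrank f S (rk d) x" if "isrank f {q \<in> S. klt f piv q} (rk d - c - 1) x" for x
              using isrank_filter_greater[OF that S(1) pS] by (simp add: c_def)
            have "wp orc (IAssign ''siz'' (V ''dp'') (ISub (ISub (IMem ''siz'' (V ''dp'')) (V ''rc'')) C1) ;;
             IAssign ''rk'' (V ''dp'') (ISub (ISub (IMem ''rk'' (V ''dp'')) (V ''rc'')) C1) ;; ''ret'' ::= C0) ?Q s3"
              unfolding wp.simps
              by (rule shrink[where z' = "siz d - c - 1" and r' = "rk d - c - 1"])
                (use s3 s2 gt gg top(1,2) z rm3 ans in \<open>auto simp: fr3 fr2 fr1 fl c_def\<close>)
            then show "runs orc (IAssign ''siz'' (V ''dp'') (ISub (ISub (IMem ''siz'' (V ''dp'')) (V ''rc'')) C1) ;;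
             IAssign ''rk'' (V ''dp'') (ISub (ISub (IMem ''rk'' (V ''dp'')) (V ''rc'')) C1) ;; ''ret'' ::= C0) s3 60 ?Q"
              by (rule runs_wp_le) simp
          qed simp
        qed simp
      qed simp
    qed (use z in simp)
  qed (use z in \<open>auto simp: defs\<close>)
qed

text \<open>The working array holds positions, initially the identity, so the keys themselves stay
  in place and the answer is a position.\<close>

definition select_prog :: "string \<Rightarrow> com" where
  "select_prog kn = (''dp'' ::= C0 ;; IAssign ''off'' C0 C0 ;; IAssign ''siz'' C0 (V ''N'') ;; IAssign ''rk'' C0 (V ''fl'') ;;
       ''ret'' ::= C0 ;; ''st'' ::= C0) ;;
     For ''st'' (V ''N'') (IAssign ''A'' (V ''st'') (V ''st'')) ;;
     While (BNot (ILess (V ''dp'') C0)) (sel_step kn)"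

lemma select_prog_writes [simp]:
  "iw (select_prog kn) = {''po'', ''pz'', ''pg'', ''pj'', ''dp'', ''off'', ''siz'', ''rk'',
     ''bl'', ''bh'', ''br'', ''bt'', ''re'', ''rlo'', ''rhi'', ''rc'', ''rt'', ''piv'', ''A'', ''fw'', ''ft'', ''fo'', ''fh'', ''ret'', ''st''}"
  "rw (select_prog kn) = {}"
  by (auto simp: select_prog_def)

lemma runs_select_prog:
  assumes fl: "0 \<le> imem s ''fl'' 0" "imem s ''fl'' 0 < imem s ''N'' 0"
  shows "runs orc (select_prog kn) s (40030 * nat (imem s ''N'' 0) + 80)
    (\<lambda>s'. isrank (rmem s kn) {0..<imem s ''N'' 0} (imem s ''fl'' 0) (imem s' ''piv'' 0))"
proof -
  define N r f where defs: "N = imem s ''N'' 0" "r = imem s ''fl'' 0" "f = rmem s kn"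
  have N: "0 < N" using fl by (simp add: defs)
  let ?init = "''dp'' ::= C0 ;; IAssign ''off'' C0 C0 ;; IAssign ''siz'' C0 (V ''N'') ;; IAssign ''rk'' C0 (V ''fl'') ;;
       ''ret'' ::= C0 ;; ''st'' ::= C0"
  let ?b = "BNot (ILess (V ''dp'') C0)"
  show ?thesis unfolding select_prog_def defs[symmetric]
  proof (rule runs_block[where Q = "\<lambda>s'. imem s' ''dp'' 0 = 0 \<and> imem s' ''off'' 0 = 0 \<and> imem s' ''siz'' 0 = N \<and>
        imem s' ''rk'' 0 = r \<and> imem s' ''ret'' 0 = 0 \<and> imem s' ''st'' 0 = 0" and T' = "40030 * nat N + 50"])
    fix s1 assume s1: "imem s1 ''dp'' 0 = 0 \<and> imem s1 ''off'' 0 = 0 \<and> imem s1 ''siz'' 0 = N \<and>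
        imem s1 ''rk'' 0 = r \<and> imem s1 ''ret'' 0 = 0 \<and> imem s1 ''st'' 0 = 0" and so1: "same_off ?init s s1"
    note fr1 = same_offD[OF so1, simplified]
    have loop: "runs orc (For ''st'' (V ''N'') (IAssign ''A'' (V ''st'') (V ''st''))) s1 (30 * nat N + 6)
      (\<lambda>s'. (\<forall>j\<in>{0..<N}. imem s' ''A'' j = j) \<and> imem s' ''st'' 0 = N)"
    proof (rule runs_For[where T = 5 and lw = 0 and hg = N and Inv = "\<lambda>k s'. \<forall>j\<in>{0..<k}. imem s' ''A'' j = j"])
      fix k :: int and s' :: state assume "0 \<le> k" "imem s' ''st'' 0 = k" "\<forall>j\<in>{0..<k}. imem s' ''A'' j = j"
      then show "runs orc (IAssign ''A'' (V ''st'') (V ''st'')) s' 5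
        (\<lambda>s''. imem s'' ''st'' 0 = k \<and> (\<forall>j\<in>{0..<k + 1}. imem (iupdate ''st'' 0 (k + 1) s'') ''A'' j = j))"
        by (intro runs_wp_le) auto
    next
      fix s' assume so: "same_off (For ''st'' (V ''N'') (IAssign ''A'' (V ''st'') (V ''st''))) s1 s'"
      show "ival (V ''N'') s' = N" using same_offD[OF so, simplified] fr1 by (simp add: defs)
    qed (use N s1 in auto)
    show "runs orc (For ''st'' (V ''N'') (IAssign ''A'' (V ''st'') (V ''st'')) ;; While ?b (sel_step kn)) s1
      (40030 * nat N + 50) (\<lambda>s'. isrank f {0..<N} r (imem s' ''piv'' 0))"
    proof (rule runs_Seq2[OF loop])
      fix s2 assume s2: "(\<forall>j\<in>{0..<N}. imem s2 ''A'' j = j) \<and> imem s2 ''st'' 0 = N"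
        and so2: "same_off (For ''st'' (V ''N'') (IAssign ''A'' (V ''st'') (V ''st''))) s1 s2"
      note fr2 = same_offD[OF so2, simplified]
      have img: "imem s2 ''A'' ` {0..<N} = {0..<N}" using s2 by force
      have inj: "inj_on (imem s2 ''A'') {0..<N}" using s2 by (auto intro: inj_onI)
      have inv: "sel_inv f {0..<N} r kn s2"
        using s1 fl inj img N by (auto simp: sel_inv_def sel_stack_def seg_def fr2 fr1 defs)
      have pot: "sel_pot s2 = 40000 * nat N"
        using s1 by (simp add: sel_pot_def fr2)
      have "runs orc (While ?b (sel_step kn)) s2 (sel_pot s2 + 1 + bcost ?b)
         (\<lambda>s'. sel_inv f {0..<N} r kn s' \<and> \<not> bval ?b s')"
      proof (rule runs_While[where Inv = "sel_inv f {0..<N} r kn" and \<Phi> = sel_pot, OF inv])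
        fix s' assume I: "sel_inv f {0..<N} r kn s'" and b: "bval ?b s'"
        define z where "z = imem s' ''siz'' (imem s' ''dp'' 0)"
        have d: "0 \<le> imem s' ''dp'' 0" using b by simp
        have st: "sel_stack f {0..<N} r (imem s' ''A'') (imem s' ''off'') (imem s' ''siz'') (imem s' ''rk'') (imem s' ''dp'' 0)"
          using I by (simp add: sel_inv_def)
        have z: "1 \<le> z" using sel_stack_top(1,2)[OF st d] by (simp add: z_def)
        have base: "runs orc (sel_step kn) s' (4000 * nat z + 20) (\<lambda>s''. sel_inv f {0..<N} r kn s'' \<and>
           36000 * nat z + sel_pot s'' \<le> sel_pot s')" if "imem s' ''ret'' 0 = 0" "z < 60"
          unfolding sel_step_def
          by (rule runs_Cond[where T = "4000 * nat z + 10"], rule runs_Cond[where T = "4000 * nat z"])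
            (use runs_base_prog[OF I d] that in \<open>auto simp: z_def[symmetric]\<close>)
        have push: "runs orc (sel_step kn) s' (500 * nat z + 20) (\<lambda>s''. sel_inv f {0..<N} r kn s'' \<and>
           1000 * nat z + sel_pot s'' \<le> sel_pot s')" if "imem s' ''ret'' 0 = 0" "60 \<le> z"
          unfolding sel_step_def
          by (rule runs_Cond[where T = "500 * nat z + 10"], rule runs_Cond[where T = "500 * nat z"])
            (use runs_push_step[OF I d] that in \<open>auto simp: z_def[symmetric]\<close>)
        have retn: "runs orc (sel_step kn) s' (500 * nat z + 20) (\<lambda>s''. sel_inv f {0..<N} r kn s'' \<and>
           1000 * nat z + sel_pot s'' \<le> sel_pot s')" "60 \<le> z" if "imem s' ''ret'' 0 \<noteq> 0"
        proof -
          have "runs orc (back_prog kn) s' (500 * nat z) (\<lambda>s''. sel_inv f {0..<N} r kn s'' \<and> 1000 * nat z + sel_pot s'' \<le> sel_pot s')"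
            using runs_back_prog[OF I d that] by (simp add: z_def)
          moreover have "imem s' ''ret'' 0 = 1" using I that by (auto simp: sel_inv_def)
          ultimately show "runs orc (sel_step kn) s' (500 * nat z + 20) (\<lambda>s''. sel_inv f {0..<N} r kn s'' \<and>
             1000 * nat z + sel_pot s'' \<le> sel_pot s')"
            unfolding sel_step_def by (intro runs_Cond[where T = "500 * nat z"]) auto
          show "60 \<le> z" using I that d by (auto simp: sel_inv_def z_def)
        qed
        obtain T k where "runs orc (sel_step kn) s' T (\<lambda>s''. sel_inv f {0..<N} r kn s'' \<and> k + sel_pot s'' \<le> sel_pot s')"
          "T + 1 + bcost ?b \<le> k"
        proof (cases "imem s' ''ret'' 0 = 0")
          case True
          show thesis
          proof (cases "z < 60")
            case small: True
            show thesis using z by (intro that[OF base[OF True small]]) auto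
          next
            case False
            then show thesis by (intro that[OF push[OF True]]) auto
          qed
        next
          case False
          show thesis using retn(2)[OF False] by (intro that[OF retn(1)[OF False]]) auto
        qed
        then show "\<exists>T. runs orc (sel_step kn) s' T (\<lambda>s''. sel_inv f {0..<N} r kn s'' \<and> T + 1 + bcost ?b + sel_pot s'' \<le> sel_pot s')"
          by (intro exI[of _ T]) (erule runs_mono, simp_all)
      qed
      then show "runs orc (While ?b (sel_step kn)) s2 (40000 * nat N + 20) (\<lambda>s'. isrank f {0..<N} r (imem s' ''piv'' 0))"
        by (rule runs_mono) (auto simp: pot sel_inv_def split: if_splits)
    qed simp
  qed (auto simp: defs)
qed

subsection \<open>Resource allocation over a box by halving blocks\<close>

lemma finite_Collect_int_less [simp]: "finite {u :: int. a \<le> u \<and> u < b \<and> P u}"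
  by (rule finite_subset[of _ "{a..<b}"]) auto

text \<open>What stability amounts to over a box. Untaken units are counted without an upper limit,
  also beyond the bounds of the box, which makes the penalty \<open>2 M\<close> above the box
  necessary.\<close>

definition downset :: "(int \<Rightarrow> int \<Rightarrow> real) \<Rightarrow> (int \<Rightarrow> int) \<Rightarrow> int \<Rightarrow> int \<Rightarrow> (int \<Rightarrow> int) \<Rightarrow> bool" where
  "downset h l p q z \<longleftrightarrow> (\<forall>i\<in>{p<..q}. \<forall>j\<in>{p<..q}. \<forall>k m. l i < k \<longrightarrow> k \<le> z i \<longrightarrow> z j < m \<longrightarrow> elt h i k j m)"

lemma elt_asym: "elt g i k j l \<Longrightarrow> \<not> elt g j l i k"
  by (auto simp: elt_def)

text \<open>Block \<open>t\<close> consists of the \<open>s\<close> units of variable \<open>pc t\<close> that follow unit \<open>pp t\<close>, and \<open>taken\<close>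
  counts those used by the solution.\<close>

definition taken :: "(int \<Rightarrow> int) \<Rightarrow> int \<Rightarrow> int \<Rightarrow> int \<Rightarrow> int" where
  "taken z s i k = max 0 (min s (z i - k))"

text \<open>\<open>X\<close> is what has been taken for good and \<open>K\<close> what is still to
  be taken. \<open>K < N * s\<close> makes \<open>K div s\<close> a valid rank among the blocks. The
  blocks are sorted by variable and position, so that their indices can stand for the tie-breaking
  of \<open>elt\<close>.\<close>

definition blocks :: "(int \<Rightarrow> int) \<Rightarrow> int \<Rightarrow> int \<Rightarrow> (int \<Rightarrow> int) \<Rightarrow> int \<Rightarrow> int \<Rightarrow> (int \<Rightarrow> int) \<Rightarrow> (int \<Rightarrow> int) \<Rightarrow>
    (int \<Rightarrow> int) \<Rightarrow> int \<Rightarrow> bool" where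
  "blocks l p q z s N pc pp X K \<longleftrightarrow>
    (\<forall>t t'. 0 \<le> t \<and> t < t' \<and> t' < N \<longrightarrow> pc t < pc t' \<or> pc t = pc t' \<and> pp t + s \<le> pp t') \<and>
    (\<forall>t\<in>{0..<N}. pc t \<in> {p<..q} \<and> l (pc t) \<le> pp t) \<and>
    K = (\<Sum>t\<in>{0..<N}. taken z s (pc t) (pp t)) \<and> K < N * s \<and>
    (\<forall>i\<in>{p<..q}. z i = X i + (\<Sum>t\<in>{t \<in> {0..<N}. pc t = i}. taken z s (pc t) (pp t)))"

lemma taken_bounds: "0 \<le> s \<Longrightarrow> 0 \<le> taken z s i k \<and> taken z s i k \<le> s"
  by (auto simp: taken_def)

lemma blocks_final:
  assumes b: "blocks l p q z s N pc pp X K" and "K = 0" "0 \<le> s" "i \<in> {p<..q}"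
  shows "X i = z i"
proof -
  have "(\<Sum>t\<in>{0..<N}. taken z s (pc t) (pp t)) = 0" using b assms(2) by (simp add: blocks_def)
  then have "\<forall>t\<in>{0..<N}. taken z s (pc t) (pp t) = 0"
    using taken_bounds[OF assms(3)] by (subst (asm) sum_nonneg_eq_0_iff) auto
  then have "(\<Sum>t\<in>{t \<in> {0..<N}. pc t = i}. taken z s (pc t) (pp t)) = 0" by (intro sum.neutral) auto
  then show ?thesis using b assms(4) unfolding blocks_def by (metis add_0_right)
qed

text \<open>One block per variable, wide enough for everything the solution takes there; the strict
  inequality \<open>z i < l i + s\<close> gives \<open>K < N * s\<close>.\<close>

lemma blocks_init:
  assumes pq: "p < q" and z: "\<And>i. i \<in> {p<..q} \<Longrightarrow> l i \<le> z i \<and> z i < l i + s"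
    and "N = q - p" and pc: "\<And>t. t \<in> {0..<N} \<Longrightarrow> pc t = p + 1 + t \<and> pp t = l (p + 1 + t)"
    and X: "\<And>i. i \<in> {p<..q} \<Longrightarrow> X i = l i" and K: "K = sum z {p<..q} - sum l {p<..q}"
  shows "blocks l p q z s N pc pp X K"
proof -
  have tk: "taken z s (pc t) (pp t) = z (p + 1 + t) - l (p + 1 + t)" if "t \<in> {0..<N}" for t
    using pc[OF that] z[of "p + 1 + t"] that assms(3) by (auto simp: taken_def)
  have bij: "bij_betw (\<lambda>t. p + 1 + t) {0..<N} {p<..q}"
    by (rule bij_betwI[where g = "\<lambda>i. i - p - 1"]) (auto simp: assms(3))
  have "(\<Sum>t\<in>{0..<N}. taken z s (pc t) (pp t)) = (\<Sum>t\<in>{0..<N}. z (p + 1 + t) - l (p + 1 + t))"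
    using tk by (intro sum.cong) auto
  also have "\<dots> = (\<Sum>i\<in>{p<..q}. z i - l i)" by (rule sum.reindex_bij_betw[OF bij])
  also have "\<dots> = K" by (simp add: K sum_subtractf)
  finally have sK: "(\<Sum>t\<in>{0..<N}. taken z s (pc t) (pp t)) = K" .
  have "K = (\<Sum>i\<in>{p<..q}. z i - l i)" by (simp add: K sum_subtractf)
  also have "\<dots> < (\<Sum>i\<in>{p<..q}. s)" using z pq by (intro sum_strict_mono) (auto simp: less_diff_eq algebra_simps)
  also have "\<dots> = N * s" using assms(3) pq by simp
  finally have lt: "K < N * s" .
  have "z i = X i + (\<Sum>t\<in>{t \<in> {0..<N}. pc t = i}. taken z s (pc t) (pp t))" if i: "i \<in> {p<..q}" for i
  proof -
    have "{t \<in> {0..<N}. pc t = i} = {i - p - 1}" using pc i assms(3) by auto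
    then show ?thesis using tk[of "i - p - 1"] i X assms(3) by simp
  qed
  then show ?thesis using pc sK lt assms(3) unfolding blocks_def by auto
qed

lemma sum_double:
  fixes f :: "int \<Rightarrow> int"
  shows "0 \<le> N \<Longrightarrow> (\<Sum>t\<in>{0..<2 * N}. f t) = (\<Sum>t\<in>{0..<N}. f (2 * t) + f (2 * t + 1))"
proof (induction N rule: int_ge_induct)
  case (step N)
  have 1: "{0..<2 * (N + 1)} = insert (2 * N) (insert (2 * N + 1) {0..<2 * N})" using step.hyps by auto
  have 2: "{0..<N + 1} = insert N {0..<N}" using step.hyps by auto
  show ?case unfolding 1 2 using step by simp
qed simp

lemma blocks_split:
  assumes b: "blocks l p q z (2 * s) N qc qp X K" and N: "0 \<le> N" and s: "0 \<le> s"
    and pc: "\<And>t. t \<in> {0..<2 * N} \<Longrightarrow> pc t = qc (t div 2) \<and> pp t = qp (t div 2) + s * (t mod 2)"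
  shows "blocks l p q z s (2 * N) pc pp X K"
proof -
  let ?T = "\<lambda>t. taken z s (pc t) (pp t)"
  \<comment> \<open>A solution takes the units of a variable in order, so it enters the second half
    of a block only after filling the first.\<close>
  have halves: "?T (2 * t) + ?T (2 * t + 1) = taken z (2 * s) (qc t) (qp t)" if "t \<in> {0..<N}" for t
    using pc[of "2 * t"] pc[of "2 * t + 1"] that s by (auto simp: taken_def)
  have K: "K = (\<Sum>t\<in>{0..<2 * N}. ?T t)"
    unfolding sum_double[OF N] using b halves by (simp add: blocks_def)
  have X: "z i = X i + (\<Sum>t\<in>{t \<in> {0..<2 * N}. pc t = i}. ?T t)" if i: "i \<in> {p<..q}" for i
  proof -
    have "(\<Sum>t\<in>{t \<in> {0..<2 * N}. pc t = i}. ?T t) = (\<Sum>t\<in>{0..<2 * N}. if pc t = i then ?T t else 0)"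
      by (rule sum.inter_filter) simp
    also have "\<dots> = (\<Sum>t\<in>{0..<N}. if qc t = i then taken z (2 * s) (qc t) (qp t) else 0)"
      unfolding sum_double[OF N]
    proof (intro sum.cong refl)
      fix t assume t: "t \<in> {0..<N}"
      have "pc (2 * t) = qc t" "pc (2 * t + 1) = qc t" using pc[of "2 * t"] pc[of "2 * t + 1"] t by auto
      then show "(if pc (2 * t) = i then ?T (2 * t) else 0) + (if pc (2 * t + 1) = i then ?T (2 * t + 1) else 0) =
          (if qc t = i then taken z (2 * s) (qc t) (qp t) else 0)"
        using halves[OF t] by (cases "qc t = i") simp_all
    qed
    also have "\<dots> = (\<Sum>t\<in>{t \<in> {0..<N}. qc t = i}. taken z (2 * s) (qc t) (qp t))"
      by (rule sum.inter_filter[symmetric]) simp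
    finally show ?thesis using b i by (simp add: blocks_def)
  qed
  have sorted: "pc t < pc t' \<or> pc t = pc t' \<and> pp t + s \<le> pp t'" if t: "0 \<le> t" "t < t'" "t' < 2 * N" for t t'
  proof -
    have e: "pc t = qc (t div 2)" "pp t = qp (t div 2) + s * (t mod 2)"
      "pc t' = qc (t' div 2)" "pp t' = qp (t' div 2) + s * (t' mod 2)"
      using pc[of t] pc[of t'] t by auto
    show ?thesis
    proof (cases "t div 2 = t' div 2")
      case True
      then have "t mod 2 = 0" "t' mod 2 = 1" using t by presburger+
      then show ?thesis using True e by simp
    next
      case False
      then have "0 \<le> t div 2 \<and> t div 2 < t' div 2 \<and> t' div 2 < N" using t by presburger
      then have "qc (t div 2) < qc (t' div 2) \<or> qc (t div 2) = qc (t' div 2) \<and> qp (t div 2) + 2 * s \<le> qp (t' div 2)"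
        using b unfolding blocks_def by blast
      moreover have "t mod 2 = 0 \<or> t mod 2 = 1" "t' mod 2 = 0 \<or> t' mod 2 = 1" by presburger+
      ultimately show ?thesis using e s by auto
    qed
  qed
  have rng: "pc t \<in> {p<..q} \<and> l (pc t) \<le> pp t" if t: "t \<in> {0..<2 * N}" for t
  proof -
    have "t div 2 \<in> {0..<N}" using t by auto
    then have "qc (t div 2) \<in> {p<..q} \<and> l (qc (t div 2)) \<le> qp (t div 2)" using b unfolding blocks_def by blast
    moreover have "0 \<le> s * (t mod 2)" using s by simp
    ultimately show ?thesis using pc[OF t] by auto
  qed
  have "K < 2 * N * s" using b by (simp add: blocks_def algebra_simps)
  then show ?thesis using K X sorted rng unfolding blocks_def by blast
qed

locale halving_step =
  fixes h :: "int \<Rightarrow> int \<Rightarrow> real" and l :: "int \<Rightarrow> int" and p q :: int and z :: "int \<Rightarrow> int"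
    and s N :: int and pc pp X :: "int \<Rightarrow> int" and K j1 j2 :: int
  assumes mono: "mono_marginals h" and dc: "downset h l p q z"
    and b: "blocks l p q z s N pc pp X K" and s: "1 \<le> s"
    and j1: "isrank (\<lambda>t. h (pc t) (pp t + s)) {0..<N} (K div s) j1"
    and j2: "isrank (\<lambda>t. h (pc t) (pp t + 1)) {0..<N} (K div s) j2"
begin

definition "kL t = h (pc t) (pp t + 1)"
definition "kR t = h (pc t) (pp t + s)"
definition "disc t \<longleftrightarrow> kR j1 < kL t \<or> \<not> kL t < kR j1 \<and> j1 < t"
definition "tak t \<longleftrightarrow> kR t < kL j2 \<or> \<not> kL j2 < kR t \<and> t < j2"
definition "kept t \<longleftrightarrow> \<not> disc t \<and> \<not> tak t"

abbreviation "cl t \<equiv> taken z s (pc t) (pp t)"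

lemma ranks: "isrank kR {0..<N} (K div s) j1" "isrank kL {0..<N} (K div s) j2"
  using j1 j2 by (simp_all add: kL_def[abs_def] kR_def[abs_def])

lemma j_range: "j1 \<in> {0..<N}" "j2 \<in> {0..<N}"
  using ranks by (simp_all add: isrank_def)

lemma kL_le_kR: "kL t \<le> kR t"
  using mono s by (simp add: kL_def kR_def mono_marginalsD)

lemma sorted: "0 \<le> t \<Longrightarrow> t < t' \<Longrightarrow> t' < N \<Longrightarrow> pc t < pc t' \<or> pc t = pc t' \<and> pp t + s \<le> pp t'"
  using b unfolding blocks_def by blast

lemma range: "t \<in> {0..<N} \<Longrightarrow> pc t \<in> {p<..q}" "t \<in> {0..<N} \<Longrightarrow> l (pc t) \<le> pp t"
  using b unfolding blocks_def by blast+

text \<open>For equal marginals, sortedness turns \<open>u < t\<close> into a smaller variable or,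
  within one variable, into an earlier unit, which is how \<open>elt\<close> breaks ties.\<close>

lemma last_before_first:
  assumes "u \<in> {0..<N}" "t \<in> {0..<N}" "kR u < kL t \<or> \<not> kL t < kR u \<and> u < t"
  shows "elt h (pc u) (pp u + s) (pc t) (pp t + 1)"
  using assms(3)
proof
  assume "\<not> kL t < kR u \<and> u < t"
  then show ?thesis using sorted[of u t] assms by (auto simp: elt_def kL_def kR_def)
qed (simp add: elt_def kL_def kR_def)

lemma cl_bounds: "0 \<le> cl t" "cl t \<le> s"
  using taken_bounds[of s] s by auto

lemma K_eq: "K = (\<Sum>t\<in>{0..<N}. cl t)"
  using b by (simp add: blocks_def)

lemma first_taken: "0 < cl t \<Longrightarrow> pp t + 1 \<le> z (pc t)"
  by (auto simp: taken_def)

lemma not_full: "cl t < s \<Longrightarrow> z (pc t) < pp t + s"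
  by (auto simp: taken_def)

definition "low = insert j1 {u \<in> {0..<N}. klt kR u j1}"

lemma low: "finite low" "low \<subseteq> {0..<N}" "int (card low) = K div s + 1"
proof -
  let ?A = "{u \<in> {0..<N}. klt kR u j1}"
  have "finite ?A" "j1 \<notin> ?A" by auto
  then have "card low = card ?A + 1" by (simp add: low_def)
  then show "int (card low) = K div s + 1" using ranks(1) by (simp add: isrank_def krank_def)
  show "finite low" "low \<subseteq> {0..<N}" using j_range by (auto simp: low_def)
qed

text \<open>If all these blocks were full they would hold \<open>(K div s + 1) * s > K\<close>
  units.\<close>

lemma low_not_full: "\<exists>u\<in>low. cl u < s"
proof (rule ccontr)
  assume "\<not> (\<exists>u\<in>low. cl u < s)"
  then have "cl u = s" if "u \<in> low" for u using that cl_bounds(2)[of u] by force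
  then have "int (card low) * s = (\<Sum>u\<in>low. cl u)" by simp
  also have "\<dots> \<le> K" unfolding K_eq using low cl_bounds by (intro sum_mono2) auto
  finally have "(K div s + 1) * s \<le> K" using low by simp
  then have "K div s * s + s \<le> K" by (simp only: distrib_right mult_1)
  moreover have "K div s * s + K mod s = K" by simp
  moreover have "K mod s < s" using s by simp
  ultimately show False by linarith
qed

text \<open>If the block were used, its first unit would be taken. But some block of
  \<open>low\<close> is not full, and its untaken last unit comes earlier.\<close>

lemma disc_cl:
  assumes t: "t \<in> {0..<N}" "disc t"
  shows "cl t = 0"
proof (rule ccontr)
  assume "cl t \<noteq> 0"
  then have ft: "pp t + 1 \<le> z (pc t)" using cl_bounds[of t] first_taken by force
  obtain u where u: "u \<in> low" "cl u < s" using low_not_full by blast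
  have uN: "u \<in> {0..<N}" using u low by blast
  have "elt h (pc t) (pp t + 1) (pc u) (pp u + s)"
    using dc range[OF t(1)] range[OF uN] ft not_full[OF u(2)] unfolding downset_def by auto
  moreover have "kR u < kL t \<or> \<not> kL t < kR u \<and> u < t"
    using t(2) u(1) by (auto simp: disc_def low_def klt_def)
  ultimately show False using last_before_first[OF uN t(1)] elt_asym by blast
qed

text \<open>If the last unit of \<open>t\<close> were untaken, all blocks outside the
  \<open>K div s\<close> ones that start before \<open>j2\<close> would be empty. Those
  \<open>K div s\<close> blocks, with \<open>t\<close> among them not full, would hold fewer than
  \<open>K div s * s\<close> units, which is at most \<open>K\<close>.\<close>

lemma tak_cl:
  assumes t: "t \<in> {0..<N}" "tak t"
  shows "cl t = s"
proof (rule ccontr)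
  assume "cl t \<noteq> s"
  then have ct: "cl t < s" using cl_bounds[of t] by linarith
  let ?P = "{u \<in> {0..<N}. klt kL u j2}"
  have zero: "cl u = 0" if u: "u \<in> {0..<N}" "\<not> klt kL u j2" for u
  proof (rule ccontr)
    assume "cl u \<noteq> 0"
    then have "pp u + 1 \<le> z (pc u)" using cl_bounds[of u] first_taken by force
    then have "elt h (pc u) (pp u + 1) (pc t) (pp t + s)"
      using dc range[OF t(1)] range[OF u(1)] not_full[OF ct] unfolding downset_def by auto
    moreover have "kR t < kL u \<or> \<not> kL u < kR t \<and> t < u"
      using t(2) u(2) by (auto simp: tak_def klt_def)
    ultimately show False using last_before_first[OF t(1) u(1)] elt_asym by blast
  qed
  have tP: "t \<in> ?P" using t kL_le_kR[of t] by (auto simp: tak_def klt_def)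
  have "K = (\<Sum>u\<in>?P. cl u)" unfolding K_eq
    using zero by (intro sum.mono_neutral_right) auto
  also have "\<dots> < (\<Sum>u\<in>?P. s)"
    using cl_bounds tP ct by (intro sum_strict_mono_ex1) auto
  also have "\<dots> = K div s * s" using ranks(2) by (simp add: isrank_def krank_def)
  finally have "K < K div s * s" .
  moreover have "K div s * s + K mod s = K" by simp
  moreover have "0 \<le> K mod s" using s by simp
  ultimately show False by linarith
qed

text \<open>Guarantees a surviving block that is not full, which is what preserves
  \<open>K < N * s\<close> in the next round.\<close>

lemma j1_kept: "kept j1" "cl j1 < s"
proof -
  show less: "cl j1 < s"
  proof (rule ccontr)
    assume "\<not> cl j1 < s"
    then have "cl j1 = s" using cl_bounds[of j1] by linarith
    then have full: "pp j1 + s \<le> z (pc j1)" using s by (auto simp: taken_def)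
    obtain u where u: "u \<in> low" "cl u < s" using low_not_full by blast
    have uN: "u \<in> {0..<N}" using u low by blast
    have "elt h (pc j1) (pp j1 + s) (pc u) (pp u + s)"
      using dc range[OF j_range(1)] range[OF uN] full not_full[OF u(2)] s unfolding downset_def by auto
    moreover have "elt h (pc u) (pp u + s) (pc j1) (pp j1 + s)"
      using u \<open>cl j1 = s\<close> uN j_range sorted[of u j1] s by (auto simp: low_def klt_def elt_def kR_def)
    ultimately show False using elt_asym by blast
  qed
  then have "\<not> tak j1" using tak_cl[OF j_range(1)] by force
  moreover have "\<not> disc j1" using kL_le_kR[of j1] by (auto simp: disc_def)
  ultimately show "kept j1" by (simp add: kept_def)
qed

lemma card_straddle:
  assumes A: "A \<subseteq> {0..<N}" and P: "\<And>t t'. t \<in> A \<Longrightarrow> t' \<in> A \<Longrightarrow> t < t' \<Longrightarrow> pc t = pc t' \<Longrightarrow> False"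
  shows "int (card A) \<le> q - p"
proof -
  have "inj_on pc A" using P by (metis inj_onI linorder_neqE_linordered_idom)
  then have "card A \<le> card {p<..q}" using A range by (intro card_inj_on_le[of pc]) auto
  moreover have "A \<noteq> {} \<Longrightarrow> p < q" using A range(1) by force
  ultimately show ?thesis
    by (cases "A = {}") (use j_range range(1)[of j1] in auto)
qed

text \<open>Of two such blocks of the same variable the earlier one ends after the pivot, so the
  later one starts after it and would have been discarded.\<close>

lemma straddle_R: "int (card {t \<in> {0..<N}. \<not> disc t \<and> klt kR j1 t}) \<le> q - p"
proof (rule card_straddle)
  fix t t' assume t: "t \<in> {t \<in> {0..<N}. \<not> disc t \<and> klt kR j1 t}" "t' \<in> {t \<in> {0..<N}. \<not> disc t \<and> klt kR j1 t}"
    and lt: "t < t'" "pc t = pc t'"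
  have "pp t + s \<le> pp t'" using sorted[of t t'] t lt by auto
  then have "kR t \<le> kL t'" using lt mono by (simp add: kL_def kR_def mono_marginalsD)
  then show False using t lt by (auto simp: disc_def klt_def)
qed auto

text \<open>Of two such blocks of the same variable the later one starts before the pivot, so the
  earlier one ends before it and would have been taken.\<close>

lemma straddle_L: "int (card {t \<in> {0..<N}. \<not> tak t \<and> klt kL t j2}) \<le> q - p"
proof (rule card_straddle)
  fix t t' assume t: "t \<in> {t \<in> {0..<N}. \<not> tak t \<and> klt kL t j2}" "t' \<in> {t \<in> {0..<N}. \<not> tak t \<and> klt kL t j2}"
    and lt: "t < t'" "pc t = pc t'"
  have "pp t + s \<le> pp t'" using sorted[of t t'] t lt by auto
  then have "kR t \<le> kL t'" using lt mono by (simp add: kL_def kR_def mono_marginalsD)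
  then show False using t lt by (auto simp: tak_def klt_def)
qed auto

text \<open>A kept block outside both straddling sets lies in \<open>?S1\<close> and
  \<open>?S2\<close>. These have \<open>K div s + 1\<close> and \<open>N - K div s\<close> elements,
  together \<open>N + 1\<close>, so their intersection has one element more than the complement
  \<open>?C\<close> of their union, and \<open>?C\<close> consists of straddling blocks.\<close>

lemma card_kept: "int (card {t \<in> {0..<N}. kept t}) \<le> 3 * (q - p) + 1"
proof -
  let ?R = "{t \<in> {0..<N}. \<not> disc t \<and> klt kR j1 t}" and ?L = "{t \<in> {0..<N}. \<not> tak t \<and> klt kL t j2}"
  let ?S1 = "{t \<in> {0..<N}. \<not> klt kR j1 t}" and ?S2 = "{t \<in> {0..<N}. \<not> klt kL t j2}"
  let ?C = "{t \<in> {0..<N}. klt kR j1 t \<and> klt kL t j2}"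
  have S1: "?S1 = low" using klt_linear[of kR j1] klt_asym[of kR j1] j_range(1) by (auto simp: low_def)
  have c2: "int (card {t \<in> {0..<N}. klt kL t j2}) = K div s" using ranks(2) by (simp add: isrank_def krank_def)
  have cN: "card {0..<N} = card {t \<in> {0..<N}. klt kL t j2} + card ?S2" by (rule card_filter_split) simp
  have N: "0 < N" using j_range by auto
  have cS2: "int (card ?S2) = N - K div s" using c2 cN N by simp
  have fin: "finite ?R" "finite ?L" "finite ?S1" "finite ?S2" "finite ?C" by auto
  \<comment> \<open>If such a block ended before \<open>j2\<close> starts, then so would all of
    \<open>low\<close>; that makes \<open>K div s + 1\<close> blocks starting before
    \<open>j2\<close>, one too many.\<close>
  have CR: "?C \<subseteq> ?L"
  proof
    fix t assume t: "t \<in> ?C"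
    have "\<not> tak t"
    proof
      assume "tak t"
      then have tj2: "kR t < kL j2 \<or> \<not> kL j2 < kR t \<and> t < j2" by (simp add: tak_def)
      have sub: "low \<subseteq> {t \<in> {0..<N}. klt kL t j2}"
      proof
        fix u assume u: "u \<in> low"
        have "klt kR u t" using u t klt_trans[of kR u j1 t] by (auto simp: low_def)
        then have "klt kL u j2" using tj2 kL_le_kR[of u] by (auto simp: klt_def)
        then show "u \<in> {t \<in> {0..<N}. klt kL t j2}" using u low by auto
      qed
      then have "card low \<le> card {t \<in> {0..<N}. klt kL t j2}" by (intro card_mono) auto
      then show False using c2 low(3) by linarith
    qed
    then show "t \<in> ?L" using t by auto
  qed
  have "{0..<N} = ?S1 \<union> ?S2 \<union> ?C" by auto
  then have "card {0..<N} = card (?S1 \<union> ?S2 \<union> ?C)" by (rule arg_cong)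
  also have "\<dots> \<le> card (?S1 \<union> ?S2) + card ?C" by (rule card_Un_le)
  finally have U: "N \<le> int (card (?S1 \<union> ?S2)) + int (card ?C)" using N by simp
  have "card ?S1 + card ?S2 = card (?S1 \<union> ?S2) + card (?S1 \<inter> ?S2)" using fin by (intro card_Un_Int) auto
  moreover have "card ?C \<le> card ?L" using CR fin by (intro card_mono) auto
  ultimately have mid: "int (card (?S1 \<inter> ?S2)) \<le> 1 + int (card ?L)"
    using U cS2 low(3) unfolding S1 by linarith
  have "{t \<in> {0..<N}. kept t} \<subseteq> ?R \<union> ?L \<union> (?S1 \<inter> ?S2)" by (auto simp: kept_def)
  then have "card {t \<in> {0..<N}. kept t} \<le> card (?R \<union> ?L \<union> (?S1 \<inter> ?S2))" using fin by (intro card_mono) auto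
  also have "\<dots> \<le> card ?R + card ?L + card (?S1 \<inter> ?S2)"
    by (meson add_le_mono1 card_Un_le le_trans)
  finally have "int (card {t \<in> {0..<N}. kept t}) \<le> int (card ?R + card ?L + card (?S1 \<inter> ?S2))"
    by (simp only: of_nat_le_iff)
  then show ?thesis using straddle_R straddle_L mid by simp
qed

text \<open>For single units, first and last unit coincide, hence so do the two pivots, and every
  other block is on one side of them.\<close>

lemma kept_unit:
  assumes "s = 1"
  shows "{t \<in> {0..<N}. kept t} = {j1}"
proof -
  have eq: "kL = kR"
    by (rule ext, unfold kL_def kR_def) (simp add: assms)
  have "krank kR {0..<N} j1 = krank kR {0..<N} j2" using ranks eq by (simp add: isrank_def)
  then have "j1 = j2" using krank_less[of "{0..<N}" _ kR] j_range klt_linear[of kR j1 j2]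
    by (metis finite_atLeastLessThan_int less_irrefl)
  have "t = j1" if "kept t" for t
  proof -
    have "\<not> disc t" "\<not> tak t" using that by (simp_all add: kept_def)
    then show ?thesis unfolding disc_def tak_def eq using \<open>j1 = j2\<close> by auto
  qed
  then show ?thesis using j1_kept j_range by auto
qed

text \<open>The surviving blocks are listed by an increasing \<open>e\<close>, so sortedness is
  inherited. For \<open>s = 1\<close> a single block that is not full remains, hence nothing is left
  to take.\<close>

lemma blocks_filter:
  assumes e: "strict_mono_on {0..<w} e" "e ` {0..<w} = {t \<in> {0..<N}. kept t}"
    and qc: "\<And>t. t \<in> {0..<w} \<Longrightarrow> qc t = pc (e t) \<and> qp t = pp (e t)"
    and K': "K' = K - s * int (card {t \<in> {0..<N}. tak t})"
    and X': "\<And>i. i \<in> {p<..q} \<Longrightarrow> X' i = X i + s * int (card {t \<in> {0..<N}. tak t \<and> pc t = i})"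
    and w: "0 \<le> w"
  shows "blocks l p q z s w qc qp X' K'" "w \<le> 3 * (q - p) + 1" "s = 1 \<Longrightarrow> K' = 0"
proof -
  have inj: "inj_on e {0..<w}" using e(1) by (rule strict_mono_on_imp_inj_on)
  have eN: "e t \<in> {0..<N}" "kept (e t)" if "t \<in> {0..<w}" for t using e(2) that by auto
  \<comment> \<open>Discarded blocks contribute 0 and taken ones \<open>s\<close> each. With
    \<open>Q\<close> constantly true this accounts for \<open>K\<close>, with \<open>Q\<close>
    fixing a variable for \<open>X\<close>.\<close>
  have split: "(\<Sum>t\<in>{t \<in> {0..<N}. Q (pc t)}. cl t) = s * int (card {t \<in> {0..<N}. tak t \<and> Q (pc t)}) +
      (\<Sum>t\<in>{t \<in> {0..<w}. Q (qc t)}. taken z s (qc t) (qp t))" for Q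
  proof -
    have bij: "bij_betw e {t \<in> {0..<w}. Q (qc t)} {t \<in> {0..<N}. kept t \<and> Q (pc t)}"
    proof (rule bij_betw_imageI)
      show "inj_on e {t \<in> {0..<w}. Q (qc t)}" using inj by (rule inj_on_subset) auto
      show "e ` {t \<in> {0..<w}. Q (qc t)} = {t \<in> {0..<N}. kept t \<and> Q (pc t)}"
      proof
        show "e ` {t \<in> {0..<w}. Q (qc t)} \<subseteq> {t \<in> {0..<N}. kept t \<and> Q (pc t)}" using eN qc by auto
        show "{t \<in> {0..<N}. kept t \<and> Q (pc t)} \<subseteq> e ` {t \<in> {0..<w}. Q (qc t)}"
        proof
          fix u assume u: "u \<in> {t \<in> {0..<N}. kept t \<and> Q (pc t)}"
          then obtain t where "t \<in> {0..<w}" "u = e t" using e(2) by blast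
          then show "u \<in> e ` {t \<in> {0..<w}. Q (qc t)}" using u qc by auto
        qed
      qed
    qed
    have "(\<Sum>t\<in>{t \<in> {0..<w}. Q (qc t)}. taken z s (qc t) (qp t)) = (\<Sum>t\<in>{t \<in> {0..<w}. Q (qc t)}. cl (e t))"
      using qc by (intro sum.cong) auto
    also have "\<dots> = (\<Sum>t\<in>{t \<in> {0..<N}. kept t \<and> Q (pc t)}. cl t)" by (rule sum.reindex_bij_betw[OF bij])
    finally have 1: "(\<Sum>t\<in>{t \<in> {0..<w}. Q (qc t)}. taken z s (qc t) (qp t)) = (\<Sum>t\<in>{t \<in> {0..<N}. kept t \<and> Q (pc t)}. cl t)" .
    let ?A = "{t \<in> {0..<N}. tak t \<and> Q (pc t)}" and ?B = "{t \<in> {0..<N}. kept t \<and> Q (pc t)}"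
    have "(\<Sum>t\<in>{t \<in> {0..<N}. Q (pc t)}. cl t) = (\<Sum>t\<in>?A \<union> ?B. cl t)"
      by (intro sum.mono_neutral_right) (auto simp: kept_def disc_cl)
    also have "\<dots> = (\<Sum>t\<in>?A. cl t) + (\<Sum>t\<in>?B. cl t)"
      by (intro sum.union_disjoint) (auto simp: kept_def)
    also have "(\<Sum>t\<in>?A. cl t) = (\<Sum>t\<in>?A. s)" using tak_cl by (intro sum.cong) auto
    finally show ?thesis using 1 by simp
  qed
  have Keq: "K' = (\<Sum>t\<in>{0..<w}. taken z s (qc t) (qp t))"
  proof -
    show ?thesis using split[of "\<lambda>_. True"] K' K_eq by (simp only: simp_thms Collect_mem_eq)
  qed
  have Xeq: "z i = X' i + (\<Sum>t\<in>{t \<in> {0..<w}. qc t = i}. taken z s (qc t) (qp t))" if "i \<in> {p<..q}" for i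
    using split[of "\<lambda>j. j = i"] X'[OF that] b that by (simp add: blocks_def)
  \<comment> \<open>The survivor \<open>j1\<close> makes the inequality \<open>K' < w * s\<close>
    strict.\<close>
  obtain t1 where t1: "t1 \<in> {0..<w}" "e t1 = j1" using e(2) j1_kept(1) j_range(1) by (metis (mono_tags, lifting) imageE mem_Collect_eq)
  have "(\<Sum>t\<in>{0..<w}. taken z s (qc t) (qp t)) < (\<Sum>t\<in>{0..<w}. s)"
    using t1 qc[OF t1(1)] j1_kept(2) taken_bounds[of s] s by (intro sum_strict_mono_ex1) (auto intro!: bexI[of _ t1])
  then have lt: "K' < w * s" using Keq w by simp
  have sort: "qc t < qc t' \<or> qc t = qc t' \<and> qp t + s \<le> qp t'" if t: "0 \<le> t" "t < t'" "t' < w" for t t'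
  proof -
    have "e t < e t'" using e(1) t by (simp add: strict_mono_on_def)
    then show ?thesis using sorted[of "e t" "e t'"] eN[of t] eN[of t'] qc[of t] qc[of t'] t by auto
  qed
  have "qc t \<in> {p<..q} \<and> l (qc t) \<le> qp t" if "t \<in> {0..<w}" for t
    using range[OF eN(1)[OF that]] qc[OF that] by simp
  then show "blocks l p q z s w qc qp X' K'" unfolding blocks_def using Keq Xeq lt sort by blast
  have cw: "int (card {t \<in> {0..<N}. kept t}) = w" using card_image[OF inj] e(2) w by simp
  then show "w \<le> 3 * (q - p) + 1" using card_kept by simp
  assume "s = 1"
  then have "w = 1" using kept_unit cw by simp
  moreover have "0 \<le> K'" unfolding Keq using taken_bounds[of s] s by (intro sum_nonneg) auto
  ultimately show "K' = 0" using lt \<open>s = 1\<close> by simp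
qed

end

text \<open>Marginals continued by \<open>-M\<close> below \<open>c\<close>, by \<open>M\<close> above \<open>d\<close>, and by \<open>2 M\<close> above the upper bounds
  \<open>U\<close> of the current box, so that no unit outside the box is ever taken.\<close>

definition padded :: "(int \<Rightarrow> int) \<Rightarrow> (int \<Rightarrow> int) \<Rightarrow> (int \<Rightarrow> int) \<Rightarrow> real \<Rightarrow> (int \<Rightarrow> int \<Rightarrow> real) \<Rightarrow> int \<Rightarrow> int \<Rightarrow> real" where
  "padded U d c M F i k = (if U i < k then M + M else if d i < k then M
     else if c i < k then F i k - F i (k - 1) else - M)"

section \<open>Programs for one halving phase\<close>

lemma ival_rupdate [simp]: "ival e (rupdate v k r s) = ival e s"
  by (induction e) auto

text \<open>The order of the tests ensures that both queried points \<open>k - 1\<close> and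
  \<open>k\<close> lie in [c, d]; elsewhere the oracle is undefined and execution would be
  stuck.\<close>

definition key_prog :: "string \<Rightarrow> iexp \<Rightarrow> com" where
  "key_prog arr off = (let i = IMem ''pc'' (V ''ti''); k = IAdd (IMem ''pp'' (V ''ti'')) off; t = V ''ti''; M = RMem ''M'' C0 in
     Cond (ILess (IMem ''U'' i) k) (RAssign arr t (RAdd M M))
     (Cond (ILess (IMem ''d'' i) k) (RAssign arr t M)
     (Cond (ILess (IMem ''c'' i) k)
       (Query ''h'' C0 i (OfInt (ISub k C1)) ;; Query arr t i (OfInt k) ;; RAssign arr t (RSub (RMem arr t) (RMem ''h'' C0)))
       (RAssign arr t (RSub (OfInt C0) M)))))"

lemma key_prog_writes [simp]: "iw (key_prog arr off) = {}" "rw (key_prog arr off) = {arr, ''h''}"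
  by (auto simp: key_prog_def Let_def)

lemma runs_key_prog:
  fixes s :: state and off :: iexp
  defines "t \<equiv> imem s ''ti'' 0"
  defines "i \<equiv> imem s ''pc'' t" and "k \<equiv> imem s ''pp'' t + ival off s"
  assumes orc: "imem s ''c'' i < k \<Longrightarrow> k \<le> imem s ''d'' i \<Longrightarrow>
      orc i (of_int k) = Some (F i k) \<and> orc i (of_int (k - 1)) = Some (F i (k - 1))"
    and arr: "arr \<noteq> ''h''" "arr \<noteq> ''M''" and off: "icost off \<le> 2"
  shows "runs orc (key_prog arr off) s 200
    (\<lambda>s'. rmem s' arr = (rmem s arr)(t := padded (imem s ''U'') (imem s ''d'') (imem s ''c'') (rmem s ''M'' 0) F i k))"
proof (rule runs_wp_le)
  let ?Q = "\<lambda>s'. rmem s' arr = (rmem s arr)(t := padded (imem s ''U'') (imem s ''d'') (imem s ''c'') (rmem s ''M'' 0) F i k)"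
  show "wp orc (key_prog arr off) ?Q s"
  proof (cases "imem s ''c'' i < k \<and> k \<le> imem s ''d'' i \<and> k \<le> imem s ''U'' i")
    case True
    then have "orc i (of_int k) = Some (F i k)" "orc i (of_int (k - 1)) = Some (F i (k - 1))" using orc by auto
    then show ?thesis using arr True
      by (simp add: key_prog_def Let_def t_def[symmetric] i_def[symmetric] k_def[symmetric] padded_def not_less
          del: of_int_diff of_int_add)
  next
    case False
    then show ?thesis using arr
      by (auto simp: key_prog_def Let_def t_def[symmetric] i_def[symmetric] k_def[symmetric] padded_def)
  qed
  show "ccost (key_prog arr off) \<le> 200" using off by (simp add: key_prog_def Let_def)
qed

definition fill_prog :: com where
  "fill_prog = ''ti'' ::= C0 ;; For ''ti'' (V ''N'') (key_prog ''kL'' C1 ;; key_prog ''kR'' (V ''s''))"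

lemma fill_prog_writes [simp]: "iw fill_prog = {''ti''}" "rw fill_prog = {''kL'', ''kR'', ''h''}"
  by (auto simp: fill_prog_def)

lemma runs_fill_prog:
  fixes s :: state and F
  defines "N \<equiv> imem s ''N'' 0" and "pc \<equiv> imem s ''pc''" and "pp \<equiv> imem s ''pp''" and "w \<equiv> imem s ''s'' 0"
  defines "h \<equiv> padded (imem s ''U'') (imem s ''d'') (imem s ''c'') (rmem s ''M'' 0) F"
  assumes orc: "\<And>t k. t \<in> {0..<N} \<Longrightarrow> imem s ''c'' (pc t) \<le> k \<Longrightarrow> k \<le> imem s ''d'' (pc t) \<Longrightarrow>
      orc (pc t) (of_int k) = Some (F (pc t) k)" and N: "0 \<le> N"
  shows "runs orc fill_prog s (420 * nat N + 20)
    (\<lambda>s'. \<forall>t\<in>{0..<N}. rmem s' ''kL'' t = h (pc t) (pp t + 1) \<and> rmem s' ''kR'' t = h (pc t) (pp t + w))"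
  unfolding fill_prog_def
proof (rule runs_block[where Q = "\<lambda>s'. imem s' ''ti'' 0 = 0" and T' = "420 * nat N + 10"])
  let ?body = "key_prog ''kL'' C1 ;; key_prog ''kR'' (V ''s'')"
  let ?I = "\<lambda>k s'. \<forall>t\<in>{0..<k}. rmem s' ''kL'' t = h (pc t) (pp t + 1) \<and> rmem s' ''kR'' t = h (pc t) (pp t + w)"
  fix s1 assume s1: "imem s1 ''ti'' 0 = 0" and so1: "same_off (''ti'' ::= C0) s s1"
  note fr1 = same_offD[OF so1, simplified]
  have "runs orc (For ''ti'' (V ''N'') ?body) s1 (420 * nat N + 10) (\<lambda>s'. ?I N s' \<and> imem s' ''ti'' 0 = N)"
  proof (rule runs_For[where T = 400 and lw = 0 and hg = N and Inv = ?I])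
    fix k s' assume k: "0 \<le> k" "k < N" "imem s' ''ti'' 0 = k" and I: "?I k s'"
      and so: "same_off (For ''ti'' (V ''N'') ?body) s1 s'"
    note fr = same_offD[OF so, simplified]
    have o: "orc (pc k) (of_int m) = Some (F (pc k) m) \<and> orc (pc k) (of_int (m - 1)) = Some (F (pc k) (m - 1))"
      if "imem s ''c'' (pc k) < m" "m \<le> imem s ''d'' (pc k)" for m
      using orc[of k m] orc[of k "m - 1"] that k by simp
    have "runs orc (key_prog ''kL'' C1) s' 200 (\<lambda>s''. rmem s'' ''kL'' = (rmem s' ''kL'')(k := h (pc k) (pp k + 1)))"
      using runs_key_prog[of s' C1 orc F "''kL''"] o[of "pp k + 1"] k(3)
      by (simp add: fr fr1 h_def pc_def pp_def del: of_int_diff of_int_add)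
    then show "runs orc ?body s' 400 (\<lambda>s''. imem s'' ''ti'' 0 = k \<and> ?I (k + 1) (iupdate ''ti'' 0 (k + 1) s''))"
    proof (rule runs_Seq2[where T' = 200])
      fix s2 assume s2: "rmem s2 ''kL'' = (rmem s' ''kL'')(k := h (pc k) (pp k + 1))"
        and so2: "same_off (key_prog ''kL'' C1) s' s2"
      note fr2 = same_offD[OF so2, simplified]
      have "runs orc (key_prog ''kR'' (V ''s'')) s2 200 (\<lambda>s''. rmem s'' ''kR'' = (rmem s2 ''kR'')(k := h (pc k) (pp k + w)))"
        using runs_key_prog[of s2 "V ''s''" orc F "''kR''"] o[of "pp k + w"] k(3)
        by (simp add: fr2 fr fr1 h_def pc_def pp_def w_def del: of_int_diff of_int_add)
      then show "runs orc (key_prog ''kR'' (V ''s'')) s2 200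
          (\<lambda>s''. imem s'' ''ti'' 0 = k \<and> ?I (k + 1) (iupdate ''ti'' 0 (k + 1) s''))"
      proof (rule runs_mono)
        fix s3 assume s3: "rmem s3 ''kR'' = (rmem s2 ''kR'')(k := h (pc k) (pp k + w))"
          and so3: "same_off (key_prog ''kR'' (V ''s'')) s2 s3"
        note fr3 = same_offD[OF so3, simplified]
        show "imem s3 ''ti'' 0 = k \<and> ?I (k + 1) (iupdate ''ti'' 0 (k + 1) s3)"
          using s3 s2 I k(3) by (auto simp: fr3 fr2)
      qed simp
    qed simp
  next
    fix k s' assume so: "same_off (For ''ti'' (V ''N'') ?body) s1 s'"
    show "ival (V ''N'') s' = N" using same_offD[OF so, simplified] fr1 by (simp add: N_def)
  qed (use s1 N in auto)
  then show "runs orc (For ''ti'' (V ''N'') ?body) s1 (420 * nat N + 10) (?I N)"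
    by (rule runs_mono) auto
qed auto

abbreviation BOr :: "bexp \<Rightarrow> bexp \<Rightarrow> bexp" where
  "BOr a b \<equiv> BNot (BAnd (BNot a) (BNot b))"

definition discard_test :: bexp where
  "discard_test = BOr (RLess (RMem ''kR'' (V ''j1'')) (RMem ''kL'' (V ''ti'')))
     (BAnd (BNot (RLess (RMem ''kL'' (V ''ti'')) (RMem ''kR'' (V ''j1'')))) (ILess (V ''j1'') (V ''ti'')))"

definition take_test :: bexp where
  "take_test = BOr (RLess (RMem ''kR'' (V ''ti'')) (RMem ''kL'' (V ''j2'')))
     (BAnd (BNot (RLess (RMem ''kL'' (V ''j2'')) (RMem ''kR'' (V ''ti'')))) (ILess (V ''ti'') (V ''j2'')))"

definition prune_body :: com where
  "prune_body = Cond discard_test Skip (Cond take_test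
     (IAssign ''XX'' (IMem ''pc'' (V ''ti'')) (IAdd (IMem ''XX'' (IMem ''pc'' (V ''ti''))) (V ''s'')) ;;
      ''K'' ::= ISub (V ''K'') (V ''s''))
     (IAssign ''qc'' (V ''w'') (IMem ''pc'' (V ''ti'')) ;; IAssign ''qp'' (V ''w'') (IMem ''pp'' (V ''ti'')) ;;
      ''w'' ::= IAdd (V ''w'') C1))"

definition prune_prog :: com where
  "prune_prog = (''ti'' ::= C0 ;; ''w'' ::= C0) ;; For ''ti'' (V ''N'') prune_body"

lemma prune_writes [simp]:
  "iw prune_body = {''XX'', ''K'', ''qc'', ''qp'', ''w''}" "rw prune_body = {}"
  "iw prune_prog = {''ti'', ''XX'', ''K'', ''qc'', ''qp'', ''w''}" "rw prune_prog = {}"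
  by (auto simp: prune_prog_def prune_body_def)

lemma strict_mono_on_snoc:
  fixes e :: "int \<Rightarrow> int"
  assumes "strict_mono_on {0..<w} e" "\<And>t. t \<in> {0..<w} \<Longrightarrow> e t < k" "0 \<le> w"
  shows "strict_mono_on {0..<w + 1} (e(w := k))"
  using assms by (auto simp: strict_mono_on_def)

text \<open>The output is described by an increasing enumeration of the kept positions instead of a
  set, because the order of the blocks has to survive.\<close>

lemma runs_prune_prog:
  fixes s :: state
  defines "N \<equiv> imem s ''N'' 0" and "pc \<equiv> imem s ''pc''" and "pp \<equiv> imem s ''pp''" and "b \<equiv> imem s ''s'' 0"
    and "kL \<equiv> rmem s ''kL''" and "kR \<equiv> rmem s ''kR''" and "j1 \<equiv> imem s ''j1'' 0" and "j2 \<equiv> imem s ''j2'' 0"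
  assumes N: "0 \<le> N"
    and D: "\<And>t. t \<in> {0..<N} \<Longrightarrow> D t \<longleftrightarrow> kR j1 < kL t \<or> \<not> kL t < kR j1 \<and> j1 < t"
    and Ta: "\<And>t. t \<in> {0..<N} \<Longrightarrow> Ta t \<longleftrightarrow> kR t < kL j2 \<or> \<not> kL j2 < kR t \<and> t < j2"
    and excl: "\<And>t. t \<in> {0..<N} \<Longrightarrow> \<not> (D t \<and> Ta t)"
  shows "runs orc prune_prog s (120 * nat N + 30)
    (\<lambda>s'. 0 \<le> imem s' ''w'' 0 \<and>
       (\<exists>e. strict_mono_on {0..<imem s' ''w'' 0} e \<and> e ` {0..<imem s' ''w'' 0} = {t \<in> {0..<N}. \<not> D t \<and> \<not> Ta t} \<and>
         (\<forall>t\<in>{0..<imem s' ''w'' 0}. imem s' ''qc'' t = pc (e t) \<and> imem s' ''qp'' t = pp (e t))) \<and>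
       imem s' ''K'' 0 = imem s ''K'' 0 - b * int (card {t \<in> {0..<N}. Ta t}) \<and>
       (\<forall>i. imem s' ''XX'' i = imem s ''XX'' i + b * int (card {t \<in> {0..<N}. Ta t \<and> pc t = i})))"
proof -
  define keep where "keep k = {t \<in> {0..<k}. \<not> D t \<and> \<not> Ta t}" for k
  define cT where "cT k = int (card {t \<in> {0..<k}. Ta t})" for k
  define cX where "cX i k = int (card {t \<in> {0..<k}. Ta t \<and> pc t = i})" for i k
  have step: "keep (k + 1) = (if \<not> D k \<and> \<not> Ta k then insert k (keep k) else keep k)"
    "cT (k + 1) = cT k + (if Ta k then 1 else 0)"
    "cX i (k + 1) = cX i k + (if Ta k \<and> pc k = i then 1 else 0)" if "0 \<le> k" for k i
    using card_Collect_upto[OF that, of Ta] card_Collect_upto[OF that, of "\<lambda>t. Ta t \<and> pc t = i"] that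
    unfolding keep_def cT_def cX_def by (auto simp: order_le_less)
  let ?I = "\<lambda>k s'. 0 \<le> imem s' ''w'' 0 \<and>
       (\<exists>e. strict_mono_on {0..<imem s' ''w'' 0} e \<and> e ` {0..<imem s' ''w'' 0} = keep k \<and>
         (\<forall>t\<in>{0..<imem s' ''w'' 0}. imem s' ''qc'' t = pc (e t) \<and> imem s' ''qp'' t = pp (e t))) \<and>
       imem s' ''K'' 0 = imem s ''K'' 0 - b * cT k \<and>
       (\<forall>i. imem s' ''XX'' i = imem s ''XX'' i + b * cX i k)"
  show ?thesis unfolding prune_prog_def keep_def[symmetric] cT_def[symmetric] cX_def[symmetric]
  proof (rule runs_block[where Q = "\<lambda>s'. imem s' ''ti'' 0 = 0 \<and> imem s' ''w'' 0 = 0" and T' = "120 * nat N + 10"])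
    fix s1 assume s1: "imem s1 ''ti'' 0 = 0 \<and> imem s1 ''w'' 0 = 0"
      and so1: "same_off (''ti'' ::= C0 ;; ''w'' ::= C0) s s1"
    note fr1 = same_offD[OF so1, simplified]
    have "runs orc (For ''ti'' (V ''N'') prune_body) s1 (120 * nat N + 10) (\<lambda>s'. ?I N s' \<and> imem s' ''ti'' 0 = N)"
    proof (rule runs_For[where T = 105 and lw = 0 and hg = N and Inv = ?I])
      show "?I 0 s1" using s1 fr1 by (auto simp: keep_def cT_def cX_def strict_mono_on_def)
    next
      fix k s' assume k: "0 \<le> k" "k < N" "imem s' ''ti'' 0 = k" and I: "?I k s'"
        and so: "same_off (For ''ti'' (V ''N'') prune_body) s1 s'"
      note fr = same_offD[OF so, simplified]
      note folds = kL_def[symmetric] kR_def[symmetric] pc_def[symmetric] pp_def[symmetric] b_def[symmetric]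
        j1_def[symmetric] j2_def[symmetric]
      have kN: "k \<in> {0..<N}" using k by simp
      have bD: "bval discard_test s' \<longleftrightarrow> D k" and bT: "bval take_test s' \<longleftrightarrow> Ta k"
        using D[OF kN] Ta[OF kN] k(3) by (auto simp: discard_test_def take_test_def fr fr1 folds)
      have cost: "ccost prune_body \<le> 105" by (simp add: prune_body_def discard_test_def take_test_def)
      show "runs orc prune_body s' 105 (\<lambda>s''. imem s'' ''ti'' 0 = k \<and> ?I (k + 1) (iupdate ''ti'' 0 (k + 1) s''))"
      proof (rule runs_wp_le[OF _ cost], cases "D k")
        case True
        then show "wp orc prune_body (\<lambda>s''. imem s'' ''ti'' 0 = k \<and> ?I (k + 1) (iupdate ''ti'' 0 (k + 1) s'')) s'"
          using bD I k excl[OF kN] by (simp add: prune_body_def step)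
      next
        case nD: False
        show "wp orc prune_body (\<lambda>s''. imem s'' ''ti'' 0 = k \<and> ?I (k + 1) (iupdate ''ti'' 0 (k + 1) s'')) s'"
        proof (cases "Ta k")
          case True
          then show ?thesis
            using nD bD bT I k by (simp add: prune_body_def step fr fr1 folds distrib_left)
        next
          case False
          define w where "w = imem s' ''w'' 0"
          have w: "0 \<le> w" using I by (simp add: w_def)
          obtain e where e: "strict_mono_on {0..<w} e" "e ` {0..<w} = keep k"
            "\<forall>t\<in>{0..<w}. imem s' ''qc'' t = pc (e t) \<and> imem s' ''qp'' t = pp (e t)"
            using I by (auto simp: w_def)
          have lt: "e t < k" if "t \<in> {0..<w}" for t
          proof -
            have "e t \<in> keep k" using e(2) that by blast
            then show ?thesis by (simp add: keep_def)
          qed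
          let ?e = "e(w := k)"
          have set: "{0..<w + 1} = insert w {0..<w}" using w by auto
          have img: "?e ` {0..<w} = e ` {0..<w}" by (intro image_cong) auto
          have "strict_mono_on {0..<w + 1} ?e" using strict_mono_on_snoc[OF e(1) lt w] by simp
          moreover have "?e ` {0..<w + 1} = keep (k + 1)"
            unfolding set image_insert img fun_upd_same e(2) using nD False step(1)[OF k(1)] by simp
          moreover have "\<forall>t\<in>{0..<w + 1}. ((imem s' ''qc'')(w := pc k)) t = pc (?e t) \<and> ((imem s' ''qp'')(w := pp k)) t = pp (?e t)"
            using e(3) by auto
          ultimately have "\<exists>e. strict_mono_on {0..<w + 1} e \<and> e ` {0..<w + 1} = keep (k + 1) \<and>
            (\<forall>t\<in>{0..<w + 1}. ((imem s' ''qc'')(w := pc k)) t = pc (e t) \<and> ((imem s' ''qp'')(w := pp k)) t = pp (e t))" by blast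
          then show ?thesis
            using nD False bD bT I k w by (simp add: prune_body_def step fr fr1 folds w_def[symmetric])
        qed
      qed
    next
      fix k s' assume so: "same_off (For ''ti'' (V ''N'') prune_body) s1 s'"
      show "ival (V ''N'') s' = N" using same_offD[OF so, simplified] fr1 by (simp add: N_def)
    qed (use s1 N in auto)
    then show "runs orc (For ''ti'' (V ''N'') prune_body) s1 (120 * nat N + 10) (?I N)"
      by (rule runs_mono) simp_all
  qed auto
qed

definition split_body :: com where
  "split_body = IAssign ''pc'' (IMul (CC 2) (V ''ti'')) (IMem ''qc'' (V ''ti'')) ;;
     IAssign ''pp'' (IMul (CC 2) (V ''ti'')) (IMem ''qp'' (V ''ti'')) ;;
     IAssign ''pc'' (IAdd (IMul (CC 2) (V ''ti'')) C1) (IMem ''qc'' (V ''ti'')) ;;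
     IAssign ''pp'' (IAdd (IMul (CC 2) (V ''ti'')) C1) (IAdd (IMem ''qp'' (V ''ti'')) (V ''s''))"

definition split_prog :: com where
  "split_prog = (''s'' ::= IDiv (V ''s'') (CC 2) ;; ''ti'' ::= C0 ;; ''N'' ::= IMul (CC 2) (V ''w'')) ;;
     For ''ti'' (V ''w'') split_body"

lemma split_writes [simp]:
  "iw split_body = {''pc'', ''pp''}" "rw split_body = {}"
  "iw split_prog = {''s'', ''ti'', ''N'', ''pc'', ''pp''}" "rw split_prog = {}"
  by (auto simp: split_prog_def split_body_def)

lemma runs_split_prog:
  fixes s :: state
  defines "w \<equiv> imem s ''w'' 0" and "b \<equiv> imem s ''s'' 0 div 2"
  assumes w: "0 \<le> w"
  shows "runs orc split_prog s (70 * nat w + 40)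
    (\<lambda>s'. imem s' ''s'' 0 = b \<and> imem s' ''N'' 0 = 2 * w \<and>
      (\<forall>t\<in>{0..<2 * w}. imem s' ''pc'' t = imem s ''qc'' (t div 2) \<and>
         imem s' ''pp'' t = imem s ''qp'' (t div 2) + b * (t mod 2)))"
  unfolding split_prog_def
proof (rule runs_block[where Q = "\<lambda>s'. imem s' ''s'' 0 = b \<and> imem s' ''ti'' 0 = 0 \<and> imem s' ''N'' 0 = 2 * w"
      and T' = "70 * nat w + 10"])
  fix s1 assume s1: "imem s1 ''s'' 0 = b \<and> imem s1 ''ti'' 0 = 0 \<and> imem s1 ''N'' 0 = 2 * w"
    and so1: "same_off (''s'' ::= IDiv (V ''s'') (CC 2) ;; ''ti'' ::= C0 ;; ''N'' ::= IMul (CC 2) (V ''w'')) s s1"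
  note fr1 = same_offD[OF so1, simplified]
  let ?I = "\<lambda>k s'. \<forall>t\<in>{0..<2 * k}. imem s' ''pc'' t = imem s ''qc'' (t div 2) \<and>
         imem s' ''pp'' t = imem s ''qp'' (t div 2) + b * (t mod 2)"
  have "runs orc (For ''ti'' (V ''w'') split_body) s1 (70 * nat w + 10) (\<lambda>s'. ?I w s' \<and> imem s' ''ti'' 0 = w)"
  proof (rule runs_For[where T = 50 and lw = 0 and hg = w and Inv = ?I])
    fix k s' assume k: "0 \<le> k" "k < w" "imem s' ''ti'' 0 = k" and I: "?I k s'"
      and so: "same_off (For ''ti'' (V ''w'') split_body) s1 s'"
    note fr = same_offD[OF so, simplified]
    have "{0..<2 * (k + 1)} = insert (2 * k) (insert (2 * k + 1) {0..<2 * k})" using k by auto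
    then show "runs orc split_body s' 50 (\<lambda>s''. imem s'' ''ti'' 0 = k \<and> ?I (k + 1) (iupdate ''ti'' 0 (k + 1) s''))"
      using I k s1 by (intro runs_wp_le) (auto simp: split_body_def fr fr1)
  next
    fix k s' assume so: "same_off (For ''ti'' (V ''w'') split_body) s1 s'"
    show "ival (V ''w'') s' = w" using same_offD[OF so, simplified] fr1 by (simp add: w_def)
  qed (use s1 w in auto)
  then show "runs orc (For ''ti'' (V ''w'') split_body) s1 (70 * nat w + 10)
    (\<lambda>s'. imem s' ''s'' 0 = b \<and> imem s' ''N'' 0 = 2 * w \<and> ?I w s')"
  proof (rule runs_mono)
    fix s' assume "?I w s' \<and> imem s' ''ti'' 0 = w" and so: "same_off (For ''ti'' (V ''w'') split_body) s1 s'"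
    then show "imem s' ''s'' 0 = b \<and> imem s' ''N'' 0 = 2 * w \<and> ?I w s'"
      using same_offD[OF so, simplified] s1 by simp
  qed simp
qed (auto simp: b_def w_def)

lemma isrank_cong:
  assumes "\<And>t. t \<in> S \<Longrightarrow> f t = g t"
  shows "isrank f S r e \<longleftrightarrow> isrank g S r e"
proof -
  have "e \<in> S \<Longrightarrow> {q \<in> S. klt f q e} = {q \<in> S. klt g q e}" using assms by (auto simp: klt_def)
  then show ?thesis by (auto simp: isrank_def krank_def)
qed

definition phase_prog :: com where
  "phase_prog = fill_prog ;; ''fl'' ::= IDiv (V ''K'') (V ''s'') ;; select_prog ''kR'' ;; ''j1'' ::= V ''piv'' ;;
     select_prog ''kL'' ;; ''j2'' ::= V ''piv'' ;; prune_prog ;; split_prog"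

definition select_vars :: "string set" where
  "select_vars = {''po'', ''pz'', ''pg'', ''pj'', ''dp'', ''off'', ''siz'', ''rk'',
     ''bl'', ''bh'', ''br'', ''bt'', ''re'', ''rlo'', ''rhi'', ''rc'', ''rt'', ''piv'', ''A'', ''fw'', ''ft'', ''fo'', ''fh'', ''ret'', ''st''}"

lemma phase_prog_writes [simp]:
  "iw phase_prog = select_vars \<union> {''ti'', ''fl'', ''j1'', ''j2'', ''XX'', ''K'', ''qc'', ''qp'', ''w'', ''s'', ''N'', ''pc'', ''pp''}"
  "rw phase_prog = {''kL'', ''kR'', ''h''}"
  by (auto simp: phase_prog_def select_vars_def)

text \<open>The bound \<open>8 * (q - p)\<close> reproduces itself: at most
  \<open>3 * (q - p) + 1\<close> blocks are kept and each is halved. The time is dominated by the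
  two selections, \<open>2 * 40030 * 8\<close> per variable.\<close>

lemma runs_phase_prog:
  fixes st :: state and F
  defines "N \<equiv> imem st ''N'' 0" and "pc \<equiv> imem st ''pc''" and "pp \<equiv> imem st ''pp''" and "s \<equiv> imem st ''s'' 0"
    and "X \<equiv> imem st ''XX''" and "K \<equiv> imem st ''K'' 0"
  defines "h \<equiv> padded (imem st ''U'') (imem st ''d'') (imem st ''c'') (rmem st ''M'' 0) F"
  assumes b: "blocks l p q z s N pc pp X K" and dc: "downset h l p q z" and mono: "mono_marginals h"
    and s: "1 \<le> s" and ev: "s = 1 \<or> even s" and N: "N \<le> 8 * (q - p)" and pq: "p < q"
    and orc: "\<And>i k. i \<in> {p<..q} \<Longrightarrow> imem st ''c'' i \<le> k \<Longrightarrow> k \<le> imem st ''d'' i \<Longrightarrow> orc i (of_int k) = Some (F i k)"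
  shows "runs orc phase_prog st (700000 * nat (q - p))
    (\<lambda>s'. imem s' ''s'' 0 = s div 2 \<and>
      (if s = 1 then \<forall>i\<in>{p<..q}. imem s' ''XX'' i = z i
       else blocks l p q z (s div 2) (imem s' ''N'' 0) (imem s' ''pc'') (imem s' ''pp'') (imem s' ''XX'') (imem s' ''K'' 0) \<and>
         imem s' ''N'' 0 \<le> 8 * (q - p)))"
    (is "runs orc phase_prog st _ ?Q")
proof -
  define n where "n = nat (q - p)"
  have n: "1 \<le> n" using pq by (simp add: n_def)
  have K: "0 \<le> K" "K < N * s" using b taken_bounds[of s z] s by (auto simp: blocks_def intro!: sum_nonneg)
  have fl: "0 \<le> K div s" "K div s < N"
  proof -
    show "0 \<le> K div s" using K s by (simp add: pos_imp_zdiv_nonneg_iff)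
    show "K div s < N"
    proof (rule ccontr)
      assume "\<not> K div s < N"
      then have "N * s \<le> K div s * s" using s by (intro mult_right_mono) auto
      moreover have "K div s * s + K mod s = K" "0 \<le> K mod s" using s by simp_all
      ultimately show False using K by linarith
    qed
  qed
  have N0: "0 \<le> N" and nN: "nat N \<le> 8 * n" using fl N by (auto simp: n_def)
  have rng: "pc t \<in> {p<..q}" if "t \<in> {0..<N}" for t using b that unfolding blocks_def by blast
  show ?thesis unfolding phase_prog_def n_def[symmetric]
  proof (rule runs_Seq2[OF runs_fill_prog[where s = st and F = F, folded N_def pc_def pp_def s_def h_def]])
    fix s1 assume s1: "\<forall>t\<in>{0..<N}. rmem s1 ''kL'' t = h (pc t) (pp t + 1) \<and> rmem s1 ''kR'' t = h (pc t) (pp t + s)"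
      and so1: "same_off fill_prog st s1"
    note fr1 = same_offD[OF so1, simplified]
    show "runs orc (''fl'' ::= IDiv (V ''K'') (V ''s'') ;; select_prog ''kR'' ;; ''j1'' ::= V ''piv'' ;;
       select_prog ''kL'' ;; ''j2'' ::= V ''piv'' ;; prune_prog ;; split_prog) s1 (2 * (40030 * nat N + 80) + 120 * nat N + 210 * n + 200) ?Q"
    proof (rule runs_block[where Q = "\<lambda>s'. imem s' ''fl'' 0 = K div s"])
      fix s2 assume s2: "imem s2 ''fl'' 0 = K div s" and so2: "same_off (''fl'' ::= IDiv (V ''K'') (V ''s'')) s1 s2"
      note fr2 = same_offD[OF so2, simplified]
      have cR: "isrank (rmem s1 ''kR'') {0..<N} r e \<longleftrightarrow> isrank (\<lambda>t. h (pc t) (pp t + s)) {0..<N} r e" for r e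
        using s1 by (intro isrank_cong) auto
      have cL: "isrank (rmem s1 ''kL'') {0..<N} r e \<longleftrightarrow> isrank (\<lambda>t. h (pc t) (pp t + 1)) {0..<N} r e" for r e
        using s1 by (intro isrank_cong) auto
      have "runs orc (select_prog ''kR'') s2 (40030 * nat N + 80)
          (\<lambda>s'. isrank (\<lambda>t. h (pc t) (pp t + s)) {0..<N} (K div s) (imem s' ''piv'' 0))"
        using runs_select_prog[of s2 orc "''kR''"] s2 fl by (simp add: fr2 fr1 cR N_def[symmetric])
      then show "runs orc (select_prog ''kR'' ;; ''j1'' ::= V ''piv'' ;; select_prog ''kL'' ;; ''j2'' ::= V ''piv'' ;;
        prune_prog ;; split_prog) s2 (2 * (40030 * nat N + 80) + 120 * nat N + 210 * n + 180) ?Q"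
      proof (rule runs_Seq2[where T' = "40030 * nat N + 80 + 120 * nat N + 210 * n + 180"])
        fix s3 assume s3: "isrank (\<lambda>t. h (pc t) (pp t + s)) {0..<N} (K div s) (imem s3 ''piv'' 0)"
          and so3: "same_off (select_prog ''kR'') s2 s3"
        note fr3 = same_offD[OF so3, simplified]
        define j1 where "j1 = imem s3 ''piv'' 0"
        show "runs orc (''j1'' ::= V ''piv'' ;; select_prog ''kL'' ;; ''j2'' ::= V ''piv'' ;; prune_prog ;; split_prog) s3
          (40030 * nat N + 80 + 120 * nat N + 210 * n + 180) ?Q"
        proof (rule runs_block[where Q = "\<lambda>s'. imem s' ''j1'' 0 = j1"])
          fix s4 assume s4: "imem s4 ''j1'' 0 = j1" and so4: "same_off (''j1'' ::= V ''piv'') s3 s4"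
          note fr4 = same_offD[OF so4, simplified]
          have "runs orc (select_prog ''kL'') s4 (40030 * nat N + 80)
              (\<lambda>s'. isrank (\<lambda>t. h (pc t) (pp t + 1)) {0..<N} (K div s) (imem s' ''piv'' 0))"
            using runs_select_prog[of s4 orc "''kL''"] s2 fl by (simp add: fr4 fr3 fr2 fr1 cL N_def[symmetric])
          then show "runs orc (select_prog ''kL'' ;; ''j2'' ::= V ''piv'' ;; prune_prog ;; split_prog) s4
            (40030 * nat N + 80 + 120 * nat N + 210 * n + 170) ?Q"
          proof (rule runs_Seq2[where T' = "120 * nat N + 210 * n + 170"])
            fix s5 assume s5: "isrank (\<lambda>t. h (pc t) (pp t + 1)) {0..<N} (K div s) (imem s5 ''piv'' 0)"
              and so5: "same_off (select_prog ''kL'') s4 s5"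
            note fr5 = same_offD[OF so5, simplified]
            define j2 where "j2 = imem s5 ''piv'' 0"
            interpret halving_step h l p q z s N pc pp X K j1 j2
              by unfold_locales (use mono dc b s s3 s5 in \<open>simp_all add: j1_def j2_def\<close>)
            have excl: "\<not> (disc t \<and> tak t)" if "t \<in> {0..<N}" for t
              using disc_cl[OF that] tak_cl[OF that] s by force
            show "runs orc (''j2'' ::= V ''piv'' ;; prune_prog ;; split_prog) s5 (120 * nat N + 210 * n + 170) ?Q"
            proof (rule runs_block[where Q = "\<lambda>s'. imem s' ''j2'' 0 = j2"])
              fix s6 assume s6: "imem s6 ''j2'' 0 = j2" and so6: "same_off (''j2'' ::= V ''piv'') s5 s6"
              note fr6 = same_offD[OF so6, simplified]
              note frs = fr6 fr5 fr4 fr3 fr2 fr1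
              note fo = N_def[symmetric] pc_def[symmetric] pp_def[symmetric] s_def[symmetric] X_def[symmetric] K_def[symmetric]
              have jN: "0 \<le> j1" "j1 < N" "0 \<le> j2" "j2 < N" using j_range by auto
              have "runs orc prune_prog s6 (120 * nat N + 30) (\<lambda>s'. 0 \<le> imem s' ''w'' 0 \<and>
                 (\<exists>e. strict_mono_on {0..<imem s' ''w'' 0} e \<and> e ` {0..<imem s' ''w'' 0} = {t \<in> {0..<N}. \<not> disc t \<and> \<not> tak t} \<and>
                   (\<forall>t\<in>{0..<imem s' ''w'' 0}. imem s' ''qc'' t = pc (e t) \<and> imem s' ''qp'' t = pp (e t))) \<and>
                 imem s' ''K'' 0 = K - s * int (card {t \<in> {0..<N}. tak t}) \<and>
                 (\<forall>i. imem s' ''XX'' i = X i + s * int (card {t \<in> {0..<N}. tak t \<and> pc t = i})))"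
                using runs_prune_prog[of s6 disc tak orc] N0 excl s1 s6 s4 jN
                by (simp add: frs fo disc_def tak_def kL_def kR_def)
              then show "runs orc (prune_prog ;; split_prog) s6 (120 * nat N + 210 * n + 150) ?Q"
              proof (rule runs_Seq2[where T' = "210 * n + 120"])
                fix s7 assume s7: "0 \<le> imem s7 ''w'' 0 \<and>
                 (\<exists>e. strict_mono_on {0..<imem s7 ''w'' 0} e \<and> e ` {0..<imem s7 ''w'' 0} = {t \<in> {0..<N}. \<not> disc t \<and> \<not> tak t} \<and>
                   (\<forall>t\<in>{0..<imem s7 ''w'' 0}. imem s7 ''qc'' t = pc (e t) \<and> imem s7 ''qp'' t = pp (e t))) \<and>
                 imem s7 ''K'' 0 = K - s * int (card {t \<in> {0..<N}. tak t}) \<and>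
                 (\<forall>i. imem s7 ''XX'' i = X i + s * int (card {t \<in> {0..<N}. tak t \<and> pc t = i}))"
                  and so7: "same_off prune_prog s6 s7"
                note fr7 = same_offD[OF so7, simplified]
                define w where "w = imem s7 ''w'' 0"
                obtain e where e: "strict_mono_on {0..<w} e" "e ` {0..<w} = {t \<in> {0..<N}. kept t}"
                  "\<And>t. t \<in> {0..<w} \<Longrightarrow> imem s7 ''qc'' t = pc (e t) \<and> imem s7 ''qp'' t = pp (e t)"
                  using s7 by (auto simp: w_def kept_def)
                have w: "0 \<le> w" and K': "imem s7 ''K'' 0 = K - s * int (card {t \<in> {0..<N}. tak t})"
                  and X': "\<And>i. imem s7 ''XX'' i = X i + s * int (card {t \<in> {0..<N}. tak t \<and> pc t = i})"
                  using s7 by (auto simp: w_def)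
                have bf: "blocks l p q z s w (imem s7 ''qc'') (imem s7 ''qp'') (imem s7 ''XX'') (imem s7 ''K'' 0)"
                  "w \<le> 3 * (q - p) + 1" "s = 1 \<Longrightarrow> imem s7 ''K'' 0 = 0"
                  by (rule blocks_filter[OF e K' X' w]; assumption)+
                have wn: "nat w \<le> 3 * n + 1" using bf(2) by (simp add: n_def)
                have s7s: "imem s7 ''s'' 0 = s" by (simp add: fr7 frs fo)
                have "runs orc split_prog s7 (70 * nat w + 40)
                  (\<lambda>s'. imem s' ''s'' 0 = s div 2 \<and> imem s' ''N'' 0 = 2 * w \<and>
                    (\<forall>t\<in>{0..<2 * w}. imem s' ''pc'' t = imem s7 ''qc'' (t div 2) \<and>
                       imem s' ''pp'' t = imem s7 ''qp'' (t div 2) + s div 2 * (t mod 2)))"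
                  using runs_split_prog[of s7 orc] w by (simp add: s7s w_def)
                then show "runs orc split_prog s7 (210 * n + 120) ?Q"
                proof (rule runs_mono)
                  show "70 * nat w + 40 \<le> 210 * n + 120" using wn by simp
                  fix s8 assume s8: "imem s8 ''s'' 0 = s div 2 \<and> imem s8 ''N'' 0 = 2 * w \<and>
                    (\<forall>t\<in>{0..<2 * w}. imem s8 ''pc'' t = imem s7 ''qc'' (t div 2) \<and>
                       imem s8 ''pp'' t = imem s7 ''qp'' (t div 2) + s div 2 * (t mod 2))"
                    and so8: "same_off split_prog s7 s8"
                  note fr8 = same_offD[OF so8, simplified]
                  show "?Q s8"
                  proof (cases "s = 1")
                    case True
                    have "imem s7 ''XX'' i = z i" if "i \<in> {p<..q}" for i
                      using blocks_final[OF bf(1) bf(3)[OF True] _ that] s by simp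
                    then show ?thesis using True s8 by (simp add: fr8)
                  next
                    case False
                    then have even: "2 * (s div 2) = s" using ev by simp
                    have "blocks l p q z (s div 2) (2 * w) (imem s8 ''pc'') (imem s8 ''pp'') (imem s7 ''XX'') (imem s7 ''K'' 0)"
                    proof (rule blocks_split)
                      show "blocks l p q z (2 * (s div 2)) w (imem s7 ''qc'') (imem s7 ''qp'') (imem s7 ''XX'') (imem s7 ''K'' 0)"
                        unfolding even by (rule bf(1))
                    qed (use w s8 \<open>1 \<le> s\<close> in auto)
                    moreover have "2 * w \<le> 8 * (q - p)" using bf(2) pq by simp
                    ultimately show ?thesis using False s8 by (simp add: fr8)
                  qed
                qed
              qed simp
            qed (simp_all add: j2_def)
          qed simp
        qed (simp_all add: j1_def)
      qed simp
    qed (simp_all add: fr1 K_def s_def)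
  next
    show "420 * nat N + 20 + (2 * (40030 * nat N + 80) + 120 * nat N + 210 * n + 200) \<le> 700000 * n"
      using nN n by simp
  qed (use orc rng N0 in \<open>auto simp: N_def pc_def\<close>)
qed

text \<open>The number of binary digits. The phases run through the widths \<open>2 ^ e\<close>,
  ..., 2, 1, and the one of width 1 leads to 0, so this is the number of phases still to
  come.\<close>

definition nlog :: "int \<Rightarrow> nat" where
  "nlog x = (LEAST k. nat x < 2 ^ k)"

lemma nlog_0: "nlog 0 = 0"
  unfolding nlog_def by (rule Least_equality) auto

lemma nlog_power: "nlog (2 ^ e) = Suc e"
  unfolding nlog_def
proof (rule Least_equality)
  show "nat (2 ^ e) < 2 ^ Suc e" by (simp add: nat_power_eq)
  fix y assume "nat (2 ^ e) < (2 :: nat) ^ y"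
  then have "(2 :: nat) ^ e < 2 ^ y" by (simp add: nat_power_eq)
  then show "Suc e \<le> y" by (simp add: Suc_le_eq)
qed

definition rap_init_body :: com where
  "rap_init_body = ''ii'' ::= IAdd (IAdd (V ''p'') C1) (V ''ti'') ;; IAssign ''pc'' (V ''ti'') (V ''ii'') ;;
     IAssign ''pp'' (V ''ti'') (IMem ''L'' (V ''ii'')) ;; IAssign ''XX'' (V ''ii'') (IMem ''L'' (V ''ii'')) ;;
     ''K'' ::= ISub (V ''K'') (IMem ''L'' (V ''ii''))"

definition rap_prog :: com where
  "rap_prog = (''N'' ::= ISub (V ''q'') (V ''p'') ;; ''ti'' ::= C0 ;; ''s'' ::= V ''S'') ;;
     For ''ti'' (V ''N'') rap_init_body ;; While (ILess C0 (V ''s'')) phase_prog"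

lemma rap_writes [simp]:
  "iw rap_init_body = {''ii'', ''pc'', ''pp'', ''XX'', ''K''}" "rw rap_init_body = {}"
  "iw rap_prog = select_vars \<union> {''ti'', ''fl'', ''j1'', ''j2'', ''XX'', ''K'', ''qc'', ''qp'', ''w'', ''s'', ''N'', ''pc'', ''pp'', ''ii''}"
  "rw rap_prog = {''kL'', ''kR'', ''h''}"
  by (auto simp: rap_prog_def rap_init_body_def select_vars_def)

lemma runs_rap_prog:
  fixes st :: state and F
  defines "l \<equiv> imem st ''L''" and "p \<equiv> imem st ''p'' 0" and "q \<equiv> imem st ''q'' 0"
  defines "h \<equiv> padded (imem st ''U'') (imem st ''d'') (imem st ''c'') (rmem st ''M'' 0) F"
  assumes pq: "p < q" and S: "imem st ''S'' 0 = 2 ^ e" and dc: "downset h l p q z" and mono: "mono_marginals h"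
    and z: "\<And>i. i \<in> {p<..q} \<Longrightarrow> l i \<le> z i \<and> z i < l i + 2 ^ e" and K: "imem st ''K'' 0 = sum z {p<..q}"
    and orc: "\<And>i k. i \<in> {p<..q} \<Longrightarrow> imem st ''c'' i \<le> k \<Longrightarrow> k \<le> imem st ''d'' i \<Longrightarrow> orc i (of_int k) = Some (F i k)"
  shows "runs orc rap_prog st (800000 * (nat (q - p) * (e + 1))) (\<lambda>s'. \<forall>i\<in>{p<..q}. imem s' ''XX'' i = z i)"
proof -
  define n where "n = nat (q - p)"
  have n: "1 \<le> n" using pq by (simp add: n_def)
  let ?pre = "''N'' ::= ISub (V ''q'') (V ''p'') ;; ''ti'' ::= C0 ;; ''s'' ::= V ''S''"
  let ?b = "ILess C0 (V ''s'')"
  let ?B = "\<lambda>s s'. blocks l p q z s (imem s' ''N'' 0) (imem s' ''pc'') (imem s' ''pp'') (imem s' ''XX'') (imem s' ''K'' 0) \<and>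
         imem s' ''N'' 0 \<le> 8 * (q - p)"
  show ?thesis unfolding rap_prog_def n_def[symmetric]
  proof (rule runs_block[where Q = "\<lambda>s'. imem s' ''N'' 0 = q - p \<and> imem s' ''ti'' 0 = 0 \<and> imem s' ''s'' 0 = 2 ^ e"
        and T' = "70 * n + 10 + (700010 * n * (e + 1) + 20)"])
    fix s1 assume s1: "imem s1 ''N'' 0 = q - p \<and> imem s1 ''ti'' 0 = 0 \<and> imem s1 ''s'' 0 = 2 ^ e" and so1: "same_off ?pre st s1"
    note fr1 = same_offD[OF so1, simplified]
    let ?I = "\<lambda>k s'. (\<forall>t\<in>{0..<k}. imem s' ''pc'' t = p + 1 + t \<and> imem s' ''pp'' t = l (p + 1 + t)) \<and>
       (\<forall>i\<in>{p<..p + k}. imem s' ''XX'' i = l i) \<and> imem s' ''K'' 0 = sum z {p<..q} - sum l {p<..p + k}"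
    have loop: "runs orc (For ''ti'' (V ''N'') rap_init_body) s1 (70 * n + 10) (\<lambda>s'. ?I (q - p) s' \<and> imem s' ''ti'' 0 = q - p)"
    proof (rule runs_For[where T = 55 and lw = 0 and hg = "q - p" and Inv = ?I])
      show "?I 0 s1" using K by (simp add: fr1)
    next
      fix k s' assume k: "0 \<le> k" "k < q - p" "imem s' ''ti'' 0 = k" and I: "?I k s'"
        and so: "same_off (For ''ti'' (V ''N'') rap_init_body) s1 s'"
      note fr = same_offD[OF so, simplified]
      have 1: "{0..<k + 1} = insert k {0..<k}" "{p<..p + (k + 1)} = insert (p + 1 + k) {p<..p + k}" using k by auto
      show "runs orc rap_init_body s' 55 (\<lambda>s''. imem s'' ''ti'' 0 = k \<and> ?I (k + 1) (iupdate ''ti'' 0 (k + 1) s''))"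
        unfolding 1 using I k
        by (intro runs_wp_le) (auto simp: rap_init_body_def fr fr1 p_def[symmetric] l_def[symmetric])
    next
      fix k s' assume so: "same_off (For ''ti'' (V ''N'') rap_init_body) s1 s'"
      show "ival (V ''N'') s' = q - p" using same_offD[OF so, simplified] s1 by simp
    qed (use s1 pq in \<open>auto simp: n_def\<close>)
    show "runs orc (For ''ti'' (V ''N'') rap_init_body ;; While ?b phase_prog) s1 (70 * n + 10 + (700010 * n * (e + 1) + 20))
       (\<lambda>s'. \<forall>i\<in>{p<..q}. imem s' ''XX'' i = z i)"
    proof (rule runs_Seq2[OF loop])
      fix s2 assume s2: "?I (q - p) s2 \<and> imem s2 ''ti'' 0 = q - p" and so2: "same_off (For ''ti'' (V ''N'') rap_init_body) s1 s2"
      note fr2 = same_offD[OF so2, simplified]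
      \<comment> \<open>The second alternative describes the state after the phase of width 1, when
        no blocks are left and \<open>XX\<close> is the solution.\<close>
      let ?J = "\<lambda>s'. (\<exists>e'. imem s' ''s'' 0 = 2 ^ e' \<and> ?B (2 ^ e') s') \<or>
         imem s' ''s'' 0 = 0 \<and> (\<forall>i\<in>{p<..q}. imem s' ''XX'' i = z i)"
      let ?F = "\<lambda>s'. 700010 * n * nlog (imem s' ''s'' 0)"
      have "blocks l p q z (2 ^ e) (q - p) (imem s2 ''pc'') (imem s2 ''pp'') (imem s2 ''XX'') (imem s2 ''K'' 0)"
        using s2 pq z by (intro blocks_init) auto
      then have J: "?J s2" using s1 pq by (auto simp: fr2)
      have "runs orc (While ?b phase_prog) s2 (?F s2 + 1 + bcost ?b) (\<lambda>s'. ?J s' \<and> \<not> bval ?b s')"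
      proof (rule runs_While[where Inv = ?J and \<Phi> = ?F, OF J])
        fix s' assume "?J s'" and bv: "bval ?b s'" and so: "same_off phase_prog s2 s'"
        note fr = same_offD[OF so, simplified, unfolded select_vars_def]
        from \<open>?J s'\<close> bv obtain e' where e': "imem s' ''s'' 0 = 2 ^ e'" and B: "?B (2 ^ e') s'" by auto
        note frs = fr fr2 fr1
        have ev: "(2 :: int) ^ e' = 1 \<or> even ((2 :: int) ^ e')" by (cases e') auto
        have h: "padded (imem s' ''U'') (imem s' ''d'') (imem s' ''c'') (rmem s' ''M'' 0) F = h"
          by (simp add: frs h_def)
        have "runs orc phase_prog s' (700000 * nat (q - p))
          (\<lambda>s''. imem s'' ''s'' 0 = imem s' ''s'' 0 div 2 \<and>
            (if imem s' ''s'' 0 = 1 then \<forall>i\<in>{p<..q}. imem s'' ''XX'' i = z i else ?B (imem s' ''s'' 0 div 2) s''))"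
        proof (rule runs_phase_prog[where F = F])
          show "orc i (real_of_int k) = Some (F i k)" if "i \<in> {p<..q}" "imem s' ''c'' i \<le> k" "k \<le> imem s' ''d'' i" for i k
            using orc[of i k] that by (simp add: frs)
        qed (use B e' dc mono pq ev in \<open>simp_all add: h\<close>)
        then have "runs orc phase_prog s' (700000 * n)
          (\<lambda>s''. ?J s'' \<and> 700000 * n + 1 + bcost ?b + ?F s'' \<le> ?F s')"
        proof (rule runs_mono)
          fix s'' assume s'': "imem s'' ''s'' 0 = imem s' ''s'' 0 div 2 \<and>
            (if imem s' ''s'' 0 = 1 then \<forall>i\<in>{p<..q}. imem s'' ''XX'' i = z i else ?B (imem s' ''s'' 0 div 2) s'')"
          show "?J s'' \<and> 700000 * n + 1 + bcost ?b + ?F s'' \<le> ?F s'"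
          proof (cases e')
            case 0
            then have "imem s'' ''s'' 0 = 0" "\<forall>i\<in>{p<..q}. imem s'' ''XX'' i = z i" using s'' e' by auto
            then show ?thesis using n e' 0 nlog_power[of 0] by (simp add: nlog_0)
          next
            case (Suc e2)
            have d: "imem s' ''s'' 0 div 2 = 2 ^ e2" "imem s' ''s'' 0 \<noteq> 1"
              using e' Suc one_less_power[of "2 :: int" "Suc e2"] by simp_all
            then have "imem s'' ''s'' 0 = 2 ^ e2" "?B (2 ^ e2) s''" using s'' by auto
            then have J: "?J s''" by blast
            have "nlog (imem s' ''s'' 0) = Suc (Suc e2)" "nlog (imem s'' ''s'' 0) = Suc e2"
              using e' Suc \<open>imem s'' ''s'' 0 = 2 ^ e2\<close> by (simp_all only: nlog_power)
            then show ?thesis using J n by simp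
          qed
        qed (simp add: n_def)
        then show "\<exists>T. runs orc phase_prog s' T (\<lambda>s''. ?J s'' \<and> T + 1 + bcost ?b + ?F s'' \<le> ?F s')" by blast
      qed
      then show "runs orc (While ?b phase_prog) s2 (700010 * n * (e + 1) + 20) (\<lambda>s'. \<forall>i\<in>{p<..q}. imem s' ''XX'' i = z i)"
      proof (rule runs_mono)
        have "nlog (imem s2 ''s'' 0) = e + 1" using s1 by (simp add: fr2 nlog_power)
        then show "?F s2 + 1 + bcost ?b \<le> 700010 * n * (e + 1) + 20" by simp
        fix s' assume "?J s' \<and> \<not> bval ?b s'"
        then show "\<forall>i\<in>{p<..q}. imem s' ''XX'' i = z i" by auto
      qed
    qed simp
  next
    have "70 * n + 10 + 20 + 20 \<le> 99990 * n * (e + 1)"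
    proof -
      have "99990 * n * 1 \<le> 99990 * n * (e + 1)" by (rule mult_le_mono2) simp
      then show ?thesis using n by linarith
    qed
    then show "ccost ?pre + (70 * n + 10 + (700010 * n * (e + 1) + 20)) \<le> 800000 * (n * (e + 1))"
      by (simp add: algebra_simps)
  qed (use S in \<open>auto simp: p_def q_def\<close>)
qed

subsection \<open>The nested problem\<close>

text \<open>Over a box, every exchange that respects the two variable bounds is feasible, so
  stability compares all pairs unless \<open>j\<close> is at its upper bound. There, the untaken
  units carry \<open>2 M\<close>, above every marginal of \<open>g\<close>.\<close>

lemma stable_downset:
  assumes st: "stable g L U (\<lambda>_. UNIV) p q \<alpha> \<beta> z" and mono: "mono_marginals g"
    and M: "\<And>i k. g i k \<le> M" "0 < M"
  shows "downset (\<lambda>i k. if U i < k then M + M else g i k) L p q z"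
  unfolding downset_def
proof (intro ballI allI impI)
  fix i j k t assume ij: "i \<in> {p<..q}" "j \<in> {p<..q}" and k: "L i < k" "k \<le> z i" and t: "z j < t"
  let ?h = "\<lambda>i k. if U i < k then M + M else g i k"
  have fz: "feas L U (\<lambda>_. UNIV) p q \<alpha> \<beta> z" using st by (simp add: stable_def)
  note bz = feasD(1,2)[OF fz]
  have hi: "?h i k = g i k" using bz(2)[OF ij(1)] k by simp
  show "elt ?h i k j t"
  proof (cases "i = j")
    case True
    have "g i k \<le> g i t" "g i k \<le> M" using mono k t True M by (auto intro: mono_marginalsD)
    then have "?h i k \<le> ?h j t" using hi M(2) True by simp
    moreover have "k < t" using True k t by simp
    ultimately show ?thesis using True unfolding elt_def order_le_less by blast
  next
    case False
    show ?thesis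
    proof (cases "z j < U j")
      case True
      have "feas L U (\<lambda>_. UNIV) p q \<alpha> \<beta> (exch z i j)"
        using fz bz[OF ij(1)] bz[OF ij(2)] ij False True k sum_exch[of i j p z q] unfolding feas_def by auto
      then have "elt g i (z i) j (z j + 1)" using st ij False by (simp add: stable_def)
      moreover have "g i k \<le> g i (z i)" "g j (z j + 1) \<le> g j t" using mono k t by (auto intro: mono_marginalsD)
      moreover have "g j t \<le> ?h j t" using M(1)[of j t] M(2) by simp
      ultimately show ?thesis using False hi unfolding elt_def by auto
    next
      case False
      then have "U j < t" using t by simp
      moreover have "g i k \<le> M" by (rule M)
      ultimately show ?thesis using hi M(2) unfolding elt_def by simp
    qed
  qed
qed

lemma feas_ok_cong:
  assumes "\<And>k. p < k \<Longrightarrow> k < q \<Longrightarrow> ok k = ok' k"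
  shows "feas l u ok p q \<alpha> \<beta> x \<longleftrightarrow> feas l u ok' p q \<alpha> \<beta> x"
  using assms by (auto simp: feas_def)

lemma stable_ok_cong:
  assumes "\<And>k. p < k \<Longrightarrow> k < q \<Longrightarrow> ok k = ok' k"
  shows "stable g l u ok p q \<alpha> \<beta> x \<longleftrightarrow> stable g l u ok' p q \<alpha> \<beta> x"
  using feas_ok_cong[of p q ok ok', OF assms] by (simp add: stable_def)

text \<open>The data of an instance, as integer-indexed arrays. \<open>PB (2 j)\<close> and \<open>PB (2 j + 1)\<close> are the bounds
  on the \<open>j\<close>-th nested sum, tightened by \<open>c \<le> x\<close> and by \<open>x - c\<close> having total \<open>R\<close>.\<close>

locale nested_instance =
  fixes n m B R :: int and sg a b c d CS PB :: "int \<Rightarrow> int" and M :: real and F :: "int \<Rightarrow> int \<Rightarrow> real"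
    and y :: "int \<Rightarrow> int"
  assumes m: "1 \<le> m" and sg0: "sg 0 = 0" and sgm: "sg m = n"
    and sg_mono: "\<And>j j'. 0 \<le> j \<Longrightarrow> j < j' \<Longrightarrow> j' \<le> m \<Longrightarrow> sg j < sg j'"
    and convex: "\<And>i k. c i < k \<Longrightarrow> k < d i \<Longrightarrow> F i k - F i (k - 1) \<le> F i (k + 1) - F i k"
    and M: "1 \<le> M" "\<And>i. c i < d i \<Longrightarrow> \<bar>F i (c i + 1) - F i (c i)\<bar> < M \<and> \<bar>F i (d i) - F i (d i - 1)\<bar> < M"
    and CS: "\<And>k. 0 \<le> k \<Longrightarrow> k \<le> n \<Longrightarrow> CS k = sum c {0<..k}" and R: "R = B - CS n"
    and y: "\<And>i. i \<in> {0<..n} \<Longrightarrow> c i \<le> y i \<and> y i \<le> d i" "sum y {0<..n} = B"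
      "\<And>j. j \<in> {1..<m} \<Longrightarrow> a j \<le> sum y {0<..sg j} \<and> sum y {0<..sg j} \<le> b j"
    and PB: "PB 0 = 0" "PB 1 = 0" "PB (2 * m) = B" "PB (2 * m + 1) = B"
      "\<And>j. j \<in> {1..<m} \<Longrightarrow> PB (2 * j) = max (a j) (CS (sg j))"
      "\<And>j. j \<in> {1..<m} \<Longrightarrow> PB (2 * j + 1) = min (b j) (CS (sg j) + R)"
begin

definition "g i k = (if d i < k then M else if c i < k then F i k - F i (k - 1) else - M)"
text \<open>Feasible points satisfy \<open>c i \<le> x i \<le> c i + R\<close>, so nothing is lost
  above. The slack of \<open>R\<close> below is what makes every leaf solvable, whatever extreme
  sums are prescribed at its ends.\<close>

definition "lo' i = c i - R"
definition "up' i = c i + R"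
definition "ok k = {w. \<forall>j\<in>{1..<m}. sg j = k \<longrightarrow> PB (2 * j) \<le> w \<and> w \<le> PB (2 * j + 1)}"

abbreviation "stab \<equiv> stable g lo' up' ok"

lemma padded_eq: "padded U d c M F = (\<lambda>i k. if U i < k then M + M else g i k)"
  by (intro ext) (simp add: padded_def g_def)

lemma intervals_ok: "intervals ok"
  unfolding intervals_def ok_def by (auto intro: order_trans)

lemma convex_mono:
  assumes "c i < k" "k \<le> l" "l \<le> d i"
  shows "F i k - F i (k - 1) \<le> F i l - F i (l - 1)"
  using assms(2,3)
proof (induction l rule: int_ge_induct)
  case (step l)
  then show ?case using convex[of i l] assms(1) by simp
qed simp

text \<open>By convexity all marginals lie between the first and the last, so four evaluations per
  variable suffice to find \<open>M\<close>.\<close>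

lemma marginal_bound: "c i < k \<Longrightarrow> k \<le> d i \<Longrightarrow> \<bar>F i k - F i (k - 1)\<bar> < M"
  using convex_mono[of i "c i + 1" k] convex_mono[of i k "d i"] M(2)[of i] by auto

lemma mono_g: "mono_marginals g"
  unfolding mono_marginals_def
proof (intro allI impI)
  fix i k l :: int assume "k \<le> l"
  then show "g i k \<le> g i l"
    using convex_mono[of i k l] marginal_bound[of i k] marginal_bound[of i l] M(1)
    by (auto simp: g_def)
qed

lemma g_le: "g i k \<le> M"
  using marginal_bound[of i k] M(1) by (auto simp: g_def)

lemma mono_padded: "mono_marginals (padded U d c M F)"
  unfolding padded_eq mono_marginals_def
proof (intro allI impI)
  fix i k l :: int assume kl: "k \<le> l"
  have "g i k \<le> g i l" "g i k \<le> M" using kl mono_g g_le by (auto intro: mono_marginalsD)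
  then show "(if U i < k then M + M else g i k) \<le> (if U i < l then M + M else g i l)" using kl M(1) by auto
qed

lemma sg_le: "0 \<le> j \<Longrightarrow> j \<le> j' \<Longrightarrow> j' \<le> m \<Longrightarrow> sg j \<le> sg j'"
  using sg_mono[of j j'] by (cases "j = j'") auto

lemma sg_range: "0 \<le> j \<Longrightarrow> j \<le> m \<Longrightarrow> 0 \<le> sg j \<and> sg j \<le> n"
  using sg_le[of 0 j] sg_le[of j m] sg0 sgm by auto

text \<open>The excess of \<open>y\<close> over \<open>c\<close> is nonnegative with total
  \<open>R\<close>, so each of its partial sums lies between 0 and \<open>R\<close>.\<close>

lemma prefix_bounds:
  assumes k: "0 \<le> k" "k \<le> n"
  shows "CS k \<le> sum y {0<..k}" "sum y {0<..k} \<le> CS k + R"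
proof -
  have "sum c {0<..k} \<le> sum y {0<..k}" using y(1) k by (intro sum_mono) auto
  then show "CS k \<le> sum y {0<..k}" using CS k by simp
  have "sum c {k<..n} \<le> sum y {k<..n}" using y(1) k by (intro sum_mono) auto
  moreover have "sum c {0<..n} = sum c {0<..k} + sum c {k<..n}" "sum y {0<..n} = sum y {0<..k} + sum y {k<..n}"
    using sum_Ioc_split[of 0 k n] k by auto
  ultimately show "sum y {0<..k} \<le> CS k + R" using CS[of k] CS[of n] k y(2) R by simp
qed

lemma R_nonneg: "0 \<le> R"
  using prefix_bounds[of 0] sg_range[of 0] sg0 m by simp

text \<open>The tightened intervals are nonempty because they contain the partial sums of the
  feasible point \<open>y\<close>.\<close>

lemma PB_bounds:
  assumes "0 \<le> j" "j \<le> m"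
  shows "PB (2 * j) \<le> PB (2 * j + 1)" "CS (sg j) \<le> PB (2 * j)" "PB (2 * j + 1) \<le> CS (sg j) + R"
proof -
  have "j = 0 \<or> j = m \<or> j \<in> {1..<m}" using assms by auto
  then have "PB (2 * j) \<le> PB (2 * j + 1) \<and> CS (sg j) \<le> PB (2 * j) \<and> PB (2 * j + 1) \<le> CS (sg j) + R"
  proof (elim disjE)
    assume "j = 0"
    then show ?thesis using PB CS[of 0] sg0 R_nonneg sg_range[of m] sgm m by simp
  next
    assume "j = m"
    then show ?thesis using PB R R_nonneg sgm by simp
  next
    assume j: "j \<in> {1..<m}"
    then show ?thesis
      using PB(5,6)[OF j] y(3)[OF j] prefix_bounds[of "sg j"] sg_range[of j] by auto
  qed
  then show "PB (2 * j) \<le> PB (2 * j + 1)" "CS (sg j) \<le> PB (2 * j)" "PB (2 * j + 1) \<le> CS (sg j) + R" by auto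
qed

lemma PB_bounds':
  assumes "0 \<le> j" "j \<le> m" "e \<in> {0, 1}"
  shows "CS (sg j) \<le> PB (2 * j + e) \<and> PB (2 * j + e) \<le> CS (sg j) + R"
  using PB_bounds[OF assms(1,2)] assms(3) by auto

lemma sg_inj: "j \<in> {0..m} \<Longrightarrow> j' \<in> {0..m} \<Longrightarrow> sg j = sg j' \<Longrightarrow> j = j'"
  using sg_mono[of j j'] sg_mono[of j' j] by (cases j j' rule: linorder_cases) auto

lemma ok_sg:
  assumes j: "1 \<le> j" "j < m"
  shows "ok (sg j) = {PB (2 * j)..PB (2 * j + 1)}"
proof -
  have "sg i = sg j \<longleftrightarrow> i = j" if "i \<in> {1..<m}" for i using sg_inj[of i j] that j by auto
  then show ?thesis using j by (auto simp: ok_def)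
qed

section \<open>The tree of segments\<close>

definition node :: "int \<Rightarrow> int \<Rightarrow> (int \<Rightarrow> int) \<Rightarrow> bool" where
  "node j j' X \<longleftrightarrow> (\<forall>ea\<in>{0, 1}. \<forall>eb\<in>{0, 1}.
     stab (sg j) (sg j') (PB (2 * j + ea)) (PB (2 * j' + eb)) (\<lambda>i. X (4 * i + 2 * ea + eb)))"

text \<open>No nested constraint lies strictly inside a leaf. The surplus \<open>r\<close> over
  \<open>c\<close> is a difference of two excesses in [0, R], hence within [-R, R], and a single
  variable can absorb it.\<close>

lemma leaf_solution:
  assumes j: "0 \<le> j" "j < m" and e: "ea \<in> {0, 1}" "eb \<in> {0, 1}"
  defines "p \<equiv> sg j" and "q \<equiv> sg (j + 1)"
  shows "\<exists>z. stab p q (PB (2 * j + ea)) (PB (2 * (j + 1) + eb)) z \<and>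
    stable g lo' up' (\<lambda>_. UNIV) p q (PB (2 * j + ea)) (PB (2 * (j + 1) + eb)) z"
proof -
  let ?\<alpha> = "PB (2 * j + ea)" and ?\<beta> = "PB (2 * (j + 1) + eb)"
  have pq: "p < q" using sg_mono[of j "j + 1"] j by (simp add: p_def q_def)
  have ok: "ok k = UNIV" if "p < k" "k < q" for k
  proof -
    have "sg j' \<noteq> k" if "j' \<in> {1..<m}" for j'
      using sg_le[of j' j] sg_le[of "j + 1" j'] that \<open>p < k\<close> \<open>k < q\<close> j by (cases "j' \<le> j") (auto simp: p_def q_def)
    then show ?thesis by (auto simp: ok_def)
  qed
  have pn: "0 \<le> p" "q \<le> n" using sg_range[of j] sg_range[of "j + 1"] j by (auto simp: p_def q_def)
  define r where "r = ?\<beta> - ?\<alpha> - sum c {p<..q}"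
  have "CS q = CS p + sum c {p<..q}"
    using CS[of p] CS[of q] pq pn sum_Ioc_split[of 0 p q c] by simp
  then have r: "- R \<le> r" "r \<le> R"
    using PB_bounds'[of j ea] PB_bounds'[of "j + 1" eb] j e by (auto simp: r_def p_def q_def)
  \<comment> \<open>The whole surplus is put on the last variable.\<close>
  define x where "x = c(q := c q + r)"
  have "sum x {p<..q} = sum c {p<..q} + r"
  proof -
    have "sum x {p<..q - 1} = sum c {p<..q - 1}" by (intro sum.cong) (auto simp: x_def)
    then show ?thesis using sum_Ioc_last[OF pq, of x] sum_Ioc_last[OF pq, of c] by (simp add: x_def)
  qed
  then have "feas lo' up' ok p q ?\<alpha> ?\<beta> x"
    using r R_nonneg ok by (auto simp: feas_def x_def lo'_def up'_def r_def)
  then obtain z where z: "stab p q ?\<alpha> ?\<beta> z" using stable_exists by blast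
  moreover have "stable g lo' up' (\<lambda>_. UNIV) p q ?\<alpha> ?\<beta> z"
    using z stable_ok_cong[of p q ok "\<lambda>_. UNIV"] ok by blast
  ultimately show ?thesis by blast
qed

text \<open>The middle sum is the right end for the left half and the left end for the right half.
  Raising it raises the former and lowers the latter, so lower bounds come from the lower value on
  the left (index \<open>2 * ea\<close>) and from the upper value on the right (index
  \<open>2 + eb\<close>).\<close>

definition "node_lower r ea eb X i = (if i \<le> r then X (4 * i + 2 * ea) else X (4 * i + 2 + eb))" for r ea eb i :: int and X :: "int \<Rightarrow> int"
definition "node_upper r ea eb X i = (if i \<le> r then X (4 * i + 2 * ea + 1) else X (4 * i + eb))" for r ea eb i :: int and X :: "int \<Rightarrow> int"

lemma node_solution:
  assumes j: "0 \<le> j" "j < jm" "jm < j'" "j' \<le> m" and e: "ea \<in> {0, 1}" "eb \<in> {0, 1}"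
    and X: "node j jm X" "node jm j' X"
  shows "\<exists>z. stab (sg j) (sg j') (PB (2 * j + ea)) (PB (2 * j' + eb)) z \<and>
    stable g (node_lower (sg jm) ea eb X) (node_upper (sg jm) ea eb X) (\<lambda>_. UNIV)
      (sg j) (sg j') (PB (2 * j + ea)) (PB (2 * j' + eb)) z"
proof -
  let ?p = "sg j" and ?r = "sg jm" and ?q = "sg j'" and ?\<alpha> = "PB (2 * j + ea)" and ?\<beta> = "PB (2 * j' + eb)"
  let ?a = "PB (2 * jm)" and ?b = "PB (2 * jm + 1)"
  have pr: "?p < ?r" "?r < ?q" using sg_mono[of j jm] sg_mono[of jm j'] j by auto
  have okr: "ok ?r = {?a..?b}" using ok_sg[of jm] j by simp
  have ab: "?a \<le> ?b" using PB_bounds[of jm] j by simp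
  have La: "stab ?p ?r ?\<alpha> ?a (\<lambda>i. X (4 * i + 2 * ea))" and Lb: "stab ?p ?r ?\<alpha> ?b (\<lambda>i. X (4 * i + 2 * ea + 1))"
    using X(1) e unfolding node_def by force+
  have Ra: "stab ?r ?q ?a ?\<beta> (\<lambda>i. X (4 * i + eb))" and Rb: "stab ?r ?q ?b ?\<beta> (\<lambda>i. X (4 * i + 2 + eb))"
    using X(2) e unfolding node_def by force+
  \<comment> \<open>Feasibility of the joined segment: two stored solutions that agree on the lower
    middle sum are glued together.\<close>
  have "feas lo' up' ok ?p ?q ?\<alpha> ?\<beta> (\<lambda>i. if i \<le> ?r then X (4 * i + 2 * ea) else X (4 * i + eb))"
    by (rule feas_append[of _ _ _ _ _ _ ?a]) (use La Ra okr ab pr in \<open>auto simp: stable_def\<close>)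
  then obtain z where z: "stab ?p ?q ?\<alpha> ?\<beta> z" using stable_exists by blast
  have "stable g (\<lambda>i. if i \<le> ?r then X (4 * i + 2 * ea) else X (4 * i + 2 + eb))
      (\<lambda>i. if i \<le> ?r then X (4 * i + 2 * ea + 1) else X (4 * i + eb)) (\<lambda>_. UNIV) ?p ?q ?\<alpha> ?\<beta> z"
    by (rule stable_combine[OF intervals_ok mono_g pr z _ _ _ La Lb Ra Rb]) (use okr ab in auto)
  then show ?thesis using z unfolding node_lower_def node_upper_def by blast
qed

text \<open>All stored solutions lie within [c - R, c + R], on every level of the tree.\<close>

lemma node_box:
  assumes j: "0 \<le> j" "j < jm" "jm < j'" "j' \<le> m" and e: "ea \<in> {0, 1}" "eb \<in> {0, 1}"
    and X: "node j jm X" "node jm j' X" and i: "i \<in> {sg j<..sg j'}"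
  shows "node_upper (sg jm) ea eb X i - node_lower (sg jm) ea eb X i \<le> 2 * R"
proof -
  have box: "lo' i \<le> X (4 * i + 2 * ea' + eb') \<and> X (4 * i + 2 * ea' + eb') \<le> up' i"
    if "node k k' X" "i \<in> {sg k<..sg k'}" "ea' \<in> {0, 1}" "eb' \<in> {0, 1}" for k k' ea' eb'
  proof -
    have "feas lo' up' ok (sg k) (sg k') (PB (2 * k + ea')) (PB (2 * k' + eb')) (\<lambda>i. X (4 * i + 2 * ea' + eb'))"
      using that unfolding node_def stable_def by blast
    then show ?thesis using feasD(1,2) that(2) by blast
  qed
  show ?thesis
  proof (cases "i \<le> sg jm")
    case True
    then show ?thesis
      using box[OF X(1), of ea 0] box[OF X(1), of ea 1] i e
      by (simp add: node_lower_def node_upper_def lo'_def up'_def)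
  next
    case False
    then show ?thesis
      using box[OF X(2), of 0 eb] box[OF X(2), of 1 eb] i e
      by (simp add: node_lower_def node_upper_def lo'_def up'_def)
  qed
qed

lemma feasible_imp_feas:
  assumes z: "\<And>i. i \<in> {0<..n} \<Longrightarrow> c i \<le> z i \<and> z i \<le> d i" "sum z {0<..n} = B"
      "\<And>j. j \<in> {1..<m} \<Longrightarrow> a j \<le> sum z {0<..sg j} \<and> sum z {0<..sg j} \<le> b j"
  shows "feas lo' up' ok 0 n 0 B z"
proof -
  \<comment> \<open>With \<open>z\<close> in the role of the feasible point,
    \<open>prefix_bounds\<close> becomes a statement about \<open>z\<close>.\<close>
  interpret zi: nested_instance n m B R sg a b c d CS PB M F z
    by unfold_locales (use m sg0 sgm sg_mono convex M CS R PB z in auto)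
  have "lo' i \<le> z i \<and> z i \<le> up' i" if i: "i \<in> {0<..n}" for i
  proof -
    have "CS i = CS (i - 1) + c i" "sum z {0<..i} = sum z {0<..i - 1} + z i"
      using CS[of i] CS[of "i - 1"] i sum_Ioc_last[of 0 i] by auto
    then have "z i \<le> c i + R" using zi.prefix_bounds(1)[of "i - 1"] zi.prefix_bounds(2)[of i] i by simp
    then show ?thesis using z(1)[OF i] R_nonneg by (simp add: lo'_def up'_def)
  qed
  moreover have "sum z {0<..k} \<in> ok k" if k: "k \<in> {0<..<n}" for k
    unfolding ok_def using PB(5,6) z(3) zi.prefix_bounds[of k] k by auto
  ultimately show ?thesis using z(2) by (simp add: feas_def)
qed

text \<open>If \<open>x i\<close> exceeded \<open>d i\<close>, the exchange towards the feasible
  \<open>y\<close> would trade a unit of marginal \<open>M\<close> for one of marginal below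
  \<open>M\<close>, against stability. Below \<open>c i\<close> the same happens with
  \<open>-M\<close>.\<close>

lemma stab_bounds:
  assumes x: "stab 0 n 0 B x" and i: "i \<in> {0<..n}"
  shows "c i \<le> x i \<and> x i \<le> d i"
proof -
  have fx: "feas lo' up' ok 0 n 0 B x" using x by (simp add: stable_def)
  have fy: "feas lo' up' ok 0 n 0 B y" using feasible_imp_feas y by blast
  have gM: "- M < g i k" if "c i < k" for i k using marginal_bound[of i k] M(1) that by (auto simp: g_def)
  have gM': "g i k < M" if "k \<le> d i" for i k using marginal_bound[of i k] M(1) that by (auto simp: g_def)
  have "x i \<le> d i"
  proof (rule ccontr)
    assume "\<not> x i \<le> d i"
    then have "y i < x i" "g i (x i) = M" using y(1)[OF i] by (auto simp: g_def)
    from exchange[OF intervals_ok fx fy _ _ i this(1)] obtain j where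
      j: "j \<in> {0<..n}" "x j < y j" "feas lo' up' ok 0 n 0 B (exch x i j)" by auto
    then have "i \<noteq> j" using \<open>y i < x i\<close> by auto
    then have "elt g i (x i) j (x j + 1)" using x i j by (simp add: stable_def)
    moreover have "g j (x j + 1) < M" using gM' y(1)[OF j(1)] j(2) by simp
    ultimately show False using \<open>g i (x i) = M\<close> by (auto simp: elt_def)
  qed
  moreover have "c i \<le> x i"
  proof (rule ccontr)
    assume "\<not> c i \<le> x i"
    then have "x i < y i" "g i (x i + 1) = - M" using y(1)[OF i] by (auto simp: g_def)
    from exchange[OF intervals_ok fy fx _ _ i this(1)] obtain j where
      j: "j \<in> {0<..n}" "y j < x j" "feas lo' up' ok 0 n 0 B (exch x j i)" by auto
    then have "i \<noteq> j" using \<open>x i < y i\<close> by auto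
    then have "elt g j (x j) i (x i + 1)" using x i j by (simp add: stable_def)
    moreover have "- M < g j (x j)" using gM y(1)[OF j(1)] j(2) by simp
    ultimately show False using \<open>g i (x i + 1) = - M\<close> by (auto simp: elt_def)
  qed
  ultimately show ?thesis by simp
qed

lemma stab_optimal:
  assumes x: "stab 0 n 0 B x"
  shows "sum x {0<..n} = B" "\<And>j. j \<in> {1..<m} \<Longrightarrow> a j \<le> sum x {0<..sg j} \<and> sum x {0<..sg j} \<le> b j"
    "\<lbrakk>\<And>i. i \<in> {0<..n} \<Longrightarrow> c i \<le> z i \<and> z i \<le> d i; sum z {0<..n} = B;
      \<And>j. j \<in> {1..<m} \<Longrightarrow> a j \<le> sum z {0<..sg j} \<and> sum z {0<..sg j} \<le> b j\<rbrakk> \<Longrightarrow>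
      (\<Sum>i\<in>{0<..n}. F i (x i)) \<le> (\<Sum>i\<in>{0<..n}. F i (z i))"
proof -
  have fx: "feas lo' up' ok 0 n 0 B x" using x by (simp add: stable_def)
  show "sum x {0<..n} = B" using feasD(4)[OF fx] by simp
  show "a j \<le> sum x {0<..sg j} \<and> sum x {0<..sg j} \<le> b j" if j: "j \<in> {1..<m}" for j
  proof -
    have "0 < sg j" "sg j < n" using sg_mono[of 0 j] sg_mono[of j m] j sg0 sgm by auto
    then have "sum x {0<..sg j} \<in> ok (sg j)" using feasD(3)[OF fx] by simp
    then show ?thesis using ok_sg[of j] PB(5,6)[OF j] j by auto
  qed
  assume z: "\<And>i. i \<in> {0<..n} \<Longrightarrow> c i \<le> z i \<and> z i \<le> d i" "sum z {0<..n} = B"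
      "\<And>j. j \<in> {1..<m} \<Longrightarrow> a j \<le> sum z {0<..sg j} \<and> sum z {0<..sg j} \<le> b j"
  have fz: "feas lo' up' ok 0 n 0 B z" by (rule feasible_imp_feas[OF z])
  \<comment> \<open>The objective continued linearly with slopes \<open>-M\<close> and
    \<open>M\<close>. Its marginals are \<open>g\<close> on the whole wide box, as
    \<open>stable_min\<close> requires, and it equals \<open>F\<close> on [c, d], where both points
    lie.\<close>
  define G where "G i k = (if k < c i then F i (c i) + M * of_int (c i - k)
    else if d i < k then F i (d i) + M * of_int (k - d i) else F i k)" for i k
  have "(\<Sum>i\<in>{0<..n}. G i (x i)) \<le> (\<Sum>i\<in>{0<..n}. G i (z i))"
  proof (rule stable_min[OF intervals_ok mono_g x fz])
    fix i k assume i: "i \<in> {0<..n}"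
    have cd: "c i \<le> d i" using y(1)[OF i] by simp
    consider "k < c i" | "k = c i" | "c i < k" "k \<le> d i" | "k = d i + 1" | "d i + 1 < k" by linarith
    then show "G i k - G i (k - 1) = g i k"
      by cases (use cd in \<open>auto simp: G_def g_def algebra_simps\<close>)
  qed
  moreover have "G i (x i) = F i (x i)" "G i (z i) = F i (z i)" if "i \<in> {0<..n}" for i
    using stab_bounds[OF x that] z(1)[OF that] by (auto simp: G_def)
  ultimately show "(\<Sum>i\<in>{0<..n}. F i (x i)) \<le> (\<Sum>i\<in>{0<..n}. F i (z i))" by simp
qed

end

section \<open>Solving one node of the tree\<close>

abbreviation "x4 i e \<equiv> IAdd (IMul (CC 4) i) e"

text \<open>\<open>e4\<close> encodes the pair of extremes as \<open>2 * ea + eb\<close>. Results go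
  to \<open>NX\<close>, because \<open>X\<close> still supplies the boxes for the remaining pairs;
  \<open>fb\<close> is the only difference between leaves and inner nodes.\<close>

definition combo_prog :: "com \<Rightarrow> com" where
  "combo_prog fb = (''ea'' ::= IDiv (V ''e4'') (CC 2) ;; ''eb'' ::= ISub (V ''e4'') (IMul (CC 2) (V ''ea'')) ;;
      ''i2'' ::= IAdd (V ''p'') C1) ;;
    For ''i2'' (IAdd (V ''q'') C1) fb ;;
    (''K'' ::= ISub (IMem ''PB'' (IAdd (IMul (CC 2) (V ''jb'')) (V ''eb''))) (IMem ''PB'' (IAdd (IMul (CC 2) (V ''ja'')) (V ''ea'')))) ;;
    rap_prog ;; ''i2'' ::= IAdd (V ''p'') C1 ;;
    For ''i2'' (IAdd (V ''q'') C1) (IAssign ''NX'' (x4 (V ''i2'') (V ''e4'')) (IMem ''XX'' (V ''i2'')))"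

definition solve_prog :: "com \<Rightarrow> com" where
  "solve_prog fb = (''p'' ::= IMem ''sigma'' (V ''ja'') ;; ''q'' ::= IMem ''sigma'' (V ''jb'') ;; ''e4'' ::= C0) ;;
    For ''e4'' (CC 4) (combo_prog fb) ;; ''i2'' ::= x4 (V ''p'') (CC 4) ;;
    For ''i2'' (x4 (V ''q'') (CC 4)) (IAssign ''X'' (V ''i2'') (IMem ''NX'' (V ''i2'')))"

definition rap_vars :: "string set" where
  "rap_vars = select_vars \<union> {''ti'', ''fl'', ''j1'', ''j2'', ''XX'', ''K'', ''qc'', ''qp'', ''w'', ''s'', ''N'', ''pc'', ''pp'', ''ii''}"

lemma solve_writes [simp]:
  "iw (combo_prog fb) = iw fb \<union> rap_vars \<union> {''ea'', ''eb'', ''i2'', ''NX''}"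
  "rw (combo_prog fb) = rw fb \<union> {''kL'', ''kR'', ''h''}"
  "iw (solve_prog fb) = iw fb \<union> rap_vars \<union> {''ea'', ''eb'', ''i2'', ''NX'', ''p'', ''q'', ''e4'', ''X''}"
  "rw (solve_prog fb) = rw fb \<union> {''kL'', ''kR'', ''h''}"
  by (auto simp: combo_prog_def solve_prog_def rap_vars_def)

lemma downset_cong:
  assumes "downset h l p q z" "\<And>i k. i \<in> {p<..q} \<Longrightarrow> h' i k = h i k" "\<And>i. i \<in> {p<..q} \<Longrightarrow> l' i = l i"
  shows "downset h' l' p q z"
  using assms unfolding downset_def elt_def by auto

locale nested_run = nested_instance +
  fixes orc :: "int \<Rightarrow> real \<Rightarrow> real option" and e :: nat
  assumes orc: "\<And>i k. i \<in> {0<..n} \<Longrightarrow> c i \<le> k \<Longrightarrow> k \<le> d i \<Longrightarrow> orc i (of_int k) = Some (F i k)"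
    and S: "2 * R < 2 ^ e"
begin

definition "env s \<longleftrightarrow> imem s ''sigma'' = sg \<and> imem s ''c'' = c \<and> imem s ''d'' = d \<and> imem s ''PB'' = PB \<and>
  imem s ''R'' 0 = R \<and> imem s ''S'' 0 = 2 ^ e \<and> imem s ''m'' 0 = m \<and> imem s ''n'' 0 = n \<and> rmem s ''M'' 0 = M"

text \<open>\<open>fb\<close> computes the box \<open>Lf\<close>, \<open>Uf\<close> at position \<open>i2\<close>.\<close>

definition "fills st fb Lf Uf \<longleftrightarrow> iw fb = {''L'', ''U''} \<and> rw fb = {} \<and> ccost fb \<le> 60 \<and>
  (\<forall>s i ea eb. (\<forall>v\<in>{''c'', ''R'', ''X'', ''r''}. imem s v = imem st v) \<longrightarrow> imem s ''i2'' 0 = i \<longrightarrow>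
     imem s ''ea'' 0 = ea \<longrightarrow> imem s ''eb'' 0 = eb \<longrightarrow>
     wp orc fb (\<lambda>s'. imem s' ''L'' = (imem s ''L'')(i := Lf ea eb i) \<and> imem s' ''U'' = (imem s ''U'')(i := Uf ea eb i)) s)"

lemma fillsD:
  assumes "fills st fb Lf Uf" "\<And>v. v \<in> {''c'', ''R'', ''X'', ''r''} \<Longrightarrow> imem s v = imem st v"
    "imem s ''i2'' 0 = i" "imem s ''ea'' 0 = ea" "imem s ''eb'' 0 = eb"
  shows "wp orc fb (\<lambda>s'. imem s' ''L'' = (imem s ''L'')(i := Lf ea eb i) \<and> imem s' ''U'' = (imem s ''U'')(i := Uf ea eb i)) s"
  using assms unfolding fills_def by blast

lemma runs_combo:
  assumes env: "env st" and fb: "fills st fb Lf Uf" and p: "imem st ''p'' 0 = p" and q: "imem st ''q'' 0 = q"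
    and pq: "0 \<le> p" "p < q" "q \<le> n" and k: "imem st ''e4'' 0 = k" "0 \<le> k" "k < 4"
    and ea: "ea = k div 2" and eb: "eb = k - 2 * ea"
    and st: "stable g (Lf ea eb) (Uf ea eb) (\<lambda>_. UNIV) p q (PB (2 * imem st ''ja'' 0 + ea)) (PB (2 * imem st ''jb'' 0 + eb)) z"
    and width: "\<And>i. i \<in> {p<..q} \<Longrightarrow> Uf ea eb i - Lf ea eb i \<le> 2 * R"
  shows "runs orc (combo_prog fb) st (800300 * (nat (q - p) * (e + 1)))
    (\<lambda>s'. (\<forall>i\<in>{p<..q}. imem s' ''NX'' (4 * i + k) = z i) \<and>
       (\<forall>t. (\<forall>i\<in>{p<..q}. t \<noteq> 4 * i + k) \<longrightarrow> imem s' ''NX'' t = imem st ''NX'' t))"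
    (is "runs orc _ st _ ?Q")
proof -
  define n' where "n' = nat (q - p)"
  have n': "1 \<le> n'" using pq by (simp add: n'_def)
  let ?A = "''ea'' ::= IDiv (V ''e4'') (CC 2) ;; ''eb'' ::= ISub (V ''e4'') (IMul (CC 2) (V ''ea'')) ;; ''i2'' ::= IAdd (V ''p'') C1"
  let ?B = "''K'' ::= ISub (IMem ''PB'' (IAdd (IMul (CC 2) (V ''jb'')) (V ''eb''))) (IMem ''PB'' (IAdd (IMul (CC 2) (V ''ja'')) (V ''ea'')))"
  let ?C = "''i2'' ::= IAdd (V ''p'') C1 ;;
    For ''i2'' (IAdd (V ''q'') C1) (IAssign ''NX'' (x4 (V ''i2'') (V ''e4'')) (IMem ''XX'' (V ''i2'')))"
  have fbw [simp]: "iw fb = {''L'', ''U''}" "rw fb = {}" and fbc: "ccost fb \<le> 60" using fb by (auto simp: fills_def)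
  have fz: "feas (Lf ea eb) (Uf ea eb) (\<lambda>_. UNIV) p q (PB (2 * imem st ''ja'' 0 + ea)) (PB (2 * imem st ''jb'' 0 + eb)) z"
    using st by (simp add: stable_def)
  show ?thesis unfolding combo_prog_def n'_def[symmetric]
  proof (rule runs_block[where Q = "\<lambda>s'. imem s' ''ea'' 0 = ea \<and> imem s' ''eb'' 0 = eb \<and> imem s' ''i2'' 0 = p + 1"
        and T' = "80 * n' + 10 + (800000 * (n' * (e + 1)) + 60 * n' + 70)"])
    fix s1 assume s1: "imem s1 ''ea'' 0 = ea \<and> imem s1 ''eb'' 0 = eb \<and> imem s1 ''i2'' 0 = p + 1" and so1: "same_off ?A st s1"
    note fr1 = same_offD[OF so1, simplified]
    have loop1: "runs orc (For ''i2'' (IAdd (V ''q'') C1) fb) s1 (80 * n' + 10)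
      (\<lambda>s'. (\<forall>i\<in>{p<..<q + 1}. imem s' ''L'' i = Lf ea eb i \<and> imem s' ''U'' i = Uf ea eb i) \<and> imem s' ''i2'' 0 = q + 1)"
    proof (rule runs_For[where T = 60 and lw = "p + 1" and hg = "q + 1" and
          Inv = "\<lambda>j s'. \<forall>i\<in>{p<..<j}. imem s' ''L'' i = Lf ea eb i \<and> imem s' ''U'' i = Uf ea eb i"])
      fix j s' assume j: "p + 1 \<le> j" "j < q + 1" "imem s' ''i2'' 0 = j"
        and I: "\<forall>i\<in>{p<..<j}. imem s' ''L'' i = Lf ea eb i \<and> imem s' ''U'' i = Uf ea eb i"
        and so: "same_off (For ''i2'' (IAdd (V ''q'') C1) fb) s1 s'"
      note fr = same_offD[OF so, simplified]
      have "wp orc fb (\<lambda>s''. imem s'' ''L'' = (imem s' ''L'')(j := Lf ea eb j) \<and> imem s'' ''U'' = (imem s' ''U'')(j := Uf ea eb j)) s'"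
        by (rule fillsD[OF fb]) (use j s1 in \<open>auto simp: fr fr1\<close>)
      then have "runs orc fb s' 60 (\<lambda>s''. imem s'' ''L'' = (imem s' ''L'')(j := Lf ea eb j) \<and> imem s'' ''U'' = (imem s' ''U'')(j := Uf ea eb j))"
        using fbc by (rule runs_wp_le)
      then show "runs orc fb s' 60 (\<lambda>s''. imem s'' ''i2'' 0 = j \<and>
          (\<forall>i\<in>{p<..<j + 1}. imem (iupdate ''i2'' 0 (j + 1) s'') ''L'' i = Lf ea eb i \<and> imem (iupdate ''i2'' 0 (j + 1) s'') ''U'' i = Uf ea eb i))"
      proof (rule runs_mono)
        fix s'' assume a: "imem s'' ''L'' = (imem s' ''L'')(j := Lf ea eb j) \<and> imem s'' ''U'' = (imem s' ''U'')(j := Uf ea eb j)"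
          and so': "same_off fb s' s''"
        note fr' = same_offD[OF so', simplified]
        show "imem s'' ''i2'' 0 = j \<and> (\<forall>i\<in>{p<..<j + 1}. imem (iupdate ''i2'' 0 (j + 1) s'') ''L'' i = Lf ea eb i \<and>
            imem (iupdate ''i2'' 0 (j + 1) s'') ''U'' i = Uf ea eb i)"
          using a I j(3) by (auto simp: fr')
      qed simp
    next
      fix j s' assume so: "same_off (For ''i2'' (IAdd (V ''q'') C1) fb) s1 s'"
      show "ival (IAdd (V ''q'') C1) s' = q + 1" using same_offD[OF so, simplified] fr1 q by simp
    next
      have "nat (q + 1 - (p + 1)) = n'" by (simp add: n'_def)
      then show "nat (q + 1 - (p + 1)) * (60 + icost (IAdd (V ''q'') C1) + 10) + icost (IAdd (V ''q'') C1) + 4 \<le> 80 * n' + 10"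
        by simp
    qed (use s1 pq in auto)
    show "runs orc (For ''i2'' (IAdd (V ''q'') C1) fb ;; ?B ;; rap_prog ;; ?C) s1
        (80 * n' + 10 + (800000 * (n' * (e + 1)) + 60 * n' + 70)) ?Q"
    proof (rule runs_Seq2[OF loop1])
      fix s2 assume s2: "(\<forall>i\<in>{p<..<q + 1}. imem s2 ''L'' i = Lf ea eb i \<and> imem s2 ''U'' i = Uf ea eb i) \<and> imem s2 ''i2'' 0 = q + 1"
        and so2: "same_off (For ''i2'' (IAdd (V ''q'') C1) fb) s1 s2"
      note fr2 = same_offD[OF so2, simplified]
      have LU: "imem s2 ''L'' i = Lf ea eb i" "imem s2 ''U'' i = Uf ea eb i" if "i \<in> {p<..q}" for i using s2 that by auto
      show "runs orc (?B ;; rap_prog ;; ?C) s2 (800000 * (n' * (e + 1)) + 60 * n' + 70) ?Q"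
      proof (rule runs_block[where Q = "\<lambda>s'. imem s' ''K'' 0 = sum z {p<..q}"])
        show "wp orc ?B (\<lambda>s'. imem s' ''K'' 0 = sum z {p<..q}) s2"
          using env s1 feasD(4)[OF fz] by (simp add: fr2 fr1 env_def)
      next
        fix s3 assume s3: "imem s3 ''K'' 0 = sum z {p<..q}" and so3: "same_off ?B s2 s3"
        note fr3 = same_offD[OF so3, simplified]
        note frs = fr3 fr2 fr1
        have "runs orc rap_prog s3 (800000 * (nat (imem s3 ''q'' 0 - imem s3 ''p'' 0) * (e + 1)))
           (\<lambda>s'. \<forall>i\<in>{imem s3 ''p'' 0<..imem s3 ''q'' 0}. imem s' ''XX'' i = z i)"
        proof (rule runs_rap_prog[where F = F])
          have pd: "padded (imem s3 ''U'') (imem s3 ''d'') (imem s3 ''c'') (rmem s3 ''M'' 0) F = padded (imem s3 ''U'') d c M F"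
            using env by (simp add: frs env_def)
          \<comment> \<open>Stability over the box becomes the hypothesis of the halving algorithm,
            with the marginals that the program reads.\<close>
          have "downset (\<lambda>i k. if Uf ea eb i < k then M + M else g i k) (Lf ea eb) p q z"
            using M by (intro stable_downset[OF st mono_g g_le]) simp
          then show "downset (padded (imem s3 ''U'') (imem s3 ''d'') (imem s3 ''c'') (rmem s3 ''M'' 0) F) (imem s3 ''L'') (imem s3 ''p'' 0) (imem s3 ''q'' 0) z"
            unfolding pd unfolding padded_eq using LU p q by (simp add: frs) (rule downset_cong, auto)
          show "mono_marginals (padded (imem s3 ''U'') (imem s3 ''d'') (imem s3 ''c'') (rmem s3 ''M'' 0) F)"
            unfolding pd by (rule mono_padded)
        next
          fix i assume "i \<in> {imem s3 ''p'' 0<..imem s3 ''q'' 0}"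
          then have i: "i \<in> {p<..q}" using p q by (simp add: frs)
          \<comment> \<open>Boxes have width at most \<open>2 * R < 2 ^ e\<close>, so one initial
            block of width \<open>2 ^ e\<close> per variable suffices.\<close>
          have "z i < Lf ea eb i + 2 ^ e" using feasD(2)[OF fz i] width[OF i] S by linarith
          then show "imem s3 ''L'' i \<le> z i \<and> z i < imem s3 ''L'' i + 2 ^ e"
            using feasD(1)[OF fz i] LU(1)[OF i] by (simp add: fr3)
        next
          fix i k assume "i \<in> {imem s3 ''p'' 0<..imem s3 ''q'' 0}" "imem s3 ''c'' i \<le> k" "k \<le> imem s3 ''d'' i"
          then show "orc i (real_of_int k) = Some (F i k)"
            using orc[of i k] env p q pq by (simp add: frs env_def)
        qed (use env p q pq s3 in \<open>auto simp: frs env_def\<close>)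
        then have "runs orc rap_prog s3 (800000 * (n' * (e + 1))) (\<lambda>s'. \<forall>i\<in>{p<..q}. imem s' ''XX'' i = z i)"
          using p q by (simp add: frs n'_def)
        then show "runs orc (rap_prog ;; ?C) s3 (800000 * (n' * (e + 1)) + 60 * n' + 40) ?Q"
        proof (rule runs_Seq2[where T' = "60 * n' + 40"])
          fix s4 assume s4: "\<forall>i\<in>{p<..q}. imem s4 ''XX'' i = z i" and so4: "same_off rap_prog s3 s4"
          note fr4 = same_offD[OF so4, simplified, unfolded select_vars_def]
          show "runs orc ?C s4 (60 * n' + 40) ?Q"
          proof (rule runs_block[where Q = "\<lambda>s'. imem s' ''i2'' 0 = p + 1" and T' = "60 * n' + 10"])
            fix s5 assume s5: "imem s5 ''i2'' 0 = p + 1" and so5: "same_off (''i2'' ::= IAdd (V ''p'') C1) s4 s5"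
            note fr5 = same_offD[OF so5, simplified]
            let ?D = "IAssign ''NX'' (x4 (V ''i2'') (V ''e4'')) (IMem ''XX'' (V ''i2''))"
            let ?I = "\<lambda>j s'. (\<forall>i\<in>{p<..<j}. imem s' ''NX'' (4 * i + k) = z i) \<and>
               (\<forall>t. (\<forall>i\<in>{p<..q}. t \<noteq> 4 * i + k) \<longrightarrow> imem s' ''NX'' t = imem st ''NX'' t)"
            have "runs orc (For ''i2'' (IAdd (V ''q'') C1) ?D) s5 (60 * n' + 10) (\<lambda>s'. ?I (q + 1) s' \<and> imem s' ''i2'' 0 = q + 1)"
            proof (rule runs_For[where T = 20 and lw = "p + 1" and hg = "q + 1" and Inv = ?I])
              fix j s' assume j: "p + 1 \<le> j" "j < q + 1" "imem s' ''i2'' 0 = j" and I: "?I j s'"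
                and so: "same_off (For ''i2'' (IAdd (V ''q'') C1) ?D) s5 s'"
              note fr = same_offD[OF so, simplified]
              have "imem s' ''XX'' j = z j" using s4 j by (simp add: fr fr5)
              moreover have "imem s' ''e4'' 0 = k" using k by (simp add: fr fr5 fr4 frs)
              moreover have "{p<..<j + 1} = insert j {p<..<j}" using j by auto
              ultimately show "runs orc ?D s' 20 (\<lambda>s''. imem s'' ''i2'' 0 = j \<and> ?I (j + 1) (iupdate ''i2'' 0 (j + 1) s''))"
                using I j by (intro runs_wp_le) auto
            next
              fix j s' assume so: "same_off (For ''i2'' (IAdd (V ''q'') C1) ?D) s5 s'"
              show "ival (IAdd (V ''q'') C1) s' = q + 1" using same_offD[OF so, simplified] q by (simp add: fr5 fr4 frs)
            next
              have "nat (q + 1 - (p + 1)) = n'" by (simp add: n'_def)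
              then show "nat (q + 1 - (p + 1)) * (20 + icost (IAdd (V ''q'') C1) + 10) + icost (IAdd (V ''q'') C1) + 4 \<le> 60 * n' + 10"
                by simp
            next
              show "?I (p + 1) s5" by (auto simp: fr5 fr4 frs)
            qed (use s5 pq in auto)
            then show "runs orc (For ''i2'' (IAdd (V ''q'') C1) ?D) s5 (60 * n' + 10) ?Q"
              by (rule runs_mono) auto
          qed (use p in \<open>auto simp: fr4 frs\<close>)
        qed simp
      qed simp
    qed simp
  next
    have "80 * n' + 10 + 60 * n' + 70 + 40 \<le> 300 * n'" using n' by simp
    also have "\<dots> \<le> 300 * (n' * (e + 1))" by simp
    finally show "ccost ?A + (80 * n' + 10 + (800000 * (n' * (e + 1)) + 60 * n' + 70)) \<le> 800300 * (n' * (e + 1))"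
      by (simp add: algebra_simps)
  qed (use k ea eb p in auto)
qed

text \<open>The second conjunct confines the changes to the positions of this segment, so that all
  other nodes of the tree remain valid by \<open>node_cong\<close>.\<close>

lemma runs_solve:
  assumes env: "env st" and fb: "fills st fb Lf Uf"
    and ja: "imem st ''ja'' 0 = j" and jb: "imem st ''jb'' 0 = j'" and j: "0 \<le> j" "j < j'" "j' \<le> m"
    and sol: "\<And>ea eb. ea \<in> {0, 1} \<Longrightarrow> eb \<in> {0, 1} \<Longrightarrow>
      \<exists>z. stab (sg j) (sg j') (PB (2 * j + ea)) (PB (2 * j' + eb)) z \<and>
      stable g (Lf ea eb) (Uf ea eb) (\<lambda>_. UNIV) (sg j) (sg j') (PB (2 * j + ea)) (PB (2 * j' + eb)) z"
    and width: "\<And>ea eb i. ea \<in> {0, 1} \<Longrightarrow> eb \<in> {0, 1} \<Longrightarrow> i \<in> {sg j<..sg j'} \<Longrightarrow> Uf ea eb i - Lf ea eb i \<le> 2 * R"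
  shows "runs orc (solve_prog fb) st (3300000 * (nat (sg j' - sg j) * (e + 1)))
    (\<lambda>s'. node j j' (imem s' ''X'') \<and>
       (\<forall>t. t < 4 * sg j + 4 \<or> 4 * sg j' + 4 \<le> t \<longrightarrow> imem s' ''X'' t = imem st ''X'' t))"
proof -
  define p q where "p = sg j" and "q = sg j'"
  have pq: "0 \<le> p" "p < q" "q \<le> n" using sg_mono[of j j'] sg_range[of j] sg_range[of j'] j by (auto simp: p_def q_def)
  define n' where "n' = nat (q - p)"
  have n': "1 \<le> n'" using pq by (simp add: n'_def)
  have fbw [simp]: "iw fb = {''L'', ''U''}" "rw fb = {}" using fb by (auto simp: fills_def)
  have ev: "k div 2 \<in> {0, 1} \<and> k - 2 * (k div 2) \<in> {0, 1}" if "0 \<le> k" "k < 4" for k :: int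
    using that by auto
  obtain zz where zz: "\<And>ea eb. ea \<in> {0, 1} \<Longrightarrow> eb \<in> {0, 1} \<Longrightarrow>
      stab p q (PB (2 * j + ea)) (PB (2 * j' + eb)) (zz ea eb) \<and>
      stable g (Lf ea eb) (Uf ea eb) (\<lambda>_. UNIV) p q (PB (2 * j + ea)) (PB (2 * j' + eb)) (zz ea eb)"
    using sol unfolding p_def q_def by metis
  let ?Q = "\<lambda>s'. node j j' (imem s' ''X'') \<and> (\<forall>t. t < 4 * p + 4 \<or> 4 * q + 4 \<le> t \<longrightarrow> imem s' ''X'' t = imem st ''X'' t)"
  define zk where "zk k = zz (k div 2) (k - 2 * (k div 2))" for k
  let ?A = "''p'' ::= IMem ''sigma'' (V ''ja'') ;; ''q'' ::= IMem ''sigma'' (V ''jb'') ;; ''e4'' ::= C0"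
  let ?D = "IAssign ''X'' (V ''i2'') (IMem ''NX'' (V ''i2''))"
  let ?C = "''i2'' ::= x4 (V ''p'') (CC 4) ;; For ''i2'' (x4 (V ''q'') (CC 4)) ?D"
  show ?thesis unfolding solve_prog_def p_def[symmetric] q_def[symmetric] n'_def[symmetric]
  proof (rule runs_block[where Q = "\<lambda>s'. imem s' ''p'' 0 = p \<and> imem s' ''q'' 0 = q \<and> imem s' ''e4'' 0 = 0"
        and T' = "3201200 * (n' * (e + 1)) + 60 + 5 + (160 * n' + 100)"])
    fix s1 assume s1: "imem s1 ''p'' 0 = p \<and> imem s1 ''q'' 0 = q \<and> imem s1 ''e4'' 0 = 0" and so1: "same_off ?A st s1"
    note fr1 = same_offD[OF so1, simplified]
    let ?I = "\<lambda>k s'. \<forall>k'\<in>{0..<k}. \<forall>i\<in>{p<..q}. imem s' ''NX'' (4 * i + k') = zk k' i"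
    have loop: "runs orc (For ''e4'' (CC 4) (combo_prog fb)) s1 (3201200 * (n' * (e + 1)) + 60 + 5)
        (\<lambda>s'. ?I 4 s' \<and> imem s' ''e4'' 0 = 4)"
    proof (rule runs_For[where T = "800300 * (n' * (e + 1))" and lw = 0 and hg = 4 and Inv = ?I])
      fix k s' assume k: "0 \<le> k" "k < 4" "imem s' ''e4'' 0 = k" and I: "?I k s'"
        and so: "same_off (For ''e4'' (CC 4) (combo_prog fb)) s1 s'"
      note fr = same_offD[OF so, simplified, unfolded rap_vars_def select_vars_def, simplified]
      have en: "env s'" using env by (simp add: env_def fr fr1)
      have fl: "fills s' fb Lf Uf" using fb unfolding fills_def by (simp add: fr fr1)
      have "runs orc (combo_prog fb) s' (800300 * (n' * (e + 1)))
        (\<lambda>s''. (\<forall>i\<in>{p<..q}. imem s'' ''NX'' (4 * i + k) = zk k i) \<and>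
         (\<forall>t. (\<forall>i\<in>{p<..q}. t \<noteq> 4 * i + k) \<longrightarrow> imem s'' ''NX'' t = imem s' ''NX'' t))"
        unfolding n'_def
      proof (rule runs_combo[OF en fl _ _ pq k(3,1,2) refl refl])
        show "imem s' ''p'' 0 = p" "imem s' ''q'' 0 = q" using s1 by (simp_all add: fr)
        have "stable g (Lf (k div 2) (k - 2 * (k div 2))) (Uf (k div 2) (k - 2 * (k div 2))) (\<lambda>_. UNIV) p q
           (PB (2 * j + k div 2)) (PB (2 * j' + (k - 2 * (k div 2)))) (zk k)"
          using zz ev[OF k(1,2)] unfolding zk_def by blast
        then show "stable g (Lf (k div 2) (k - 2 * (k div 2))) (Uf (k div 2) (k - 2 * (k div 2))) (\<lambda>_. UNIV) p q
           (PB (2 * imem s' ''ja'' 0 + k div 2)) (PB (2 * imem s' ''jb'' 0 + (k - 2 * (k div 2)))) (zk k)"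
          using ja jb by (simp add: fr fr1)
        show "Uf (k div 2) (k - 2 * (k div 2)) i - Lf (k div 2) (k - 2 * (k div 2)) i \<le> 2 * R" if "i \<in> {p<..q}" for i
          using width ev[OF k(1,2)] that unfolding p_def q_def by blast
      qed
      then show "runs orc (combo_prog fb) s' (800300 * (n' * (e + 1)))
        (\<lambda>s''. imem s'' ''e4'' 0 = k \<and> ?I (k + 1) (iupdate ''e4'' 0 (k + 1) s''))"
      proof (rule runs_mono)
        fix s'' assume a: "(\<forall>i\<in>{p<..q}. imem s'' ''NX'' (4 * i + k) = zk k i) \<and>
         (\<forall>t. (\<forall>i\<in>{p<..q}. t \<noteq> 4 * i + k) \<longrightarrow> imem s'' ''NX'' t = imem s' ''NX'' t)"
          and so'': "same_off (combo_prog fb) s' s''"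
        note fr'' = same_offD[OF so'', simplified, unfolded rap_vars_def select_vars_def, simplified]
        have "imem s'' ''NX'' (4 * i + k') = zk k' i" if k': "k' \<in> {0..<k + 1}" and i: "i \<in> {p<..q}" for k' i
        proof (cases "k' = k")
          case False
          \<comment> \<open>The four interleaved solutions occupy different residues modulo
            4.\<close>
          have "4 * i + k' \<noteq> 4 * i' + k" for i'
          proof -
            have "0 \<le> k'" "k' < 4" using k' k by auto
            then show ?thesis using k(1,2) False by presburger
          qed
          then have "imem s'' ''NX'' (4 * i + k') = imem s' ''NX'' (4 * i + k')" using a by blast
          then show ?thesis using I k' i False by simp
        qed (use a i in simp)
        then show "imem s'' ''e4'' 0 = k \<and> ?I (k + 1) (iupdate ''e4'' 0 (k + 1) s'')"
          using k(3) by (simp add: fr'')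
      qed simp
    qed (use s1 in auto)
    show "runs orc (For ''e4'' (CC 4) (combo_prog fb) ;; ?C) s1 (3201200 * (n' * (e + 1)) + 60 + 5 + (160 * n' + 100)) ?Q"
    proof (rule runs_Seq2[OF loop])
      fix s2 assume s2: "?I 4 s2 \<and> imem s2 ''e4'' 0 = 4" and so2: "same_off (For ''e4'' (CC 4) (combo_prog fb)) s1 s2"
      note fr2 = same_offD[OF so2, simplified, unfolded rap_vars_def select_vars_def, simplified]
      show "runs orc ?C s2 (160 * n' + 100) ?Q"
      proof (rule runs_block[where Q = "\<lambda>s'. imem s' ''i2'' 0 = 4 * p + 4" and T' = "160 * n' + 60"])
        fix s3 assume s3: "imem s3 ''i2'' 0 = 4 * p + 4" and so3: "same_off (''i2'' ::= x4 (V ''p'') (CC 4)) s2 s3"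
        note fr3 = same_offD[OF so3, simplified]
        let ?J = "\<lambda>j s'. (\<forall>t\<in>{4 * p + 4..<j}. imem s' ''X'' t = imem s2 ''NX'' t) \<and>
           (\<forall>t. t < 4 * p + 4 \<or> j \<le> t \<longrightarrow> imem s' ''X'' t = imem st ''X'' t)"
        have "runs orc (For ''i2'' (x4 (V ''q'') (CC 4)) ?D) s3 (160 * n' + 60) (\<lambda>s'. ?J (4 * q + 4) s' \<and> imem s' ''i2'' 0 = 4 * q + 4)"
        proof (rule runs_For[where T = 10 and lw = "4 * p + 4" and hg = "4 * q + 4" and Inv = ?J])
          fix j s' assume j: "4 * p + 4 \<le> j" "j < 4 * q + 4" "imem s' ''i2'' 0 = j" and J: "?J j s'"
            and so: "same_off (For ''i2'' (x4 (V ''q'') (CC 4)) ?D) s3 s'"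
          note fr = same_offD[OF so, simplified]
          have "{4 * p + 4..<j + 1} = insert j {4 * p + 4..<j}" using j by auto
          then show "runs orc ?D s' 10 (\<lambda>s''. imem s'' ''i2'' 0 = j \<and> ?J (j + 1) (iupdate ''i2'' 0 (j + 1) s''))"
            using J j by (intro runs_wp_le) (auto simp: fr fr3)
        next
          fix j s' assume so: "same_off (For ''i2'' (x4 (V ''q'') (CC 4)) ?D) s3 s'"
          show "ival (x4 (V ''q'') (CC 4)) s' = 4 * q + 4" using same_offD[OF so, simplified] s1 by (simp add: fr3 fr2)
        next
          have "nat (4 * q + 4 - (4 * p + 4)) = 4 * n'" using pq by (simp add: n'_def)
          then show "nat (4 * q + 4 - (4 * p + 4)) * (10 + icost (x4 (V ''q'') (CC 4)) + 10) + icost (x4 (V ''q'') (CC 4)) + 4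
              \<le> 160 * n' + 60" by simp
        next
          show "?J (4 * p + 4) s3" by (auto simp: fr3 fr2 fr1)
        qed (use s3 pq in auto)
        then show "runs orc (For ''i2'' (x4 (V ''q'') (CC 4)) ?D) s3 (160 * n' + 60)
          (\<lambda>s'. node j j' (imem s' ''X'') \<and> (\<forall>t. t < 4 * p + 4 \<or> 4 * q + 4 \<le> t \<longrightarrow> imem s' ''X'' t = imem st ''X'' t))"
        proof (rule runs_mono)
          fix s' assume J: "?J (4 * q + 4) s' \<and> imem s' ''i2'' 0 = 4 * q + 4"
          have "stab p q (PB (2 * j + ea)) (PB (2 * j' + eb)) (\<lambda>i. imem s' ''X'' (4 * i + 2 * ea + eb))"
            if ee: "ea \<in> {0, 1}" "eb \<in> {0, 1}" for ea eb
          proof -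
            have k: "2 * ea + eb \<in> {0..<4}" "(2 * ea + eb) div 2 = ea" using ee by auto
            have "imem s' ''X'' (4 * i + 2 * ea + eb) = zz ea eb i" if i: "i \<in> {p<..q}" for i
            proof -
              have "4 * i + (2 * ea + eb) \<in> {4 * p + 4..<4 * q + 4}" using i k(1) by auto
              then have "imem s' ''X'' (4 * i + (2 * ea + eb)) = imem s2 ''NX'' (4 * i + (2 * ea + eb))" using J by blast
              also have "\<dots> = zk (2 * ea + eb) i" using s2 k(1) i by blast
              finally show ?thesis using k(2) by (simp add: zk_def add.assoc)
            qed
            then have "stab p q (PB (2 * j + ea)) (PB (2 * j' + eb)) (\<lambda>i. imem s' ''X'' (4 * i + 2 * ea + eb)) \<longleftrightarrow>
              stab p q (PB (2 * j + ea)) (PB (2 * j' + eb)) (zz ea eb)" by (rule stable_cong)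
            then show ?thesis using zz[OF ee] by blast
          qed
          then show "node j j' (imem s' ''X'') \<and> (\<forall>t. t < 4 * p + 4 \<or> 4 * q + 4 \<le> t \<longrightarrow> imem s' ''X'' t = imem st ''X'' t)"
            using J unfolding node_def p_def q_def by blast
        qed simp
      qed (use s1 in \<open>auto simp: fr2\<close>)
    qed simp
  next
    have "60 + 5 + (160 * n' + 100) + 20 \<le> 1000 * n'" using n' by simp
    also have "\<dots> \<le> 1000 * (n' * (e + 1))" by simp
    finally show "ccost ?A + (3201200 * (n' * (e + 1)) + 60 + 5 + (160 * n' + 100)) \<le> 3300000 * (n' * (e + 1))" by (simp add: algebra_simps)
  qed (use env ja jb in \<open>auto simp: env_def p_def q_def\<close>)
qed

end

section \<open>The levels of the tree\<close>

definition leaf_fill :: com where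
  "leaf_fill = IAssign ''L'' (V ''i2'') (ISub (IMem ''c'' (V ''i2'')) (V ''R'')) ;;
     IAssign ''U'' (V ''i2'') (IAdd (IMem ''c'' (V ''i2'')) (V ''R''))"

definition node_fill :: com where
  "node_fill = Cond (ILess (V ''r'') (V ''i2''))
     (IAssign ''L'' (V ''i2'') (IMem ''X'' (x4 (V ''i2'') (IAdd (CC 2) (V ''eb'')))) ;;
      IAssign ''U'' (V ''i2'') (IMem ''X'' (x4 (V ''i2'') (V ''eb''))))
     (IAssign ''L'' (V ''i2'') (IMem ''X'' (x4 (V ''i2'') (IMul (CC 2) (V ''ea'')))) ;;
      IAssign ''U'' (V ''i2'') (IMem ''X'' (x4 (V ''i2'') (IAdd (IMul (CC 2) (V ''ea'')) C1))))"

definition leaf_body :: com where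
  "leaf_body = ''jb'' ::= IAdd (V ''ja'') C1 ;; solve_prog leaf_fill ;; ''ja'' ::= IAdd (V ''ja'') C1"

definition leaf_prog :: com where
  "leaf_prog = ''ja'' ::= C0 ;; While (ILess (V ''ja'') (V ''m'')) leaf_body"

text \<open>The number of leaves need not be a power of two. A shorter right half is handled by
  cutting \<open>jb\<close> at \<open>m\<close>; a segment without right neighbour is left out by
  the guard of the enclosing loop and passes to the next level as it is.\<close>

definition node_body :: com where
  "node_body = (''jm'' ::= IAdd (V ''ja'') (V ''lw'') ;; ''jb'' ::= IAdd (V ''jm'') (V ''lw'') ;;
      Cond (ILess (V ''m'') (V ''jb'')) (''jb'' ::= V ''m'') Skip ;; ''r'' ::= IMem ''sigma'' (V ''jm'')) ;;
     solve_prog node_fill ;; ''ja'' ::= IAdd (V ''ja'') (IMul (CC 2) (V ''lw''))"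

definition level_body :: com where
  "level_body = ''ja'' ::= C0 ;; While (ILess (IAdd (V ''ja'') (V ''lw'')) (V ''m'')) node_body ;;
     ''lw'' ::= IMul (CC 2) (V ''lw'')"

definition level_prog :: com where
  "level_prog = ''lw'' ::= C1 ;; While (ILess (V ''lw'') (V ''m'')) level_body"

definition solve_vars :: "string set" where
  "solve_vars = rap_vars \<union> {''L'', ''U'', ''ea'', ''eb'', ''i2'', ''NX'', ''p'', ''q'', ''e4'', ''X'', ''ja'', ''jb'', ''jm'', ''r''}"

lemma level_writes [simp]:
  "iw leaf_fill = {''L'', ''U''}" "rw leaf_fill = {}" "iw node_fill = {''L'', ''U''}" "rw node_fill = {}"
  "iw leaf_body = rap_vars \<union> {''L'', ''U'', ''ea'', ''eb'', ''i2'', ''NX'', ''p'', ''q'', ''e4'', ''X'', ''ja'', ''jb''}"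
  "rw leaf_body = {''kL'', ''kR'', ''h''}"
  "iw node_body = solve_vars" "rw node_body = {''kL'', ''kR'', ''h''}"
  "iw level_body = solve_vars \<union> {''lw''}" "rw level_body = {''kL'', ''kR'', ''h''}"
  by (auto simp: leaf_fill_def node_fill_def leaf_body_def node_body_def level_body_def solve_vars_def)

text \<open>The number of doublings that take \<open>w\<close> up to \<open>m\<close>. It counts the
  levels above the leaves and also the exponent of the initial block width.\<close>

definition lev :: "int \<Rightarrow> int \<Rightarrow> nat" where
  "lev m w = (LEAST k. m \<le> w * 2 ^ k)"

lemma lev_ex: "1 \<le> w \<Longrightarrow> m \<le> w * 2 ^ nat m" for w m :: int
proof -
  assume w: "1 \<le> w"
  have "m \<le> int (nat m)" by simp
  also have "\<dots> \<le> int (2 ^ nat m)" using less_exp[of "nat m"] by (simp only: of_nat_le_iff less_imp_le)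
  also have "\<dots> = 2 ^ nat m" by simp
  also have "\<dots> \<le> w * 2 ^ nat m" using w by simp
  finally show ?thesis .
qed

lemma lev_double:
  assumes "1 \<le> w" "w < m"
  shows "lev m w = Suc (lev m (2 * w))"
proof -
  have "lev m w = Suc (LEAST k. m \<le> w * 2 ^ Suc k)"
    unfolding lev_def by (rule Least_Suc[where P = "\<lambda>k. m \<le> w * 2 ^ k", OF lev_ex]) (use assms in auto)
  then show ?thesis by (simp add: lev_def mult.assoc mult.left_commute)
qed

context nested_run
begin

lemma fills_leaf:
  assumes "env st"
  shows "fills st leaf_fill (\<lambda>_ _. lo') (\<lambda>_ _. up')"
  using assms by (auto simp: fills_def leaf_fill_def env_def lo'_def up'_def)

lemma fills_node:
  assumes "imem st ''r'' 0 = r"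
  shows "fills st node_fill (\<lambda>ea eb. node_lower r ea eb (imem st ''X'')) (\<lambda>ea eb. node_upper r ea eb (imem st ''X''))"
  using assms by (auto simp: fills_def node_fill_def node_lower_def node_upper_def algebra_simps)

lemma node_cong:
  assumes "\<And>t. 4 * sg j + 4 \<le> t \<Longrightarrow> t < 4 * sg j' + 4 \<Longrightarrow> X' t = X t" "node j j' X"
  shows "node j j' X'"
  unfolding node_def
proof (intro ballI)
  fix ea eb :: int assume e: "ea \<in> {0, 1}" "eb \<in> {0, 1}"
  have "stab (sg j) (sg j') (PB (2 * j + ea)) (PB (2 * j' + eb)) (\<lambda>i. X' (4 * i + 2 * ea + eb)) \<longleftrightarrow>
    stab (sg j) (sg j') (PB (2 * j + ea)) (PB (2 * j' + eb)) (\<lambda>i. X (4 * i + 2 * ea + eb))"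
    using e by (intro stable_cong assms(1)) auto
  then show "stab (sg j) (sg j') (PB (2 * j + ea)) (PB (2 * j' + eb)) (\<lambda>i. X' (4 * i + 2 * ea + eb))"
    using assms(2) e unfolding node_def by blast
qed

lemma env_cong: "env s \<Longrightarrow> (\<And>v. v \<in> {''sigma'', ''c'', ''d'', ''PB'', ''R'', ''S'', ''m'', ''n''} \<Longrightarrow> imem s' v = imem s v) \<Longrightarrow>
    rmem s' ''M'' = rmem s ''M'' \<Longrightarrow> env s'"
  by (simp add: env_def)

lemma sg_diff_pos: "0 \<le> j \<Longrightarrow> j < j' \<Longrightarrow> j' \<le> m \<Longrightarrow> 1 \<le> nat (sg j' - sg j) * (e + 1)"
  using sg_mono[of j j'] by simp

lemma runs_leaf_prog:
  assumes env: "env st"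
  shows "runs orc leaf_prog st (3300100 * (nat n * (e + 1)) + 20)
    (\<lambda>s'. env s' \<and> (\<forall>j. 0 \<le> j \<longrightarrow> j < m \<longrightarrow> node j (j + 1) (imem s' ''X'')))"
  unfolding leaf_prog_def
proof (rule runs_block[where Q = "\<lambda>s'. imem s' ''ja'' 0 = 0" and T' = "3300100 * (nat n * (e + 1)) + 10"])
  fix s1 assume s1: "imem s1 ''ja'' 0 = 0" and so1: "same_off (''ja'' ::= C0) st s1"
  have env1: "env s1" by (rule env_cong[OF env]) (use same_offD[OF so1] in auto)
  let ?b = "ILess (V ''ja'') (V ''m'')"
  let ?I = "\<lambda>s'. env s' \<and> 0 \<le> imem s' ''ja'' 0 \<and> imem s' ''ja'' 0 \<le> m \<and>
     (\<forall>j. 0 \<le> j \<longrightarrow> j < imem s' ''ja'' 0 \<longrightarrow> node j (j + 1) (imem s' ''X''))"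
  \<comment> \<open>The potential is proportional to the number of variables not yet covered, so the
    costs of the leaves telescope to a multiple of \<open>n\<close>.\<close>
  let ?F = "\<lambda>s'. 3300100 * (nat (n - sg (imem s' ''ja'' 0)) * (e + 1))"
  have "runs orc (While ?b leaf_body) s1 (?F s1 + 1 + bcost ?b) (\<lambda>s'. ?I s' \<and> \<not> bval ?b s')"
  proof (rule runs_While[where Inv = ?I and \<Phi> = ?F])
    show "?I s1" using env1 s1 m by simp
  next
    fix s' assume I: "?I s'" and b: "bval ?b s'" and so: "same_off leaf_body s1 s'"
    define j where "j = imem s' ''ja'' 0"
    have j: "0 \<le> j" "j < m" using I b by (simp_all add: j_def env_def)
    define w where "w = nat (sg (j + 1) - sg j) * (e + 1)"
    have w: "1 \<le> w" using sg_diff_pos[of j "j + 1"] j by (simp add: w_def)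
    have "runs orc leaf_body s' (3300000 * w + 20) (\<lambda>s''. ?I s'' \<and> imem s'' ''ja'' 0 = j + 1)"
      unfolding leaf_body_def
    proof (rule runs_block[where Q = "\<lambda>s''. imem s'' ''jb'' 0 = j + 1" and T' = "3300000 * w + 10"])
      fix s2 assume s2: "imem s2 ''jb'' 0 = j + 1" and so2: "same_off (''jb'' ::= IAdd (V ''ja'') C1) s' s2"
      note fr2 = same_offD[OF so2, simplified]
      have env2: "env s2" by (rule env_cong[of s']) (use I in \<open>auto simp: fr2\<close>)
      have "runs orc (solve_prog leaf_fill) s2 (3300000 * (nat (sg (j + 1) - sg j) * (e + 1)))
        (\<lambda>s'. node j (j + 1) (imem s' ''X'') \<and>
          (\<forall>t. t < 4 * sg j + 4 \<or> 4 * sg (j + 1) + 4 \<le> t \<longrightarrow> imem s' ''X'' t = imem s2 ''X'' t))"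
      proof (rule runs_solve[OF env2 fills_leaf[OF env2]])
        show "up' i - lo' i \<le> 2 * R" for i by (simp add: up'_def lo'_def)
        show "\<exists>z. stab (sg j) (sg (j + 1)) (PB (2 * j + ea)) (PB (2 * (j + 1) + eb)) z \<and>
           stable g lo' up' (\<lambda>_. UNIV) (sg j) (sg (j + 1)) (PB (2 * j + ea)) (PB (2 * (j + 1) + eb)) z"
          if "ea \<in> {0, 1}" "eb \<in> {0, 1}" for ea eb using leaf_solution[OF j that] .
        show "imem s2 ''ja'' 0 = j" by (simp add: fr2 j_def)
        show "imem s2 ''jb'' 0 = j + 1" using s2 .
        show "0 \<le> j" "j < j + 1" "j + 1 \<le> m" using j by simp_all
      qed
      then show "runs orc (solve_prog leaf_fill ;; ''ja'' ::= IAdd (V ''ja'') C1) s2 (3300000 * w + 10)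
         (\<lambda>s''. ?I s'' \<and> imem s'' ''ja'' 0 = j + 1)"
      proof (rule runs_Seq2)
        fix s3 assume s3: "node j (j + 1) (imem s3 ''X'') \<and>
          (\<forall>t. t < 4 * sg j + 4 \<or> 4 * sg (j + 1) + 4 \<le> t \<longrightarrow> imem s3 ''X'' t = imem s2 ''X'' t)"
          and so3: "same_off (solve_prog leaf_fill) s2 s3"
        note fr3 = same_offD[OF so3, simplified, unfolded rap_vars_def select_vars_def, simplified]
        have env3: "env s3" by (rule env_cong[OF env2]) (auto simp: fr3)
        have nodes: "node k (k + 1) (imem s3 ''X'')" if k: "0 \<le> k" "k < j + 1" for k
        proof (cases "k = j")
          case False
          have "sg (k + 1) \<le> sg j" using sg_le[of "k + 1" j] k False j by simp
          then show ?thesis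
            using s3 I k False by (intro node_cong[of k "k + 1" "imem s3 ''X''" "imem s2 ''X''"]) (auto simp: fr2 j_def)
        qed (use s3 in simp)
        have "env (iupdate ''ja'' 0 (j + 1) s3)" by (rule env_cong[OF env3]) auto
        then show "runs orc (''ja'' ::= IAdd (V ''ja'') C1) s3 7 (\<lambda>s''. ?I s'' \<and> imem s'' ''ja'' 0 = j + 1)"
          using nodes j by (intro runs_wp_le) (auto simp: fr3 fr2 j_def)
      qed (simp add: w_def)
    qed (auto simp: j_def)
    then show "\<exists>T. runs orc leaf_body s' T (\<lambda>s''. ?I s'' \<and> T + 1 + bcost ?b + ?F s'' \<le> ?F s')"
    proof (intro exI[of _ "3300000 * w + 20"], elim runs_mono)
      fix s'' assume s'': "?I s'' \<and> imem s'' ''ja'' 0 = j + 1"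
      have "sg j \<le> sg (j + 1)" "sg (j + 1) \<le> n" using sg_le[of j "j + 1"] sg_range[of "j + 1"] j by auto
      then have "nat (n - sg j) = nat (sg (j + 1) - sg j) + nat (n - sg (j + 1))" by simp
      then have "?F s' = 3300100 * w + ?F s''" using s'' by (simp add: j_def[symmetric] w_def algebra_simps)
      then show "?I s'' \<and> 3300000 * w + 20 + 1 + bcost ?b + ?F s'' \<le> ?F s'" using s'' w by simp
    qed simp
  qed
  then show "runs orc (While ?b leaf_body) s1 (3300100 * (nat n * (e + 1)) + 10)
     (\<lambda>s'. env s' \<and> (\<forall>j. 0 \<le> j \<longrightarrow> j < m \<longrightarrow> node j (j + 1) (imem s' ''X'')))"
  proof (rule runs_mono)
    show "?F s1 + 1 + bcost ?b \<le> 3300100 * (nat n * (e + 1)) + 10" using s1 sg0 by simp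
    fix s' assume a: "?I s' \<and> \<not> bval ?b s'"
    then have "imem s' ''ja'' 0 = m" by (auto simp: env_def)
    with a show "env s' \<and> (\<forall>j. 0 \<le> j \<longrightarrow> j < m \<longrightarrow> node j (j + 1) (imem s' ''X''))" by simp
  qed
qed auto

text \<open>Vacuous once \<open>k * w\<close> reaches \<open>m\<close>, so that it can be asserted
  for all \<open>k\<close>; the last segment is cut at \<open>m\<close>.\<close>

definition "nb w k X \<longleftrightarrow> (k * w < m \<longrightarrow> node (k * w) (min (k * w + w) m) X)"

lemma runs_level_body:
  assumes env: "env st" and w: "imem st ''lw'' 0 = w" "1 \<le> w" "w < m"
    and nb: "\<And>k. 0 \<le> k \<Longrightarrow> nb w k (imem st ''X'')"
  shows "runs orc level_body st (3300200 * (nat n * (e + 1)))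
    (\<lambda>s'. env s' \<and> imem s' ''lw'' 0 = 2 * w \<and> (\<forall>k\<ge>0. nb (2 * w) k (imem s' ''X'')))"
  unfolding level_body_def
proof (rule runs_block[where Q = "\<lambda>s'. imem s' ''ja'' 0 = 0" and T' = "3300100 * (nat n * (e + 1)) + 30"])
  have "1 \<le> nat n * (e + 1)" using sg_diff_pos[of 0 m] m sg0 sgm by simp
  moreover have "ccost (''ja'' ::= C0) = 3" by simp
  ultimately show "ccost (''ja'' ::= C0) + (3300100 * (nat n * (e + 1)) + 30) \<le> 3300200 * (nat n * (e + 1))"
    by linarith
  fix s1 assume s1: "imem s1 ''ja'' 0 = 0" and so1: "same_off (''ja'' ::= C0) st s1"
  note fr1 = same_offD[OF so1, simplified]
  have env1: "env s1" by (rule env_cong[OF env]) (auto simp: fr1)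
  let ?b = "ILess (IAdd (V ''ja'') (V ''lw'')) (V ''m'')"
  \<comment> \<open>Segments before \<open>k\<close> already have width \<open>2 * w\<close>, those
    from \<open>2 * k\<close> on still have width \<open>w\<close>.\<close>
  let ?I = "\<lambda>s'. env s' \<and> imem s' ''lw'' 0 = w \<and> (\<exists>k\<ge>0. imem s' ''ja'' 0 = 2 * k * w \<and>
     (\<forall>k'. 0 \<le> k' \<and> k' < k \<longrightarrow> nb (2 * w) k' (imem s' ''X'')) \<and> (\<forall>k'\<ge>2 * k. nb w k' (imem s' ''X'')))"
  \<comment> \<open>The minimum is there because the last step may carry \<open>ja\<close> beyond
    \<open>m\<close>.\<close>
  let ?F = "\<lambda>s'. 3300100 * (nat (n - sg (min (imem s' ''ja'' 0) m)) * (e + 1))"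
  have loop: "runs orc (While ?b node_body) s1 (?F s1 + 1 + bcost ?b) (\<lambda>s'. ?I s' \<and> \<not> bval ?b s')"
  proof (rule runs_While[where Inv = ?I and \<Phi> = ?F])
    show "?I s1" using env1 s1 w(1) nb fr1 by (auto intro!: exI[of _ "0 :: int"])
  next
    fix s' assume I: "?I s'" and b: "bval ?b s'" and so: "same_off node_body s1 s'"
    define j where "j = imem s' ''ja'' 0"
    obtain k where k: "0 \<le> k" "j = 2 * k * w" and old: "\<And>k'. 0 \<le> k' \<Longrightarrow> k' < k \<Longrightarrow> nb (2 * w) k' (imem s' ''X'')"
      and new: "\<And>k'. 2 * k \<le> k' \<Longrightarrow> nb w k' (imem s' ''X'')" using I by (auto simp: j_def)
    have env': "env s'" and lw: "imem s' ''lw'' 0 = w" using I by auto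
    define j' where "j' = min (j + 2 * w) m"
    have j0: "0 \<le> j" using k w by simp
    have jw: "j + w < m" using b lw env' by (simp add: j_def env_def)
    have j': "j + w < j'" "j' \<le> m" "j < j'" using jw w by (auto simp: j'_def)
    define v where "v = nat (sg j' - sg j) * (e + 1)"
    have v: "1 \<le> v" using sg_diff_pos[OF j0 j'(3,2)] by (simp add: v_def)
    have n1: "node j (j + w) (imem s' ''X'')"
    proof -
      have "2 * k * w < m" "min (2 * k * w + w) m = j + w" using jw w k by auto
      then show ?thesis using new[of "2 * k"] k by (simp add: nb_def)
    qed
    have n2: "node (j + w) j' (imem s' ''X'')"
    proof -
      have e: "(2 * k + 1) * w = j + w" using k by (simp add: algebra_simps)
      have "min (j + w + w) m = j'" by (simp add: j'_def)
      then show ?thesis using new[of "2 * k + 1"] jw unfolding nb_def e by simp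
    qed
    let ?A = "''jm'' ::= IAdd (V ''ja'') (V ''lw'') ;; ''jb'' ::= IAdd (V ''jm'') (V ''lw'') ;;
      Cond (ILess (V ''m'') (V ''jb'')) (''jb'' ::= V ''m'') Skip ;; ''r'' ::= IMem ''sigma'' (V ''jm'')"
    let ?J = "\<lambda>s''. ?I s'' \<and> imem s'' ''ja'' 0 = j + 2 * w"
    have "runs orc node_body s' (3300000 * v + 70) ?J"
      unfolding node_body_def
    proof (rule runs_block[where Q = "\<lambda>s''. imem s'' ''jb'' 0 = j' \<and> imem s'' ''r'' 0 = sg (j + w)" and T' = "3300000 * v + 20"])
      show "wp orc ?A (\<lambda>s''. imem s'' ''jb'' 0 = j' \<and> imem s'' ''r'' 0 = sg (j + w)) s'"
        using env' lw by (auto simp: env_def j'_def j_def)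
      fix s2 assume s2: "imem s2 ''jb'' 0 = j' \<and> imem s2 ''r'' 0 = sg (j + w)" and so2: "same_off ?A s' s2"
      note fr2 = same_offD[OF so2, simplified]
      have env2: "env s2" by (rule env_cong[OF env']) (auto simp: fr2)
      have "runs orc (solve_prog node_fill) s2 (3300000 * (nat (sg j' - sg j) * (e + 1)))
        (\<lambda>s''. node j j' (imem s'' ''X'') \<and>
          (\<forall>t. t < 4 * sg j + 4 \<or> 4 * sg j' + 4 \<le> t \<longrightarrow> imem s'' ''X'' t = imem s2 ''X'' t))"
      proof (rule runs_solve[OF env2 fills_node])
        show "imem s2 ''r'' 0 = sg (j + w)" using s2 by simp
        show "node_upper (sg (j + w)) ea eb (imem s2 ''X'') i - node_lower (sg (j + w)) ea eb (imem s2 ''X'') i \<le> 2 * R"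
          if "ea \<in> {0, 1}" "eb \<in> {0, 1}" "i \<in> {sg j<..sg j'}" for ea eb i
          using node_box[of j "j + w" j' ea eb "imem s2 ''X''" i] n1 n2 that j0 j' w by (simp add: fr2)
        show "\<exists>z. stab (sg j) (sg j') (PB (2 * j + ea)) (PB (2 * j' + eb)) z \<and>
           stable g (node_lower (sg (j + w)) ea eb (imem s2 ''X'')) (node_upper (sg (j + w)) ea eb (imem s2 ''X'')) (\<lambda>_. UNIV)
             (sg j) (sg j') (PB (2 * j + ea)) (PB (2 * j' + eb)) z"
          if "ea \<in> {0, 1}" "eb \<in> {0, 1}" for ea eb
          using node_solution[of j "j + w" j' ea eb "imem s2 ''X''"] n1 n2 that j0 j' w by (simp add: fr2)
        show "imem s2 ''ja'' 0 = j" by (simp add: fr2 j_def)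
        show "imem s2 ''jb'' 0 = j'" using s2 by simp
        show "0 \<le> j" "j < j'" "j' \<le> m" by (fact j0 j'(3) j'(2))+
      qed
      then show "runs orc (solve_prog node_fill ;; ''ja'' ::= IAdd (V ''ja'') (IMul (CC 2) (V ''lw''))) s2 (3300000 * v + 20) ?J"
      proof (rule runs_Seq2)
        fix s3 assume s3: "node j j' (imem s3 ''X'') \<and>
          (\<forall>t. t < 4 * sg j + 4 \<or> 4 * sg j' + 4 \<le> t \<longrightarrow> imem s3 ''X'' t = imem s2 ''X'' t)"
          and so3: "same_off (solve_prog node_fill) s2 s3"
        note fr3 = same_offD[OF so3, simplified, unfolded rap_vars_def select_vars_def, simplified]
        have X2: "imem s2 ''X'' = imem s' ''X''" by (simp add: fr2)
        have env3: "env s3" by (rule env_cong[OF env2]) (auto simp: fr3)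
        have old': "nb (2 * w) k' (imem s3 ''X'')" if k': "0 \<le> k'" "k' < k + 1" for k'
        proof (cases "k' = k")
          case True
          have "k * (2 * w) = j" using k by simp
          then show ?thesis using True s3 j'_def by (simp add: nb_def)
        next
          case False
          then have "(k' + 1) * w \<le> k * w" using k' w by (intro mult_right_mono) auto
          then have le: "k' * (2 * w) + 2 * w \<le> j" using k by (simp add: algebra_simps)
          then have mn: "min (k' * (2 * w) + 2 * w) m = k' * (2 * w) + 2 * w" using jw w by simp
          have s: "sg (k' * (2 * w) + 2 * w) \<le> sg j" using sg_le[OF _ le] k' w jw by simp
          show ?thesis unfolding nb_def mn
          proof
            assume "k' * (2 * w) < m"
            then have "node (k' * (2 * w)) (k' * (2 * w) + 2 * w) (imem s' ''X'')"
              using old[of k'] k' False by (simp add: nb_def mn)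
            then show "node (k' * (2 * w)) (k' * (2 * w) + 2 * w) (imem s3 ''X'')"
              using s3 s X2 by (elim node_cong[rotated]) auto
          qed
        qed
        have new': "nb w k' (imem s3 ''X'')" if k': "2 * (k + 1) \<le> k'" for k'
          unfolding nb_def
        proof
          assume km: "k' * w < m"
          have "2 * (k + 1) * w \<le> k' * w" using k' w by (intro mult_right_mono) auto
          then have le: "j + 2 * w \<le> k' * w" using k by (simp add: algebra_simps)
          then have s: "sg j' \<le> sg (k' * w)" using sg_le[of j' "k' * w"] j' j0 km by (simp add: j'_def)
          have "node (k' * w) (min (k' * w + w) m) (imem s' ''X'')"
            using new[of k'] k' km by (simp add: nb_def)
          then show "node (k' * w) (min (k' * w + w) m) (imem s3 ''X'')"
            using s3 s X2 by (elim node_cong[rotated]) auto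
        qed
        have "env (iupdate ''ja'' 0 (j + 2 * w) s3)" by (rule env_cong[OF env3]) auto
        moreover have "j + 2 * w = 2 * (k + 1) * w" using k by (simp add: algebra_simps)
        ultimately show "runs orc (''ja'' ::= IAdd (V ''ja'') (IMul (CC 2) (V ''lw''))) s3 12 ?J"
          using old' new' k(1) lw
          by (intro runs_wp_le) (auto simp: fr3 fr2 j_def[symmetric] intro!: exI[of _ "k + 1"])
      qed (simp add: v_def)
    qed simp
    then show "\<exists>T. runs orc node_body s' T (\<lambda>s''. ?I s'' \<and> T + 1 + bcost ?b + ?F s'' \<le> ?F s')"
    proof (intro exI[of _ "3300000 * v + 70"], elim runs_mono)
      fix s'' assume s'': "?J s''"
      have "sg j \<le> sg j'" "sg j' \<le> n" using sg_le[of j j'] sg_range[of j'] j0 j' by auto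
      then have "nat (n - sg j) = nat (sg j' - sg j) + nat (n - sg j')" by simp
      moreover have "min j m = j" using jw w by simp
      then have "?F s' = 3300100 * (nat (n - sg j) * (e + 1))" by (simp add: j_def[symmetric])
      moreover have "?F s'' = 3300100 * (nat (n - sg j') * (e + 1))" using s'' by (simp add: j'_def)
      ultimately have "?F s' = 3300100 * v + ?F s''" by (simp add: v_def algebra_simps)
      then have "3300000 * v + 70 + 1 + bcost ?b + ?F s'' \<le> ?F s'" using v by simp
      then show "?I s'' \<and> 3300000 * v + 70 + 1 + bcost ?b + ?F s'' \<le> ?F s'" by (rule conjI[OF conjunct1[OF s'']])
    qed simp
  qed
  then show "runs orc (While ?b node_body ;; ''lw'' ::= IMul (CC 2) (V ''lw'')) s1 (3300100 * (nat n * (e + 1)) + 30)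
     (\<lambda>s'. env s' \<and> imem s' ''lw'' 0 = 2 * w \<and> (\<forall>k\<ge>0. nb (2 * w) k (imem s' ''X'')))"
  proof (rule runs_Seq2)
    show "?F s1 + 1 + bcost ?b + 10 \<le> 3300100 * (nat n * (e + 1)) + 30" using s1 sg0 m by simp
    fix s' assume a: "?I s' \<and> \<not> bval ?b s'"
    then obtain k where k: "0 \<le> k" "imem s' ''ja'' 0 = 2 * k * w" and old: "\<And>k'. 0 \<le> k' \<Longrightarrow> k' < k \<Longrightarrow> nb (2 * w) k' (imem s' ''X'')"
      and new: "\<And>k'. 2 * k \<le> k' \<Longrightarrow> nb w k' (imem s' ''X'')" by auto
    have fin: "m \<le> 2 * k * w + w" using a k by (auto simp: env_def)
    have "nb (2 * w) k' (imem s' ''X'')" if k': "0 \<le> k'" for k'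
    proof (cases "k' < k")
      case False
      show ?thesis unfolding nb_def
      proof
        assume km: "k' * (2 * w) < m"
        \<comment> \<open>Beyond the processed pairs at most one segment is left. It reaches up to
          \<open>m\<close>, so its old solution already serves as the one for width
          \<open>2 * w\<close>.\<close>
        have "k' = k"
        proof (rule ccontr)
          assume "k' \<noteq> k"
          then have "(k + 1) * w \<le> k' * w" using False w by (intro mult_right_mono) auto
          then show False using km fin w by (simp add: algebra_simps)
        qed
        moreover have "node (k * (2 * w)) m (imem s' ''X'')"
        proof -
          have e: "k * (2 * w) = 2 * k * w" "min (2 * k * w + w) m = m" using fin by simp_all
          then have "2 * k * w < m" using km \<open>k' = k\<close> by simp
          then show ?thesis using new[of "2 * k"] unfolding nb_def e by simp
        qed
        ultimately show "node (k' * (2 * w)) (min (k' * (2 * w) + 2 * w) m) (imem s' ''X'')"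
          using fin w by (simp add: min_def algebra_simps)
      qed
    qed (use old k' in blast)
    moreover have "env (iupdate ''lw'' 0 (2 * w) s')" by (rule env_cong[of s']) (use a in auto)
    ultimately show "runs orc (''lw'' ::= IMul (CC 2) (V ''lw'')) s' 10
      (\<lambda>s'. env s' \<and> imem s' ''lw'' 0 = 2 * w \<and> (\<forall>k\<ge>0. nb (2 * w) k (imem s' ''X'')))"
      using a by (intro runs_wp_le) auto
  qed
qed auto

lemma runs_level_prog:
  assumes env: "env st" and leaf: "\<forall>j. 0 \<le> j \<longrightarrow> j < m \<longrightarrow> node j (j + 1) (imem st ''X'')"
  shows "runs orc level_prog st (lev m 1 * (3300300 * (nat n * (e + 1))) + 20) (\<lambda>s'. env s' \<and> node 0 m (imem s' ''X''))"
proof -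
  define W where "W = nat n * (e + 1)"
  have n: "1 \<le> W" using sg_diff_pos[of 0 m] m sg0 sgm by (simp add: W_def)
  show ?thesis
  unfolding level_prog_def W_def[symmetric]
proof (rule runs_block[where Q = "\<lambda>s'. imem s' ''lw'' 0 = 1" and T' = "lev m 1 * (3300300 * W) + 10"])
  fix s1 assume s1: "imem s1 ''lw'' 0 = 1" and so1: "same_off (''lw'' ::= C1) st s1"
  note fr1 = same_offD[OF so1, simplified]
  have env1: "env s1" by (rule env_cong[OF env]) (auto simp: fr1)
  let ?b = "ILess (V ''lw'') (V ''m'')"
  let ?I = "\<lambda>s'. env s' \<and> 1 \<le> imem s' ''lw'' 0 \<and> (\<forall>k\<ge>0. nb (imem s' ''lw'' 0) k (imem s' ''X''))"
  let ?F = "\<lambda>s'. lev m (imem s' ''lw'' 0) * (3300300 * W)"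
  have "runs orc (While ?b level_body) s1 (?F s1 + 1 + bcost ?b) (\<lambda>s'. ?I s' \<and> \<not> bval ?b s')"
  proof (rule runs_While[where Inv = ?I and \<Phi> = ?F])
    show "?I s1" using env1 s1 leaf fr1 by (simp add: nb_def min_def)
  next
    fix s' assume I: "?I s'" and b: "bval ?b s'"
    define w where "w = imem s' ''lw'' 0"
    have w: "1 \<le> w" "w < m" using I b by (auto simp: w_def env_def)
    have "runs orc level_body s' (3300200 * W)
      (\<lambda>s'. env s' \<and> imem s' ''lw'' 0 = 2 * w \<and> (\<forall>k\<ge>0. nb (2 * w) k (imem s' ''X'')))"
      unfolding W_def by (rule runs_level_body) (use I w in \<open>auto simp: w_def\<close>)
    then show "\<exists>T. runs orc level_body s' T (\<lambda>s''. ?I s'' \<and> T + 1 + bcost ?b + ?F s'' \<le> ?F s')"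
    proof (intro exI[of _ "3300200 * W"], elim runs_mono)
      fix s'' assume s'': "env s'' \<and> imem s'' ''lw'' 0 = 2 * w \<and> (\<forall>k\<ge>0. nb (2 * w) k (imem s'' ''X''))"
      have "?F s' = 3300300 * W + ?F s''"
        using s'' lev_double[OF w] by (simp add: w_def[symmetric])
      then show "?I s'' \<and> 3300200 * W + 1 + bcost ?b + ?F s'' \<le> ?F s'" using s'' w n by simp
    qed simp
  qed
  then show "runs orc (While ?b level_body) s1 (lev m 1 * (3300300 * W) + 10)
    (\<lambda>s'. env s' \<and> node 0 m (imem s' ''X''))"
  proof (rule runs_mono)
    show "?F s1 + 1 + bcost ?b \<le> lev m 1 * (3300300 * W) + 10" using s1 by simp
    fix s' assume a: "?I s' \<and> \<not> bval ?b s'"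
    then have "m \<le> imem s' ''lw'' 0" by (auto simp: env_def)
    moreover have "nb (imem s' ''lw'' 0) 0 (imem s' ''X'')" using a by simp
    ultimately show "env s' \<and> node 0 m (imem s' ''X'')" using a m by (simp add: nb_def min_def split: if_splits)
  qed
qed auto
qed

end

subsection \<open>Preprocessing\<close>

text \<open>\<open>u * u + 1\<close> exceeds the absolute value of \<open>u\<close> without a case
  distinction. \<open>M\<close> only has to dominate, so these terms are added up instead of
  maximised.\<close>

definition prefix_body :: com where
  "prefix_body = IAssign ''CS'' (V ''i1'') (IAdd (IMem ''CS'' (ISub (V ''i1'') C1)) (IMem ''c'' (V ''i1''))) ;;
     Cond (ILess (IMem ''c'' (V ''i1'')) (IMem ''d'' (V ''i1'')))
       (Query ''h'' C0 (V ''i1'') (OfInt (IMem ''c'' (V ''i1''))) ;;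
        Query ''h'' C1 (V ''i1'') (OfInt (IAdd (IMem ''c'' (V ''i1'')) C1)) ;;
        Query ''h'' (CC 2) (V ''i1'') (OfInt (ISub (IMem ''d'' (V ''i1'')) C1)) ;;
        Query ''h'' (CC 3) (V ''i1'') (OfInt (IMem ''d'' (V ''i1''))) ;;
        RAssign ''h'' C0 (RSub (RMem ''h'' C1) (RMem ''h'' C0)) ;;
        RAssign ''h'' C1 (RSub (RMem ''h'' (CC 3)) (RMem ''h'' (CC 2))) ;;
        RAssign ''M'' C0 (RAdd (RMem ''M'' C0) (RAdd
          (RAdd (RMul (RMem ''h'' C0) (RMem ''h'' C0)) (OfInt C1))
          (RAdd (RMul (RMem ''h'' C1) (RMem ''h'' C1)) (OfInt C1)))))
       Skip"

definition prefix_prog :: com where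
  "prefix_prog = (''i1'' ::= C1 ;; RAssign ''M'' C0 (OfInt C1)) ;; For ''i1'' (IAdd (V ''n'') C1) prefix_body"

lemma prefix_writes [simp]:
  "iw prefix_body = {''CS''}" "rw prefix_body = {''h'', ''M''}"
  "iw prefix_prog = {''i1'', ''CS''}" "rw prefix_prog = {''h'', ''M''}"
  by (auto simp: prefix_prog_def prefix_body_def)

lemma abs_less_square: "\<bar>x\<bar> < x * x + 1" for x :: real
proof -
  have "0 \<le> (\<bar>x\<bar> - 1 / 2)\<^sup>2" by simp
  also have "\<dots> = x * x - \<bar>x\<bar> + 1 / 4" by (simp add: power2_eq_square algebra_simps abs_mult_self_eq)
  finally show ?thesis by simp
qed

lemma runs_prefix_prog:
  fixes st :: state and F
  defines "n \<equiv> imem st ''n'' 0" and "c \<equiv> imem st ''c''" and "d \<equiv> imem st ''d''"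
  assumes n: "0 \<le> n" and CS: "imem st ''CS'' 0 = 0"
    and orc: "\<And>i k. i \<in> {0<..n} \<Longrightarrow> c i \<le> k \<Longrightarrow> k \<le> d i \<Longrightarrow> orc i (of_int k) = Some (F i k)"
  shows "runs orc prefix_prog st (150 * nat n + 30)
    (\<lambda>s'. (\<forall>k\<in>{0..n}. imem s' ''CS'' k = sum c {0<..k}) \<and> 1 \<le> rmem s' ''M'' 0 \<and>
      (\<forall>i\<in>{0<..n}. c i < d i \<longrightarrow> \<bar>F i (c i + 1) - F i (c i)\<bar> < rmem s' ''M'' 0 \<and>
         \<bar>F i (d i) - F i (d i - 1)\<bar> < rmem s' ''M'' 0))"
  unfolding prefix_prog_def
proof (rule runs_block[where Q = "\<lambda>s'. imem s' ''i1'' 0 = 1 \<and> rmem s' ''M'' 0 = 1" and T' = "150 * nat n + 10"])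
  fix s1 assume s1: "imem s1 ''i1'' 0 = 1 \<and> rmem s1 ''M'' 0 = 1"
    and so1: "same_off (''i1'' ::= C1 ;; RAssign ''M'' C0 (OfInt C1)) st s1"
  note fr1 = same_offD[OF so1, simplified]
  let ?I = "\<lambda>k s'. (\<forall>j\<in>{0..<k}. imem s' ''CS'' j = sum c {0<..j}) \<and> 1 \<le> rmem s' ''M'' 0 \<and>
      (\<forall>i\<in>{0<..<k}. c i < d i \<longrightarrow> \<bar>F i (c i + 1) - F i (c i)\<bar> < rmem s' ''M'' 0 \<and>
         \<bar>F i (d i) - F i (d i - 1)\<bar> < rmem s' ''M'' 0)"
  have "runs orc (For ''i1'' (IAdd (V ''n'') C1) prefix_body) s1 (150 * nat n + 10) (\<lambda>s'. ?I (n + 1) s' \<and> imem s' ''i1'' 0 = n + 1)"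
  proof (rule runs_For[where T = 130 and lw = 1 and hg = "n + 1" and Inv = ?I])
    have "{0..<1} = {0 :: int}" "{0<..<1} = ({} :: int set)" by auto
    then show "?I 1 s1" using s1 CS by (simp add: fr1)
  next
    fix k s' assume k: "1 \<le> k" "k < n + 1" "imem s' ''i1'' 0 = k" and I: "?I k s'"
      and so: "same_off (For ''i1'' (IAdd (V ''n'') C1) prefix_body) s1 s'"
    note fr = same_offD[OF so, simplified]
    have cd: "imem s' ''c'' = c" "imem s' ''d'' = d" by (simp_all add: fr fr1 c_def d_def)
    have CSk: "imem s' ''CS'' (k - 1) + c k = sum c {0<..k}"
      using I k(1) sum_Ioc_last[of 0 k c] by simp
    have s1': "{0..<k + 1} = insert k {0..<k}" "{0<..<k + 1} = insert k {0<..<k}" using k by auto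
    have kn: "k \<in> {0<..n}" using k by simp
    define M where "M = rmem s' ''M'' 0"
    have M: "1 \<le> M" using I by (simp add: M_def)
    let ?Q = "\<lambda>s''. imem s'' ''i1'' 0 = k \<and> ?I (k + 1) (iupdate ''i1'' 0 (k + 1) s'')"
    have "wp orc prefix_body ?Q s'"
    proof (cases "c k < d k")
      case True
      have q: "orc k (real_of_int (c k)) = Some (F k (c k))" "orc k (real_of_int (c k + 1)) = Some (F k (c k + 1))"
        "orc k (real_of_int (d k - 1)) = Some (F k (d k - 1))" "orc k (real_of_int (d k)) = Some (F k (d k))"
        using orc[OF kn] True by (simp_all del: of_int_add of_int_diff)
      define u where "u = F k (c k + 1) - F k (c k)"
      define v where "v = F k (d k) - F k (d k - 1)"
      have pos: "0 \<le> u * u" "0 \<le> v * v" by simp_all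
      have uv: "\<bar>u\<bar> < M + (u * u + 1 + (v * v + 1))" "\<bar>v\<bar> < M + (u * u + 1 + (v * v + 1))"
        using abs_less_square[of u] abs_less_square[of v] M pos by linarith+
      have old: "\<bar>F i (c i + 1) - F i (c i)\<bar> < M + (u * u + 1 + (v * v + 1)) \<and> \<bar>F i (d i) - F i (d i - 1)\<bar> < M + (u * u + 1 + (v * v + 1))"
        if "i \<in> {0<..<k}" "c i < d i" for i
      proof -
        have "\<bar>F i (c i + 1) - F i (c i)\<bar> < M \<and> \<bar>F i (d i) - F i (d i - 1)\<bar> < M" using I that by (simp add: M_def)
        then show ?thesis using pos by linarith
      qed
      have "1 \<le> M + (u * u + 1 + (v * v + 1))" using M pos by linarith
      then show ?thesis unfolding s1'
        using True I k(3) CSk uv old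
        by (simp add: prefix_body_def cd q M_def[symmetric] u_def[symmetric] v_def[symmetric] del: of_int_add of_int_diff)
    next
      case False
      then show ?thesis unfolding s1' using I k(3) CSk by (simp add: prefix_body_def cd)
    qed
    then show "runs orc prefix_body s' 130 ?Q" by (rule runs_wp_le) (simp add: prefix_body_def)
  next
    fix k s' assume so: "same_off (For ''i1'' (IAdd (V ''n'') C1) prefix_body) s1 s'"
    show "ival (IAdd (V ''n'') C1) s' = n + 1" using same_offD[OF so, simplified] by (simp add: fr1 n_def)
  qed (use s1 n in auto)
  then show "runs orc (For ''i1'' (IAdd (V ''n'') C1) prefix_body) s1 (150 * nat n + 10)
    (\<lambda>s'. (\<forall>k\<in>{0..n}. imem s' ''CS'' k = sum c {0<..k}) \<and> 1 \<le> rmem s' ''M'' 0 \<and>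
      (\<forall>i\<in>{0<..n}. c i < d i \<longrightarrow> \<bar>F i (c i + 1) - F i (c i)\<bar> < rmem s' ''M'' 0 \<and>
         \<bar>F i (d i) - F i (d i - 1)\<bar> < rmem s' ''M'' 0))"
    by (rule runs_mono) auto
qed auto

definition bounds_body :: com where
  "bounds_body =
     Cond (ILess (IMem ''a'' (V ''i1'')) (IMem ''CS'' (IMem ''sigma'' (V ''i1''))))
       (IAssign ''PB'' (IMul (CC 2) (V ''i1'')) (IMem ''CS'' (IMem ''sigma'' (V ''i1''))))
       (IAssign ''PB'' (IMul (CC 2) (V ''i1'')) (IMem ''a'' (V ''i1''))) ;;
     Cond (ILess (IMem ''b'' (V ''i1'')) (IAdd (IMem ''CS'' (IMem ''sigma'' (V ''i1''))) (V ''R'')))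
       (IAssign ''PB'' (IAdd (IMul (CC 2) (V ''i1'')) C1) (IMem ''b'' (V ''i1'')))
       (IAssign ''PB'' (IAdd (IMul (CC 2) (V ''i1'')) C1) (IAdd (IMem ''CS'' (IMem ''sigma'' (V ''i1''))) (V ''R'')))"

text \<open>The entries 0 and 1 of \<open>PB\<close> are never assigned: the empty sum is 0, which
  is the initial content of the memory.\<close>

definition bounds_prog :: com where
  "bounds_prog = (''R'' ::= ISub (V ''B'') (IMem ''CS'' (V ''n'')) ;;
      IAssign ''PB'' (IMul (CC 2) (V ''m'')) (V ''B'') ;; IAssign ''PB'' (IAdd (IMul (CC 2) (V ''m'')) C1) (V ''B'') ;;
      ''i1'' ::= C1) ;; For ''i1'' (V ''m'') bounds_body"

lemma bounds_writes [simp]: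
  "iw bounds_body = {''PB''}" "rw bounds_body = {}"
  "iw bounds_prog = {''R'', ''PB'', ''i1''}" "rw bounds_prog = {}"
  by (auto simp: bounds_prog_def bounds_body_def)

lemma runs_bounds_prog:
  fixes st :: state
  defines "m \<equiv> imem st ''m'' 0" and "B \<equiv> imem st ''B'' 0" and "CS \<equiv> imem st ''CS''" and "sg \<equiv> imem st ''sigma''"
  defines "R \<equiv> B - CS (imem st ''n'' 0)"
  assumes m: "1 \<le> m" and z: "imem st ''PB'' 0 = 0" "imem st ''PB'' 1 = 0"
  shows "runs orc bounds_prog st (100 * nat m + 50)
    (\<lambda>s'. imem s' ''R'' 0 = R \<and> imem s' ''PB'' 0 = 0 \<and> imem s' ''PB'' 1 = 0 \<and>
      imem s' ''PB'' (2 * m) = B \<and> imem s' ''PB'' (2 * m + 1) = B \<and>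
      (\<forall>j\<in>{1..<m}. imem s' ''PB'' (2 * j) = max (imem st ''a'' j) (CS (sg j)) \<and>
         imem s' ''PB'' (2 * j + 1) = min (imem st ''b'' j) (CS (sg j) + R)))"
  unfolding bounds_prog_def
proof (rule runs_block[where Q = "\<lambda>s'. imem s' ''R'' 0 = R \<and> imem s' ''PB'' 0 = 0 \<and> imem s' ''PB'' 1 = 0 \<and>
      imem s' ''PB'' (2 * m) = B \<and> imem s' ''PB'' (2 * m + 1) = B \<and> imem s' ''i1'' 0 = 1" and T' = "100 * nat m + 10"])
  let ?pre = "''R'' ::= ISub (V ''B'') (IMem ''CS'' (V ''n'')) ;;
      IAssign ''PB'' (IMul (CC 2) (V ''m'')) (V ''B'') ;; IAssign ''PB'' (IAdd (IMul (CC 2) (V ''m'')) C1) (V ''B'') ;;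
      ''i1'' ::= C1"
  show "wp orc ?pre (\<lambda>s'. imem s' ''R'' 0 = R \<and> imem s' ''PB'' 0 = 0 \<and> imem s' ''PB'' 1 = 0 \<and>
      imem s' ''PB'' (2 * m) = B \<and> imem s' ''PB'' (2 * m + 1) = B \<and> imem s' ''i1'' 0 = 1) st"
    using m z by (simp add: m_def[symmetric] B_def[symmetric] CS_def[symmetric] R_def)
  fix s1 assume s1: "imem s1 ''R'' 0 = R \<and> imem s1 ''PB'' 0 = 0 \<and> imem s1 ''PB'' 1 = 0 \<and>
      imem s1 ''PB'' (2 * m) = B \<and> imem s1 ''PB'' (2 * m + 1) = B \<and> imem s1 ''i1'' 0 = 1" and so1: "same_off ?pre st s1"
  note fr1 = same_offD[OF so1, simplified]
  let ?I = "\<lambda>k s'. imem s' ''PB'' 0 = 0 \<and> imem s' ''PB'' 1 = 0 \<and>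
      imem s' ''PB'' (2 * m) = B \<and> imem s' ''PB'' (2 * m + 1) = B \<and>
      (\<forall>j\<in>{1..<k}. imem s' ''PB'' (2 * j) = max (imem st ''a'' j) (CS (sg j)) \<and>
         imem s' ''PB'' (2 * j + 1) = min (imem st ''b'' j) (CS (sg j) + R))"
  have "runs orc (For ''i1'' (V ''m'') bounds_body) s1 (100 * nat m + 10) (\<lambda>s'. ?I m s' \<and> imem s' ''i1'' 0 = m)"
  proof (rule runs_For[where T = 80 and lw = 1 and hg = m and Inv = ?I])
    fix k s' assume k: "1 \<le> k" "k < m" "imem s' ''i1'' 0 = k" and I: "?I k s'"
      and so: "same_off (For ''i1'' (V ''m'') bounds_body) s1 s'"
    note fr = same_offD[OF so, simplified]
    have mem: "imem s' ''a'' = imem st ''a''" "imem s' ''b'' = imem st ''b''" "imem s' ''CS'' = CS" "imem s' ''sigma'' = sg"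
      "imem s' ''R'' 0 = R" using s1 by (simp_all add: fr fr1 CS_def sg_def)
    have par: "2 * i \<noteq> 2 * j + 1" "2 * i + 1 \<noteq> 2 * j" for i j :: int by presburger+
    have set: "{1..<k + 1} = insert k {1..<k}" using k by auto
    have "wp orc bounds_body (\<lambda>s''. imem s'' ''i1'' 0 = k \<and> ?I (k + 1) (iupdate ''i1'' 0 (k + 1) s'')) s'"
      unfolding set using I k by (simp add: bounds_body_def mem par max_def min_def)
    then show "runs orc bounds_body s' 80 (\<lambda>s''. imem s'' ''i1'' 0 = k \<and> ?I (k + 1) (iupdate ''i1'' 0 (k + 1) s''))"
      by (rule runs_wp_le) (simp add: bounds_body_def)
  next
    fix k s' assume so: "same_off (For ''i1'' (V ''m'') bounds_body) s1 s'"
    show "ival (V ''m'') s' = m" using same_offD[OF so, simplified] by (simp add: fr1 m_def)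
  qed (use s1 m in auto)
  then show "runs orc (For ''i1'' (V ''m'') bounds_body) s1 (100 * nat m + 10)
    (\<lambda>s'. imem s' ''R'' 0 = R \<and> imem s' ''PB'' 0 = 0 \<and> imem s' ''PB'' 1 = 0 \<and>
      imem s' ''PB'' (2 * m) = B \<and> imem s' ''PB'' (2 * m + 1) = B \<and>
      (\<forall>j\<in>{1..<m}. imem s' ''PB'' (2 * j) = max (imem st ''a'' j) (CS (sg j)) \<and>
         imem s' ''PB'' (2 * j + 1) = min (imem st ''b'' j) (CS (sg j) + R)))"
  proof (rule runs_mono)
    fix s' assume a: "?I m s' \<and> imem s' ''i1'' 0 = m" and so: "same_off (For ''i1'' (V ''m'') bounds_body) s1 s'"
    have "imem s' ''R'' 0 = R" using s1 same_offD[OF so, simplified] by simp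
    with a show "imem s' ''R'' 0 = R \<and> imem s' ''PB'' 0 = 0 \<and> imem s' ''PB'' 1 = 0 \<and>
      imem s' ''PB'' (2 * m) = B \<and> imem s' ''PB'' (2 * m + 1) = B \<and>
      (\<forall>j\<in>{1..<m}. imem s' ''PB'' (2 * j) = max (imem st ''a'' j) (CS (sg j)) \<and>
         imem s' ''PB'' (2 * j + 1) = min (imem st ''b'' j) (CS (sg j) + R))" by blast
  qed simp
qed auto

definition width_prog :: com where
  "width_prog = ''S'' ::= C1 ;; While (BNot (ILess (IMul (CC 2) (V ''R'')) (V ''S''))) (''S'' ::= IMul (CC 2) (V ''S''))"

lemma width_writes [simp]: "iw width_prog = {''S''}" "rw width_prog = {}"
  by (auto simp: width_prog_def)

lemma lev_0: "m \<le> w \<Longrightarrow> lev m w = 0"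
  unfolding lev_def by (rule Least_eq_0) simp

lemma runs_width_prog:
  fixes st :: state
  defines "R \<equiv> imem st ''R'' 0"
  shows "runs orc width_prog st (30 * lev (2 * R + 1) 1 + 20)
    (\<lambda>s'. imem s' ''S'' 0 = 2 ^ lev (2 * R + 1) 1 \<and> 2 * R < 2 ^ lev (2 * R + 1) 1)"
  unfolding width_prog_def
proof (rule runs_block[where Q = "\<lambda>s'. imem s' ''S'' 0 = 1" and T' = "30 * lev (2 * R + 1) 1 + 10"])
  fix s1 assume s1: "imem s1 ''S'' 0 = 1" and so1: "same_off (''S'' ::= C1) st s1"
  note fr1 = same_offD[OF so1, simplified]
  let ?b = "BNot (ILess (IMul (CC 2) (V ''R'')) (V ''S''))" and ?c = "''S'' ::= IMul (CC 2) (V ''S'')"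
  let ?L = "\<lambda>s'. lev (2 * R + 1) (imem s' ''S'' 0)"
  \<comment> \<open>The doublings done, \<open>e\<close>, and those still to do add up to a
    constant, which identifies the final exponent.\<close>
  let ?I = "\<lambda>s'. imem s' ''R'' 0 = R \<and> 1 \<le> imem s' ''S'' 0 \<and> (\<exists>e. imem s' ''S'' 0 = 2 ^ e \<and> lev (2 * R + 1) 1 = e + ?L s')"
  have "runs orc (While ?b ?c) s1 (30 * ?L s1 + 1 + bcost ?b) (\<lambda>s'. ?I s' \<and> \<not> bval ?b s')"
  proof (rule runs_While[where Inv = ?I and \<Phi> = "\<lambda>s'. 30 * ?L s'"])
    show "?I s1" using s1 by (auto simp: fr1 R_def intro!: exI[of _ "0 :: nat"])
  next
    fix s' assume I: "?I s'" and b: "bval ?b s'"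
    obtain e where e: "imem s' ''S'' 0 = 2 ^ e" "lev (2 * R + 1) 1 = e + ?L s'" using I by auto
    have dbl: "?L s' = Suc (lev (2 * R + 1) (2 * imem s' ''S'' 0))"
      using I b by (intro lev_double) auto
    have "wp orc ?c (\<lambda>s''. ?I s'' \<and> 8 + 1 + bcost ?b + 30 * ?L s'' \<le> 30 * ?L s') s'"
      using I e dbl one_le_power[of "2 :: int" "Suc e"] by (auto intro!: exI[of _ "Suc e"])
    then have "runs orc ?c s' 8 (\<lambda>s''. ?I s'' \<and> 8 + 1 + bcost ?b + 30 * ?L s'' \<le> 30 * ?L s')"
      by (rule runs_wp_le) simp
    then show "\<exists>T. runs orc ?c s' T (\<lambda>s''. ?I s'' \<and> T + 1 + bcost ?b + 30 * ?L s'' \<le> 30 * ?L s')" by blast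
  qed
  then show "runs orc (While ?b ?c) s1 (30 * lev (2 * R + 1) 1 + 10)
    (\<lambda>s'. imem s' ''S'' 0 = 2 ^ lev (2 * R + 1) 1 \<and> 2 * R < 2 ^ lev (2 * R + 1) 1)"
  proof (rule runs_mono)
    show "30 * ?L s1 + 1 + bcost ?b \<le> 30 * lev (2 * R + 1) 1 + 10" using s1 by simp
    fix s' assume a: "?I s' \<and> \<not> bval ?b s'"
    then have lt: "2 * R < imem s' ''S'' 0" by auto
    then have "?L s' = 0" by (intro lev_0) simp
    with a lt show "imem s' ''S'' 0 = 2 ^ lev (2 * R + 1) 1 \<and> 2 * R < 2 ^ lev (2 * R + 1) 1" by auto
  qed
qed auto

text \<open>At the root the extremes coincide at both ends, 0 on the left and \<open>B\<close> on
  the right, so any of the four solutions may be read; position \<open>4 * i\<close> is the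
  first.\<close>

definition output_prog :: com where
  "output_prog = ''i1'' ::= C1 ;; For ''i1'' (IAdd (V ''n'') C1) (IAssign ''x'' (V ''i1'') (IMem ''X'' (IMul (CC 4) (V ''i1''))))"

lemma runs_output_prog:
  fixes st :: state
  defines "n \<equiv> imem st ''n'' 0"
  assumes n: "0 \<le> n"
  shows "runs orc output_prog st (40 * nat n + 20) (\<lambda>s'. \<forall>i\<in>{0<..n}. imem s' ''x'' i = imem st ''X'' (4 * i))"
  unfolding output_prog_def
proof (rule runs_block[where Q = "\<lambda>s'. imem s' ''i1'' 0 = 1" and T' = "40 * nat n + 10"])
  fix s1 assume s1: "imem s1 ''i1'' 0 = 1" and so1: "same_off (''i1'' ::= C1) st s1"
  note fr1 = same_offD[OF so1, simplified]
  let ?c = "IAssign ''x'' (V ''i1'') (IMem ''X'' (IMul (CC 4) (V ''i1'')))"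
  let ?I = "\<lambda>k s'. \<forall>i\<in>{0<..<k}. imem s' ''x'' i = imem st ''X'' (4 * i)"
  have "runs orc (For ''i1'' (IAdd (V ''n'') C1) ?c) s1 (40 * nat n + 10) (\<lambda>s'. ?I (n + 1) s' \<and> imem s' ''i1'' 0 = n + 1)"
  proof (rule runs_For[where T = 10 and lw = 1 and hg = "n + 1" and Inv = ?I])
    fix k s' assume k: "1 \<le> k" "k < n + 1" "imem s' ''i1'' 0 = k" and I: "?I k s'"
      and so: "same_off (For ''i1'' (IAdd (V ''n'') C1) ?c) s1 s'"
    note fr = same_offD[OF so, simplified]
    have "{0<..<k + 1} = insert k {0<..<k}" using k by auto
    then show "runs orc ?c s' 10 (\<lambda>s''. imem s'' ''i1'' 0 = k \<and> ?I (k + 1) (iupdate ''i1'' 0 (k + 1) s''))"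
      using I k by (intro runs_wp_le) (auto simp: fr fr1)
  next
    fix k s' assume so: "same_off (For ''i1'' (IAdd (V ''n'') C1) ?c) s1 s'"
    show "ival (IAdd (V ''n'') C1) s' = n + 1" using same_offD[OF so, simplified] by (simp add: fr1 n_def)
  qed (use s1 n in auto)
  then show "runs orc (For ''i1'' (IAdd (V ''n'') C1) ?c) s1 (40 * nat n + 10) (\<lambda>s'. \<forall>i\<in>{0<..n}. imem s' ''x'' i = imem st ''X'' (4 * i))"
    by (rule runs_mono) auto
qed auto

lemma sum_int_index: "(\<Sum>i=1..k. f (int i)) = sum f {0<..int k}"
  by (rule sum.reindex_bij_witness[of _ nat int]) auto

lemma sum_of_int_index: "(\<Sum>i=1..k. real_of_int (z (int i))) = real_of_int (sum z {0<..int k})"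
  using sum_int_index[of "\<lambda>i. real_of_int (z i)" k] by simp

definition main_prog :: com where
  "main_prog = prefix_prog ;; bounds_prog ;; width_prog ;; leaf_prog ;; level_prog ;; output_prog"

lemma (in nested_run) runs_core:
  assumes env: "env st"
  shows "runs orc (leaf_prog ;; level_prog ;; output_prog) st
    (3300100 * (nat n * (e + 1)) + lev m 1 * (3300300 * (nat n * (e + 1))) + 40 * nat n + 60)
    (\<lambda>s'. \<exists>z. stab 0 n 0 B z \<and> (\<forall>i\<in>{0<..n}. imem s' ''x'' i = z i))"
proof (rule runs_Seq2[OF runs_leaf_prog[OF env]])
  fix s1 :: state assume s1: "env s1 \<and> (\<forall>j. 0 \<le> j \<longrightarrow> j < m \<longrightarrow> node j (j + 1) (imem s1 ''X''))"
  show "runs orc (level_prog ;; output_prog) s1 (lev m 1 * (3300300 * (nat n * (e + 1))) + 40 * nat n + 40)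
    (\<lambda>s'. \<exists>z. stab 0 n 0 B z \<and> (\<forall>i\<in>{0<..n}. imem s' ''x'' i = z i))"
  proof (rule runs_Seq2[OF runs_level_prog])
    show "env s1" "\<forall>j. 0 \<le> j \<longrightarrow> j < m \<longrightarrow> node j (j + 1) (imem s1 ''X'')" using s1 by auto
    fix s2 :: state assume s2: "env s2 \<and> node 0 m (imem s2 ''X'')"
    then have n: "imem s2 ''n'' 0 = n" by (simp add: env_def)
    have st: "stab 0 n 0 B (\<lambda>i. imem s2 ''X'' (4 * i))"
      using s2 PB(1,3) sg0 sgm by (simp add: node_def)
    have "0 \<le> imem s2 ''n'' 0" using n sg_range[of 0] m sg0 by simp
    then show "runs orc output_prog s2 (40 * nat n + 20)
      (\<lambda>s'. \<exists>z. stab 0 n 0 B z \<and> (\<forall>i\<in>{0<..n}. imem s' ''x'' i = z i))"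
      using st by (intro runs_mono[OF runs_output_prog]) (auto simp: n)
  qed simp
qed simp

section \<open>From a problem instance to integer-indexed data\<close>

locale feasible_rapnc =
  fixes I :: rapnc and x :: "nat \<Rightarrow> real"
  assumes valid: "valid_instance I" and feasible: "rapnc_feasible I x"
begin

definition "nn = int (nvars I)"
definition "mm = int (ncons I)"
definition "sg = load_array (ncons I) (\<lambda>i. int (sig I i))"
definition "aa = load_array (ncons I - 1) (lo I)"
definition "bb = load_array (ncons I - 1) (up I)"
definition "cc = load_array (nvars I) (lb I)"
definition "dd = load_array (nvars I) (ub I)"
definition "FF i k = obj I (nat i) (real_of_int k)"
definition "pre k = (\<Sum>i=1..nat k. x i)"
text \<open>Feasibility is only given for a real point. Rounding down its partial sums yields an
  integer one: the bounds on sums and on differences of neighbouring sums are integers and survive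
  the rounding.\<close>

definition "yy k = \<lfloor>pre k\<rfloor> - \<lfloor>pre (k - 1)\<rfloor>"

lemma mm: "1 \<le> mm"
  using valid by (simp add: valid_instance_def mm_def)

lemma sg_eq: "1 \<le> j \<Longrightarrow> j \<le> ncons I \<Longrightarrow> sg (int j) = int (sig I j)"
  by (simp add: sg_def load_array_def)

text \<open>The default value outside the loaded array supplies the left end of the first
  segment.\<close>

lemma sg0: "sg 0 = 0"
  by (simp add: sg_def load_array_def)

lemma sgm: "sg mm = nn"
  using valid mm sg_eq[of "ncons I"] by (simp add: valid_instance_def mm_def nn_def)

lemma sg_pos: "1 \<le> j \<Longrightarrow> j \<le> ncons I \<Longrightarrow> 1 \<le> sig I j \<and> sig I j \<le> nvars I"
  using valid by (force simp: valid_instance_def)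

lemma sg_mono:
  assumes "0 \<le> j" "j < j'" "j' \<le> mm"
  shows "sg j < sg j'"
proof -
  define i i' where "i = nat j" and "i' = nat j'"
  have i: "j = int i" "j' = int i'" "i < i'" "i' \<le> ncons I" using assms by (auto simp: i_def i'_def mm_def)
  show ?thesis
  proof (cases "i = 0")
    case True
    then show ?thesis using i sg0 sg_eq[of i'] sg_pos[of i'] by simp
  next
    case False
    then have "sig I i < sig I i'" using valid i unfolding valid_instance_def by (auto simp: strict_mono_on_def)
    then show ?thesis using i False sg_eq[of i] sg_eq[of i'] by simp
  qed
qed

lemma ab_eq: "1 \<le> j \<Longrightarrow> j < ncons I \<Longrightarrow> aa (int j) = lo I j \<and> bb (int j) = up I j"
  by (auto simp: aa_def bb_def load_array_def)

lemma cd_eq: "i \<in> {0<..nn} \<Longrightarrow> cc i = lb I (nat i) \<and> dd i = ub I (nat i)"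
  by (auto simp: cc_def dd_def load_array_def nn_def)

text \<open>With \<open>c = d\<close> outside the index range, conditions that assume
  \<open>c i < d i\<close> can be required for all integers \<open>i\<close>.\<close>

lemma cd_out: "i \<notin> {0<..nn} \<Longrightarrow> cc i = 0 \<and> dd i = 0"
  by (auto simp: cc_def dd_def load_array_def nn_def)

lemma orc:
  assumes "i \<in> {0<..nn}" "cc i \<le> k" "k \<le> dd i"
  shows "eval_oracle I i (real_of_int k) = Some (FF i k)"
  using assms cd_eq[OF assms(1)] by (auto simp: eval_oracle_def FF_def nn_def)

lemma FF_convex:
  assumes "cc i < k" "k < dd i"
  shows "FF i k - FF i (k - 1) \<le> FF i (k + 1) - FF i k"
proof -
  have i: "i \<in> {0<..nn}" using assms cd_out[of i] by force
  have cv: "convex_on {of_int (lb I (nat i))..of_int (ub I (nat i))} (obj I (nat i))"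
  proof -
    have "nat i \<in> {1..nvars I}" using i by (auto simp: nn_def)
    then show ?thesis using valid unfolding valid_instance_def by blast
  qed
  have mem: "real_of_int (k - 1) \<in> {of_int (lb I (nat i))..of_int (ub I (nat i))}"
    "real_of_int (k + 1) \<in> {of_int (lb I (nat i))..of_int (ub I (nat i))}"
    using assms cd_eq[OF i] by auto
  have "obj I (nat i) ((1 - 1 / 2) *\<^sub>R real_of_int (k - 1) + (1 / 2) *\<^sub>R real_of_int (k + 1)) \<le>
      (1 - 1 / 2) * obj I (nat i) (real_of_int (k - 1)) + (1 / 2) * obj I (nat i) (real_of_int (k + 1))"
    by (rule convex_onD[OF cv _ _ mem]) auto
  moreover have "(1 - 1 / 2) *\<^sub>R real_of_int (k - 1) + (1 / 2) *\<^sub>R real_of_int (k + 1) = real_of_int k" by (simp add: field_simps)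
  ultimately show ?thesis unfolding FF_def by simp
qed

lemma sum_yy: "0 \<le> k \<Longrightarrow> sum yy {0<..k} = \<lfloor>pre k\<rfloor>"
proof (induction k rule: int_ge_induct)
  case base
  then show ?case by (simp add: pre_def)
next
  case (step k)
  then show ?case using sum_Ioc_last[of 0 "k + 1" yy] by (simp add: yy_def)
qed

lemma yy_bounds:
  assumes i: "i \<in> {0<..nn}"
  shows "cc i \<le> yy i \<and> yy i \<le> dd i"
proof -
  have "nat i = Suc (nat (i - 1))" using i by auto
  then have "pre i = pre (i - 1) + x (nat i)" by (simp add: pre_def)
  moreover have "real_of_int (cc i) \<le> x (nat i)" "x (nat i) \<le> real_of_int (dd i)"
  proof -
    have "nat i \<in> {1..nvars I}" using i by (auto simp: nn_def)
    then have "of_int (lb I (nat i)) \<le> x (nat i) \<and> x (nat i) \<le> of_int (ub I (nat i))"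
      using feasible unfolding rapnc_feasible_def by blast
    then show "real_of_int (cc i) \<le> x (nat i)" "x (nat i) \<le> real_of_int (dd i)" using cd_eq[OF i] by auto
  qed
  ultimately have a: "pre (i - 1) + real_of_int (cc i) \<le> pre i" and b: "pre i \<le> pre (i - 1) + real_of_int (dd i)" by auto
  show ?thesis using floor_mono[OF a] floor_mono[OF b] by (simp add: yy_def)
qed

lemma yy_sum: "sum yy {0<..nn} = res I"
  using sum_yy[of nn] feasible by (simp add: nn_def pre_def rapnc_feasible_def)

lemma yy_nested:
  assumes j: "j \<in> {1..<mm}"
  shows "aa j \<le> sum yy {0<..sg j} \<and> sum yy {0<..sg j} \<le> bb j"
proof -
  define i where "i = nat j"
  have i: "j = int i" "1 \<le> i" "i < ncons I" using j by (auto simp: i_def mm_def)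
  have "real_of_int (lo I i) \<le> pre (int (sig I i)) \<and> pre (int (sig I i)) \<le> real_of_int (up I i)"
    using feasible i by (auto simp: rapnc_feasible_def pre_def)
  then have "lo I i \<le> \<lfloor>pre (int (sig I i))\<rfloor> \<and> \<lfloor>pre (int (sig I i))\<rfloor> \<le> up I i"
    by (auto simp: le_floor_iff floor_le_iff)
  then show ?thesis using sum_yy[of "int (sig I i)"] i sg_eq[of i] ab_eq[of i] by simp
qed

lemma integer_feasible_iff:
  assumes w: "\<And>i. i \<in> {1..nvars I} \<Longrightarrow> w i = real_of_int (z (int i))"
  shows "integer_feasible I w \<longleftrightarrow> (\<forall>i\<in>{0<..nn}. cc i \<le> z i \<and> z i \<le> dd i) \<and> sum z {0<..nn} = res I \<and>
    (\<forall>j\<in>{1..<mm}. aa j \<le> sum z {0<..sg j} \<and> sum z {0<..sg j} \<le> bb j)"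
proof -
  have sums: "(\<Sum>i=1..k. w i) = real_of_int (sum z {0<..int k})" if "k \<le> nvars I" for k
    unfolding sum_of_int_index[symmetric] using w that by (intro sum.cong) auto
  have 1: "(\<forall>i\<in>{1..nvars I}. of_int (lb I i) \<le> w i \<and> w i \<le> of_int (ub I i)) \<longleftrightarrow> (\<forall>i\<in>{0<..nn}. cc i \<le> z i \<and> z i \<le> dd i)"
  proof
    assume l: "\<forall>i\<in>{1..nvars I}. of_int (lb I i) \<le> w i \<and> w i \<le> of_int (ub I i)"
    show "\<forall>i\<in>{0<..nn}. cc i \<le> z i \<and> z i \<le> dd i"
    proof
      fix i assume i: "i \<in> {0<..nn}"
      then have ni: "nat i \<in> {1..nvars I}" "int (nat i) = i" by (auto simp: nn_def)
      then show "cc i \<le> z i \<and> z i \<le> dd i" using bspec[OF l ni(1)] w[OF ni(1)] cd_eq[OF i] by auto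
    qed
  next
    assume r: "\<forall>i\<in>{0<..nn}. cc i \<le> z i \<and> z i \<le> dd i"
    show "\<forall>i\<in>{1..nvars I}. of_int (lb I i) \<le> w i \<and> w i \<le> of_int (ub I i)"
    proof
      fix i assume i: "i \<in> {1..nvars I}"
      then have ii: "int i \<in> {0<..nn}" by (auto simp: nn_def)
      show "of_int (lb I i) \<le> w i \<and> w i \<le> of_int (ub I i)" using bspec[OF r ii] w[OF i] cd_eq[OF ii] by auto
    qed
  qed
  have 2: "(\<Sum>k=1..nvars I. w k) = of_int (res I) \<longleftrightarrow> sum z {0<..nn} = res I"
    by (simp only: sums[OF order_refl] nn_def of_int_eq_iff)
  have 3: "(\<forall>i\<in>{1..<ncons I}. of_int (lo I i) \<le> (\<Sum>k=1..sig I i. w k) \<and> (\<Sum>k=1..sig I i. w k) \<le> of_int (up I i)) \<longleftrightarrow>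
    (\<forall>j\<in>{1..<mm}. aa j \<le> sum z {0<..sg j} \<and> sum z {0<..sg j} \<le> bb j)"
  proof -
    have e: "of_int (lo I i) \<le> (\<Sum>k=1..sig I i. w k) \<and> (\<Sum>k=1..sig I i. w k) \<le> of_int (up I i) \<longleftrightarrow>
      aa (int i) \<le> sum z {0<..sg (int i)} \<and> sum z {0<..sg (int i)} \<le> bb (int i)" if "i \<in> {1..<ncons I}" for i
    proof -
      have "sig I i \<le> nvars I" "sg (int i) = int (sig I i)" "aa (int i) = lo I i" "bb (int i) = up I i"
        using that sg_pos[of i] sg_eq[of i] ab_eq[of i] by auto
      then show ?thesis by (simp only: sums of_int_le_iff)
    qed
    have "{1..<mm} = int ` {1..<ncons I}" by (simp add: mm_def image_int_atLeastLessThan)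
    then show ?thesis using e by auto
  qed
  have 4: "\<forall>i\<in>{1..nvars I}. w i \<in> \<int>" using w by simp
  show ?thesis unfolding integer_feasible_def rapnc_feasible_def using 1 2 3 4 by blast
qed

lemma cost_eq:
  assumes w: "\<And>i. i \<in> {1..nvars I} \<Longrightarrow> w i = real_of_int (z (int i))"
  shows "rapnc_cost I w = (\<Sum>i\<in>{0<..nn}. FF i (z i))"
  unfolding rapnc_cost_def nn_def sum_int_index[symmetric] FF_def using w by (intro sum.cong) auto

lemma nn_pos: "1 \<le> nn"
  using sg_mono[of 0 mm] mm sg0 sgm by simp

text \<open>Absorbs the preprocessing of the \<open>m\<close> nested bounds into the term linear in
  \<open>n\<close>.\<close>

lemma mm_le_nn: "mm \<le> nn"
proof -
  have le: "j \<le> sg j" if "0 \<le> j" "j \<le> mm" for j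
    using that
  proof (induction j rule: int_ge_induct)
    case (step j)
    then show ?case using sg_mono[of j "j + 1"] by simp
  qed (simp add: sg0)
  show ?thesis using le[of mm] sgm mm by simp
qed

text \<open>The resource after translating every variable by its lower bound.
  \<open>resource_bound\<close> translates only by the negative ones and is therefore at least as
  large.\<close>

definition "RR = res I - sum cc {0<..nn}"

lemma runs_main_prog:
  shows "runs (eval_oracle I) main_prog (initial_state I)
    (3302000 * (nvars I * (lev (2 * RR + 1) 1 + 1)) * (lev mm 1 + 1))
    (\<lambda>s. integer_optimal I (solution_output s))"
  unfolding main_prog_def
proof -
  define e where "e = lev (2 * RR + 1) 1"
  define st where "st = initial_state I"
  have st: "imem st ''n'' 0 = nn" "imem st ''m'' 0 = mm" "imem st ''B'' 0 = res I" "imem st ''sigma'' = sg"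
    "imem st ''a'' = aa" "imem st ''b'' = bb" "imem st ''c'' = cc" "imem st ''d'' = dd"
    "imem st ''CS'' 0 = 0" "imem st ''PB'' 0 = 0" "imem st ''PB'' 1 = 0"
    by (simp_all add: st_def initial_state_def load_scalar_def nn_def mm_def sg_def aa_def bb_def cc_def dd_def)
  let ?Q = "\<lambda>s. integer_optimal I (solution_output s)"
  define N where "N = nat nn"
  define M where "M = nat mm"
  define W where "W = N * (e + 1)"
  have N: "1 \<le> N" "N = nvars I" "M \<le> N" using nn_pos mm_le_nn by (auto simp: N_def nn_def M_def)
  have W: "N \<le> W" "e \<le> W" using N(1) mult_le_mono1[of 1 N "e + 1"] by (simp_all add: W_def)
  have "runs (eval_oracle I) (prefix_prog ;; bounds_prog ;; width_prog ;; leaf_prog ;; level_prog ;; output_prog) st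
    (150 * N + 30 + (100 * M + 50 + (30 * e + 20 + (3300100 * W + lev mm 1 * (3300300 * W) + 40 * N + 60)))) ?Q"
  proof (rule runs_Seq2[OF runs_prefix_prog[where F = FF]])
    show "0 \<le> imem st ''n'' 0" using st nn_pos by simp
    show "imem st ''CS'' 0 = 0" by (rule st)
    show "eval_oracle I i (real_of_int k) = Some (FF i k)"
      if "i \<in> {0<..imem st ''n'' 0}" "imem st ''c'' i \<le> k" "k \<le> imem st ''d'' i" for i k
      using that orc[of i k] by (simp add: st)
    fix s1 :: state assume s1: "(\<forall>k\<in>{0..imem st ''n'' 0}. imem s1 ''CS'' k = sum (imem st ''c'') {0<..k}) \<and> 1 \<le> rmem s1 ''M'' 0 \<and>
      (\<forall>i\<in>{0<..imem st ''n'' 0}. imem st ''c'' i < imem st ''d'' i \<longrightarrow>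
         \<bar>FF i (imem st ''c'' i + 1) - FF i (imem st ''c'' i)\<bar> < rmem s1 ''M'' 0 \<and>
         \<bar>FF i (imem st ''d'' i) - FF i (imem st ''d'' i - 1)\<bar> < rmem s1 ''M'' 0)" and so1: "same_off prefix_prog st s1"
    note fr1 = same_offD[OF so1, simplified]
    define CS where "CS = imem s1 ''CS''"
    define MM where "MM = rmem s1 ''M'' 0"
    have CS: "\<And>k. 0 \<le> k \<Longrightarrow> k \<le> nn \<Longrightarrow> CS k = sum cc {0<..k}" using s1 by (simp add: CS_def st)
    have MM: "1 \<le> MM" "\<And>i. i \<in> {0<..nn} \<Longrightarrow> cc i < dd i \<Longrightarrow>
        \<bar>FF i (cc i + 1) - FF i (cc i)\<bar> < MM \<and> \<bar>FF i (dd i) - FF i (dd i - 1)\<bar> < MM"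
      using s1 by (simp_all add: MM_def st)
    have RR: "res I - CS nn = RR" using CS[of nn] nn_pos by (simp add: RR_def)
    have bp: "runs (eval_oracle I) bounds_prog s1 (100 * M + 50)
      (\<lambda>s'. imem s' ''R'' 0 = RR \<and> imem s' ''PB'' 0 = 0 \<and> imem s' ''PB'' 1 = 0 \<and>
        imem s' ''PB'' (2 * mm) = res I \<and> imem s' ''PB'' (2 * mm + 1) = res I \<and>
        (\<forall>j\<in>{1..<mm}. imem s' ''PB'' (2 * j) = max (aa j) (CS (sg j)) \<and>
           imem s' ''PB'' (2 * j + 1) = min (bb j) (CS (sg j) + RR)))"
      using runs_bounds_prog[of s1 "eval_oracle I"] mm by (simp add: fr1 st CS_def[symmetric] M_def RR)
    show "runs (eval_oracle I) (bounds_prog ;; width_prog ;; leaf_prog ;; level_prog ;; output_prog) s1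
      (100 * M + 50 + (30 * e + 20 + (3300100 * W + lev mm 1 * (3300300 * W) + 40 * N + 60))) ?Q"
    proof (rule runs_Seq2[OF bp])
      fix s2 :: state assume s2: "imem s2 ''R'' 0 = RR \<and> imem s2 ''PB'' 0 = 0 \<and> imem s2 ''PB'' 1 = 0 \<and>
        imem s2 ''PB'' (2 * mm) = res I \<and> imem s2 ''PB'' (2 * mm + 1) = res I \<and>
        (\<forall>j\<in>{1..<mm}. imem s2 ''PB'' (2 * j) = max (aa j) (CS (sg j)) \<and>
           imem s2 ''PB'' (2 * j + 1) = min (bb j) (CS (sg j) + RR))" and so2: "same_off bounds_prog s1 s2"
      note fr2 = same_offD[OF so2, simplified]
      define PB where "PB = imem s2 ''PB''"
      have PB: "PB 0 = 0" "PB 1 = 0" "PB (2 * mm) = res I" "PB (2 * mm + 1) = res I"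
        "\<And>j. j \<in> {1..<mm} \<Longrightarrow> PB (2 * j) = max (aa j) (CS (sg j))"
        "\<And>j. j \<in> {1..<mm} \<Longrightarrow> PB (2 * j + 1) = min (bb j) (CS (sg j) + RR)"
        using s2 by (simp_all add: PB_def)
      have wpg: "runs (eval_oracle I) width_prog s2 (30 * e + 20) (\<lambda>s'. imem s' ''S'' 0 = 2 ^ e \<and> 2 * RR < 2 ^ e)"
        using runs_width_prog[where st = s2 and orc = "eval_oracle I"] s2 by (simp add: e_def)
      show "runs (eval_oracle I) (width_prog ;; leaf_prog ;; level_prog ;; output_prog) s2
        (30 * e + 20 + (3300100 * W + lev mm 1 * (3300300 * W) + 40 * N + 60)) ?Q"
      proof (rule runs_Seq2[OF wpg])
        fix s3 :: state assume s3: "imem s3 ''S'' 0 = 2 ^ e \<and> 2 * RR < 2 ^ e" and so3: "same_off width_prog s2 s3"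
        note fr3 = same_offD[OF so3, simplified]
        interpret nested_run nn mm "res I" RR sg aa bb cc dd CS PB MM FF yy "eval_oracle I" e
        proof
          show "1 \<le> mm" "sg 0 = 0" "sg mm = nn" by (fact mm sg0 sgm)+
          show "\<And>j j'. 0 \<le> j \<Longrightarrow> j < j' \<Longrightarrow> j' \<le> mm \<Longrightarrow> sg j < sg j'" by (rule sg_mono)
          show "\<And>i k. cc i < k \<Longrightarrow> k < dd i \<Longrightarrow> FF i k - FF i (k - 1) \<le> FF i (k + 1) - FF i k" by (rule FF_convex)
          show "1 \<le> MM" by (fact MM)
          show "\<bar>FF i (cc i + 1) - FF i (cc i)\<bar> < MM \<and> \<bar>FF i (dd i) - FF i (dd i - 1)\<bar> < MM" if "cc i < dd i" for i
            using MM(2)[of i] that cd_out[of i] by force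
          show "\<And>k. 0 \<le> k \<Longrightarrow> k \<le> nn \<Longrightarrow> CS k = sum cc {0<..k}" by (rule CS)
          show "RR = res I - CS nn" using RR by simp
          show "\<And>i. i \<in> {0<..nn} \<Longrightarrow> cc i \<le> yy i \<and> yy i \<le> dd i" by (rule yy_bounds)
          show "sum yy {0<..nn} = res I" by (rule yy_sum)
          show "\<And>j. j \<in> {1..<mm} \<Longrightarrow> aa j \<le> sum yy {0<..sg j} \<and> sum yy {0<..sg j} \<le> bb j" by (rule yy_nested)
          show "PB 0 = 0" "PB 1 = 0" "PB (2 * mm) = res I" "PB (2 * mm + 1) = res I" by (fact PB)+
          show "\<And>j. j \<in> {1..<mm} \<Longrightarrow> PB (2 * j) = max (aa j) (CS (sg j))" by (fact PB)
          show "\<And>j. j \<in> {1..<mm} \<Longrightarrow> PB (2 * j + 1) = min (bb j) (CS (sg j) + RR)" by (fact PB)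
          show "\<And>i k. i \<in> {0<..nn} \<Longrightarrow> cc i \<le> k \<Longrightarrow> k \<le> dd i \<Longrightarrow> eval_oracle I i (real_of_int k) = Some (FF i k)" by (rule orc)
          show "2 * RR < 2 ^ e" using s3 by simp
        qed
        have "env s3" unfolding env_def using s3 s2 st by (simp add: fr3 fr2 fr1 PB_def MM_def)
        from runs_core[OF this]
        show "runs (eval_oracle I) (leaf_prog ;; level_prog ;; output_prog) s3
          (3300100 * W + lev mm 1 * (3300300 * W) + 40 * N + 60) ?Q"
        proof (rule runs_mono)
          fix s' :: state assume "\<exists>z. stab 0 nn 0 (res I) z \<and> (\<forall>i\<in>{0<..nn}. imem s' ''x'' i = z i)"
          then obtain z where z: "stab 0 nn 0 (res I) z" and xz: "\<forall>i\<in>{0<..nn}. imem s' ''x'' i = z i" by blast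
          have out: "solution_output s' i = real_of_int (z (int i))" if "i \<in> {1..nvars I}" for i
            using xz that by (simp add: solution_output_def nn_def)
          have "integer_feasible I (solution_output s')"
            using integer_feasible_iff[of "solution_output s'" z] out stab_bounds[OF z] stab_optimal(1,2)[OF z] by blast
          moreover have "rapnc_cost I (solution_output s') \<le> rapnc_cost I w" if w: "integer_feasible I w" for w
          proof -
            \<comment> \<open>The competitor \<open>w\<close> has integer values, so the floor
              merely converts its type.\<close>
            define v where "v i = \<lfloor>w (nat i)\<rfloor>" for i :: int
            have wv: "w i = real_of_int (v (int i))" if "i \<in> {1..nvars I}" for i
              using w that by (auto simp: integer_feasible_def v_def)
            have "(\<Sum>i\<in>{0<..nn}. FF i (z i)) \<le> (\<Sum>i\<in>{0<..nn}. FF i (v i))"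
              using w integer_feasible_iff[of w v, OF wv] by (intro stab_optimal(3)[OF z]) blast+
            then show ?thesis using cost_eq[of "solution_output s'" z, OF out] cost_eq[of w v, OF wv] by simp
          qed
          ultimately show "?Q s'" by (simp add: integer_optimal_def)
        qed (simp add: W_def N_def)
      qed simp
    qed simp
  next
    show "150 * nat (imem st ''n'' 0) + 30 + (100 * M + 50 + (30 * e + 20 + (3300100 * W + lev mm 1 * (3300300 * W) + 40 * N + 60)))
      \<le> 150 * N + 30 + (100 * M + 50 + (30 * e + 20 + (3300100 * W + lev mm 1 * (3300300 * W) + 40 * N + 60)))"
      by (simp add: st N_def)
  qed
  then show "runs (eval_oracle I) (prefix_prog ;; bounds_prog ;; width_prog ;; leaf_prog ;; level_prog ;; output_prog) (initial_state I)
    (3302000 * (nvars I * (lev (2 * RR + 1) 1 + 1)) * (lev mm 1 + 1)) ?Q"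
    unfolding st_def e_def[symmetric] N(2)[symmetric] W_def[symmetric]
  proof (rule runs_mono)
    have "150 * N + 30 + (100 * M + 50 + (30 * e + 20 + (3300100 * W + lev mm 1 * (3300300 * W) + 40 * N + 60))) \<le>
        3302000 * W + lev mm 1 * (3302000 * W)"
      using N W mult_le_mono2[of "3300300 * W" "3302000 * W" "lev mm 1"] by linarith
    then show "150 * N + 30 + (100 * M + 50 + (30 * e + 20 + (3300100 * W + lev mm 1 * (3300300 * W) + 40 * N + 60))) \<le>
        3302000 * W * (lev mm 1 + 1)" by (simp add: algebra_simps)
  qed
qed

end

text \<open>By minimality one doubling fewer does not reach \<open>m\<close>.\<close>

lemma lev_le_log:
  assumes "1 \<le> m"
  shows "real (lev m 1) \<le> 1 + log 2 (real_of_int m)"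
proof (cases "lev m 1")
  case 0
  then show ?thesis using assms by simp
next
  case (Suc k)
  then have "\<not> m \<le> 1 * 2 ^ k" unfolding lev_def by (metis lessI not_less_Least)
  then have "real_of_int (2 ^ k) < real_of_int m" by (simp only: of_int_less_iff)
  then have "(2 :: real) ^ k < real_of_int m" by simp
  then have "log 2 (2 ^ k) \<le> log 2 (real_of_int m)" using assms by (intro log_le_cancel_iff[THEN iffD2]) auto
  then show ?thesis using Suc by simp
qed

theorem mainTheorem1:
  shows "\<exists>(P :: com) (K :: real). \<forall>I :: rapnc.
    valid_instance I \<and> (\<exists>x. rapnc_feasible I x) \<longrightarrow>
    (\<exists>t s. exec (eval_oracle I) P (initial_state I) t s \<and>
           integer_optimal I (solution_output s) \<and>
           real t \<le> K * (real (nvars I) * lg (real (ncons I)) * lg (real_of_int (resource_bound I))))"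
proof (rule exI[of _ main_prog], rule exI[of _ 50000000], intro allI impI, elim conjE exE)
  fix I x assume valid: "valid_instance I" and feas: "rapnc_feasible I x"
  interpret feasible_rapnc I x using valid feas by unfold_locales
  define Lm where "Lm = lg (real (ncons I))"
  define LR where "LR = lg (real_of_int (resource_bound I))"
  have L1: "1 \<le> Lm" "1 \<le> LR" by (simp_all add: Lm_def LR_def lg_def)
  have m: "real (lev mm 1) + 1 \<le> 3 * Lm"
  proof -
    have "log 2 (real_of_int mm) \<le> Lm" by (simp add: Lm_def lg_def mm_def)
    then show ?thesis using lev_le_log[OF mm] L1 by linarith
  qed
  have RR: "real (lev (2 * RR + 1) 1) + 1 \<le> 5 * LR"
  proof (cases "RR \<le> 0")
    case True
    then show ?thesis using L1 by (simp add: lev_0)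
  next
    case False
    have "(\<Sum>i=1..nvars I. min (lb I i) 0) \<le> (\<Sum>i=1..nvars I. cc (int i))"
      using cd_eq by (intro sum_mono) (auto simp: nn_def)
    then have le: "RR \<le> resource_bound I"
      unfolding RR_def resource_bound_def nn_def sum_int_index[symmetric] by linarith
    have "real (lev (2 * RR + 1) 1) \<le> 1 + log 2 (real_of_int (2 * RR + 1))"
      using False by (intro lev_le_log) simp
    \<comment> \<open>As \<open>1 \<le> RR \<le> resource_bound I\<close>, the factor 4 is enough
      and costs 2. With the 1 from \<open>lev_le_log\<close> and the 1 in the claim this is
      \<open>LR + 4\<close>, at most \<open>5 * LR\<close> because \<open>LR\<close> is at least
      1.\<close>
    also have "log 2 (real_of_int (2 * RR + 1)) \<le> log 2 (4 * real_of_int (resource_bound I))"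
      using False le by (intro log_le_cancel_iff[THEN iffD2]) auto
    also have "\<dots> = 2 + log 2 (real_of_int (resource_bound I))"
      using False le log_mult[of 2 4 "real_of_int (resource_bound I)"] log2_of_power_eq[of 4 2] by simp
    also have "log 2 (real_of_int (resource_bound I)) \<le> LR" by (simp add: LR_def lg_def)
    finally show ?thesis using L1 by simp
  qed
  obtain t s where t: "exec (eval_oracle I) main_prog (initial_state I) t s" "integer_optimal I (solution_output s)"
    "t \<le> 3302000 * (nvars I * (lev (2 * RR + 1) 1 + 1)) * (lev mm 1 + 1)"
    using runs_main_prog unfolding runs_def by blast
  have "real t \<le> real (3302000 * (nvars I * (lev (2 * RR + 1) 1 + 1)) * (lev mm 1 + 1))"
    using t(3) by (rule of_nat_mono)
  also have "\<dots> = 3302000 * real (nvars I) * ((real (lev (2 * RR + 1) 1) + 1) * (real (lev mm 1) + 1))"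
    by (simp only: of_nat_mult of_nat_add of_nat_1 of_nat_numeral mult.assoc)
  also have "\<dots> \<le> 3302000 * real (nvars I) * ((5 * LR) * (3 * Lm))"
    using RR m L1 by (intro mult_left_mono mult_mono) auto
  \<comment> \<open>\<open>3302000 * 5 * 3 = 49530000\<close>, which explains the constant
    50000000.\<close>
  also have "\<dots> \<le> 50000000 * (real (nvars I) * Lm * LR)"
    using L1 by (simp add: mult_ac mult_left_mono)
  finally show "\<exists>t s. exec (eval_oracle I) main_prog (initial_state I) t s \<and> integer_optimal I (solution_output s) \<and>
       real t \<le> 50000000 * (real (nvars I) * lg (real (ncons I)) * lg (real_of_int (resource_bound I)))"
    using t(1,2) unfolding Lm_def LR_def by blast
qed

end
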